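(* Let $w\in F_r$ be a nontrivial word. Then for any $n\geq1$ there exists a finite set $S(n)$ of primes such that for every $q\in\mathcal P_{S(n)}$, every $k\geq1$ and every $g\in\mathrm{SL}_n(\mathbb Z_q/\mathfrak m_q^k)$, $$\tau_{w,\mathrm{SL}_n,q,k}(g)\leq\left|\mathrm{SL}_n(\mathbb Z_q/\mathfrak m_q^k)\right|^{-\frac{1}{2\cdot10^{17}\ell(w)^{9}}}.$$
   Context: $F_r$ is the free group on $r$ generators and $\ell(w)$ is the length of $w$ as a reduced word. For a set $S$ of primes, $\mathcal P_S$ is the set of prime powers $q=p^s$ ($s\geq1$) with $p\notin S$. For $q=p^s$, $\mathbb Q_q$ is the unramified extension of $\mathbb Q_p$ of degree $s$, $\mathbb Z_q$ its ring of integers and $\mathfrak m_q$ the maximal ideal. $\tau_{w,\mathrm{SL}_n,q,k}$ is the pushforward of the uniform probability measure on $\mathrm{SL}_n(\mathbb Z_q/\mathfrak m_q^k)^r$ under the word map $\varphi_w:\mathrm{SL}_n(\mathbb Z_q/\mathfrak m_q^k)^r\to\mathrm{SL}_n(\mathbb Z_q/\mathfrak m_q^k)$ induced by substitution. *)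

theory Defs
  imports
    "HOL-Algebra.Algebra"
    "HOL-Combinatorics.Permutations"
    "HOL-Probability.Probability_Mass_Function"
begin

hide_const (open) Divisibility.prime

section \<open>Free groups and word maps\<close>

text \<open>The letter \<open>(i, True)\<close> stands for the generator \<open>x\<^sub>i\<close> and \<open>(i, False)\<close> for its inverse;
  elements of the free group are represented by reduced words.\<close>

type_synonym letter = "nat \<times> bool"

definition inv_letter :: "letter \<Rightarrow> letter" where
  "inv_letter a = (fst a, \<not> snd a)"

definition reduced_word :: "letter list \<Rightarrow> bool" where
  "reduced_word w \<longleftrightarrow> successively (\<lambda>a b. b \<noteq> inv_letter a) w"

fun push :: "letter \<Rightarrow> letter list \<Rightarrow> letter list" where
  "push a [] = [a]"
| "push a (b # w) = (if b = inv_letter a then w else a # b # w)"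

definition free_group :: "nat \<Rightarrow> letter list monoid" where
  "free_group r = \<lparr>carrier = {w. reduced_word w \<and> fst ` set w \<subseteq> {..<r}},
                   monoid.mult = (\<lambda>u v. foldr push u v), one = []\<rparr>"

definition word_map :: "('a, 'b) monoid_scheme \<Rightarrow> letter list \<Rightarrow> (nat \<Rightarrow> 'a) \<Rightarrow> 'a" where
  "word_map G w g =
     foldr (\<lambda>(i, pos) y. (if pos then g i else inv\<^bsub>G\<^esub> (g i)) \<otimes>\<^bsub>G\<^esub> y) w \<one>\<^bsub>G\<^esub>"

text \<open>The uniform measure on \<open>G\<^sup>r\<close> is only meaningful for finite \<open>G\<close>.\<close>

definition word_measure :: "('a, 'b) monoid_scheme \<Rightarrow> nat \<Rightarrow> letter list \<Rightarrow> 'a pmf" where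
  "word_measure G r w = map_pmf (word_map G w) (pmf_of_set ({..<r} \<rightarrow>\<^sub>E carrier G))"

lemma inv_letter_inv [simp]: "inv_letter (inv_letter a) = a"
  by (simp add: inv_letter_def)

lemma inv_letter_neq [simp]: "inv_letter a \<noteq> a"
  by (simp add: inv_letter_def prod_eq_iff)

lemma inv_letter_eq_iff [simp]: "inv_letter a = inv_letter b \<longleftrightarrow> a = b"
  by (metis inv_letter_inv)

lemma reduced_simps [simp]: "reduced_word []" "reduced_word [a]"
  "reduced_word (a # b # w) \<longleftrightarrow> b \<noteq> inv_letter a \<and> reduced_word (b # w)"
  by (simp_all add: reduced_word_def)

lemma reduced_Cons: "reduced_word (a # w) \<Longrightarrow> reduced_word w"
  by (cases w) auto

lemma reduced_push: "reduced_word w \<Longrightarrow> reduced_word (push a w)"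
  by (cases w) (auto dest: reduced_Cons)

lemma push_inv_push: "reduced_word w \<Longrightarrow> push a (push (inv_letter a) w) = w"
  by (cases w rule: remdups_adj.cases) auto

lemma push_inv_push': "reduced_word w \<Longrightarrow> push (inv_letter a) (push a w) = w"
  using push_inv_push[of w "inv_letter a"] by simp

lemma reduced_foldr_push: "reduced_word v \<Longrightarrow> reduced_word (foldr push u v)"
  by (induction u) (auto intro: reduced_push)

lemma push_reduced: "reduced_word (a # w) \<Longrightarrow> push a w = a # w"
  by (cases w) auto

lemma foldr_push_Nil: "reduced_word u \<Longrightarrow> foldr push u [] = u"
proof (induction u)
  case (Cons a u)
  then have "foldr push u [] = u" by (auto dest: reduced_Cons)
  then show ?case using Cons.prems by (simp add: push_reduced)
qed simp

lemma foldr_push_push: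
  assumes "reduced_word v" "reduced_word w"
  shows "foldr push (push a v) w = push a (foldr push v w)"
  using assms by (cases v) (auto simp: push_inv_push reduced_foldr_push dest: reduced_Cons)

lemma foldr_push_assoc:
  assumes "reduced_word v" "reduced_word w"
  shows "foldr push (foldr push u v) w = foldr push u (foldr push v w)"
  by (induction u) (simp_all add: assms foldr_push_push reduced_foldr_push)

lemma gens_push: "fst ` set (push a w) \<subseteq> insert (fst a) (fst ` set w)"
  by (cases w) auto

lemma gens_foldr_push: "fst ` set (foldr push u v) \<subseteq> fst ` set u \<union> fst ` set v"
proof (induction u)
  case (Cons a u)
  then show ?case using gens_push[of a "foldr push u v"] by (simp del: Un_insert_left) blast
qed simp

lemma foldr_push_rev:
  assumes "reduced_word v"
  shows "foldr push (map inv_letter (rev u)) (foldr push u v) = v"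
  using assms by (induction u arbitrary: v) (simp_all add: push_inv_push' reduced_foldr_push)

theorem free_group_is_group: "group (free_group r)"
proof (rule groupI)
  fix u v assume "u \<in> carrier (free_group r)" "v \<in> carrier (free_group r)"
  then show "u \<otimes>\<^bsub>free_group r\<^esub> v \<in> carrier (free_group r)"
    using order_trans[OF gens_foldr_push[of u v] Un_least]
    by (simp add: free_group_def reduced_foldr_push)
next
  fix u assume u: "u \<in> carrier (free_group r)"
  define v where "v = foldr push (map inv_letter (rev u)) []"
  have "fst ` set (map inv_letter (rev u)) = fst ` set u"
    by (simp add: image_image inv_letter_def)
  then have "v \<in> carrier (free_group r)"
    using u order_trans[OF gens_foldr_push[of "map inv_letter (rev u)" "[]"] Un_least]
    by (simp add: free_group_def v_def reduced_foldr_push)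
  moreover have "v \<otimes>\<^bsub>free_group r\<^esub> u = \<one>\<^bsub>free_group r\<^esub>"
    using u foldr_push_assoc[of "[]" u "map inv_letter (rev u)"] foldr_push_rev[of "[]" u]
    by (simp add: free_group_def v_def foldr_push_Nil)
  ultimately show "\<exists>v\<in>carrier (free_group r). v \<otimes>\<^bsub>free_group r\<^esub> u = \<one>\<^bsub>free_group r\<^esub>"
    by blast
qed (auto simp: free_group_def foldr_push_assoc)


section \<open>The special linear group over a commutative ring\<close>

definition mat_det :: "nat \<Rightarrow> ('a, 'b) ring_scheme \<Rightarrow> (nat \<times> nat \<Rightarrow> 'a) \<Rightarrow> 'a" where
  "mat_det n R A =
     (\<Oplus>\<^bsub>R\<^esub>\<sigma>\<in>{\<sigma>. \<sigma> permutes {..<n}}.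
        let t = (\<Otimes>\<^bsub>R\<^esub>i\<in>{..<n}. A (i, \<sigma> i)) in if evenperm \<sigma> then t else \<ominus>\<^bsub>R\<^esub> t)"

definition SL :: "nat \<Rightarrow> ('a, 'b) ring_scheme \<Rightarrow> (nat \<times> nat \<Rightarrow> 'a) monoid" where
  "SL n R =
     \<lparr>carrier = {A \<in> {..<n} \<times> {..<n} \<rightarrow>\<^sub>E carrier R. mat_det n R A = \<one>\<^bsub>R\<^esub>},
      monoid.mult = (\<lambda>A B. \<lambda>(i, j)\<in>{..<n} \<times> {..<n}. \<Oplus>\<^bsub>R\<^esub>k\<in>{..<n}. A (i, k) \<otimes>\<^bsub>R\<^esub> B (k, j)),
      one = (\<lambda>(i, j)\<in>{..<n} \<times> {..<n}. if i = j then \<one>\<^bsub>R\<^esub> else \<zero>\<^bsub>R\<^esub>)\<rparr>"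


section \<open>The field of p-adic numbers\<close>

definition padic_abs :: "nat \<Rightarrow> rat \<Rightarrow> real" where
  "padic_abs p x =
     (if x = 0 then 0
      else real p powi (int (multiplicity (int p) (snd (quotient_of x)))
                        - int (multiplicity (int p) (fst (quotient_of x)))))"

definition padic_Cauchy :: "nat \<Rightarrow> (nat \<Rightarrow> rat) \<Rightarrow> bool" where
  "padic_Cauchy p x \<longleftrightarrow> (\<forall>e>0. \<exists>N. \<forall>m\<ge>N. \<forall>n\<ge>N. padic_abs p (x m - x n) < e)"

definition padic_Cauchy_ring :: "nat \<Rightarrow> (nat \<Rightarrow> rat) ring" where
  "padic_Cauchy_ring p =
     \<lparr>carrier = {x. padic_Cauchy p x}, monoid.mult = (\<lambda>x y n. x n * y n), one = (\<lambda>n. 1),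
      ring.zero = (\<lambda>n. 0), add = (\<lambda>x y n. x n + y n)\<rparr>"

definition padic_null :: "nat \<Rightarrow> (nat \<Rightarrow> rat) set" where
  "padic_null p = {x. (\<lambda>n. padic_abs p (x n)) \<longlonglongrightarrow> 0}"

definition Qp :: "nat \<Rightarrow> (nat \<Rightarrow> rat) set ring" where
  "Qp p = padic_Cauchy_ring p Quot padic_null p"

lemma padic_abs_0 [simp]: "padic_abs p 0 = 0"
  by (simp add: padic_abs_def)

lemma padic_abs_of_frac:
  assumes p: "prime p" and ab: "a \<noteq> 0" "b \<noteq> 0"
  shows "padic_abs p (of_int a / of_int b)
           = real p powi (int (multiplicity (int p) b) - int (multiplicity (int p) a))"
proof -
  obtain n d where nd: "quotient_of (of_int a / of_int b) = (n, d)"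
    by (cases "quotient_of (of_int a / of_int b)")
  have d: "d > 0" using nd by (rule quotient_of_denom_pos)
  have eq: "of_int a / of_int b = (of_int n / of_int d :: rat)"
    using nd by (rule quotient_of_div)
  have "(of_int (a * d) :: rat) = of_int (n * b)"
    using eq ab d by (simp add: field_simps)
  then have *: "a * d = n * b" using of_int_eq_iff by blast
  have n: "n \<noteq> 0" using * ab d by auto
  have pe: "prime_elem (int p)" using p by simp
  have "multiplicity (int p) a + multiplicity (int p) d
          = multiplicity (int p) n + multiplicity (int p) b"
    using arg_cong[OF *, of "multiplicity (int p)"] ab d n
    by (simp add: prime_elem_multiplicity_mult_distrib[OF pe])
  then show ?thesis
    using ab nd by (simp add: padic_abs_def) (smt (verit) of_nat_add)
qed

lemma padic_abs_nonneg [simp]: "padic_abs p x \<ge> 0"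
  by (simp add: padic_abs_def)

lemma padic_abs_eq_0 [simp]: "prime p \<Longrightarrow> padic_abs p x = 0 \<longleftrightarrow> x = 0"
  by (auto simp: padic_abs_def prime_gt_0_nat)

lemma rat_frac: obtains a b :: int where "b > 0" "x = (of_int a / of_int b :: rat)"
  by (metis quotient_of_denom_pos quotient_of_div surj_pair)

lemma padic_abs_mult:
  assumes p: "prime p"
  shows "padic_abs p (x * y) = padic_abs p x * padic_abs p y"
proof (cases "x = 0 \<or> y = 0")
  case False
  obtain a b where ab: "b > 0" "x = of_int a / of_int b" by (rule rat_frac)
  obtain c d where cd: "d > 0" "y = of_int c / of_int d" by (rule rat_frac)
  have nz: "a \<noteq> 0" "c \<noteq> 0" "b \<noteq> 0" "d \<noteq> 0" using False ab cd by auto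
  have xy: "x * y = of_int (a * c) / of_int (b * d)" using ab cd by simp
  have pe: "prime_elem (int p)" using p by simp
  have p0: "real p \<noteq> 0" using p by (simp add: prime_gt_0_nat)
  show ?thesis
    unfolding xy
    using nz p0 unfolding ab(2) cd(2)
    by (simp only: padic_abs_of_frac[OF p] mult_eq_0_iff
        prime_elem_multiplicity_mult_distrib[OF pe] power_int_add[symmetric] of_nat_add
        not_False_eq_True simp_thms)
      (simp add: power_int_add[symmetric] algebra_simps)
qed auto

lemma padic_abs_1 [simp]: "prime p \<Longrightarrow> padic_abs p 1 = 1"
  using padic_abs_of_frac[of p 1 1] by simp

lemma padic_abs_uminus [simp]: "padic_abs p (- x) = padic_abs p x"
proof -
  have "multiplicity q (- a) = multiplicity q a" for q a :: int
    using multiplicity_times_unit_right[of "- 1" q a] by simp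
  then show ?thesis by (simp add: padic_abs_def rat_uminus_code split: prod.split)
qed

lemma padic_abs_minus_commute: "padic_abs p (x - y) = padic_abs p (y - x)"
  using padic_abs_uminus[of p "x - y"] by simp

lemma padic_abs_int_le_1: "prime p \<Longrightarrow> padic_abs p (of_int a) \<le> 1"
  using padic_abs_of_frac[of p a 1] prime_gt_1_nat[of p]
  by (cases "a = 0") (auto simp: power_int_minus inverse_le_1_iff)

lemma padic_abs_add:
  assumes p: "prime p"
  shows "padic_abs p (x + y) \<le> max (padic_abs p x) (padic_abs p y)"
proof (cases "x = 0 \<or> y = 0 \<or> x + y = 0")
  case False
  obtain a b where ab: "b > 0" "x = of_int a / of_int b" by (rule rat_frac)
  obtain c d where cd: "d > 0" "y = of_int c / of_int d" by (rule rat_frac)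
  have nz: "a \<noteq> 0" "c \<noteq> 0" "b \<noteq> 0" "d \<noteq> 0" using False ab cd by auto
  let ?u = "a * d" and ?v = "c * b" and ?m = "multiplicity (int p)"
  have x: "x = of_int ?u / of_int (b * d)" and y: "y = of_int ?v / of_int (b * d)"
    using ab cd by (simp_all add: field_simps)
  have xy: "x + y = of_int (?u + ?v) / of_int (b * d)"
    unfolding x y by (simp add: add_divide_distrib)
  have "?u + ?v \<noteq> 0"
  proof
    assume "?u + ?v = 0"
    then have "x + y = 0" unfolding xy by (simp only: of_int_0 div_0)
    then show False using False by simp
  qed
  then have nz': "?u \<noteq> 0" "?v \<noteq> 0" "b * d \<noteq> 0" "?u + ?v \<noteq> 0"
    using nz by auto
  have "\<not> is_unit (int p)" using p not_prime_unit[of "int p"] by auto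
  moreover have "int p ^ min (?m ?u) (?m ?v) dvd ?u + ?v"
    by (intro dvd_add) (rule multiplicity_dvd', simp)+
  ultimately have "min (?m ?u) (?m ?v) \<le> ?m (?u + ?v)"
    using nz'(4) by (intro multiplicity_geI)
  then have "?m ?u \<le> ?m (?u + ?v) \<or> ?m ?v \<le> ?m (?u + ?v)" by linarith
  moreover have "real p \<ge> 1" using prime_gt_1_nat[OF p] by simp
  ultimately have "padic_abs p (x + y) \<le> padic_abs p x \<or> padic_abs p (x + y) \<le> padic_abs p y"
    unfolding xy unfolding x y padic_abs_of_frac[OF p nz'(4,3)] padic_abs_of_frac[OF p nz'(1,3)]
      padic_abs_of_frac[OF p nz'(2,3)]
    by (auto intro: power_int_increasing)
  then show ?thesis by auto
qed (auto simp: max_def)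

lemma padic_abs_triangle:
  "prime p \<Longrightarrow> padic_abs p (x + y) \<le> padic_abs p x + padic_abs p y"
  by (smt (verit) padic_abs_add padic_abs_nonneg)

lemma padic_abs_diff: "prime p \<Longrightarrow> padic_abs p x - padic_abs p y \<le> padic_abs p (x - y)"
  using padic_abs_triangle[of p "x - y" y] by simp

lemma padic_abs_inverse: "prime p \<Longrightarrow> padic_abs p (inverse x) = inverse (padic_abs p x)"
  using padic_abs_mult[of p x "inverse x"]
  by (cases "x = 0") (auto simp: field_simps)

lemma padic_Cauchy_bounded:
  assumes p: "prime p" and x: "padic_Cauchy p x"
  obtains B where "B > 0" "\<And>n. padic_abs p (x n) \<le> B"
proof -
  obtain N where N: "\<And>m n. m \<ge> N \<Longrightarrow> n \<ge> N \<Longrightarrow> padic_abs p (x m - x n) < 1"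
    using x unfolding padic_Cauchy_def by (meson zero_less_one)
  let ?B = "1 + (\<Sum>i\<le>N. padic_abs p (x i))"
  have mem: "padic_abs p (x i) \<le> (\<Sum>i\<le>N. padic_abs p (x i))" if "i \<le> N" for i
    using that by (intro member_le_sum) auto
  have "padic_abs p (x n) \<le> ?B" for n
  proof (cases "n \<le> N")
    case False
    then have "padic_abs p (x n - x N) < 1" using N by auto
    then show ?thesis using padic_abs_diff[OF p, of "x n" "x N"] mem[of N] by auto
  qed (use mem in force)
  moreover have "?B > 0" using sum_nonneg[of "{..N}" "\<lambda>i. padic_abs p (x i)"] by auto
  ultimately show ?thesis using that by blast
qed

lemma padic_Cauchy_add:
  assumes p: "prime p" and "padic_Cauchy p x" "padic_Cauchy p y"
  shows "padic_Cauchy p (\<lambda>n. x n + y n)"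
  unfolding padic_Cauchy_def
proof (intro allI impI)
  fix e :: real assume "e > 0"
  then obtain M N where
    M: "\<And>m n. m \<ge> M \<Longrightarrow> n \<ge> M \<Longrightarrow> padic_abs p (x m - x n) < e" and
    N: "\<And>m n. m \<ge> N \<Longrightarrow> n \<ge> N \<Longrightarrow> padic_abs p (y m - y n) < e"
    using assms unfolding padic_Cauchy_def by meson
  have "padic_abs p (x m + y m - (x n + y n)) < e" if "m \<ge> max M N" "n \<ge> max M N" for m n
    using padic_abs_add[OF p, of "x m - x n" "y m - y n"] M[of m n] N[of m n] that
    by (simp add: algebra_simps)
  then show "\<exists>N. \<forall>m\<ge>N. \<forall>n\<ge>N. padic_abs p (x m + y m - (x n + y n)) < e" by blast
qed

lemma padic_Cauchy_mult:
  assumes p: "prime p" and xy: "padic_Cauchy p x" "padic_Cauchy p y"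
  shows "padic_Cauchy p (\<lambda>n. x n * y n)"
  unfolding padic_Cauchy_def
proof (intro allI impI)
  fix e :: real assume e: "e > 0"
  obtain B where B: "B > 0" "\<And>n. padic_abs p (x n) \<le> B"
    using padic_Cauchy_bounded[OF p xy(1)] by blast
  obtain C where C: "C > 0" "\<And>n. padic_abs p (y n) \<le> C"
    using padic_Cauchy_bounded[OF p xy(2)] by blast
  have "e / C > 0" "e / B > 0" using e B C by auto
  then obtain M N where
    M: "\<And>m n. m \<ge> M \<Longrightarrow> n \<ge> M \<Longrightarrow> padic_abs p (x m - x n) < e / C" and
    N: "\<And>m n. m \<ge> N \<Longrightarrow> n \<ge> N \<Longrightarrow> padic_abs p (y m - y n) < e / B"
    using xy unfolding padic_Cauchy_def by meson
  have "padic_abs p (x m * y m - x n * y n) < e" if mn: "m \<ge> max M N" "n \<ge> max M N" for m n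
  proof -
    have eq: "x m * y m - x n * y n = (x m - x n) * y m + x n * (y m - y n)"
      by (simp add: algebra_simps)
    have "padic_abs p ((x m - x n) * y m) \<le> padic_abs p (x m - x n) * C"
      unfolding padic_abs_mult[OF p] using C by (intro mult_left_mono) auto
    also have "\<dots> < e" using M[of m n] mn C by (simp add: field_simps)
    finally have 1: "padic_abs p ((x m - x n) * y m) < e" .
    have "padic_abs p (x n * (y m - y n)) \<le> B * padic_abs p (y m - y n)"
      unfolding padic_abs_mult[OF p] using B by (intro mult_right_mono) auto
    also have "\<dots> < e" using N[of m n] mn B by (simp add: field_simps)
    finally show ?thesis
      using 1 padic_abs_add[OF p, of "(x m - x n) * y m" "x n * (y m - y n)"]
      unfolding eq by linarith
  qed
  then show "\<exists>N. \<forall>m\<ge>N. \<forall>n\<ge>N. padic_abs p (x m * y m - x n * y n) < e" by blast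
qed

lemma padic_Cauchy_const: "padic_Cauchy p (\<lambda>n. c)"
  by (simp add: padic_Cauchy_def)

lemma padic_Cauchy_uminus: "padic_Cauchy p x \<Longrightarrow> padic_Cauchy p (\<lambda>n. - x n)"
proof -
  have "padic_abs p (- x m - - x n) = padic_abs p (x m - x n)" for m n
    using padic_abs_uminus[of p "x m - x n"] by (simp add: algebra_simps)
  then show "padic_Cauchy p x \<Longrightarrow> padic_Cauchy p (\<lambda>n. - x n)"
    unfolding padic_Cauchy_def by simp
qed

lemma padic_Cauchy_ring_is_cring:
  assumes p: "prime p" shows "cring (padic_Cauchy_ring p)"
proof (rule cringI)
  show "abelian_group (padic_Cauchy_ring p)"
  proof (rule abelian_groupI)
    fix x assume x: "x \<in> carrier (padic_Cauchy_ring p)"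
    show "\<exists>y\<in>carrier (padic_Cauchy_ring p). y \<oplus>\<^bsub>padic_Cauchy_ring p\<^esub> x = \<zero>\<^bsub>padic_Cauchy_ring p\<^esub>"
      by (rule bexI[of _ "\<lambda>n. - x n"])
         (use x in \<open>auto simp: padic_Cauchy_ring_def intro: padic_Cauchy_uminus\<close>)
  qed (auto simp: padic_Cauchy_ring_def padic_Cauchy_const algebra_simps intro: padic_Cauchy_add[OF p])
  show "comm_monoid (padic_Cauchy_ring p)"
    by (rule comm_monoidI)
       (auto simp: padic_Cauchy_ring_def padic_Cauchy_const algebra_simps
             intro: padic_Cauchy_mult[OF p])
qed (auto simp: padic_Cauchy_ring_def algebra_simps)

lemma padic_null_Cauchy:
  assumes p: "prime p" and x: "x \<in> padic_null p"
  shows "padic_Cauchy p x"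
  unfolding padic_Cauchy_def
proof (intro allI impI)
  fix e :: real assume "e > 0"
  then obtain N where N: "\<And>n. n \<ge> N \<Longrightarrow> padic_abs p (x n) < e"
    using x unfolding padic_null_def by (auto simp: LIMSEQ_iff)
  have "padic_abs p (x m - x n) < e" if "m \<ge> N" "n \<ge> N" for m n
    using padic_abs_add[OF p, of "x m" "- x n"] N[OF that(1)] N[OF that(2)] by simp
  then show "\<exists>N. \<forall>m\<ge>N. \<forall>n\<ge>N. padic_abs p (x m - x n) < e" by blast
qed

lemma padic_null_add:
  assumes p: "prime p" and "x \<in> padic_null p" "y \<in> padic_null p"
  shows "(\<lambda>n. x n + y n) \<in> padic_null p"
proof -
  have "(\<lambda>n. padic_abs p (x n) + padic_abs p (y n)) \<longlonglongrightarrow> 0"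
    using assms unfolding padic_null_def by (auto intro: tendsto_add_zero)
  then have "(\<lambda>n. padic_abs p (x n + y n)) \<longlonglongrightarrow> 0"
    by (rule Lim_null_comparison[rotated]) (auto simp: padic_abs_triangle[OF p])
  then show ?thesis by (simp add: padic_null_def)
qed

lemma padic_null_mult:
  assumes p: "prime p" and x: "x \<in> padic_null p" and y: "padic_Cauchy p y"
  shows "(\<lambda>n. x n * y n) \<in> padic_null p"
proof -
  obtain C where C: "C > 0" "\<And>n. padic_abs p (y n) \<le> C"
    using padic_Cauchy_bounded[OF p y] by blast
  have "(\<lambda>n. padic_abs p (x n) * C) \<longlonglongrightarrow> 0"
    using x unfolding padic_null_def by (auto intro: tendsto_mult_left_zero)
  then have "(\<lambda>n. padic_abs p (x n * y n)) \<longlonglongrightarrow> 0"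
    by (rule Lim_null_comparison[rotated]) (auto simp: padic_abs_mult[OF p] C(2) mult_left_mono)
  then show ?thesis by (simp add: padic_null_def)
qed

lemma padic_null_ideal:
  assumes p: "prime p" shows "ideal (padic_null p) (padic_Cauchy_ring p)"
proof -
  interpret R: cring "padic_Cauchy_ring p" by (rule padic_Cauchy_ring_is_cring[OF p])
  have inv: "\<ominus>\<^bsub>padic_Cauchy_ring p\<^esub> x = (\<lambda>n. - x n)" if "x \<in> padic_null p" for x
    using padic_null_Cauchy[OF p that]
    by (intro R.minus_equality) (auto simp: padic_Cauchy_ring_def intro: padic_Cauchy_uminus)
  show ?thesis
  proof (rule idealI)
    show "subgroup (padic_null p) (add_monoid (padic_Cauchy_ring p))"
    proof (rule R.add.subgroupI)
      show "padic_null p \<subseteq> carrier (padic_Cauchy_ring p)"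
        using padic_null_Cauchy[OF p] by (auto simp: padic_Cauchy_ring_def)
      show "padic_null p \<noteq> {}" by (auto simp: padic_null_def intro!: exI[of _ "\<lambda>n. 0"])
      show "\<ominus>\<^bsub>padic_Cauchy_ring p\<^esub> x \<in> padic_null p" if "x \<in> padic_null p" for x
        using that by (simp add: inv padic_null_def)
    qed (auto simp: padic_Cauchy_ring_def padic_null_add[OF p])
    show "y \<otimes>\<^bsub>padic_Cauchy_ring p\<^esub> x \<in> padic_null p"
      if "x \<in> padic_null p" "y \<in> carrier (padic_Cauchy_ring p)" for x y
      using padic_null_mult[OF p that(1), of y] that(2)
      by (simp add: padic_Cauchy_ring_def mult.commute)
    show "x \<otimes>\<^bsub>padic_Cauchy_ring p\<^esub> y \<in> padic_null p"
      if "x \<in> padic_null p" "y \<in> carrier (padic_Cauchy_ring p)" for x y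
      using padic_null_mult[OF p that(1), of y] that(2) by (simp add: padic_Cauchy_ring_def)
  qed (rule R.ring_axioms)
qed

lemma padic_Cauchy_away:
  assumes p: "prime p" and x: "padic_Cauchy p x" "x \<notin> padic_null p"
  obtains c N where "c > 0" "\<And>n. n \<ge> N \<Longrightarrow> padic_abs p (x n) \<ge> c"
proof -
  obtain e where e: "e > 0" "\<And>N. \<exists>n\<ge>N. padic_abs p (x n) \<ge> e"
    using x(2) unfolding padic_null_def by (auto simp: LIMSEQ_iff not_less)
  have "e / 2 > 0" using e by auto
  then obtain N where N: "\<And>m n. m \<ge> N \<Longrightarrow> n \<ge> N \<Longrightarrow> padic_abs p (x m - x n) < e / 2"
    using x(1) unfolding padic_Cauchy_def by meson
  obtain m where m: "m \<ge> N" "padic_abs p (x m) \<ge> e" using e by blast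
  have "padic_abs p (x n) \<ge> e / 2" if "n \<ge> N" for n
    using padic_abs_diff[OF p, of "x m" "x n"] N[OF m(1) that] m(2) by linarith
  then show ?thesis using that e by (meson half_gt_zero)
qed

lemma padic_Cauchy_inverse:
  assumes p: "prime p" and x: "padic_Cauchy p x" "x \<notin> padic_null p"
  shows "padic_Cauchy p (\<lambda>n. inverse (x n))"
  unfolding padic_Cauchy_def
proof (intro allI impI)
  fix e :: real assume e: "e > 0"
  obtain c M where c: "c > 0" and M: "\<And>n. n \<ge> M \<Longrightarrow> padic_abs p (x n) \<ge> c"
    using padic_Cauchy_away[OF p x] by blast
  have "e * (c * c) > 0" using e c by auto
  then obtain N where N: "\<And>m n. m \<ge> N \<Longrightarrow> n \<ge> N \<Longrightarrow> padic_abs p (x m - x n) < e * (c * c)"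
    using x(1) unfolding padic_Cauchy_def by meson
  have "padic_abs p (inverse (x m) - inverse (x n)) < e" if mn: "m \<ge> max M N" "n \<ge> max M N" for m n
  proof -
    have cm: "padic_abs p (x m) \<ge> c" "padic_abs p (x n) \<ge> c" using M mn by auto
    then have nz: "x m \<noteq> 0" "x n \<noteq> 0" using c by auto
    have "inverse (x m) - inverse (x n) = (x n - x m) * inverse (x m * x n)"
      using nz by (simp add: field_simps)
    then have "padic_abs p (inverse (x m) - inverse (x n))
        = padic_abs p (x n - x m) / (padic_abs p (x m) * padic_abs p (x n))"
      by (simp only: padic_abs_mult[OF p] padic_abs_inverse[OF p] divide_inverse)
    also have "\<dots> \<le> padic_abs p (x n - x m) / (c * c)"
      using cm c by (intro divide_left_mono mult_mono) auto
    also have "\<dots> < e" using N[of n m] mn c by (simp add: field_simps)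
    finally show ?thesis .
  qed
  then show "\<exists>N. \<forall>m\<ge>N. \<forall>n\<ge>N. padic_abs p (inverse (x m) - inverse (x n)) < e" by blast
qed

theorem Qp_is_field:
  assumes p: "prime p" shows "field (Qp p)"
proof -
  let ?R = "padic_Cauchy_ring p" and ?N = "padic_null p"
  interpret R: cring ?R by (rule padic_Cauchy_ring_is_cring[OF p])
  interpret N: ideal ?N ?R by (rule padic_null_ideal[OF p])
  have "maximalideal ?N ?R"
  proof (rule maximalidealI)
    show "ideal ?N ?R" by (rule padic_null_ideal[OF p])
    have "(\<lambda>n. 1) \<notin> ?N" using p by (simp add: padic_null_def LIMSEQ_const_iff)
    moreover have "(\<lambda>n. 1) \<in> carrier ?R" by (simp add: padic_Cauchy_ring_def padic_Cauchy_const)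
    ultimately show "carrier ?R \<noteq> ?N" by blast
    fix J assume J: "ideal J ?R" "?N \<subseteq> J" "J \<subseteq> carrier ?R"
    interpret J: ideal J ?R by (rule J(1))
    show "J = ?N \<or> J = carrier ?R"
    proof (cases "J = ?N")
      case False
      then obtain x where x: "x \<in> J" "x \<notin> ?N" using J by blast
      have xC: "padic_Cauchy p x" using x J by (auto simp: padic_Cauchy_ring_def)
      define y where "y = (\<lambda>n. inverse (x n))"
      have y: "y \<in> carrier ?R"
        using padic_Cauchy_inverse[OF p xC x(2)] by (simp add: padic_Cauchy_ring_def y_def)
      define z where "z = (\<lambda>n. 1 - x n * y n)"
      obtain c M where c: "c > 0" and M: "\<And>n. n \<ge> M \<Longrightarrow> padic_abs p (x n) \<ge> c"
        using padic_Cauchy_away[OF p xC x(2)] by blast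
      have "padic_abs p (z n) = 0" if "n \<ge> M" for n
      proof -
        have "x n \<noteq> 0" using M[OF that] c by auto
        then show ?thesis by (simp add: z_def y_def)
      qed
      then have "(\<lambda>n. padic_abs p (z n)) \<longlonglongrightarrow> 0"
        by (intro tendsto_eventually) (auto simp: eventually_sequentially)
      then have z: "z \<in> J" using J by (auto simp: padic_null_def)
      have "x \<otimes>\<^bsub>?R\<^esub> y \<in> J" using x(1) y by (rule J.I_r_closed)
      then have "(x \<otimes>\<^bsub>?R\<^esub> y) \<oplus>\<^bsub>?R\<^esub> z \<in> J" using z by (rule J.a_closed)
      moreover have "(x \<otimes>\<^bsub>?R\<^esub> y) \<oplus>\<^bsub>?R\<^esub> z = \<one>\<^bsub>?R\<^esub>"
        by (simp add: padic_Cauchy_ring_def z_def)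
      ultimately show ?thesis using J.one_imp_carrier by simp
    qed simp
  qed
  then show ?thesis
    unfolding Qp_def by (intro maximalideal.quotient_is_field R.cring_axioms)
qed

text \<open>The extension of the \<open>p\<close>-adic absolute value to the completion; the limit does not depend
  on the chosen representative.\<close>

definition Qp_abs :: "nat \<Rightarrow> (nat \<Rightarrow> rat) set \<Rightarrow> real" where
  "Qp_abs p a = lim (\<lambda>n. padic_abs p ((SOME x. x \<in> a) n))"

definition Zp :: "nat \<Rightarrow> (nat \<Rightarrow> rat) set set" where
  "Zp p = {a \<in> carrier (Qp p). Qp_abs p a \<le> 1}"


section \<open>Unramified extensions\<close>

type_synonym Qp_alg = "((nat \<Rightarrow> rat) set list \<times> nat) multiset \<Rightarrow> (nat \<Rightarrow> rat) set"

definition Qp_closure :: "nat \<Rightarrow> Qp_alg ring" where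
  "Qp_closure p = field.alg_closure (Qp p)"

abbreviation Qp_embed :: "nat \<Rightarrow> (nat \<Rightarrow> rat) set \<Rightarrow> Qp_alg" where
  "Qp_embed p \<equiv> ring.indexed_const (Qp p)"

lemma Qp_closure_algebraic_closure:
  "prime p \<Longrightarrow> algebraic_closure (Qp_closure p) (Qp_embed p ` carrier (Qp p))"
  unfolding Qp_closure_def by (rule field.alg_closureE(1)[OF Qp_is_field])

definition integral_over :: "('a, 'b) ring_scheme \<Rightarrow> 'a set \<Rightarrow> 'a \<Rightarrow> bool" where
  "integral_over R A x \<longleftrightarrow>
     (\<exists>P. P \<noteq> [] \<and> polynomial\<^bsub>R\<^esub> A P \<and> hd P = \<one>\<^bsub>R\<^esub> \<and> ring.eval R P x = \<zero>\<^bsub>R\<^esub>)"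

text \<open>A finite extension of \<open>\<rat>\<^sub>p\<close> is given by its underlying set \<open>F\<close> inside the algebraic closure;
  its ring of integers is the integral closure of \<open>\<int>\<^sub>p\<close> in \<open>F\<close>.\<close>

definition ring_of_integers :: "nat \<Rightarrow> Qp_alg set \<Rightarrow> Qp_alg ring" where
  "ring_of_integers p F =
     Qp_closure p \<lparr>carrier := {x \<in> F. integral_over (Qp_closure p) (Qp_embed p ` Zp p) x}\<rparr>"

definition max_ideal :: "('a, 'b) ring_scheme \<Rightarrow> 'a set" where
  "max_ideal R = (THE I. maximalideal I R)"

text \<open>Unramified means ramification index one, i.e. \<open>p\<close> generates the maximal ideal; separability of
  the residue field extension is automatic, as residue fields are finite.\<close>

definition unramified_extension :: "nat \<Rightarrow> nat \<Rightarrow> Qp_alg set \<Rightarrow> bool" where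
  "unramified_extension p s F \<longleftrightarrow>
     subfield F (Qp_closure p) \<and>
     Qp_embed p ` carrier (Qp p) \<subseteq> F \<and>
     ring.dimension (Qp_closure p) s (Qp_embed p ` carrier (Qp p)) F \<and>
     (let R = ring_of_integers p F in PIdl\<^bsub>R\<^esub> ([p] \<cdot>\<^bsub>R\<^esub> \<one>\<^bsub>R\<^esub>) = max_ideal R)"

definition residue_ring_pow :: "nat \<Rightarrow> Qp_alg set \<Rightarrow> nat \<Rightarrow> Qp_alg set ring" where
  "residue_ring_pow p F k =
     (let R = ring_of_integers p F in R Quot (max_ideal R [^]\<^bsub>ideals_set R\<^esub> k))"

definition prime_powers_avoiding :: "nat set \<Rightarrow> nat set" where
  "prime_powers_avoiding S = {p ^ s |p s. prime p \<and> p \<notin> S \<and> s \<ge> 1}"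

end

theory Submission
  imports Defs "HOL-Library.Function_Algebras" "Jordan_Normal_Form.Determinant"
begin

hide_const (open) Ring_Hom.ring_hom

text \<open>The residue ring is a finite chain ring: its maximal ideal is generated by \<open>p\<close> and nilpotent of
  exact order \<open>k\<close>; only the locality of the ring of integers needs an argument, which lifts
  idempotents from the residue ring modulo \<open>p\<close> by completeness. Let \<open>Q\<close> be the size of the residue
  field. If \<open>n\<close> is large compared with \<open>\<ell>(w)\<close>, follow about \<open>n / 2\<ell>(w)\<close> basis vectors through the
  letters of \<open>w\<close>, revealing each random matrix only on the vectors met so far. A step that leads to a
  vector independent of the revealed ones is, because of the transvections fixing these, close to
  uniform modulo the revealed subspace, and hence each basis vector hits its image under \<open>g\<close> with
  probability about \<open>Q\<close> to the power \<open>- k n / 2\<close>. If \<open>n\<close> is small, multiply the random matrices by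
  products of transvections whose parameters run through a random line. The word becomes a
  polynomial in the line parameter of degree \<open>O(n \<ell>(w))\<close>, and since \<open>w\<close> is not a law modulo \<open>p\<close>, the
  line can be made to pass through a point where this polynomial differs from \<open>g\<close> modulo \<open>p\<close>; such a
  polynomial of degree \<open>d\<close> takes the value \<open>g\<close> with probability at most \<open>d\<close> times \<open>Q\<close> to the power
  \<open>- k / d\<close>.\<close>

section \<open>Modules over finite chain rings\<close>

text \<open>The obstacle is uniformity in \<open>k\<close>: a coincidence modulo \<open>p\<close>
  has probability only about 1/Q, while a saving of Q to a multiple of \<open>k\<close> is needed.
  In large rank this is met by recording the p-adic depth of the part of a vector that is new to the
  next letter. A rise of the depth by i has conditional probability at most Q^(-i \<beta>), which
  exactly repays the smaller gain that is left for the later letters. In small rank the rule that a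
  polynomial of degree d has at most d roots fails because of zero divisors. Its substitute: if d b
  < k and the polynomial is non-zero modulo \<open>p\<close> at 0, its zeros lie in at most d
  residue classes modulo p^(b+1). Both arguments see the group only through its transvections, a
  faithful linear action and one consequence of determinant one. The bound on the excluded primes
  does not involve the rank: with l the length of the word, 2^l absorbs a factor (k+1)^l that counts
  the possible depths, 2304 l^4 dominates (2 d)^2 for the degrees d \<le> 24 l^2 of small rank, and
  the terms linear in \<open>r\<close> and l supply enough distinct residues modulo \<open>p\<close>
  to see that the word is not a law.\<close>

lemma card_eq_ker_times_image:
  fixes f :: "'a::ab_group_add \<Rightarrow> 'b::ab_group_add"
  assumes fin: "finite A" and ne: "A \<noteq> {}" and diff: "\<And>x y. x \<in> A \<Longrightarrow> y \<in> A \<Longrightarrow> x - y \<in> A"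
    and hom: "\<And>x y. x \<in> A \<Longrightarrow> y \<in> A \<Longrightarrow> f (x - y) = f x - f y"
  shows "card A = card {x \<in> A. f x = 0} * card (f ` A)"
proof -
  have zero: "0 \<in> A" using ne diff by force
  have add: "x + y \<in> A" if "x \<in> A" "y \<in> A" for x y
    using diff[of x "0 - y"] diff[OF zero, of y] that by simp
  have f0: "f 0 = 0" using hom[OF zero zero] by simp
  have fadd: "f (x + y) = f x + f y" if "x \<in> A" "y \<in> A" for x y
    using hom[of x "0 - y"] hom[OF zero, of y] diff[OF zero, of y] that f0 by simp
  have fib: "card {x \<in> A. f x = b} = card {x \<in> A. f x = 0}" if "b \<in> f ` A" for b
  proof -
    obtain a where a: "a \<in> A" "b = f a" using \<open>b \<in> f ` A\<close> by blast
    have "bij_betw (\<lambda>x. x + a) {x \<in> A. f x = 0} {x \<in> A. f x = b}"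
      by (rule bij_betw_byWitness[where f' = "\<lambda>x. x - a"])
         (use a add diff hom fadd in auto)
    then show ?thesis by (simp add: bij_betw_same_card)
  qed
  have "card A = (\<Sum>b\<in>f ` A. card {x \<in> A. f x = b})"
  proof -
    have "A = (\<Union>b\<in>f ` A. {x \<in> A. f x = b})" by auto
    then have "card A = card (\<Union>b\<in>f ` A. {x \<in> A. f x = b})" by simp
    also have "\<dots> = (\<Sum>b\<in>f ` A. card {x \<in> A. f x = b})"
      by (rule card_UN_disjoint) (use fin in auto)
    finally show ?thesis .
  qed
  also have "\<dots> = (\<Sum>b\<in>f ` A. card {x \<in> A. f x = 0})" by (rule sum.cong) (use fib in auto)
  finally show ?thesis by simp
qed

definition smul :: "'u::comm_ring_1 \<Rightarrow> (nat \<Rightarrow> 'u) \<Rightarrow> nat \<Rightarrow> 'u" where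
  "smul c v = (\<lambda>i. c * v i)"

lemma smul_apply [simp]: "smul c v i = c * v i"
  by (simp add: smul_def)

lemma smul_simps:
  "smul c (v + w) = smul c v + smul c w" "smul c (v - w) = smul c v - smul c w"
  "smul (c + d) v = smul c v + smul d v" "smul (c - d) v = smul c v - smul d v"
  "smul c (smul d v) = smul (c * d) v" "smul 1 v = v" "smul 0 v = 0" "smul c 0 = 0"
  "smul (- c) v = - smul c v" "smul c (- v) = - smul c v"
  by (auto simp: smul_def fun_eq_iff algebra_simps)

text \<open>The ring under study is the ideal \<open>S = e R\<close> generated by an idempotent \<open>e\<close>, its unit, in an ambient
  type-class ring \<open>R\<close>; both here and in \<open>dvr_ext\<close> this stands in for rings with explicit carriers.\<close>

locale chain_ring =
  fixes e :: "'u::comm_ring_1" and p k n :: nat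
  assumes ee: "e * e = e" and finS: "finite {x. e * x = x}" and kpos: "k \<ge> 1"
    and p: "prime p"
    and loc: "\<And>x. (\<exists>y. e * x * y = e) \<or> (\<exists>y. e * x = e * (of_nat p * y))"
    and pk: "of_nat p ^ k * e = 0" and pk1: "of_nat p ^ (k - 1) * e \<noteq> 0"
begin

abbreviation \<pi> :: 'u where "\<pi> \<equiv> of_nat p"

definition S :: "'u set" where "S = {x. e * x = x}"
definition I :: "nat \<Rightarrow> 'u set" where "I m = (\<lambda>x. \<pi> ^ m * x) ` S"
text \<open>Vectors are functions on all of \<open>nat\<close> that vanish from \<open>n\<close> on,
  so that \<open>V\<close> is a subgroup of a function type and inherits its pointwise
  addition.\<close>

definition V :: "(nat \<Rightarrow> 'u) set" where "V = {v. (\<forall>i<n. v i \<in> S) \<and> (\<forall>i\<ge>n. v i = 0)}"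
definition P :: "nat \<Rightarrow> (nat \<Rightarrow> 'u) set" where "P m = {v \<in> V. \<forall>i. v i \<in> I m}"
text \<open>The order of the residue field: multiplication by \<open>\<pi> ^ (k - 1)\<close>
  identifies \<open>S\<close> modulo \<open>\<pi>\<close> with \<open>I (k - 1)\<close>.\<close>

definition Q :: nat where "Q = card (I (k - 1))"

lemma S_closed [simp, intro]:
  "0 \<in> S" "e \<in> S" "x \<in> S \<Longrightarrow> y \<in> S \<Longrightarrow> x + y \<in> S" "x \<in> S \<Longrightarrow> y \<in> S \<Longrightarrow> x - y \<in> S"
  "x \<in> S \<Longrightarrow> - x \<in> S" "x \<in> S \<Longrightarrow> c * x \<in> S" "x \<in> S \<Longrightarrow> x * c \<in> S"
  unfolding S_def by (auto simp: ee algebra_simps)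

lemma e_S: "x \<in> S \<Longrightarrow> e * x = x" by (simp add: S_def)
lemma eS [simp]: "e * c \<in> S" using S_closed(7)[OF S_closed(2)] .
lemma S_sum: "(\<And>i. i \<in> A \<Longrightarrow> f i \<in> S) \<Longrightarrow> sum f A \<in> S"
  by (induction A rule: infinite_finite_induct) auto

lemma finite_S [simp]: "finite S" using finS by (simp add: S_def)
lemma finite_I [simp]: "finite (I m)" by (simp add: I_def)

lemma I_sub_S: "x \<in> I m \<Longrightarrow> x \<in> S" by (auto simp: I_def)

lemma I_closed [simp, intro]:
  "0 \<in> I m" "x \<in> I m \<Longrightarrow> y \<in> I m \<Longrightarrow> x + y \<in> I m" "x \<in> I m \<Longrightarrow> y \<in> I m \<Longrightarrow> x - y \<in> I m"
  "x \<in> I m \<Longrightarrow> - x \<in> I m" "x \<in> I m \<Longrightarrow> c * x \<in> I m" "x \<in> I m \<Longrightarrow> x * c \<in> I m"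
  unfolding I_def image_iff
       apply (rule bexI[of _ 0]; simp)
      apply (auto)
  subgoal for a b by (rule bexI[of _ "a + b"]) (auto simp: algebra_simps)
  subgoal for a b by (rule bexI[of _ "a - b"]) (auto simp: algebra_simps)
  subgoal for a by (rule bexI[of _ "- a"]) (auto simp: algebra_simps)
  subgoal for a by (rule bexI[of _ "c * a"]) (auto simp: algebra_simps)
  subgoal for a by (rule bexI[of _ "c * a"]) (auto simp: algebra_simps)
  done

lemma I_0 [simp]: "I 0 = S" by (auto simp: I_def)

lemma I_mono: "a \<le> b \<Longrightarrow> I b \<subseteq> I a"
proof
  fix x assume "a \<le> b" "x \<in> I b"
  then obtain y where "y \<in> S" "x = \<pi> ^ b * y" by (auto simp: I_def)
  then have "x = \<pi> ^ a * (\<pi> ^ (b - a) * y)" using \<open>a \<le> b\<close>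
    by (metis le_add_diff_inverse mult.assoc power_add)
  then show "x \<in> I a" using \<open>y \<in> S\<close> by (auto simp: I_def)
qed

lemma pS: "x \<in> S \<Longrightarrow> \<pi> ^ m * x \<in> I m" by (auto simp: I_def)
lemma pI: "x \<in> I a \<Longrightarrow> \<pi> ^ b * x \<in> I (a + b)"
  by (auto simp: I_def power_add algebra_simps image_iff)

lemma I_k: "I k = {0}"
proof -
  have "\<pi> ^ k * x = 0" if "x \<in> S" for x
    by (metis e_S mult.assoc mult_zero_left pk that)
  then show ?thesis by (auto simp: I_def image_iff intro!: bexI[of _ 0])
qed

lemma unit_or: assumes "x \<in> S" "x \<notin> I (Suc 0)" obtains y where "y \<in> S" "x * y = e"
proof -
  from loc[of x] e_S[OF assms(1)] consider y where "x * y = e" | y where "x = e * (\<pi> * y)" by auto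
  then show ?thesis
  proof cases
    case 1
    then have "x * (e * y) = e" by (metis ee mult.left_commute)
    then show ?thesis using that[of "e * y"] by simp
  next
    case 2
    then have "x = \<pi> ^ Suc 0 * (e * y)" by (simp add: algebra_simps)
    then have "x \<in> I (Suc 0)" by (metis eS pS)
    then show ?thesis using assms by simp
  qed
qed

lemma e_notin: "e \<notin> I (Suc 0)"
proof
  assume "e \<in> I (Suc 0)"
  then have "\<pi> ^ (k - 1) * e \<in> I (Suc 0 + (k - 1))" by (rule pI)
  then show False using pk1 I_k kpos by simp
qed

text \<open>If x is \<open>\<pi> ^ j\<close> times a unit, then \<open>\<pi> ^ a * x = 0\<close>
  forces a + j \<ge> k. So one more factor \<open>\<pi>\<close> can be split off as long as j < k -
  a.\<close>

lemma ann: assumes "x \<in> S" "\<pi> ^ a * x = 0" "a \<le> k" shows "x \<in> I (k - a)"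
proof -
  have "x \<in> I j" if "j \<le> k - a" for j
    using that
  proof (induction j)
    case (Suc j)
    then obtain u where u: "u \<in> S" "x = \<pi> ^ j * u" by (auto simp: I_def)
    have "u \<in> I (Suc 0)"
    proof (rule ccontr)
      assume "u \<notin> I (Suc 0)"
      then obtain y where y: "u * y = e" using unit_or u by metis
      have "\<pi> ^ (a + j) * e = \<pi> ^ a * x * y" by (simp add: u y[symmetric] power_add algebra_simps)
      then have "\<pi> ^ (a + j) * e = 0" using assms by simp
      moreover have "k - 1 = (k - 1 - (a + j)) + (a + j)" using Suc.prems assms by simp
      ultimately have "\<pi> ^ (k - 1) * e = 0" by (metis mult.assoc mult_zero_right power_add)
      then show False using pk1 by simp
    qed
    then have "\<pi> ^ j * u \<in> I (Suc 0 + j)" by (rule pI)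
    then show ?case using u by simp
  qed (use assms in simp)
  then show ?thesis by simp
qed

text \<open>The element x differs from a multiple of \<open>\<pi> ^ b\<close> by something that
  \<open>\<pi> ^ a\<close> kills, hence by an element of \<open>I (k - a)\<close>; the condition a +
  b \<le> k places this inside \<open>I b\<close>.\<close>

lemma p_cancel: assumes "x \<in> S" "\<pi> ^ a * x \<in> I (a + b)" "a + b \<le> k" shows "x \<in> I b"
proof -
  obtain y where y: "y \<in> S" "\<pi> ^ a * x = \<pi> ^ (a + b) * y" using assms by (auto simp: I_def)
  have "\<pi> ^ a * (x - \<pi> ^ b * y) = 0" using y by (simp add: algebra_simps power_add)
  then have "x - \<pi> ^ b * y \<in> I (k - a)" using assms y by (intro ann) auto
  moreover have "b \<le> k - a" using assms(3) by simp
  ultimately have "x - \<pi> ^ b * y \<in> I b" using I_mono by blast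
  moreover have "\<pi> ^ b * y \<in> I b" using y by (simp add: pS)
  ultimately have "(x - \<pi> ^ b * y) + \<pi> ^ b * y \<in> I b" by (rule I_closed)
  then show ?thesis by simp
qed

lemma val_ex: assumes "x \<in> S" "x \<notin> I (Suc b)"
  obtains a u y where "a \<le> b" "u \<in> S" "x = \<pi> ^ a * u" "u * y = e"
proof -
  define a where "a = (LEAST a. x \<notin> I (Suc a))"
  have a: "x \<notin> I (Suc a)" unfolding a_def using assms(2) by (rule LeastI)
  have ab: "a \<le> b" unfolding a_def using assms(2) by (rule Least_le)
  have "x \<in> I a"
  proof (cases a)
    case (Suc a')
    then have "\<not> (x \<notin> I (Suc a'))" using not_less_Least[of a' "\<lambda>a. x \<notin> I (Suc a)"] a_def by auto
    then show ?thesis using Suc by simp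
  qed (use assms in simp)
  then obtain u where u: "u \<in> S" "x = \<pi> ^ a * u" by (auto simp: I_def)
  have "u \<notin> I (Suc 0)" using pI[of u "Suc 0" a] a u by auto
  then obtain y where "u * y = e" using unit_or u by metis
  then show ?thesis using that ab u by blast
qed

text \<open>Multiplication by \<open>\<pi> ^ (k - 1 - m)\<close> maps \<open>I m\<close> onto
  \<open>I (k - 1)\<close> with kernel \<open>I (Suc m)\<close>.\<close>

lemma card_I_step: assumes "m < k" shows "card (I m) = Q * card (I (Suc m))"
proof -
  let ?f = "\<lambda>x. \<pi> ^ (k - 1 - m) * x"
  have "card (I m) = card {x \<in> I m. ?f x = 0} * card (?f ` I m)"
    by (rule card_eq_ker_times_image) (auto simp: algebra_simps intro: I_closed(1))
  moreover have "{x \<in> I m. ?f x = 0} = I (Suc m)"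
  proof safe
    fix x assume x: "x \<in> I m" "?f x = 0"
    have "x \<in> I (k - (k - 1 - m))" by (rule ann) (use x I_sub_S assms in auto)
    then show "x \<in> I (Suc m)" using assms by (simp add: Suc_diff_le)
  next
    fix x assume x: "x \<in> I (Suc m)"
    then show "x \<in> I m" using I_mono[of m "Suc m"] by auto
    have "?f x \<in> I (Suc m + (k - 1 - m))" using x by (rule pI)
    then show "?f x = 0" using I_k assms by simp
  qed
  moreover have "?f ` I m = I (k - 1)"
    using assms by (simp add: I_def image_image mult.assoc[symmetric] power_add[symmetric])
  ultimately show ?thesis by (simp add: Q_def)
qed

lemma card_I: "m \<le> k \<Longrightarrow> card (I m) = Q ^ (k - m)"
proof (induction "k - m" arbitrary: m)
  case 0
  then have "m = k" by simp
  then show ?case by (simp add: I_k)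
next
  case (Suc d)
  then have "card (I m) = Q * card (I (Suc m))" by (intro card_I_step) simp
  also have "\<dots> = Q * Q ^ (k - Suc m)" using Suc.hyps(1)[of "Suc m"] Suc by simp
  also have "\<dots> = Q ^ (k - m)" using Suc(2) by (simp add: Suc_diff_Suc[symmetric] flip: power_Suc)
  finally show ?case .
qed

lemma card_S: "card S = Q ^ k" using card_I[of 0] by simp

lemma nat_unit: assumes "0 < j" "j < p" obtains y where "y \<in> S" "of_nat j * y = e"
proof -
  have "coprime (int j) (int p)"
    using assms p by (metis coprime_commute coprime_int_iff nat_dvd_not_less prime_imp_coprime)
  then obtain a b where ab: "a * int j + b * int p = 1" using coprime_iff_gcd_eq_1 bezout_int by metis
  have 1: "of_nat j * (of_int a * e) + \<pi> * (of_int b * e) = e"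
  proof -
    have "of_nat j * (of_int a * e) + \<pi> * (of_int b * e) = of_int (a * int j + b * int p) * e"
      by (simp add: algebra_simps)
    then show ?thesis using ab by simp
  qed
  have "e * of_nat j \<notin> I (Suc 0)"
  proof
    assume *: "e * of_nat j \<in> I (Suc 0)"
    have "of_nat j * (of_int a * e) = of_int a * (e * of_nat j)" by (simp add: algebra_simps)
    then have "of_nat j * (of_int a * e) \<in> I (Suc 0)" using I_closed(5)[OF *, of "of_int a"] by metis
    moreover have "\<pi> * (of_int b * e) \<in> I (Suc 0)" using pS[of "of_int b * e" "Suc 0"] by simp
    ultimately show False using 1 e_notin I_closed(2) by metis
  qed
  then obtain y where y: "y \<in> S" "e * of_nat j * y = e" using unit_or[of "e * of_nat j"] by auto
  then have "of_nat j * y = e" by (metis e_S mult.assoc mult.commute)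
  then show ?thesis using that y by blast
qed

text \<open>The integers below \<open>p\<close> are pairwise incongruent modulo the maximal ideal.
  They serve later as directions of transvections and as points of evaluation, which is one reason
  why \<open>p\<close> has to be large.\<close>

lemma nat_diff_notin: assumes "i < p" "j < p" "i \<noteq> j" shows "of_nat i * e - of_nat j * e \<notin> I (Suc 0)"
proof -
  have *: "of_nat i * e - of_nat j * e \<notin> I (Suc 0)" if ij: "j < i" "i < p" for i j
  proof
    assume a: "of_nat i * e - of_nat j * e \<in> I (Suc 0)"
    have "0 < i - j" "i - j < p" using ij by auto
    then obtain y where y: "of_nat (i - j) * y = e" "y \<in> S" using nat_unit by metis
    have "(of_nat i * e - of_nat j * e) * y = of_nat (i - j) * (e * y)"
      using ij by (simp add: of_nat_diff algebra_simps)
    also have "\<dots> = e" using y by (simp add: e_S)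
    finally show False using I_closed(6)[OF a, of y] e_notin by simp
  qed
  show ?thesis
  proof (cases "j < i")
    case False
    then have "of_nat j * e - of_nat i * e \<notin> I (Suc 0)" using *[of i j] assms by simp
    then show ?thesis using I_closed(4)[of "of_nat i * e - of_nat j * e" "Suc 0"] by auto
  qed (use * assms in simp)
qed

text \<open>Transfers lower bounds on \<open>p\<close> to \<open>Q\<close>: the elements j
  \<open>\<pi> ^ (k - 1)\<close> with j < p are distinct members of
  \<open>I (k - 1)\<close>.\<close>

lemma Q_ge_p: "p \<le> Q"
proof -
  let ?f = "\<lambda>j. \<pi> ^ (k - 1) * (of_nat j * e)"
  have "inj_on ?f {..<p}"
  proof (rule inj_onI, rule ccontr)
    fix i j assume ij: "i \<in> {..<p}" "j \<in> {..<p}" "?f i = ?f j" "i \<noteq> j"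
    have "\<pi> ^ (k - 1) * (of_nat i * e - of_nat j * e) = 0" using ij by (simp add: algebra_simps)
    then have "of_nat i * e - of_nat j * e \<in> I (k - (k - 1))" by (intro ann) auto
    then have "of_nat i * e - of_nat j * e \<in> I (Suc 0)" using kpos by simp
    then show False using nat_diff_notin ij by auto
  qed
  then have "card (?f ` {..<p}) = p" by (simp add: card_image)
  moreover have "?f ` {..<p} \<subseteq> I (k - 1)" by (auto intro: pS)
  ultimately show ?thesis unfolding Q_def by (metis card_mono finite_I)
qed

lemma Q_gt_1: "1 < Q" using Q_ge_p p prime_gt_1_nat by (meson less_le_trans)

lemma V_closed [simp, intro]:
  "0 \<in> V" "v \<in> V \<Longrightarrow> w \<in> V \<Longrightarrow> v + w \<in> V" "v \<in> V \<Longrightarrow> w \<in> V \<Longrightarrow> v - w \<in> V"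
  "v \<in> V \<Longrightarrow> - v \<in> V" "v \<in> V \<Longrightarrow> smul c v \<in> V"
  by (auto simp: V_def)

lemma P_closed [simp, intro]:
  "0 \<in> P m" "v \<in> P m \<Longrightarrow> w \<in> P m \<Longrightarrow> v + w \<in> P m" "v \<in> P m \<Longrightarrow> w \<in> P m \<Longrightarrow> v - w \<in> P m"
  "v \<in> P m \<Longrightarrow> - v \<in> P m" "v \<in> P m \<Longrightarrow> smul c v \<in> P m"
  by (auto simp: P_def)

lemma P_sub_V: "v \<in> P m \<Longrightarrow> v \<in> V" by (simp add: P_def)
lemma V_S: "v \<in> V \<Longrightarrow> v i \<in> S" by (cases "i < n") (auto simp: V_def)
lemma P_0 [simp]: "P 0 = V" by (auto simp: P_def V_S)
lemma P_mono: "a \<le> b \<Longrightarrow> P b \<subseteq> P a" using I_mono by (auto simp: P_def)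
lemma smul_e: "v \<in> V \<Longrightarrow> smul e v = v" by (auto simp: fun_eq_iff V_S e_S)
lemma smul_P: "v \<in> V \<Longrightarrow> smul (\<pi> ^ m) v \<in> P m" by (auto simp: P_def pS V_S)

lemma P_ex: assumes "v \<in> P m" obtains u where "u \<in> V" "v = smul (\<pi> ^ m) u"
proof -
  have "\<forall>i. \<exists>x. x \<in> S \<and> v i = \<pi> ^ m * x" using assms by (auto simp: P_def I_def)
  then obtain f where f: "\<And>i. f i \<in> S" "\<And>i. v i = \<pi> ^ m * f i" by metis
  have "(\<lambda>i. if i < n then f i else 0) \<in> V" using f by (auto simp: V_def)
  moreover have "v = smul (\<pi> ^ m) (\<lambda>i. if i < n then f i else 0)"
    using f assms by (auto simp: fun_eq_iff P_def V_def)
  ultimately show ?thesis using that by blast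
qed

lemma P_cancel: assumes "v \<in> V" "smul (\<pi> ^ a) v \<in> P (a + b)" "a + b \<le> k" shows "v \<in> P b"
  using assms p_cancel[of _ a b] by (auto simp: P_def V_S)

lemma finite_V [simp]: "finite V" and card_V: "card V = card S ^ n"
  and card_P: "card (P m) = card (I m) ^ n"
proof -
  have bij: "bij_betw (\<lambda>v. restrict v {..<n}) {v. (\<forall>i<n. v i \<in> A) \<and> (\<forall>i\<ge>n. v i = 0)} ({..<n} \<rightarrow>\<^sub>E A)"
    for A :: "'u set"
    by (rule bij_betw_byWitness[where f' = "\<lambda>v i. if i < n then v i else 0"])
       (auto simp: fun_eq_iff restrict_def PiE_def extensional_def not_less)
  have *: "finite {v. (\<forall>i<n. v i \<in> A) \<and> (\<forall>i\<ge>n. v i = 0)} \<and>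
     card {v. (\<forall>i<n. v i \<in> A) \<and> (\<forall>i\<ge>n. v i = 0)} = card A ^ n" if "finite A" for A :: "'u set"
    using bij_betw_same_card[OF bij[of A]] bij_betw_finite[OF bij[of A]] that
    by (simp add: card_PiE finite_PiE)
  show "finite V" "card V = card S ^ n" using *[of S] by (simp_all add: V_def)
  have "P m = {v. (\<forall>i<n. v i \<in> I m) \<and> (\<forall>i\<ge>n. v i = 0)}"
  proof safe
    fix v assume v: "\<forall>i<n. v i \<in> I m" "\<forall>i\<ge>n. v i = 0"
    then have "v i \<in> I m" for i by (cases "i < n") auto
    then show "v \<in> P m" using v I_sub_S by (auto simp: P_def V_def)
  qed (auto simp: P_def V_def)
  then show "card (P m) = card (I m) ^ n" using *[of "I m"] by simp
qed

lemma finite_P [simp]: "finite (P m)" by (rule finite_subset[OF _ finite_V]) (auto simp: P_def)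

end

section \<open>Linear maps, functionals, projections with free kernel, and spreading by
  transvections\<close>

context chain_ring
begin

definition lin :: "((nat \<Rightarrow> 'u) \<Rightarrow> nat \<Rightarrow> 'u) \<Rightarrow> bool" where
  "lin A \<longleftrightarrow> (\<forall>v\<in>V. A v \<in> V) \<and> (\<forall>v\<in>V. \<forall>w\<in>V. A (v + w) = A v + A w) \<and>
     (\<forall>c. \<forall>v\<in>V. A (smul c v) = smul c (A v))"

definition fnl :: "((nat \<Rightarrow> 'u) \<Rightarrow> 'u) \<Rightarrow> bool" where
  "fnl f \<longleftrightarrow> (\<forall>v\<in>V. f v \<in> S) \<and> (\<forall>v\<in>V. \<forall>w\<in>V. f (v + w) = f v + f w) \<and>
     (\<forall>c. \<forall>v\<in>V. f (smul c v) = c * f v)"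

lemma lin_simps:
  assumes "lin A"
  shows lin_V: "v \<in> V \<Longrightarrow> A v \<in> V" and lin_add: "v \<in> V \<Longrightarrow> w \<in> V \<Longrightarrow> A (v + w) = A v + A w"
    and lin_smul: "v \<in> V \<Longrightarrow> A (smul c v) = smul c (A v)"
    and lin_uminus: "v \<in> V \<Longrightarrow> A (- v) = - A v"
    and lin_diff: "v \<in> V \<Longrightarrow> w \<in> V \<Longrightarrow> A (v - w) = A v - A w" and lin_0: "A 0 = 0"
proof -
  show 1: "v \<in> V \<Longrightarrow> A v \<in> V" "v \<in> V \<Longrightarrow> w \<in> V \<Longrightarrow> A (v + w) = A v + A w"
     "v \<in> V \<Longrightarrow> A (smul c v) = smul c (A v)" for v w c
    using assms by (auto simp: lin_def)
  show 2: "v \<in> V \<Longrightarrow> A (- v) = - A v" for v using 1(3)[of v "- 1"] by (simp add: smul_simps)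
  show "v \<in> V \<Longrightarrow> w \<in> V \<Longrightarrow> A (v - w) = A v - A w" for v w using 1(2)[of v "- w"] 2[of w] by simp
  show "A 0 = 0" using 1(3)[of 0 0] by (simp add: smul_simps)
qed

lemma fnl_simps:
  assumes "fnl f"
  shows fnl_S: "v \<in> V \<Longrightarrow> f v \<in> S" and fnl_add: "v \<in> V \<Longrightarrow> w \<in> V \<Longrightarrow> f (v + w) = f v + f w"
    and fnl_smul: "v \<in> V \<Longrightarrow> f (smul c v) = c * f v"
    and fnl_uminus: "v \<in> V \<Longrightarrow> f (- v) = - f v"
    and fnl_diff: "v \<in> V \<Longrightarrow> w \<in> V \<Longrightarrow> f (v - w) = f v - f w" and fnl_0: "f 0 = 0"
proof -
  show 1: "v \<in> V \<Longrightarrow> f v \<in> S" "v \<in> V \<Longrightarrow> w \<in> V \<Longrightarrow> f (v + w) = f v + f w"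
     "v \<in> V \<Longrightarrow> f (smul c v) = c * f v" for v w c
    using assms by (auto simp: fnl_def)
  show 2: "v \<in> V \<Longrightarrow> f (- v) = - f v" for v using 1(3)[of v "- 1"] by (simp add: smul_simps)
  show "v \<in> V \<Longrightarrow> w \<in> V \<Longrightarrow> f (v - w) = f v - f w" for v w using 1(2)[of v "- w"] 2[of w] by simp
  show "f 0 = 0" using 1(3)[of 0 0] by (simp add: smul_simps)
qed

lemma lin_P: assumes "lin A" "v \<in> P m" shows "A v \<in> P m"
proof -
  obtain u where "u \<in> V" "v = smul (\<pi> ^ m) u" using assms P_ex by blast
  then show ?thesis using assms by (metis lin_smul lin_V smul_P)
qed

lemma smul_IP: assumes "c \<in> I m" "v \<in> V" shows "smul c v \<in> P m"
  using assms unfolding P_def by auto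

lemma fnl_coord: "fnl (\<lambda>v. v i)"
  by (auto simp: fnl_def V_S)

lemma fnl_comp: "fnl f \<Longrightarrow> lin B \<Longrightarrow> fnl (\<lambda>v. f (B v))" by (auto simp: lin_def fnl_def)
lemma fnl_scale: "fnl f \<Longrightarrow> fnl (\<lambda>v. c * f v)" by (auto simp: fnl_def algebra_simps)
lemma lin_id: "lin (\<lambda>v. v)" by (auto simp: lin_def)

text \<open>\<open>proj d \<rho>\<close>: a projection \<open>\<rho>\<close> of the free module whose kernel is free of rank \<open>d\<close>.\<close>

inductive proj :: "nat \<Rightarrow> ((nat \<Rightarrow> 'u) \<Rightarrow> nat \<Rightarrow> 'u) \<Rightarrow> bool" where
  proj_0: "\<forall>v\<in>V. \<rho> v = v \<Longrightarrow> proj 0 \<rho>"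
| proj_Suc: "proj d \<rho> \<Longrightarrow> x \<in> V \<Longrightarrow> \<rho> x = x \<Longrightarrow> fnl f \<Longrightarrow> e * f x = e \<Longrightarrow>
    \<forall>v\<in>V. \<rho>' v = \<rho> v - smul (f (\<rho> v)) x \<Longrightarrow> proj (Suc d) \<rho>'"

lemma proj_lin: "proj d \<rho> \<Longrightarrow> lin \<rho>"
proof (induction rule: proj.induct)
  case (proj_0 \<rho>)
  then show ?case by (simp add: lin_def)
next
  case (proj_Suc d \<rho> x f \<rho>')
  note l = lin_simps[OF proj_Suc(7)] and ff = fnl_simps[OF proj_Suc(4)]
  have \<rho>': "\<rho>' v = \<rho> v - smul (f (\<rho> v)) x" if "v \<in> V" for v using proj_Suc(6) that by blast
  show ?case unfolding lin_def
  proof (intro conjI ballI allI)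
    fix v w assume v: "v \<in> V" and w: "w \<in> V"
    show "\<rho>' v \<in> V" unfolding \<rho>'[OF v] using l(1)[OF v] proj_Suc(2) by blast
    show "\<rho>' (v + w) = \<rho>' v + \<rho>' w"
      unfolding \<rho>'[OF v] \<rho>'[OF w] \<rho>'[OF V_closed(2)[OF v w]] l(2)[OF v w] ff(2)[OF l(1)[OF v] l(1)[OF w]]
      by (simp add: smul_simps)
    show "\<rho>' (smul c v) = smul c (\<rho>' v)" for c
      unfolding \<rho>'[OF v] \<rho>'[OF V_closed(5)[OF v]] l(3)[OF v] ff(3)[OF l(1)[OF v]]
      by (simp add: smul_simps)
  qed
qed

text \<open>In the inductive step \<open>\<rho>' v\<close> is fixed by the old projection and, since
  f x = e, killed by \<open>f\<close>; so the second application subtracts nothing.\<close>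

lemma proj_idem: "proj d \<rho> \<Longrightarrow> v \<in> V \<Longrightarrow> \<rho> (\<rho> v) = \<rho> v"
proof (induction arbitrary: v rule: proj.induct)
  case (proj_Suc d \<rho> x f \<rho>')
  note l = lin_simps[OF proj_lin[OF proj_Suc(1)]] and ff = fnl_simps[OF proj_Suc(4)]
  note v = proj_Suc.prems and lv = l(1)[OF proj_Suc.prems]
  have 1: "\<rho>' v = \<rho> v - smul (f (\<rho> v)) x" using proj_Suc(6) v by blast
  have m: "\<rho>' v \<in> V" unfolding 1 using lv proj_Suc(2) by blast
  have 2: "\<rho> (\<rho>' v) = \<rho>' v"
    unfolding 1 l(5)[OF lv V_closed(5)[OF proj_Suc(2)]] l(3)[OF proj_Suc(2)] proj_Suc(3) proj_Suc(7)[OF v] ..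
  have fx: "f x = e" using proj_Suc(5) e_S[OF ff(1)[OF proj_Suc(2)]] by simp
  have "f (\<rho>' v) = f (\<rho> v) - f (\<rho> v) * f x"
    unfolding 1 ff(5)[OF lv V_closed(5)[OF proj_Suc(2)]] ff(3)[OF proj_Suc(2)] ..
  also have "\<dots> = f (\<rho> v) - e * f (\<rho> v)" unfolding fx by (simp only: mult.commute)
  also have "\<dots> = 0" using e_S[OF ff(1)[OF lv]] by simp
  finally have f0: "f (\<rho>' v) = 0" .
  have "\<rho>' (\<rho>' v) = \<rho> (\<rho>' v) - smul (f (\<rho> (\<rho>' v))) x" using proj_Suc(6) m by blast
  then show ?case unfolding 2 f0 by (simp add: smul_simps)
qed simp

text \<open>Transports the record kept for a letter to its inverse: if a matrix A is known on the
  kernel of \<open>\<rho>\<close>, its inverse is known on the image of that kernel under A.\<close>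

lemma proj_conj:
  assumes "lin A" "lin B" "\<And>v. v \<in> V \<Longrightarrow> B (A v) = v" "\<And>v. v \<in> V \<Longrightarrow> A (B v) = v"
  shows "proj d \<rho> \<Longrightarrow> proj d (\<lambda>v. A (\<rho> (B v)))"
proof (induction rule: proj.induct)
  case (proj_0 \<rho>)
  then show ?case using assms by (intro proj.proj_0) (auto simp: lin_V)
next
  case (proj_Suc d \<rho> x f \<rho>')
  note la = lin_simps[OF assms(1)] and lb = lin_simps[OF assms(2)]
    and l = lin_simps[OF proj_lin[OF proj_Suc(1)]]
  show ?case
  proof (rule proj.proj_Suc[OF proj_Suc(7), of "A x" "\<lambda>v. f (B v)"])
    show "A x \<in> V" "A (\<rho> (B (A x))) = A x" "e * f (B (A x)) = e"
      using la(1) proj_Suc(2,3,5) assms(3)[OF proj_Suc(2)] by simp_all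
    show "fnl (\<lambda>v. f (B v))" by (rule fnl_comp[OF proj_Suc(4) assms(2)])
    show "\<forall>v\<in>V. A (\<rho>' (B v)) = A (\<rho> (B v)) - smul (f (B (A (\<rho> (B v))))) (A x)"
    proof
      fix v assume v: "v \<in> V"
      have m: "\<rho> (B v) \<in> V" using l(1) lb(1) v by blast
      have "\<rho>' (B v) = \<rho> (B v) - smul (f (\<rho> (B v))) x" using proj_Suc(6) lb(1)[OF v] by blast
      then show "A (\<rho>' (B v)) = A (\<rho> (B v)) - smul (f (B (A (\<rho> (B v))))) (A x)"
        unfolding assms(3)[OF m] using la(5)[OF m V_closed(5)[OF proj_Suc(2)]] la(3)[OF proj_Suc(2)] by simp
    qed
  qed
qed

lemma card_coset_I: assumes "a \<in> S" shows "card {b \<in> S. a - b \<in> I m} = card (I m)"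
proof -
  have "bij_betw (\<lambda>b. a - b) {b \<in> S. a - b \<in> I m} (I m)"
    by (rule bij_betw_byWitness[where f' = "\<lambda>b. a - b"]) (use assms I_sub_S in auto)
  then show ?thesis by (rule bij_betw_same_card)
qed

lemma card_coset_P: assumes "a \<in> V" shows "card {b \<in> V. b - a \<in> P m} = card (P m)"
proof -
  have "bij_betw (\<lambda>b. b - a) {b \<in> V. b - a \<in> P m} (P m)"
    by (rule bij_betw_byWitness[where f' = "\<lambda>b. b + a"]) (use assms P_sub_V in auto)
  then show ?thesis by (rule bij_betw_same_card)
qed

text \<open>Only the residue of \<open>g c\<close> modulo \<open>\<pi> ^ i\<close> matters, and it
  takes at most Q^i values; for each of them the hypothesis applies with another \<open>z\<close>.
  No representatives are chosen: the count runs over all b in \<open>S\<close> congruent to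
  \<open>g c\<close>, which multiplies both sides by \<open>card (I i)\<close>.\<close>

lemma card_shift_bound:
  assumes A: "\<And>z. z \<in> V \<Longrightarrow> card {c \<in> V. A c - z \<in> P i} \<le> N"
    and g: "\<And>c. c \<in> V \<Longrightarrow> g c \<in> S" and x: "x \<in> V" and z: "z \<in> V" and i: "i \<le> k"
  shows "card {c \<in> V. A c - smul (g c) x - z \<in> P i} \<le> Q ^ i * N"
proof -
  let ?A = "{c \<in> V. A c - smul (g c) x - z \<in> P i}"
  have "card ?A * card (I i) = (\<Sum>c\<in>?A. card {b \<in> S. g c - b \<in> I i})"
    using g by (simp add: card_coset_I)
  also have "\<dots> = card (Sigma ?A (\<lambda>c. {b \<in> S. g c - b \<in> I i}))"
    by (simp add: card_SigmaI)
  also have "\<dots> \<le> card (Sigma S (\<lambda>b. {c \<in> V. A c - (z + smul b x) \<in> P i}))"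
  proof (rule card_inj_on_le[where f = prod.swap])
    show "prod.swap ` Sigma ?A (\<lambda>c. {b \<in> S. g c - b \<in> I i})
      \<subseteq> Sigma S (\<lambda>b. {c \<in> V. A c - (z + smul b x) \<in> P i})"
    proof clarsimp
      fix c b assume h: "c \<in> V" "A c - smul (g c) x - z \<in> P i" "b \<in> S" "g c - b \<in> I i"
      have "A c - (z + smul b x) = (A c - smul (g c) x - z) + smul (g c - b) x"
        by (simp add: smul_simps)
      then show "A c - (z + smul b x) \<in> P i" using h smul_IP[OF h(4) x] by (metis P_closed(2))
    qed
  qed auto
  also have "\<dots> = (\<Sum>b\<in>S. card {c \<in> V. A c - (z + smul b x) \<in> P i})"
    by (simp add: card_SigmaI)
  also have "\<dots> \<le> (\<Sum>b\<in>S. N)" by (rule sum_mono) (use A z x in auto)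
  also have "\<dots> = Q ^ i * N * card (I i)"
    using i by (simp add: card_S card_I power_add[symmetric] algebra_simps)
  finally have "card ?A * card (I i) \<le> Q ^ i * N * card (I i)" .
  moreover have "0 < card (I i)" using I_closed(1) by (auto simp: card_gt_0_iff)
  ultimately show ?thesis by simp
qed

text \<open>Each of the \<open>d\<close> steps that build the projection subtracts a multiple of one
  fixed vector, and so costs a factor Q^i by \<open>card_shift_bound\<close>.\<close>

lemma proj_card:
  assumes "i \<le> k" shows "proj d \<rho> \<Longrightarrow> z \<in> V \<Longrightarrow> card {c \<in> V. \<rho> c - z \<in> P i} \<le> Q ^ (i * d) * card (P i)"
proof (induction arbitrary: z rule: proj.induct)
  case (proj_0 \<rho>)
  then have "{c \<in> V. \<rho> c - z \<in> P i} = {c \<in> V. c - z \<in> P i}" by auto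
  then show ?case using card_coset_P[OF proj_0(2), of i] by (simp only: mult_0_right power_0 mult_1)
next
  case (proj_Suc d \<rho> x f \<rho>')
  have "card {c \<in> V. \<rho>' c - z \<in> P i} = card {c \<in> V. \<rho> c - smul (f (\<rho> c)) x - z \<in> P i}"
    by (rule arg_cong[where f = card]) (use proj_Suc in auto)
  also have "\<dots> \<le> Q ^ i * (Q ^ (i * d) * card (P i))"
  proof (rule card_shift_bound)
    show "card {c \<in> V. \<rho> c - z \<in> P i} \<le> Q ^ (i * d) * card (P i)" if "z \<in> V" for z
      by (rule proj_Suc.IH[OF that])
    show "f (\<rho> c) \<in> S" if "c \<in> V" for c
      by (rule fnl_S[OF proj_Suc(4) lin_V[OF proj_lin[OF proj_Suc(1)] that]])
  qed (rule proj_Suc assms)+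
  finally show ?case by (simp only: power_add mult_Suc_right mult.assoc)
qed

text \<open>Counting modulo \<open>\<pi>\<close>: if the image of the projection were contained in
  \<open>P (Suc 0)\<close>, then \<open>proj_card\<close> with i = 1 would bound
  \<open>card V\<close>, which is Q^n \<open>card (P (Suc 0))\<close>, by Q^d
  \<open>card (P (Suc 0))\<close>.\<close>

lemma proj_nontrivial:
  assumes "proj d \<rho>" "d < n" obtains x where "x \<in> V" "\<rho> x = x" "x \<notin> P (Suc 0)"
proof -
  have "\<exists>c\<in>V. \<rho> c \<notin> P (Suc 0)"
  proof (rule ccontr)
    assume "\<not> ?thesis"
    then have "V = {c \<in> V. \<rho> c - 0 \<in> P (Suc 0)}" by auto
    then have "card V \<le> Q ^ (Suc 0 * d) * card (P (Suc 0))"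
      using proj_card[OF _ assms(1), of "Suc 0" 0] kpos by (metis V_closed(1) One_nat_def)
    moreover have "card V = Q ^ n * card (P (Suc 0))"
      using card_I_step[of 0] kpos by (simp add: card_V card_P power_mult_distrib)
    moreover have "0 < card (P (Suc 0))" using P_closed(1) by (auto simp: card_gt_0_iff)
    ultimately have "Q ^ n \<le> Q ^ d" by simp
    then show False using assms(2) Q_gt_1 by simp
  qed
  then show ?thesis using that proj_idem[OF assms(1)] proj_lin[OF assms(1)] by (metis lin_V)
qed

text \<open>The functional is a coordinate at which x is a unit, normalised and composed with the
  projection. Vanishing on the kernel is the point: transvections built from it fix everything
  already revealed.\<close>

lemma proj_separate:
  assumes "proj d \<rho>" "x \<in> V" "\<rho> x = x" "x \<notin> P (Suc 0)"
  obtains f where "fnl f" "f x = e" "\<And>u. u \<in> V \<Longrightarrow> \<rho> u = 0 \<Longrightarrow> f u = 0"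
proof -
  obtain i where i: "x i \<notin> I (Suc 0)" using assms by (auto simp: P_def)
  obtain y where y: "x i * y = e" using unit_or[OF V_S[OF assms(2)] i] by blast
  have "fnl (\<lambda>v. y * (\<rho> v) i)"
    by (rule fnl_scale[OF fnl_comp[OF fnl_coord proj_lin[OF assms(1)]]])
  then show ?thesis using that[of "\<lambda>v. y * (\<rho> v) i"] y assms(3) by (simp add: mult.commute)
qed

text \<open>The engine of the argument: if translating a uniform \<open>g \<in> \<Omega>\<close> by transvections moves the vector
  \<open>Y g\<close> through a hyperplane, then \<open>Y g\<close> avoids a neighbourhood of every submodule of small rank.\<close>

lemma transvection_spread:
  assumes fin: "finite \<Omega>" and bij: "\<And>c. c \<in> V \<Longrightarrow> bij_betw (\<tau> c) \<Omega> \<Omega>"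
    and Y: "\<And>g. g \<in> \<Omega> \<Longrightarrow> Y g \<in> V"
    and tr: "\<And>g. g \<in> \<Omega> \<Longrightarrow> \<exists>A. lin A \<and> inj_on A V \<and>
       (\<forall>c\<in>V. Y (\<tau> c g) = Y g + A (c - smul (f c) x))"
    and f: "fnl f" and x: "x \<in> V" and \<rho>: "proj d \<rho>" and z: "z \<in> V" and ij: "j + i \<le> k"
  shows "card {g \<in> \<Omega>. \<rho> (smul (\<pi> ^ j) (Y g)) - z \<in> P (j + i)} * Q ^ (i * n) \<le> card \<Omega> * Q ^ (i * Suc d)"
proof -
  define W where "W = {g \<in> \<Omega>. \<rho> (smul (\<pi> ^ j) (Y g)) - z \<in> P (j + i)}"
  note l = lin_simps[OF proj_lin[OF \<rho>]]
  let ?N = "Q ^ (i * Suc d) * card (P i)"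
  \<comment> \<open>For fixed g the parameters leading into \<open>W\<close> are compared with one
    such parameter b. The difference c - b satisfies a condition without \<open>z\<close>, in which
    \<open>\<pi> ^ j\<close> cancels. The rank \<open>d\<close> of the kernel and the shift along x
    together cost Q^(i (d + 1)).\<close>
  have fib: "card {c \<in> V. \<tau> c g \<in> W} \<le> ?N" if g: "g \<in> \<Omega>" for g
  proof (cases "{c \<in> V. \<tau> c g \<in> W} = {}")
    case False
    then obtain b where b: "b \<in> V" "\<tau> b g \<in> W" by auto
    obtain A where A: "lin A" "inj_on A V" "\<And>c. c \<in> V \<Longrightarrow> Y (\<tau> c g) = Y g + A (c - smul (f c) x)"
      using tr[OF g] by blast
    note la = lin_simps[OF A(1)]
    let ?D = "{c \<in> V. \<rho> (A c) - smul (f c) (\<rho> (A x)) - 0 \<in> P i}"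
    have "card {c \<in> V. \<tau> c g \<in> W} \<le> card ?D"
    proof (rule card_inj_on_le[where f = "\<lambda>c. c - b"])
      show "(\<lambda>c. c - b) ` {c \<in> V. \<tau> c g \<in> W} \<subseteq> ?D"
      proof clarsimp
        fix c assume c: "c \<in> V" "\<tau> c g \<in> W"
        have E: "\<rho> (smul (\<pi> ^ j) (Y (\<tau> c g)))
            = smul (\<pi> ^ j) (\<rho> (Y g) + (\<rho> (A c) - smul (f c) (\<rho> (A x))))" if c: "c \<in> V" for c
        proof -
          have 1: "Y (\<tau> c g) = Y g + (A c - smul (f c) (A x))"
            unfolding A(3)[OF c] la(5)[OF c V_closed(5)[OF x]] la(3)[OF x] ..
          have m: "Y g \<in> V" "A c \<in> V" "A x \<in> V" using Y g la(1) c x by blast+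
          then have m2: "A c - smul (f c) (A x) \<in> V" "smul (f c) (A x) \<in> V" by blast+
          have "\<rho> (smul (\<pi> ^ j) (Y (\<tau> c g))) = smul (\<pi> ^ j) (\<rho> (Y (\<tau> c g)))"
            unfolding 1 by (rule l(3)) (use m m2 in blast)
          also have "\<rho> (Y (\<tau> c g)) = \<rho> (Y g) + (\<rho> (A c) - smul (f c) (\<rho> (A x)))"
            unfolding 1 l(2)[OF m(1) m2(1)] l(5)[OF m(2) m2(2)] l(3)[OF m(3)] ..
          finally show ?thesis .
        qed
        have F: "\<rho> (A (c - b)) = \<rho> (A c) - \<rho> (A b)" "f (c - b) = f c - f b"
          using la(5)[OF c(1) b(1)] l(5)[OF la(1)[OF c(1)] la(1)[OF b(1)]] fnl_diff[OF f c(1) b(1)] by simp_all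
        have "(\<rho> (smul (\<pi> ^ j) (Y (\<tau> c g))) - z) - (\<rho> (smul (\<pi> ^ j) (Y (\<tau> b g))) - z) \<in> P (j + i)"
          by (rule P_closed(3)) (use b c in \<open>simp_all add: W_def\<close>)
        also have "(\<rho> (smul (\<pi> ^ j) (Y (\<tau> c g))) - z) - (\<rho> (smul (\<pi> ^ j) (Y (\<tau> b g))) - z)
            = smul (\<pi> ^ j) (\<rho> (A (c - b)) - smul (f (c - b)) (\<rho> (A x)))"
          unfolding F E[OF b(1)] E[OF c(1)] by (simp add: smul_simps algebra_simps)
        finally have "\<rho> (A (c - b)) - smul (f (c - b)) (\<rho> (A x)) \<in> P i"
          using ij V_closed(3)[OF l(1)[OF la(1)[OF V_closed(3)[OF c(1) b(1)]]] V_closed(5)[OF l(1)[OF la(1)[OF x]]]]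
          by (intro P_cancel[of _ j i])
        then show "c - b \<in> V \<and> \<rho> (A (c - b)) - smul (f (c - b)) (\<rho> (A x)) \<in> P i"
          using b c by blast
      qed
    qed (simp_all add: inj_on_def)
    also have "\<dots> \<le> Q ^ i * (Q ^ (i * d) * card (P i))"
    proof (rule card_shift_bound)
      fix z' assume z': "z' \<in> V"
      have "card {c \<in> V. \<rho> (A c) - z' \<in> P i} \<le> card {c \<in> V. \<rho> c - z' \<in> P i}"
      proof (rule card_inj_on_le[where f = A])
        show "inj_on A {c \<in> V. \<rho> (A c) - z' \<in> P i}" using A(2) by (rule inj_on_subset) blast
        show "A ` {c \<in> V. \<rho> (A c) - z' \<in> P i} \<subseteq> {c \<in> V. \<rho> c - z' \<in> P i}" using la(1) by blast
      qed simp
      then show "card {c \<in> V. \<rho> (A c) - z' \<in> P i} \<le> Q ^ (i * d) * card (P i)"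
        using proj_card[OF _ \<rho> z', of i] ij by linarith
    next
      show "f c \<in> S" if "c \<in> V" for c using fnl_S[OF f that] .
      show "\<rho> (A x) \<in> V" using l(1)[OF la(1)[OF x]] .
      show "i \<le> k" using ij by linarith
    qed (rule V_closed(1))
    finally show ?thesis by (simp only: power_add mult_Suc_right mult.assoc)
  next
    case True
    show ?thesis unfolding True by simp
  qed
  have pre: "card {g \<in> \<Omega>. \<tau> c g \<in> W} = card W" if "c \<in> V" for c
  proof -
    have "\<tau> c ` {g \<in> \<Omega>. \<tau> c g \<in> W} = W"
    proof -
      have "\<tau> c ` \<Omega> = \<Omega>" using bij[OF that] by (simp add: bij_betw_def)
      moreover have "g \<in> \<Omega>" if "g \<in> W" for g using that unfolding W_def by simp
      ultimately show ?thesis by fast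
    qed
    moreover have "inj_on (\<tau> c) {g \<in> \<Omega>. \<tau> c g \<in> W}"
      by (rule inj_on_subset[OF bij_betw_imp_inj_on[OF bij[OF that]]]) blast
    ultimately show ?thesis by (metis card_image)
  qed
  \<comment> \<open>Double counting of the pairs (c, g) with \<open>\<tau> c g\<close> in
    \<open>W\<close>: every c contributes exactly \<open>card W\<close> because
    \<open>\<tau> c\<close> permutes \<open>\<Omega>\<close>, and every g contributes at most
    \<open>?N\<close>.\<close>
  have "card V * card W = (\<Sum>c\<in>V. card {g \<in> \<Omega>. \<tau> c g \<in> W})" using pre by simp
  also have "\<dots> = card (Sigma V (\<lambda>c. {g \<in> \<Omega>. \<tau> c g \<in> W}))" using fin by (simp add: card_SigmaI)
  also have "\<dots> = card (Sigma \<Omega> (\<lambda>g. {c \<in> V. \<tau> c g \<in> W}))"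
    by (rule bij_betw_same_card[of prod.swap],
        rule bij_betw_byWitness[where f' = prod.swap]) auto
  also have "\<dots> = (\<Sum>g\<in>\<Omega>. card {c \<in> V. \<tau> c g \<in> W})" using fin by (simp add: card_SigmaI)
  also have "\<dots> \<le> (\<Sum>g\<in>\<Omega>. ?N)" by (rule sum_mono) (use fib in auto)
  finally have "card V * card W \<le> card \<Omega> * ?N" by simp
  moreover have "card V = Q ^ (i * n) * card (P i)"
  proof -
    have "i + (k - i) = k" using ij by simp
    then show ?thesis using ij card_I[of i]
      by (simp only: card_V card_S card_P power_mult power_mult_distrib[symmetric] power_add[symmetric] le_add2 add_leE)
  qed
  ultimately have "(card W * Q ^ (i * n)) * card (P i) \<le> (card \<Omega> * Q ^ (i * Suc d)) * card (P i)"
    by (simp add: algebra_simps)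
  moreover have "0 < card (P i)" using P_closed(1) by (auto simp: card_gt_0_iff)
  ultimately show ?thesis unfolding W_def by simp
qed

end

section \<open>Groups containing all transvections\<close>

text \<open>The law of total probability: a bound \<open>b g\<close> on the conditional probability
  of \<open>E\<close>, given the value of \<open>z\<close>, is averaged over
  \<open>\<Omega>\<close>.\<close>

lemma sum_over_fibres_le:
  fixes b :: "'a \<Rightarrow> real" and z :: "'a \<Rightarrow> 'b"
  assumes fin: "finite \<Omega>" and E: "E \<subseteq> \<Omega>"
    and const: "\<And>g g'. g \<in> \<Omega> \<Longrightarrow> g' \<in> \<Omega> \<Longrightarrow> z g = z g' \<Longrightarrow> b g = b g'"
    and le: "\<And>g. g \<in> \<Omega> \<Longrightarrow> real (card {g' \<in> E. z g' = z g}) \<le> real (card {g' \<in> \<Omega>. z g' = z g}) * b g"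
  shows "real (card E) \<le> (\<Sum>g\<in>\<Omega>. b g)"
proof -
  have finE: "finite E" by (rule finite_subset[OF E fin])
  have "real (card E) = (\<Sum>g\<in>E. 1)" by simp
  also have "\<dots> = (\<Sum>y\<in>z ` \<Omega>. \<Sum>g\<in>{g \<in> E. z g = y}. 1)"
    by (rule sym, rule sum.group[OF finE finite_imageI[OF fin] image_mono[OF E]])
  also have "\<dots> \<le> (\<Sum>y\<in>z ` \<Omega>. \<Sum>g\<in>{g \<in> \<Omega>. z g = y}. b g)"
  proof (rule sum_mono)
    fix y assume "y \<in> z ` \<Omega>"
    then obtain g where g: "g \<in> \<Omega>" "y = z g" by auto
    have "(\<Sum>g'\<in>{g' \<in> \<Omega>. z g' = y}. b g') = (\<Sum>g'\<in>{g' \<in> \<Omega>. z g' = y}. b g)"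
      by (rule sum.cong[OF refl]) (use g const in blast)
    then show "(\<Sum>g\<in>{g \<in> E. z g = y}. 1) \<le> (\<Sum>g\<in>{g \<in> \<Omega>. z g = y}. b g)" using le[OF g(1)] g by simp
  qed
  also have "\<dots> = (\<Sum>g\<in>\<Omega>. b g)" by (rule sum.group[OF fin finite_imageI[OF fin] order_refl])
  finally show ?thesis .
qed

text \<open>The interface through which the special linear group is used. The determinant leaves its
  trace in \<open>last_coord\<close>: an element that fixes all basis vectors but the last has last
  diagonal entry \<open>e\<close>.\<close>

locale lin_group = chain_ring e p k n + group G
  for e :: "'u::comm_ring_1" and p k n and G :: "('g, 'h) monoid_scheme" (structure) +
  fixes act :: "'g \<Rightarrow> (nat \<Rightarrow> 'u) \<Rightarrow> nat \<Rightarrow> 'u"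
  assumes finG: "finite (carrier G)"
    and act_lin: "g \<in> carrier G \<Longrightarrow> lin (act g)"
    and act_mult: "g \<in> carrier G \<Longrightarrow> h \<in> carrier G \<Longrightarrow> v \<in> V \<Longrightarrow> act (g \<otimes> h) v = act g (act h v)"
    and act_one: "v \<in> V \<Longrightarrow> act \<one> v = v"
    and transv: "fnl f \<Longrightarrow> y \<in> V \<Longrightarrow> f y = 0 \<Longrightarrow> \<exists>g\<in>carrier G. \<forall>v\<in>V. act g v = v + smul (f v) y"
    and faithful: "g \<in> carrier G \<Longrightarrow> (\<And>v. v \<in> V \<Longrightarrow> act g v = v) \<Longrightarrow> g = \<one>"
    and last_coord: "g \<in> carrier G \<Longrightarrow> n \<ge> 1 \<Longrightarrow>
      (\<And>i. i < n - 1 \<Longrightarrow> act g (\<lambda>j. if j = i then e else 0) = (\<lambda>j. if j = i then e else 0)) \<Longrightarrow>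
      act g (\<lambda>j. if j = n - 1 then e else 0) (n - 1) = e"
begin

lemma act_V: "g \<in> carrier G \<Longrightarrow> v \<in> V \<Longrightarrow> act g v \<in> V"
  using act_lin lin_V by blast

lemma act_inv [simp]:
  "g \<in> carrier G \<Longrightarrow> v \<in> V \<Longrightarrow> act (inv g) (act g v) = v"
  "g \<in> carrier G \<Longrightarrow> v \<in> V \<Longrightarrow> act g (act (inv g) v) = v"
  by (metis act_mult act_one inv_closed l_inv r_inv)+

lemma act_inj: "g \<in> carrier G \<Longrightarrow> inj_on (act g) V"
  by (metis act_inv(1) inj_onI)

lemma act_eq_0: "g \<in> carrier G \<Longrightarrow> v \<in> V \<Longrightarrow> act g v = 0 \<Longrightarrow> v = 0"
  by (metis act_inv(1) act_lin inv_closed lin_0)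

definition ga :: "letter \<Rightarrow> (nat \<Rightarrow> 'g) \<Rightarrow> 'g" where
  "ga a g = (if snd a then g (fst a) else inv (g (fst a)))"

definition tup :: "nat \<Rightarrow> (nat \<Rightarrow> 'g) set" where
  "tup r = {..<r} \<rightarrow>\<^sub>E carrier G"

text \<open>The list is read from its head, in the order in which the letters meet the vector; a
  word acting on the left corresponds to the path along its reversal.\<close>

definition path :: "letter list \<Rightarrow> (nat \<Rightarrow> 'g) \<Rightarrow> (nat \<Rightarrow> 'u) \<Rightarrow> nat \<Rightarrow> 'u" where
  "path L g = fold (\<lambda>a. act (ga a g)) L"

lemma finite_tup [simp]: "finite (tup r)" by (simp add: tup_def finite_PiE finG)

lemma ga_closed [simp]: "g \<in> tup r \<Longrightarrow> fst a < r \<Longrightarrow> ga a g \<in> carrier G"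
  by (auto simp: ga_def tup_def)

lemma ga_inv: "g \<in> tup r \<Longrightarrow> fst a < r \<Longrightarrow> ga (inv_letter a) g = inv (ga a g)"
  by (auto simp: ga_def inv_letter_def tup_def PiE_iff)

lemma fst_inv_letter [simp]: "fst (inv_letter a) = fst a" by (simp add: inv_letter_def)

lemma act_ga_inv [simp]:
  assumes "g \<in> tup r" "fst a < r" "v \<in> V"
  shows "act (ga (inv_letter a) g) (act (ga a g) v) = v" "act (ga a g) (act (ga (inv_letter a) g) v) = v"
  using assms by (simp_all add: ga_inv)

lemma word_map_Cons: "word_map G (a # w) g = ga a g \<otimes> word_map G w g"
  by (simp add: word_map_def ga_def split_beta)

lemma word_map_Nil: "word_map G [] g = \<one>" by (simp add: word_map_def)

lemma word_map_closed: "fst ` set w \<subseteq> {..<r} \<Longrightarrow> g \<in> tup r \<Longrightarrow> word_map G w g \<in> carrier G"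
  by (induction w) (auto simp: word_map_Cons word_map_Nil)

lemma act_word_map:
  "fst ` set w \<subseteq> {..<r} \<Longrightarrow> g \<in> tup r \<Longrightarrow> x \<in> V \<Longrightarrow> act (word_map G w g) x = foldr (\<lambda>a. act (ga a g)) w x"
proof (induction w)
  case (Cons a w)
  then have a: "fst a < r" and w: "fst ` set w \<subseteq> {..<r}" by auto
  show ?case
    unfolding word_map_Cons act_mult[OF ga_closed[OF Cons.prems(2) a] word_map_closed[OF w Cons.prems(2)] Cons.prems(3)]
    using Cons.IH[OF w Cons.prems(2,3)] by simp
qed (simp add: word_map_Nil act_one)

lemma act_word_path:
  "fst ` set w \<subseteq> {..<r} \<Longrightarrow> g \<in> tup r \<Longrightarrow> x \<in> V \<Longrightarrow> act (word_map G w g) x = path (rev w) g x"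
  by (simp add: act_word_map path_def foldr_conv_fold)

text \<open>The p-adic valuation of a vector, truncated at \<open>k\<close>, which is the value at
  0.\<close>

definition dep :: "(nat \<Rightarrow> 'u) \<Rightarrow> nat" where
  "dep v = Max {m. m \<le> k \<and> v \<in> P m}"

lemma dep: assumes "v \<in> V"
  shows dep_le: "dep v \<le> k" and dep_P: "v \<in> P (dep v)" and dep_ge: "m \<le> k \<Longrightarrow> v \<in> P m \<Longrightarrow> m \<le> dep v"
proof -
  have "dep v \<in> {m. m \<le> k \<and> v \<in> P m}" unfolding dep_def by (rule Max_in) (use assms P_0 in auto)
  then show "dep v \<le> k" "v \<in> P (dep v)" by auto
  show "m \<le> k \<Longrightarrow> v \<in> P m \<Longrightarrow> m \<le> dep v" unfolding dep_def by (rule Max_ge) auto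
qed

text \<open>What has been exposed of a tuple \<open>g\<close> is recorded by a base point \<open>g0\<close> and, for every letter \<open>a\<close>,
  a projection \<open>pr a\<close>: the letter is known on the kernel of \<open>pr a\<close>, where it agrees with \<open>g0\<close>.\<close>

definition exposed :: "nat \<Rightarrow> (nat \<Rightarrow> 'g) \<Rightarrow> (letter \<Rightarrow> (nat \<Rightarrow> 'u) \<Rightarrow> nat \<Rightarrow> 'u) \<Rightarrow> (nat \<Rightarrow> 'g) set" where
  "exposed r g0 pr = {g \<in> tup r. \<forall>a. fst a < r \<longrightarrow>
     (\<forall>u\<in>V. pr a u = 0 \<longrightarrow> act (ga a g) u = act (ga a g0) u)}"

text \<open>The number \<open>t\<close> of exposures made so far bounds the rank of every kernel.
  The last condition keeps a letter and its inverse consistent: what is known about a letter is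
  carried by the base point into what is known about its inverse.\<close>

definition state :: "nat \<Rightarrow> nat \<Rightarrow> (nat \<Rightarrow> 'g) \<Rightarrow> (letter \<Rightarrow> (nat \<Rightarrow> 'u) \<Rightarrow> nat \<Rightarrow> 'u) \<Rightarrow> bool" where
  "state r t g0 pr \<longleftrightarrow> g0 \<in> tup r \<and> (\<forall>a. fst a < r \<longrightarrow> (\<exists>d\<le>t. proj d (pr a))) \<and>
     (\<forall>a. fst a < r \<longrightarrow> (\<forall>u\<in>V. pr a u = 0 \<longrightarrow> pr (inv_letter a) (act (ga a g0) u) = 0))"

lemma stateD:
  assumes "state r t g0 pr" "fst a < r"
  shows "g0 \<in> tup r" "\<exists>d\<le>t. proj d (pr a)" "lin (pr a)" "\<And>v. v \<in> V \<Longrightarrow> pr a (pr a v) = pr a v"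
    "\<And>u. u \<in> V \<Longrightarrow> pr a u = 0 \<Longrightarrow> pr (inv_letter a) (act (ga a g0) u) = 0"
    "\<And>u. u \<in> V \<Longrightarrow> pr a (u - pr a u) = 0"
proof -
  show 1: "g0 \<in> tup r" "\<exists>d\<le>t. proj d (pr a)"
    "\<And>u. u \<in> V \<Longrightarrow> pr a u = 0 \<Longrightarrow> pr (inv_letter a) (act (ga a g0) u) = 0"
    using assms unfolding state_def by blast+
  show 2: "lin (pr a)" "\<And>v. v \<in> V \<Longrightarrow> pr a (pr a v) = pr a v" using 1 proj_lin proj_idem by blast+
  then show "\<And>u. u \<in> V \<Longrightarrow> pr a (u - pr a u) = 0" using lin_diff lin_V by (metis diff_self)
qed

lemma exposed_tup: "g \<in> exposed r g0 pr \<Longrightarrow> g \<in> tup r" by (simp add: exposed_def)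
lemma finite_exposed [simp]: "finite (exposed r g0 pr)"
  by (rule finite_subset[OF _ finite_tup[of r]]) (auto simp: exposed_def)
lemma exposedD: "g \<in> exposed r g0 pr \<Longrightarrow> fst a < r \<Longrightarrow> u \<in> V \<Longrightarrow> pr a u = 0 \<Longrightarrow> act (ga a g) u = act (ga a g0) u"
  unfolding exposed_def by blast

lemma exposed_rebase: "g1 \<in> exposed r g0 pr \<Longrightarrow> exposed r g1 pr = exposed r g0 pr"
  by (auto simp: exposed_def)

lemma state_rebase: "state r t g0 pr \<Longrightarrow> g1 \<in> exposed r g0 pr \<Longrightarrow> state r t g1 pr"
  by (auto simp: state_def exposed_def)

text \<open>As x is primitive and fixed by \<open>pr a\<close>, some functional f has f x = e and
  vanishes on the kernel of \<open>pr a\<close>. Multiplying the letter by a transvection with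
  functional f changes nothing that is known and so permutes the exposed set, while x is moved by c
  - f(c) x for an arbitrary c.\<close>

lemma exposed_spread:
  assumes st: "state r t g0 pr" and a: "fst a < r" and x: "x \<in> V" "pr a x = x" "x \<notin> P (Suc 0)"
    and \<rho>: "proj d \<rho>" and z: "z \<in> V" and ij: "j + i \<le> k"
  shows "card {g \<in> exposed r g0 pr. \<rho> (smul (\<pi> ^ j) (act (ga a g) x)) - z \<in> P (j + i)} * Q ^ (i * n)
     \<le> card (exposed r g0 pr) * Q ^ (i * Suc d)"
proof -
  note s = stateD[OF st a]
  obtain d' where d': "proj d' (pr a)" using s(2) by blast
  obtain f where f: "fnl f" "f x = e" and fk: "\<And>u. u \<in> V \<Longrightarrow> pr a u = 0 \<Longrightarrow> f u = 0"
    using proj_separate[OF d' x] by blast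
  have "\<forall>c\<in>V. \<exists>T\<in>carrier G. \<forall>v\<in>V. act T v = v + smul (f v) (c - smul (f c) x)"
  proof
    fix c assume c: "c \<in> V"
    have "f (c - smul (f c) x) = f c - e * f c" using c f x by (simp add: fnl_simps mult.commute)
    also have "\<dots> = 0" using e_S fnl_S f c by simp
    finally show "\<exists>T\<in>carrier G. \<forall>v\<in>V. act T v = v + smul (f v) (c - smul (f c) x)"
      using transv[OF f(1), of "c - smul (f c) x"] c x by auto
  qed
  then obtain T where T: "\<And>c. c \<in> V \<Longrightarrow> T c \<in> carrier G"
    "\<And>c v. c \<in> V \<Longrightarrow> v \<in> V \<Longrightarrow> act (T c) v = v + smul (f v) (c - smul (f c) x)" by metis
  define \<tau> where "\<tau> c g = g(fst a := if snd a then g (fst a) \<otimes> T c else inv (T c) \<otimes> g (fst a))" for c and g :: "nat \<Rightarrow> 'g"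
  have gm: "g (fst a) \<in> carrier G" if "g \<in> tup r" for g using that a by (auto simp: tup_def)
  have \<tau>_tup: "\<tau> c g \<in> tup r" if "c \<in> V" "g \<in> tup r" for c g
    using that T(1) a gm by (auto simp: tup_def \<tau>_def PiE_iff extensional_def)
  have ga1: "ga a (\<tau> c g) = ga a g \<otimes> T c" if "c \<in> V" "g \<in> tup r" for c g
    using that T(1) gm by (auto simp: ga_def \<tau>_def inv_mult_group)
  have ga2: "ga b (\<tau> c g) = ga b g" if "fst b \<noteq> fst a" for b c g
    using that by (auto simp: ga_def \<tau>_def)
  have fixk: "act (T c) u = u" if "c \<in> V" "u \<in> V" "pr a u = 0" for c u
    using that fk T by (simp add: smul_simps)
  have \<tau>_exp: "\<tau> c g \<in> exposed r g0 pr" if c: "c \<in> V" and g: "g \<in> exposed r g0 pr" for c g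
  proof -
    have gt: "g \<in> tup r" using g exposed_tup by blast
    have A: "act (ga a (\<tau> c g)) u = act (ga a g0) u" if "u \<in> V" "pr a u = 0" for u
      using that c T(1) gt a fixk exposedD[OF g a] by (simp add: ga1 act_mult)
    \<comment> \<open>The inverse letter changes as well. By the last condition of
      \<open>state\<close> its known vectors are sent by the base point to known vectors of
      \<open>a\<close>, so that the preceding fact applies to them.\<close>
    have B: "act (ga (inv_letter a) (\<tau> c g)) u = act (ga (inv_letter a) g0) u"
      if u: "u \<in> V" "pr (inv_letter a) u = 0" for u
    proof -
      let ?u = "act (ga (inv_letter a) g0) u"
      have u': "?u \<in> V" "pr a ?u = 0"
        using u a s(1) stateD(5)[OF st, of "inv_letter a"] by (auto intro: act_V[OF ga_closed])
      have "act (ga a (\<tau> c g)) ?u = u" using A[OF u'] u s(1) a by simp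
      then show ?thesis using act_ga_inv(1)[OF \<tau>_tup[OF c gt] a u'(1)] by simp
    qed
    show ?thesis unfolding exposed_def
    proof (intro CollectI conjI allI impI ballI)
      fix b u assume b: "fst b < r" and u: "u \<in> V" "pr b u = 0"
      consider "b = a" | "b = inv_letter a" | "fst b \<noteq> fst a"
        by (cases a; cases b) (auto simp: inv_letter_def)
      then show "act (ga b (\<tau> c g)) u = act (ga b g0) u"
        using A B u ga2 exposedD[OF g b] by cases auto
    qed (use \<tau>_tup c gt in simp)
  qed
  have inj: "inj_on (\<tau> c) (exposed r g0 pr)" if c: "c \<in> V" for c
  proof (rule inj_onI)
    fix g g' assume g: "g \<in> exposed r g0 pr" "g' \<in> exposed r g0 pr" "\<tau> c g = \<tau> c g'"
    have "g i = g' i" for i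
    proof (cases "i = fst a")
      case True
      have "\<tau> c g (fst a) = \<tau> c g' (fst a)" using g by simp
      then show ?thesis using True gm g exposed_tup T(1)[OF c]
        by (auto simp: \<tau>_def split: if_splits)
    next
      case False
      then show ?thesis using fun_cong[OF g(3), of i] by (simp add: \<tau>_def)
    qed
    then show "g = g'" by auto
  qed
  show ?thesis
  proof (rule transvection_spread[where f = f and \<tau> = \<tau> and x = x])
    fix c assume c: "c \<in> V"
    have "\<tau> c ` exposed r g0 pr \<subseteq> exposed r g0 pr" using \<tau>_exp c by auto
    then show "bij_betw (\<tau> c) (exposed r g0 pr) (exposed r g0 pr)"
      using endo_inj_surj[OF finite_exposed _ inj[OF c]] inj[OF c] by (simp add: bij_betw_def)
  next
    fix g assume g: "g \<in> exposed r g0 pr"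
    then have gt: "g \<in> tup r" by (rule exposed_tup)
    show "act (ga a g) x \<in> V" using gt a x act_V by simp
    have "act (ga a (\<tau> c g)) x = act (ga a g) x + act (ga a g) (c - smul (f c) x)" if "c \<in> V" for c
    proof -
      have "act (T c) x = x + (c - smul (f c) x)" using T that x f by (simp add: smul_e)
      then show ?thesis using that T(1) gt a x lin_add[OF act_lin[OF ga_closed[OF gt a]]]
        by (simp add: ga1 act_mult)
    qed
    then show "\<exists>A. lin A \<and> inj_on A V \<and> (\<forall>c\<in>V. act (ga a (\<tau> c g)) x = act (ga a g) x + A (c - smul (f c) x))"
      using act_lin act_inj gt a by (metis ga_closed)
  qed (use f x \<rho> z ij in auto)
qed

text \<open>Exposes the letter \<open>a\<close> at one more vector. The new projection for
  \<open>a\<close> removes the component along x and does not depend on the value that is found, so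
  it is obtained before \<open>g1\<close>. The one for the inverse letter is its conjugate by
  \<open>g1\<close> and does depend on that value; in a reduced word the inverse letter never comes
  next.\<close>

lemma refine:
  assumes st: "state r t g0 pr" and a: "fst a < r" and x: "x \<in> V" "pr a x = x" "x \<notin> P (Suc 0)"
  obtains \<rho> d where "proj d \<rho>" "d \<le> Suc t"
    "\<And>g1. g1 \<in> exposed r g0 pr \<Longrightarrow> \<exists>pr1. state r (Suc t) g1 pr1 \<and> pr1 a = \<rho> \<and>
       (\<forall>b. fst b \<noteq> fst a \<longrightarrow> pr1 b = pr b) \<and>
       exposed r g1 pr1 = {g \<in> exposed r g0 pr. act (ga a g) x = act (ga a g1) x}"
proof -
  note s = stateD[OF st a] and l = lin_simps[OF stateD(3)[OF st a]]
  obtain d where d: "proj d (pr a)" "d \<le> t" using s(2) by blast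
  obtain f where f: "fnl f" "f x = e" using proj_separate[OF d(1) x] by blast
  define \<rho> where "\<rho> v = pr a v - smul (f (pr a v)) x" for v
  have "e * f x = e" using f(2) ee by simp
  then have \<rho>: "proj (Suc d) \<rho>" by (rule proj_Suc[OF d(1) x(1,2) f(1)]) (simp add: \<rho>_def)
  note l\<rho> = lin_simps[OF proj_lin[OF \<rho>]]
  have \<rho>k: "\<rho> u = 0" if "pr a u = 0" for u using that f by (simp add: \<rho>_def fnl_simps smul_simps)
  have \<rho>x: "\<rho> x = 0" using x f by (simp add: \<rho>_def smul_e)
  show ?thesis
  proof (rule that[OF \<rho>])
    fix g1 assume g1: "g1 \<in> exposed r g0 pr"
    have g1t: "g1 \<in> tup r" using g1 by (rule exposed_tup)
    have st1: "state r t g1 pr" using st g1 by (rule state_rebase)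
    have Gg: "ga a g1 \<in> carrier G" "ga (inv_letter a) g1 \<in> carrier G" using g1t a by auto
    define \<sigma> where "\<sigma> v = act (ga a g1) (\<rho> (act (ga (inv_letter a) g1) v))" for v
    define pr1 where "pr1 = pr(a := \<rho>, inv_letter a := \<sigma>)"
    have pa: "pr1 a = \<rho>" "pr1 (inv_letter a) = \<sigma>" "\<And>b :: letter. fst b \<noteq> fst a \<Longrightarrow> pr1 b = pr b"
      by (auto simp: pr1_def) (metis inv_letter_neq)
    have \<sigma>p: "proj (Suc d) \<sigma>" unfolding \<sigma>_def
      by (rule proj_conj[OF act_lin act_lin _ _ \<rho>]) (use g1t a in auto)
    have cases_b: "b = a \<or> b = inv_letter a \<or> fst b \<noteq> fst a" for b :: letter
      by (cases a; cases b) (auto simp: inv_letter_def)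
    have \<sigma>0: "\<rho> (act (ga (inv_letter a) g1) w) = 0" if "w \<in> V" "\<sigma> w = 0" for w
      using that act_eq_0[OF Gg(1)] act_V[OF Gg(2)] l\<rho> by (simp add: \<sigma>_def)
    have st': "state r (Suc t) g1 pr1" unfolding state_def
    proof (intro conjI allI impI ballI)
      fix b :: letter assume b: "fst b < r"
      show "\<exists>d\<le>Suc t. proj d (pr1 b)"
        using cases_b[of b] pa \<rho> \<sigma>p d(2) stateD(2)[OF st b] by (metis Suc_le_mono le_SucI)
      fix u assume u: "u \<in> V" "pr1 b u = 0"
      from cases_b[of b] show "pr1 (inv_letter b) (act (ga b g1) u) = 0"
      proof (elim disjE)
        assume "b = a"
        then show ?thesis using u pa g1t a lin_0[OF act_lin[OF Gg(1)]] by (simp add: \<sigma>_def)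
      next
        assume "b = inv_letter a"
        then show ?thesis using u pa \<sigma>0 by simp
      next
        assume "fst b \<noteq> fst a"
        then show ?thesis using u pa stateD(5)[OF st1 b u(1)] by simp
      qed
    qed (rule g1t)
    have "exposed r g1 pr1 = {g \<in> exposed r g1 pr. act (ga a g) x = act (ga a g1) x}"
    proof (intro equalityI subsetI CollectI conjI)
      fix g assume g: "g \<in> exposed r g1 pr1"
      have gt: "g \<in> tup r" using g by (rule exposed_tup)
      have A: "act (ga a g) u = act (ga a g1) u" if "u \<in> V" "\<rho> u = 0" for u
        using exposedD[OF g a that(1)] that pa by simp
      show "act (ga a g) x = act (ga a g1) x" using A x \<rho>x by simp
      show "g \<in> exposed r g1 pr" unfolding exposed_def
      proof (intro CollectI conjI allI impI ballI)
        fix b u assume b: "fst b < r" and u: "u \<in> V" "pr b u = 0"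
        from cases_b[of b] show "act (ga b g) u = act (ga b g1) u"
        proof (elim disjE)
          assume "b = a"
          then show ?thesis using A u \<rho>k by simp
        next
          assume ba: "b = inv_letter a"
          let ?u = "act (ga (inv_letter a) g1) u"
          have "pr a ?u = 0" using stateD(5)[OF st1, of "inv_letter a" u] a u ba by simp
          then have "act (ga a g) ?u = act (ga a g1) ?u" using A \<rho>k act_V[OF Gg(2)] u by simp
          then have "act (ga a g) ?u = u" using g1t a u by simp
          then show ?thesis using ba act_ga_inv(1)[OF gt a act_V[OF Gg(2) u(1)]] by simp
        next
          assume "fst b \<noteq> fst a"
          then show ?thesis using exposedD[OF g b u(1)] pa u by simp
        qed
      qed (rule gt)
    next
      fix g assume "g \<in> {g \<in> exposed r g1 pr. act (ga a g) x = act (ga a g1) x}"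
      then have g: "g \<in> exposed r g1 pr" and gx: "act (ga a g) x = act (ga a g1) x" by auto
      have gt: "g \<in> tup r" using g by (rule exposed_tup)
      have Ga: "ga a g \<in> carrier G" using gt a by simp
      have A: "act (ga a g) u = act (ga a g1) u" if u: "u \<in> V" "\<rho> u = 0" for u
      proof -
        have "pr a u = smul (f (pr a u)) x" using u by (simp add: \<rho>_def)
        then have "u = (u - pr a u) + smul (f (pr a u)) x" by simp
        moreover have "act (ga a g) (u - pr a u) = act (ga a g1) (u - pr a u)"
          using exposedD[OF g a] s(6) u l by simp
        moreover have "u - pr a u \<in> V" using u l by simp
        ultimately show ?thesis
          using lin_simps[OF act_lin[OF Ga]] lin_simps[OF act_lin[OF Gg(1)]] gx x by (metis V_closed(5))
      qed
      show "g \<in> exposed r g1 pr1" unfolding exposed_def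
      proof (intro CollectI conjI allI impI ballI)
        fix b u assume b: "fst b < r" and u: "u \<in> V" "pr1 b u = 0"
        from cases_b[of b] show "act (ga b g) u = act (ga b g1) u"
        proof (elim disjE)
          assume "b = a"
          then show ?thesis using A u pa by simp
        next
          assume ba: "b = inv_letter a"
          let ?u = "act (ga (inv_letter a) g1) u"
          have "\<rho> ?u = 0" using \<sigma>0 u pa ba by simp
          then have "act (ga a g) ?u = act (ga a g1) ?u" using A act_V[OF Gg(2)] u by simp
          then have "act (ga a g) ?u = u" using g1t a u by simp
          then show ?thesis using ba act_ga_inv(1)[OF gt a act_V[OF Gg(2) u(1)]] by simp
        next
          assume "fst b \<noteq> fst a"
          then show ?thesis using exposedD[OF g b u(1)] pa u by simp
        qed
      qed (rule gt)
    qed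
    then show "\<exists>pr1. state r (Suc t) g1 pr1 \<and> pr1 a = \<rho> \<and> (\<forall>b. fst b \<noteq> fst a \<longrightarrow> pr1 b = pr b) \<and>
       exposed r g1 pr1 = {g \<in> exposed r g0 pr. act (ga a g) x = act (ga a g1) x}"
      using st' pa exposed_rebase[OF g1] by auto
  qed (use d in simp)
qed

end

section \<open>Large rank: exposing trajectories\<close>

context lin_group
begin

text \<open>The vector whose depth measures how much can still be gained: the part of x that is
  unknown to the next letter, or at the end of the path the distance from the target.\<close>

definition chk :: "letter list \<Rightarrow> (letter \<Rightarrow> (nat \<Rightarrow> 'u) \<Rightarrow> nat \<Rightarrow> 'u) \<Rightarrow> (nat \<Rightarrow> 'u) \<Rightarrow> (nat \<Rightarrow> 'u) \<Rightarrow> nat \<Rightarrow> 'u" where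
  "chk L pr y x = (case L of [] \<Rightarrow> x - y | a # _ \<Rightarrow> pr a x)"

text \<open>With kernels of rank at most n - 1 - \<beta>, one exposure lifts the depth from j to j +
  i with conditional probability at most Q^(-i \<beta>).\<close>

lemma exposed_spread_power:
  assumes st: "state r t g0 pr" and a: "fst a < r" and x: "x \<in> V" "pr a x = x" "x \<notin> P (Suc 0)"
    and \<rho>: "proj d \<rho>" and z: "z \<in> V" and ij: "j + i \<le> k" and d: "\<beta> + d + 1 \<le> n"
  shows "card {g \<in> exposed r g0 pr. \<rho> (smul (\<pi> ^ j) (act (ga a g) x)) - z \<in> P (j + i)} * Q ^ (i * \<beta>)
     \<le> card (exposed r g0 pr)" (is "?A * _ \<le> ?B")
proof -
  have "(?A * Q ^ (i * \<beta>)) * Q ^ (i * Suc d) \<le> ?A * Q ^ (i * n)"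
  proof -
    have "i * \<beta> + i * Suc d \<le> i * n"
      using mult_le_mono2[OF d, of i] by (simp add: algebra_simps)
    then have "Q ^ (i * \<beta> + i * Suc d) \<le> Q ^ (i * n)"
      using Q_gt_1 by (intro power_increasing) auto
    then have "Q ^ (i * \<beta>) * Q ^ (i * Suc d) \<le> Q ^ (i * n)" by (simp only: power_add)
    then show ?thesis using mult_le_mono2[of _ _ ?A] by (simp only: mult.assoc)
  qed
  also have "\<dots> \<le> ?B * Q ^ (i * Suc d)" by (rule exposed_spread[OF st a x \<rho> z ij])
  finally show ?thesis using Q_gt_1 by (simp only: mult_le_cancel2 zero_less_power)
qed

text \<open>Depth bookkeeping: the probability that the depth rises from \<open>j\<close> to \<open>m\<close> pays exactly for
  the factor gained in the remaining steps.\<close>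

lemma depth_sum:
  fixes D :: "'a \<Rightarrow> nat"
  assumes fin: "finite \<Omega>" and Dk: "\<And>g. g \<in> \<Omega> \<Longrightarrow> D g \<le> k" and jk: "j \<le> k"
    and sp: "\<And>i. j + i \<le> k \<Longrightarrow> card {g \<in> \<Omega>. D g \<ge> j + i} * Q ^ (i * \<beta>) \<le> card \<Omega>"
  shows "(\<Sum>g\<in>\<Omega>. 1 / real Q ^ ((k - D g) * \<beta>)) \<le> real (card \<Omega>) * (real (k + 1) / real Q ^ ((k - j) * \<beta>))"
proof -
  have Q0: "0 < real Q" "1 \<le> real Q" using Q_gt_1 by auto
  have *: "real (card {g \<in> \<Omega>. D g = m}) * (1 / real Q ^ ((k - m) * \<beta>))
      \<le> real (card \<Omega>) / real Q ^ ((k - j) * \<beta>)" if m: "m \<le> k" for m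
  proof (cases "m \<le> j")
    case True
    have "real (card {g \<in> \<Omega>. D g = m}) \<le> real (card \<Omega>)" using fin by (simp add: card_mono)
    moreover have "1 / real Q ^ ((k - m) * \<beta>) \<le> 1 / real Q ^ ((k - j) * \<beta>)"
      using True Q0 by (intro divide_left_mono power_increasing mult_le_mono1) auto
    ultimately have "real (card {g \<in> \<Omega>. D g = m}) * (1 / real Q ^ ((k - m) * \<beta>))
        \<le> real (card \<Omega>) * (1 / real Q ^ ((k - j) * \<beta>))"
      by (intro mult_mono) auto
    then show ?thesis by simp
  next
    case False
    define i where "i = m - j"
    have i: "m = j + i" "j + i \<le> k" using False m by (auto simp: i_def)
    have "card {g \<in> \<Omega>. D g = m} * Q ^ (i * \<beta>) \<le> card {g \<in> \<Omega>. D g \<ge> j + i} * Q ^ (i * \<beta>)"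
      using fin i by (intro mult_le_mono1 card_mono) auto
    also have "\<dots> \<le> card \<Omega>" by (rule sp) (rule i)
    finally have "real (card {g \<in> \<Omega>. D g = m} * Q ^ (i * \<beta>)) \<le> real (card \<Omega>)" by linarith
    then have le: "real (card {g \<in> \<Omega>. D g = m}) * real Q ^ (i * \<beta>) \<le> real (card \<Omega>)" by simp
    have "(k - j) * \<beta> = i * \<beta> + (k - m) * \<beta>" using i by (simp add: add_mult_distrib[symmetric])
    then have "real Q ^ ((k - j) * \<beta>) = real Q ^ (i * \<beta>) * real Q ^ ((k - m) * \<beta>)"
      by (simp add: power_add)
    then show ?thesis using le Q0 by (simp add: field_simps)
  qed
  have "(\<Sum>g\<in>\<Omega>. 1 / real Q ^ ((k - D g) * \<beta>))
      = (\<Sum>m\<in>{..k}. \<Sum>g\<in>{g \<in> \<Omega>. D g = m}. 1 / real Q ^ ((k - D g) * \<beta>))"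
    by (rule sum.group[symmetric]) (use fin Dk in auto)
  also have "\<dots> = (\<Sum>m\<in>{..k}. real (card {g \<in> \<Omega>. D g = m}) * (1 / real Q ^ ((k - m) * \<beta>)))"
    by (rule sum.cong) auto
  also have "\<dots> \<le> (\<Sum>m\<in>{..k}. real (card \<Omega>) / real Q ^ ((k - j) * \<beta>))"
    by (rule sum_mono) (use * in auto)
  also have "\<dots> = real (card \<Omega>) * (real (k + 1) / real Q ^ ((k - j) * \<beta>))" by simp
  finally show ?thesis .
qed

text \<open>Induction along the path. A path that ends in y must have depth \<open>k\<close> at its
  end, and every rise of the depth is paid for by an exposure; so a start at depth j gives Q^(-(k -
  j) \<beta>), up to a factor k + 1 per letter. \<open>H\<close> is the event left to later
  trajectories, for which \<open>c\<close> exposures are held in reserve.\<close>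

lemma trajectory_bound:
  fixes B :: real
  assumes B: "0 \<le> B" and \<beta>: "\<beta> + T + 1 \<le> n"
    and base: "\<And>t g0 pr. state r t g0 pr \<Longrightarrow> t + c \<le> T \<Longrightarrow>
      real (card {g \<in> exposed r g0 pr. g \<in> H}) \<le> real (card (exposed r g0 pr)) * B"
  shows "reduced_word L \<Longrightarrow> fst ` set L \<subseteq> {..<r} \<Longrightarrow> state r t g0 pr \<Longrightarrow> t + length L + c \<le> T \<Longrightarrow>
     x \<in> V \<Longrightarrow> y \<in> V \<Longrightarrow>
     real (card {g \<in> exposed r g0 pr. path L g x = y \<and> g \<in> H})
      \<le> real (card (exposed r g0 pr)) * (real (k + 1) ^ length L / real Q ^ ((k - dep (chk L pr y x)) * \<beta>) * B)"
proof (induction L arbitrary: t g0 pr x)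
  case Nil
  show ?case
  proof (cases "x = y")
    case True
    have "dep (0 :: nat \<Rightarrow> 'u) = k" using dep_le[of 0] dep_ge[of 0 k] by force
    moreover have "chk [] pr y x = 0" unfolding chk_def True by (simp only: list.case diff_self)
    ultimately have "dep (chk [] pr y x) = k" by simp
    then show ?thesis using True base[OF Nil(3)] Nil(4) by (simp add: path_def)
  next
    case False
    then show ?thesis using B by (simp add: path_def)
  qed
next
  case (Cons a L)
  note st = Cons.prems(3) and x = Cons.prems(5) and y = Cons.prems(6)
  let ?\<Omega> = "exposed r g0 pr"
  have a: "fst a < r" and L: "fst ` set L \<subseteq> {..<r}" "reduced_word L"
    using Cons.prems reduced_Cons by auto
  note s = stateD[OF st a] and l = lin_simps[OF stateD(3)[OF st a]]
  define j where "j = dep (pr a x)"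
  have prx: "pr a x \<in> V" using l(1)[OF x] .
  have Q1: "1 \<le> real Q" using Q_gt_1 by simp
  have goal_j: "dep (chk (a # L) pr y x) = j" by (simp add: chk_def j_def)
  show ?case
  proof (cases "j = k")
    case True
    have "real (card {g \<in> ?\<Omega>. path (a # L) g x = y \<and> g \<in> H}) \<le> real (card {g \<in> ?\<Omega>. g \<in> H})"
      using finite_exposed by (intro of_nat_mono card_mono) auto
    also have "\<dots> \<le> real (card ?\<Omega>) * B" by (rule base[OF st]) (use Cons.prems(4) in linarith)
    also have "\<dots> \<le> real (card ?\<Omega>) * (real (k + 1) ^ length (a # L) * B)"
    proof -
      have "1 \<le> real (k + 1) ^ length (a # L)" by (rule one_le_power) simp
      then have "1 * B \<le> real (k + 1) ^ length (a # L) * B" using B by (intro mult_right_mono) auto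
      then show ?thesis by (intro mult_left_mono) auto
    qed
    finally show ?thesis unfolding goal_j True by simp
  next
    case False
    then have jk: "j < k" using dep_le[OF prx] by (simp add: j_def)
    \<comment> \<open>The new part of x is \<open>\<pi> ^ j\<close> times a primitive vector
      \<open>x'\<close>. The letter is exposed at \<open>x'\<close>, not at the multiple, so that
      kernels remain free.\<close>
    obtain u where u: "u \<in> V" "pr a x = smul (\<pi> ^ j) u" using P_ex[OF dep_P[OF prx]] unfolding j_def by metis
    define x' where "x' = pr a u"
    have x': "x' \<in> V" "pr a x' = x'" using l(1) u(1) s(4) by (auto simp: x'_def)
    have px': "smul (\<pi> ^ j) x' = pr a x" unfolding x'_def l(3)[OF u(1), symmetric] u(2)[symmetric] by (rule s(4)[OF x])
    have x'n: "x' \<notin> P (Suc 0)"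
    proof
      assume "x' \<in> P (Suc 0)"
      then obtain v where v: "v \<in> V" "x' = smul (\<pi> ^ Suc 0) v" using P_ex by blast
      have "pr a x = smul (\<pi> ^ Suc j) v" unfolding px'[symmetric] v(2) by (simp add: smul_simps mult.commute)
      then have "pr a x \<in> P (Suc j)" using smul_P v by metis
      then have "Suc j \<le> j" unfolding j_def using dep_ge[OF prx] jk j_def by auto
      then show False by simp
    qed
    obtain \<rho>' d' where \<rho>': "proj d' \<rho>'" "d' \<le> Suc t" and ref:
      "\<And>g1. g1 \<in> ?\<Omega> \<Longrightarrow> \<exists>pr1. state r (Suc t) g1 pr1 \<and> pr1 a = \<rho>' \<and>
       (\<forall>b. fst b \<noteq> fst a \<longrightarrow> pr1 b = pr b) \<and>
       exposed r g1 pr1 = {g \<in> ?\<Omega>. act (ga a g) x' = act (ga a g1) x'}"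
      by (rule refine[OF st a x' x'n]) (rule that)
    \<comment> \<open>The projection that the next letter will use. It is fixed before the value at
      \<open>x'\<close> is known, because in a reduced word the next letter is not the inverse of
      \<open>a\<close>; the spreading estimate requires such a fixed projection.\<close>
    define \<rho> where "\<rho> = (case L of [] \<Rightarrow> (\<lambda>v. v) | b # _ \<Rightarrow> if b = a then \<rho>' else pr b)"
    define y' where "y' = (case L of [] \<Rightarrow> y | b # _ \<Rightarrow> 0)"
    have y': "y' \<in> V" using y by (auto simp: y'_def split: list.split)
    have "\<exists>d\<le>T. proj d \<rho>"
    proof (cases L)
      case Nil
      then show ?thesis using proj_0[of "\<lambda>v. v"] by (auto simp: \<rho>_def)
    next
      case bL: (Cons b L')
      then have "fst b < r" using L by auto
      then obtain d where d: "d \<le> t" "proj d (pr b)" using stateD(2)[OF st, of b] by blast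
      have "d \<le> T" "d' \<le> T" using d(1) \<rho>'(2) Cons.prems(4) bL by auto
      then show ?thesis using d(2) \<rho>'(1) bL by (cases "b = a") (auto simp: \<rho>_def)
    qed
    then obtain d where d: "d \<le> T" "proj d \<rho>" by blast
    note l\<rho> = lin_simps[OF proj_lin[OF d(2)]]
    define x0 where "x0 = act (ga a g0) (x - pr a x)"
    have x0: "x0 \<in> V" unfolding x0_def using act_V[OF ga_closed[OF s(1) a]] x prx by blast
    define v where "v g = act (ga a g) x" for g
    have vV: "v g \<in> V" "act (ga a g) x' \<in> V" if "g \<in> ?\<Omega>" for g
      unfolding v_def using act_V[OF ga_closed[OF exposed_tup[OF that] a]] x x' by blast+
    have v: "v g = x0 + smul (\<pi> ^ j) (act (ga a g) x')" if g: "g \<in> ?\<Omega>" for g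
    proof -
      have G: "ga a g \<in> carrier G" using exposed_tup[OF g] a by simp
      note lg = lin_simps[OF act_lin[OF G]]
      have "v g = act (ga a g) ((x - pr a x) + smul (\<pi> ^ j) x')" unfolding v_def px' by simp
      also have "\<dots> = act (ga a g) (x - pr a x) + smul (\<pi> ^ j) (act (ga a g) x')"
        unfolding lg(2)[OF V_closed(3)[OF x prx] V_closed(5)[OF x'(1)]] lg(3)[OF x'(1)] ..
      also have "act (ga a g) (x - pr a x) = x0"
        unfolding x0_def by (rule exposedD[OF g a V_closed(3)[OF x prx] s(6)[OF x]])
      finally show ?thesis .
    qed
    define D where "D g = dep (\<rho> (v g) - y')" for g
    have rv: "\<rho> (v g) - y' \<in> V" if "g \<in> ?\<Omega>" for g using l\<rho>(1)[OF vV(1)[OF that]] y' by blast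
    \<comment> \<open>The bound for the rest of the path, given the value of the letter at
      \<open>x'\<close>; it depends on that value only through the depth reached.\<close>
    define b where "b g = real (k + 1) ^ length L / real Q ^ ((k - D g) * \<beta>) * B" for g
    have step: "real (card {g' \<in> {g \<in> ?\<Omega>. path (a # L) g x = y \<and> g \<in> H}. act (ga a g') x' = act (ga a g) x'})
        \<le> real (card {g' \<in> ?\<Omega>. act (ga a g') x' = act (ga a g) x'}) * b g" if g: "g \<in> ?\<Omega>" for g
    proof -
      obtain pr1 where pr1: "state r (Suc t) g pr1" "pr1 a = \<rho>'" "\<And>b. fst b \<noteq> fst a \<Longrightarrow> pr1 b = pr b"
        "exposed r g pr1 = {g' \<in> ?\<Omega>. act (ga a g') x' = act (ga a g) x'}"
        using ref[OF g] by blast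
      have same: "v g' = v g" if "g' \<in> exposed r g pr1" for g'
        using that v g unfolding pr1(4) by simp
      have "chk L pr1 y (v g) = \<rho> (v g) - y'"
      proof (cases L)
        case (Cons b L')
        then have "b \<noteq> inv_letter a" using \<open>reduced_word (a # L)\<close> by simp
        then have "b = a \<or> fst b \<noteq> fst a" by (cases a; cases b) (auto simp: inv_letter_def)
        then have "pr1 b = (if b = a then \<rho>' else pr b)" using pr1(2,3) by presburger
        then show ?thesis using Cons by (simp add: chk_def \<rho>_def y'_def)
      qed (simp add: chk_def \<rho>_def y'_def)
      then have D: "dep (chk L pr1 y (v g)) = D g" by (simp add: D_def)
      have "{g' \<in> {g \<in> ?\<Omega>. path (a # L) g x = y \<and> g \<in> H}. act (ga a g') x' = act (ga a g) x'}
          = {g' \<in> exposed r g pr1. path L g' (v g) = y \<and> g' \<in> H}"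
        (is "?l = ?r")
      proof (intro equalityI subsetI)
        fix g' assume h: "g' \<in> ?l"
        then have "g' \<in> exposed r g pr1" unfolding pr1(4) by simp
        then show "g' \<in> ?r" using h same[of g'] by (simp add: path_def v_def)
      next
        fix g' assume h: "g' \<in> ?r"
        then have "g' \<in> exposed r g pr1" by simp
        then show "g' \<in> ?l" using h same[of g'] unfolding pr1(4) by (simp add: path_def v_def)
      qed
      moreover have "real (card {g' \<in> exposed r g pr1. path L g' (v g) = y \<and> g' \<in> H})
          \<le> real (card (exposed r g pr1)) * b g"
        unfolding b_def D[symmetric]
        by (rule Cons.IH[OF L(2,1) pr1(1) _ vV(1)[OF g] y]) (use Cons.prems(4) in simp)
      ultimately show ?thesis unfolding pr1(4) by simp
    qed
    have "real (card {g \<in> ?\<Omega>. path (a # L) g x = y \<and> g \<in> H}) \<le> (\<Sum>g\<in>?\<Omega>. b g)"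
    proof (rule sum_over_fibres_le[where z = "\<lambda>g. act (ga a g) x'"])
      show "b g = b g'" if "g \<in> ?\<Omega>" "g' \<in> ?\<Omega>" "act (ga a g) x' = act (ga a g') x'" for g g'
        using v[OF that(1)] v[OF that(2)] that(3) by (simp add: b_def D_def)
    qed (use step in auto)
    also have "\<dots> = (\<Sum>g\<in>?\<Omega>. 1 / real Q ^ ((k - D g) * \<beta>)) * (real (k + 1) ^ length L * B)"
      by (simp add: b_def sum_distrib_right)
    also have "\<dots> \<le> (real (card ?\<Omega>) * (real (k + 1) / real Q ^ ((k - j) * \<beta>))) * (real (k + 1) ^ length L * B)"
    proof (rule mult_right_mono[OF depth_sum])
      fix i assume ij: "j + i \<le> k"
      have z: "y' - \<rho> x0 \<in> V" using y' l\<rho>(1)[OF x0] by blast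
      have "card {g \<in> ?\<Omega>. j + i \<le> D g} * Q ^ (i * \<beta>)
          \<le> card {g \<in> ?\<Omega>. \<rho> (smul (\<pi> ^ j) (act (ga a g) x')) - (y' - \<rho> x0) \<in> P (j + i)} * Q ^ (i * \<beta>)"
      proof (intro mult_le_mono1 card_mono)
        show "{g \<in> ?\<Omega>. j + i \<le> D g} \<subseteq> {g \<in> ?\<Omega>. \<rho> (smul (\<pi> ^ j) (act (ga a g) x')) - (y' - \<rho> x0) \<in> P (j + i)}"
        proof (intro subsetI CollectI)
          fix g assume "g \<in> {g \<in> ?\<Omega>. j + i \<le> D g}"
          then have g: "g \<in> ?\<Omega>" "j + i \<le> D g" by auto
          have "\<rho> (v g) - y' \<in> P (D g)" unfolding D_def by (rule dep_P[OF rv[OF g(1)]])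
          then have "\<rho> (v g) - y' \<in> P (j + i)" using P_mono[OF g(2)] by blast
          moreover have "\<rho> (v g) - y' = \<rho> (smul (\<pi> ^ j) (act (ga a g) x')) - (y' - \<rho> x0)"
            unfolding v[OF g(1)] l\<rho>(2)[OF x0 V_closed(5)[OF vV(2)[OF g(1)]]] by simp
          ultimately show "g \<in> ?\<Omega> \<and> \<rho> (smul (\<pi> ^ j) (act (ga a g) x')) - (y' - \<rho> x0) \<in> P (j + i)"
            using g(1) by simp
        qed
      qed simp
      also have "\<dots> \<le> card ?\<Omega>"
        by (rule exposed_spread_power[OF st a x' x'n d(2) z ij]) (use d(1) \<beta> in linarith)
      finally show "card {g \<in> ?\<Omega>. j + i \<le> D g} * Q ^ (i * \<beta>) \<le> card ?\<Omega>" .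
    qed (use jk B dep_le[OF rv] D_def in auto)
    finally show ?thesis unfolding goal_j by simp
  qed
qed

text \<open>\<open>M\<close> trajectories in succession, each started at a primitive vector that is
  new to the first letter read: it has depth 0 and is worth a factor Q^(-k \<beta>). Each uses
  \<open>length w\<close> exposures, so all kernels have rank at most \<open>M * length w\<close>,
  which the hypothesis on \<open>n\<close> keeps at most n - 1 - \<beta>.\<close>

theorem word_fibre_large_rank:
  assumes w: "reduced_word w" "w \<noteq> []" "fst ` set w \<subseteq> {..<r}" and h: "h \<in> carrier G"
    and n: "\<beta> + M * length w + 1 \<le> n"
  shows "real (card {g \<in> tup r. word_map G w g = h})
     \<le> real (card (tup r)) * (real (k + 1) ^ length w / real Q ^ (k * \<beta>)) ^ M"
proof -
  let ?B = "real (k + 1) ^ length w / real Q ^ (k * \<beta>)"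
  define T where "T = M * length w"
  have "real (card {g \<in> exposed r g0 pr. g \<in> {g. word_map G w g = h}}) \<le> real (card (exposed r g0 pr)) * ?B ^ m"
    if "state r t g0 pr" "t + m * length w \<le> T" for t g0 pr m
    using that
  proof (induction m arbitrary: t g0 pr)
    case 0
    show ?case by (simp, rule card_mono) auto
  next
    case (Suc m)
    obtain a L where L: "rev w = a # L" using w(2) by (cases "rev w") auto
    have seta: "a \<in> set w" using L by (metis list.set_intros(1) set_rev)
    then have a: "fst a < r" using w(3) by auto
    obtain d where d: "d \<le> t" "proj d (pr a)" using stateD(2)[OF Suc.prems(1) a] by blast
    \<comment> \<open>Fewer than \<open>n\<close> vectors have been exposed so far, so a fresh
      primitive vector is still available.\<close>
    have "d < n" using d(1) Suc.prems(2) n unfolding T_def by linarith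
    then obtain x where x: "x \<in> V" "pr a x = x" "x \<notin> P (Suc 0)" using proj_nontrivial[OF d(2)] by blast
    have dep0: "dep (chk (rev w) pr (act h x) x) = 0"
    proof -
      have "x \<notin> P m" if "m > 0" for m using P_mono[of "Suc 0" m] x(3) that by auto
      then have "dep x = 0" using dep_P[OF x(1)] by (metis neq0_conv)
      then show ?thesis using x(2) by (simp add: chk_def L)
    qed
    have rw: "reduced_word (rev w)"
      using w(1) unfolding reduced_word_def successively_rev
      by (rule successively_mono) (metis inv_letter_inv)
    \<comment> \<open>The word equation prescribes the endpoint of the trajectory; the equation
      itself is kept as the event for the remaining trajectories.\<close>
    have eq: "{g \<in> exposed r g0 pr. g \<in> {g. word_map G w g = h}}
        = {g \<in> exposed r g0 pr. path (rev w) g x = act h x \<and> g \<in> {g. word_map G w g = h}}"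
      using act_word_path[OF w(3) exposed_tup x(1)] by auto
    have "real (card {g \<in> exposed r g0 pr. g \<in> {g. word_map G w g = h}})
       \<le> real (card (exposed r g0 pr)) *
        (real (k + 1) ^ length (rev w) / real Q ^ ((k - dep (chk (rev w) pr (act h x) x)) * \<beta>) * ?B ^ m)"
      unfolding eq
    proof (rule trajectory_bound[OF _ _ _ rw])
      show "real (card {g \<in> exposed r g0 pr. g \<in> {g. word_map G w g = h}}) \<le> real (card (exposed r g0 pr)) * ?B ^ m"
        if "state r t g0 pr" "t + m * length w \<le> T" for t g0 pr by (rule Suc.IH[OF that])
      show "\<beta> + T + 1 \<le> n" using n by (simp add: T_def)
      show "t + length (rev w) + m * length w \<le> T" using Suc.prems(2) by simp
    qed (use w x Suc.prems act_V h in auto)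
    then show ?case unfolding dep0 by simp
  qed
  moreover have "state r 0 (\<lambda>i\<in>{..<r}. \<one>) (\<lambda>_ v. v)"
    unfolding state_def
  proof (intro conjI allI impI ballI)
    show one: "(\<lambda>i\<in>{..<r}. \<one>) \<in> tup r" by (auto simp: tup_def)
    fix a :: letter assume a: "fst a < r"
    show "\<exists>d\<le>0. proj d (\<lambda>v. v)" using proj_0[of "\<lambda>v. v"] by auto
    show "act (ga a (\<lambda>i\<in>{..<r}. \<one>)) u = 0" if "u = 0" for u
      using lin_0[OF act_lin[OF ga_closed[OF one a]]] that by simp
  qed
  moreover have "exposed r (\<lambda>i\<in>{..<r}. \<one>) (\<lambda>_ v. v) = tup r"
  proof -
    have "(\<lambda>i\<in>{..<r}. \<one>) \<in> tup r" by (auto simp: tup_def)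
    then have "act (ga a g) 0 = act (ga a (\<lambda>i\<in>{..<r}. \<one>)) 0" if "g \<in> tup r" "fst a < r" for g a
      using lin_0[OF act_lin[OF ga_closed]] that by simp
    then show ?thesis unfolding exposed_def by blast
  qed
  ultimately show ?thesis using T_def by fastforce
qed

end

section \<open>Words along polynomial lines\<close>

declare plus_fun_apply [simp del] minus_apply [simp del] uminus_apply [simp del]
  zero_fun_apply [simp del] smul_apply [simp del]

section \<open>Polynomial functions over a chain ring and their zeros\<close>

context chain_ring
begin

text \<open>Division by an element of valuation at most b loses at most b levels of
  divisibility.\<close>

lemma smul_cancel_P:
  assumes "c \<in> S" "c \<notin> I (Suc b)" "v \<in> V" "smul c v \<in> P m" "m \<le> k"
  shows "v \<in> P (m - b)"
proof -
  obtain a u y where a: "a \<le> b" "u \<in> S" "c = \<pi> ^ a * u" "u * y = e" using val_ex[OF assms(1,2)] by metis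
  show ?thesis
  proof (cases "a \<le> m")
    case True
    have "smul (\<pi> ^ a) (smul u v) \<in> P (a + (m - a))" using assms(4) True by (simp only: a(3) smul_simps(5) le_add_diff_inverse)
    moreover have "a + (m - a) \<le> k" using True assms(5) by simp
    ultimately have "smul u v \<in> P (m - a)" by (rule P_cancel[OF V_closed(5)[OF assms(3)]])
    then have "smul y (smul u v) \<in> P (m - a)" by (rule P_closed(5))
    moreover have "smul y (smul u v) = v" using smul_e[OF assms(3)] a(4) by (simp add: smul_simps mult.commute)
    moreover have "m - b \<le> m - a" using a(1) by simp
    ultimately show ?thesis using P_mono by auto
  next
    case False
    then have "m - b = 0" using a(1) by simp
    then show ?thesis using assms(3) by simp
  qed
qed

text \<open>Vector-valued polynomial functions of degree at most \<open>d\<close>, in Horner form.\<close>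

inductive polv :: "nat \<Rightarrow> ('u \<Rightarrow> nat \<Rightarrow> 'u) \<Rightarrow> bool" where
  polv_const: "C \<in> V \<Longrightarrow> \<forall>s\<in>S. F s = C \<Longrightarrow> polv 0 F"
| polv_Suc: "C \<in> V \<Longrightarrow> polv d F' \<Longrightarrow> \<forall>s\<in>S. F s = C + smul s (F' s) \<Longrightarrow> polv (Suc d) F"

lemma polv_V: "polv d F \<Longrightarrow> s \<in> S \<Longrightarrow> F s \<in> V"
proof (induction rule: polv.induct)
  case (polv_Suc C d F' F)
  then have "F s = C + smul s (F' s)" by blast
  then show ?case using V_closed(2)[OF polv_Suc(1) V_closed(5)[OF polv_Suc(4)[OF polv_Suc(5)]]] by metis
qed simp

lemma polv_0E: assumes "polv 0 F" obtains C where "C \<in> V" "\<And>s. s \<in> S \<Longrightarrow> F s = C"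
  using assms by (cases rule: polv.cases) auto

lemma polv_SucE: assumes "polv (Suc d) F"
  obtains C F' where "C \<in> V" "polv d F'" "\<And>s. s \<in> S \<Longrightarrow> F s = C + smul s (F' s)"
  using assms by (cases rule: polv.cases) auto

lemma polv_add: "polv d F \<Longrightarrow> polv d F' \<Longrightarrow> polv d (\<lambda>s. F s + F' s)"
proof (induction d arbitrary: F F')
  case 0
  obtain C where C: "C \<in> V" "\<And>s. s \<in> S \<Longrightarrow> F s = C" using polv_0E[OF 0(1)] by blast
  obtain C' where C': "C' \<in> V" "\<And>s. s \<in> S \<Longrightarrow> F' s = C'" using polv_0E[OF 0(2)] by blast
  show ?case by (rule polv_const[OF V_closed(2)[OF C(1) C'(1)]]) (simp add: C(2) C'(2))
next
  case (Suc d)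
  obtain C G where C: "C \<in> V" "polv d G" "\<And>s. s \<in> S \<Longrightarrow> F s = C + smul s (G s)"
    using polv_SucE[OF Suc(2)] by metis
  obtain C' G' where C': "C' \<in> V" "polv d G'" "\<And>s. s \<in> S \<Longrightarrow> F' s = C' + smul s (G' s)"
    using polv_SucE[OF Suc(3)] by metis
  show ?case
    by (rule polv_Suc[OF V_closed(2)[OF C(1) C'(1)] Suc.IH[OF C(2) C'(2)]])
       (simp add: C(3) C'(3) smul_simps)
qed

lemma polv_lin: assumes "lin A" shows "polv d F \<Longrightarrow> polv d (\<lambda>s. A (F s))"
proof (induction d arbitrary: F)
  case 0
  obtain C where C: "C \<in> V" "\<And>s. s \<in> S \<Longrightarrow> F s = C" using polv_0E[OF 0(1)] by blast
  show ?case by (rule polv_const[OF lin_V[OF assms C(1)]]) (simp add: C(2))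
next
  case (Suc d)
  obtain C G where C: "C \<in> V" "polv d G" "\<And>s. s \<in> S \<Longrightarrow> F s = C + smul s (G s)"
    using polv_SucE[OF Suc(2)] by metis
  show ?case
  proof (rule polv_Suc[OF lin_V[OF assms C(1)] Suc.IH[OF C(2)]], rule ballI)
    fix s assume s: "s \<in> S"
    show "A (F s) = A C + smul s (A (G s))"
      unfolding C(3)[OF s] lin_add[OF assms C(1) V_closed(5)[OF polv_V[OF C(2) s]]]
        lin_smul[OF assms polv_V[OF C(2) s]] ..
  qed
qed

lemma polv_cong: "polv d F \<Longrightarrow> (\<And>s. s \<in> S \<Longrightarrow> F' s = F s) \<Longrightarrow> polv d F'"
proof (induction d F arbitrary: F' rule: polv.induct)
  case (polv_const C F)
  show ?case by (rule polv.polv_const[OF polv_const(1)]) (simp add: polv_const)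
next
  case (polv_Suc C d G F)
  show ?case by (rule polv.polv_Suc[OF polv_Suc(1,2)]) (use polv_Suc in simp)
qed

lemma polv_Suc_mono: "polv d F \<Longrightarrow> polv (Suc d) F"
proof (induction rule: polv.induct)
  case (polv_const C F)
  have "polv 0 (\<lambda>s. 0)" by (rule polv.polv_const[OF V_closed(1)]) simp
  then show ?case by (rule polv.polv_Suc[OF polv_const(1)]) (simp add: polv_const smul_simps)
next
  case (polv_Suc C d F' F)
  show ?case by (rule polv.polv_Suc[OF polv_Suc(1) polv_Suc(4) polv_Suc(3)])
qed

lemma polv_constant: "C \<in> V \<Longrightarrow> polv d (\<lambda>s. C)"
  by (induction d) (auto intro: polv_const polv_Suc_mono)

lemma polv_times: "polv d F \<Longrightarrow> polv (Suc d) (\<lambda>s. smul s (F s))"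
  by (rule polv_Suc[OF V_closed(1)]) auto

text \<open>The form in which a transvection with parameter linear in s acts: each one raises the
  degree by one.\<close>

lemma polv_affine:
  assumes "lin A" "lin B" "polv d F" shows "polv (Suc d) (\<lambda>s. A (F s) + smul s (B (F s)))"
  by (rule polv_add[OF polv_Suc_mono[OF polv_lin[OF assms(1,3)]] polv_times[OF polv_lin[OF assms(2,3)]]])

lemma polv_monomial: "C \<in> V \<Longrightarrow> polv d (\<lambda>s. smul (s ^ d) C)"
proof (induction d)
  case 0
  then show ?case using polv_constant[of C 0] by (simp add: smul_simps)
next
  case (Suc d)
  then have "polv (Suc d) (\<lambda>s. smul s (smul (s ^ d) C))" by (intro polv_times)
  then show ?case by (simp add: smul_simps)
qed

lemma polv_diff: assumes "polv d F" "polv d G" shows "polv d (\<lambda>s. F s - G s)"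
proof -
  have "lin (\<lambda>v. - v)" by (auto simp: lin_def smul_simps V_closed(4))
  then have "polv d (\<lambda>s. F s + - G s)" by (intro polv_add[OF assms(1)] polv_lin[OF _ assms(2)])
  then show ?thesis by simp
qed

text \<open>Division by s - s0 following the Horner form: if F = C + s G and G = G(s0) + (s - s0) H,
  then F - F(s0) = (s - s0) (G + s0 H).\<close>

lemma polv_quotient:
  assumes "s0 \<in> S"
  shows "polv (Suc d) F \<Longrightarrow> \<exists>G. polv d G \<and> (\<forall>s\<in>S. F s = F s0 + smul (s - s0) (G s))"
proof (induction d arbitrary: F)
  case 0
  obtain C G where C: "C \<in> V" "polv 0 G" "\<And>s. s \<in> S \<Longrightarrow> F s = C + smul s (G s)"
    using polv_SucE[OF 0] by metis
  obtain C' where C': "C' \<in> V" "\<And>s. s \<in> S \<Longrightarrow> G s = C'" using polv_0E[OF C(2)] by blast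
  have "\<forall>s\<in>S. F s = F s0 + smul (s - s0) (G s)" using C(3) C'(2) assms by (simp add: smul_simps)
  then show ?case using C(2) by blast
next
  case (Suc d)
  obtain C G where C: "C \<in> V" "polv (Suc d) G" "\<And>s. s \<in> S \<Longrightarrow> F s = C + smul s (G s)"
    using polv_SucE[OF Suc.prems] by metis
  obtain H where H: "polv d H" "\<And>s. s \<in> S \<Longrightarrow> G s = G s0 + smul (s - s0) (H s)"
    using Suc.IH[OF C(2)] by blast
  have "lin (smul s0)" by (auto simp: lin_def smul_simps mult.commute V_closed(5))
  then have "polv (Suc d) (\<lambda>s. G s + smul s0 (H s))" by (intro polv_add[OF C(2)] polv_Suc_mono[OF polv_lin[OF _ H(1)]])
  moreover have "F s = F s0 + smul (s - s0) (G s + smul s0 (H s))" if s: "s \<in> S" for s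
  proof -
    have "smul s0 (G s) = smul s0 (G s0) + smul (s - s0) (smul s0 (H s))"
      by (subst H(2)[OF s]) (simp add: smul_simps algebra_simps)
    then show ?thesis unfolding C(3)[OF s] C(3)[OF assms] by (simp add: smul_simps)
  qed
  ultimately show ?case by blast
qed

text \<open>The substitute for counting roots in the presence of zero divisors. Splitting off the
  factor that belongs to one node loses at most b levels at the other nodes, since their differences
  have valuation at most b; this happens d times.\<close>

lemma polv_many_zeros:
  assumes "polv d F" "m \<le> k"
    and "\<And>i. i \<le> d \<Longrightarrow> \<sigma> i \<in> S" "\<And>i. i \<le> d \<Longrightarrow> F (\<sigma> i) \<in> P m"
    and "\<And>i j. i \<le> d \<Longrightarrow> j \<le> d \<Longrightarrow> i \<noteq> j \<Longrightarrow> \<sigma> i - \<sigma> j \<notin> I (Suc b)" and "s \<in> S"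
  shows "F s \<in> P (m - d * b)"
  using assms
proof (induction d arbitrary: F m)
  case 0
  then show ?case using polv_0E[OF 0(1)] 0(3)[of 0] 0(4)[of 0] by (metis diff_zero le0 mult_0)
next
  case (Suc d)
  let ?s = "\<sigma> (Suc d)"
  have s0: "?s \<in> S" using Suc.prems(3) by blast
  obtain G where G: "polv d G" "\<And>s. s \<in> S \<Longrightarrow> F s = F ?s + smul (s - ?s) (G s)"
    using polv_quotient[OF s0 Suc.prems(1)] by blast
  have Gi: "G (\<sigma> i) \<in> P (m - b)" if i: "i \<le> d" for i
  proof (rule smul_cancel_P)
    have si: "\<sigma> i \<in> S" using Suc.prems(3) i by simp
    show "\<sigma> i - ?s \<in> S" using si s0 by blast
    show "\<sigma> i - ?s \<notin> I (Suc b)" using Suc.prems(5)[of i "Suc d"] i by simp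
    show "G (\<sigma> i) \<in> V" by (rule polv_V[OF G(1) si])
    have "smul (\<sigma> i - ?s) (G (\<sigma> i)) = F (\<sigma> i) - F ?s" using G(2)[OF si] by simp
    then show "smul (\<sigma> i - ?s) (G (\<sigma> i)) \<in> P m" using P_closed(3) Suc.prems(4) i by simp
  qed (rule Suc.prems(2))
  have "G s \<in> P (m - b - d * b)"
    by (rule Suc.IH[OF G(1) _ _ Gi]) (use Suc.prems in auto)
  then have "G s \<in> P (m - Suc d * b)" by simp
  moreover have "F ?s \<in> P (m - Suc d * b)" using Suc.prems(4)[of "Suc d"] P_mono[of "m - Suc d * b" m] by auto
  ultimately show ?case unfolding G(2)[OF Suc.prems(6)] using P_closed(2,5) by blast
qed

text \<open>Zeros in d + 1 different classes modulo \<open>\<pi> ^ Suc b\<close> would, by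
  \<open>polv_many_zeros\<close> with m = k, put F(0) into \<open>P (k - d * b)\<close> and hence
  into \<open>P (Suc 0)\<close>. So at most d classes contain zeros. For b near k/d the proportion
  of zeros is about d Q^(-k/d).\<close>

lemma card_polv_zeros:
  assumes F: "polv d F" and F0: "F 0 \<notin> P (Suc 0)" and b: "d * b < k"
  shows "card {s \<in> S. F s = 0} \<le> d * card (I (Suc b))"
proof -
  let ?Z = "{s \<in> S. F s = 0}"
  define cl where "cl s = {t \<in> S. s - t \<in> I (Suc b)}" for s
  have "card (cl ` ?Z) \<le> d"
  proof (rule ccontr)
    assume "\<not> ?thesis"
    then have "Suc d \<le> card (cl ` ?Z)" by simp
    then obtain C where C: "C \<subseteq> cl ` ?Z" "card C = Suc d" by (rule obtain_subset_with_card_n)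
    have "finite C" using C(2) card.infinite[of C] by fastforce
    then obtain f where f: "bij_betw f {0..<Suc d} C" using ex_bij_betw_nat_finite[of C] C(2) by auto
    define \<sigma> where "\<sigma> i = (SOME s. s \<in> ?Z \<and> cl s = f i)" for i
    have \<sigma>: "\<sigma> i \<in> ?Z \<and> cl (\<sigma> i) = f i" if "i \<le> d" for i
    proof -
      have "f i \<in> C" using bij_betwE[OF f] that by simp
      then obtain s where "s \<in> ?Z \<and> cl s = f i" using C(1) by blast
      then show ?thesis unfolding \<sigma>_def by (rule someI)
    qed
    have "\<sigma> i - \<sigma> j \<notin> I (Suc b)" if ij: "i \<le> d" "j \<le> d" "i \<noteq> j" for i j
    proof
      assume a: "\<sigma> i - \<sigma> j \<in> I (Suc b)"
      have "cl (\<sigma> i) = cl (\<sigma> j)"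
      proof -
        have "\<sigma> i - t \<in> I (Suc b) \<longleftrightarrow> \<sigma> j - t \<in> I (Suc b)" for t
        proof
          assume "\<sigma> i - t \<in> I (Suc b)"
          from I_closed(3)[OF this a] show "\<sigma> j - t \<in> I (Suc b)" by simp
        next
          assume "\<sigma> j - t \<in> I (Suc b)"
          from I_closed(2)[OF a this] show "\<sigma> i - t \<in> I (Suc b)" by simp
        qed
        then show ?thesis by (auto simp: cl_def)
      qed
      then have "f i = f j" using \<sigma> ij by metis
      then show False using inj_onD[OF bij_betw_imp_inj_on[OF f], of i j] ij by simp
    qed
    moreover have "\<sigma> i \<in> S \<and> F (\<sigma> i) \<in> P k" if "i \<le> d" for i
      using \<sigma>[OF that] P_closed(1)[of k] by simp
    ultimately have "F 0 \<in> P (k - d * b)"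
      using polv_many_zeros[OF F, of k \<sigma> b 0] by blast
    moreover have "Suc 0 \<le> k - d * b" using b by simp
    ultimately show False using F0 P_mono by blast
  qed
  moreover have "card ?Z \<le> (\<Sum>C\<in>cl ` ?Z. card C)"
  proof -
    have "?Z \<subseteq> \<Union> (cl ` ?Z)" by (auto simp: cl_def)
    then have "card ?Z \<le> card (\<Union> (cl ` ?Z))"
      by (intro card_mono) (auto simp: cl_def)
    also have "\<dots> \<le> (\<Sum>C\<in>cl ` ?Z. card C)" using card_Union_le_sum_card by blast
    finally show ?thesis .
  qed
  moreover have "(\<Sum>C\<in>cl ` ?Z. card C) = (\<Sum>C\<in>cl ` ?Z. card (I (Suc b)))"
    by (rule sum.cong) (auto simp: cl_def card_coset_I)
  ultimately show ?thesis by (simp add: le_trans mult_le_mono1)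
qed

definition line :: "'j set \<Rightarrow> ('j \<Rightarrow> nat \<Rightarrow> 'u) \<Rightarrow> ('j \<Rightarrow> nat \<Rightarrow> 'u) \<Rightarrow> 'u \<Rightarrow> 'j \<Rightarrow> nat \<Rightarrow> 'u" where
  "line J t v s = (\<lambda>j\<in>J. t j + smul s (v j))"

text \<open>For a unit \<open>s\<close> the point \<open>t + s v\<close> is uniform when \<open>v\<close> is; so a bound along every line through
  the single point \<open>t\<close> gives a bound on the whole space.\<close>

lemma line_average:
  fixes J :: "'j set"
  assumes J: "finite J" and t: "t \<in> J \<rightarrow>\<^sub>E V" and E: "E \<subseteq> J \<rightarrow>\<^sub>E V"
    and N: "\<And>v. v \<in> J \<rightarrow>\<^sub>E V \<Longrightarrow> card {s \<in> S. line J t v s \<in> E} \<le> N"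
  shows "card E * card S \<le> 2 * card (J \<rightarrow>\<^sub>E V) * N"
proof -
  let ?T = "J \<rightarrow>\<^sub>E V" and ?U = "S - I (Suc 0)"
  have finT: "finite ?T" using J by (simp add: finite_PiE)
  have bij: "card {v \<in> ?T. line J t v s \<in> E} = card E" if s: "s \<in> ?U" for s
  proof -
    obtain y where y: "s * y = e" using unit_or s by blast
    have inv: "smul y (smul s v) = v" "smul s (smul y v) = v" if "v \<in> V" for v
      using smul_e[OF that] y by (simp_all add: smul_simps mult.commute)
    have "bij_betw (\<lambda>v. line J t v s) {v \<in> ?T. line J t v s \<in> E} E"
    proof (rule bij_betw_byWitness[where f' = "\<lambda>v. \<lambda>j\<in>J. smul y (v j - t j)"])
      show "\<forall>v\<in>{v \<in> ?T. line J t v s \<in> E}. (\<lambda>j\<in>J. smul y (line J t v s j - t j)) = v"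
        using inv by (auto simp: line_def fun_eq_iff PiE_iff extensional_def)
      have *: "line J t (\<lambda>j\<in>J. smul y (v j - t j)) s = v" if v: "v \<in> ?T" for v
      proof (rule ext)
        fix j
        show "line J t (\<lambda>j\<in>J. smul y (v j - t j)) s j = v j"
        proof (cases "j \<in> J")
          case True
          then have "v j - t j \<in> V" using v t V_closed(3) by (metis PiE_mem)
          then show ?thesis using True inv(2)[of "v j - t j"] by (simp add: line_def)
        next
          case False
          then show ?thesis using PiE_arb[OF v False] by (simp add: line_def)
        qed
      qed
      then show "\<forall>v\<in>E. line J t (\<lambda>j\<in>J. smul y (v j - t j)) s = v" using E by blast
      show "(\<lambda>v. \<lambda>j\<in>J. smul y (v j - t j)) ` E \<subseteq> {v \<in> ?T. line J t v s \<in> E}"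
      proof clarify
        fix v assume v: "v \<in> E"
        then have vT: "v \<in> ?T" using E by blast
        have "smul y (v j - t j) \<in> V" if "j \<in> J" for j
          using V_closed(5)[OF V_closed(3)[OF PiE_mem[OF vT that] PiE_mem[OF t that]]] .
        then have "(\<lambda>j\<in>J. smul y (v j - t j)) \<in> ?T" by simp
        then show "(\<lambda>j\<in>J. smul y (v j - t j)) \<in> ?T \<and> line J t (\<lambda>j\<in>J. smul y (v j - t j)) s \<in> E"
          using *[OF vT] v by simp
      qed
    qed auto
    then show ?thesis by (rule bij_betw_same_card)
  qed
  have "card ?U * card E = (\<Sum>s\<in>?U. card {v \<in> ?T. line J t v s \<in> E})" using bij by simp
  also have "\<dots> \<le> (\<Sum>s\<in>S. card {v \<in> ?T. line J t v s \<in> E})"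
    by (rule sum_mono2) auto
  also have "\<dots> = card (Sigma S (\<lambda>s. {v \<in> ?T. line J t v s \<in> E}))" using finT by (simp add: card_SigmaI)
  also have "\<dots> = card (Sigma ?T (\<lambda>v. {s \<in> S. line J t v s \<in> E}))"
    by (rule bij_betw_same_card[of prod.swap], rule bij_betw_byWitness[where f' = prod.swap]) auto
  also have "\<dots> = (\<Sum>v\<in>?T. card {s \<in> S. line J t v s \<in> E})" using finT by (simp add: card_SigmaI)
  also have "\<dots> \<le> (\<Sum>v\<in>?T. N)" by (rule sum_mono) (rule N)
  finally have 1: "card ?U * card E \<le> card ?T * N" by simp
  \<comment> \<open>Since Q \<ge> 2, at least half of the elements of \<open>S\<close> are units;
    this is the factor 2 in the conclusion.\<close>
  have "card S \<le> 2 * card ?U"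
  proof -
    have "card ?U = card S - card (I (Suc 0))" using I_sub_S by (intro card_Diff_subset) auto
    moreover have "card S = Q * card (I (Suc 0))" using card_I_step[of 0] kpos by (simp only: I_0)
    moreover have "2 * card (I (Suc 0)) \<le> Q * card (I (Suc 0))" using Q_gt_1 by (intro mult_le_mono1) simp
    ultimately show ?thesis by linarith
  qed
  then have "card E * card S \<le> card E * (2 * card ?U)" by simp
  also have "\<dots> \<le> 2 * card ?T * N" using 1 by (simp add: mult.commute mult.left_commute)
  finally show ?thesis .
qed

end

section \<open>Gaussian elimination by a fixed pattern of transvections\<close>

context lin_group
begin

definition eb :: "nat \<Rightarrow> nat \<Rightarrow> 'u" where
  "eb i = (\<lambda>j. if j = i then e else 0)"

lemma eb_V: "i < n \<Longrightarrow> eb i \<in> V" by (auto simp: eb_def V_def)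
lemma eb_same [simp]: "eb i i = e" and eb_other: "j \<noteq> i \<Longrightarrow> eb i j = 0" by (simp_all add: eb_def)

lemma V_updI: "y \<in> V \<Longrightarrow> y(c := 0) \<in> V"
  by (auto simp: V_def)

lemma lin_fixes_span:
  assumes A: "lin A" and fix_eb: "\<And>i. i < c \<Longrightarrow> A (eb i) = eb i"
  shows "c \<le> n \<Longrightarrow> v \<in> V \<Longrightarrow> (\<And>i. i \<ge> c \<Longrightarrow> v i = 0) \<Longrightarrow> A v = v"
  using fix_eb
proof (induction c arbitrary: v)
  case 0
  then have "v = 0" by (auto simp: fun_eq_iff zero_fun_apply)
  then show ?case using lin_0[OF A] by simp
next
  case (Suc c)
  let ?w = "v(c := 0)"
  have w: "?w \<in> V" using V_updI Suc.prems(2) by blast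
  have cn: "c < n" using Suc.prems(1) by simp
  have v: "v = ?w + smul (v c) (eb c)"
    using e_S[OF V_S[OF Suc.prems(2)], of c]
    by (auto simp: fun_eq_iff plus_fun_apply smul_apply eb_def mult.commute)
  have "A ?w = ?w"
  proof (rule Suc.IH[OF _ w])
    show "?w i = 0" if "c \<le> i" for i using Suc.prems(3)[of i] that by (cases "i = c") auto
  qed (use Suc.prems(4) cn in auto)
  moreover have "A v = A ?w + smul (v c) (A (eb c))"
    by (subst v, subst lin_add[OF A w V_closed(5)[OF eb_V[OF cn]]], subst lin_smul[OF A eb_V[OF cn]]) (rule refl)
  ultimately show ?case using Suc.prems(4)[of c] v by simp
qed

text \<open>The transvection pattern: for each column \<open>c = m div 3\<close> a column operation, a row operation and a
  column operation, each depending linearly on a vector parameter.\<close>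

definition tf :: "nat \<Rightarrow> (nat \<Rightarrow> 'u) \<Rightarrow> (nat \<Rightarrow> 'u) \<Rightarrow> 'u" where
  "tf m y v = (if m mod 3 = 1 then (\<Sum>i\<in>{..<n} - {m div 3}. y i * v i) else v (m div 3))"

definition tz :: "nat \<Rightarrow> (nat \<Rightarrow> 'u) \<Rightarrow> nat \<Rightarrow> 'u" where
  "tz m y = (if m mod 3 = 1 then eb (m div 3) else y(m div 3 := 0))"

definition tr :: "nat \<Rightarrow> (nat \<Rightarrow> 'u) \<Rightarrow> (nat \<Rightarrow> 'u) \<Rightarrow> nat \<Rightarrow> 'u" where
  "tr m y v = smul (tf m y v) (tz m y)"

text \<open>The group is given only by its action, so the element is chosen; faithfulness makes it
  unique.\<close>

definition el :: "nat \<Rightarrow> (nat \<Rightarrow> 'u) \<Rightarrow> 'g" where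
  "el m y = (SOME g. g \<in> carrier G \<and> (\<forall>v\<in>V. act g v = v + tr m y v))"

lemma tf_fnl: assumes "y \<in> V" shows "fnl (tf m y)"
  unfolding fnl_def tf_def using V_S
  by (auto simp: plus_fun_apply smul_apply sum.distrib[symmetric] sum_distrib_left algebra_simps
      intro!: S_sum)

lemma tz_V: "m < 3 * n \<Longrightarrow> y \<in> V \<Longrightarrow> tz m y \<in> V"
  unfolding tz_def using eb_V[of "m div 3"] V_updI by auto

lemma tf_tz: "tf m y (tz m y) = 0"
  by (auto simp: tf_def tz_def eb_def)

lemma tr_lin: assumes "m < 3 * n" "y \<in> V" shows "lin (tr m y)"
proof -
  note f = fnl_simps[OF tf_fnl[OF assms(2), of m]]
  show ?thesis unfolding lin_def tr_def
    using V_closed(5)[OF tz_V[OF assms]] f(2,3) by (simp add: smul_simps)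
qed

text \<open>Linearity holds because the parameter enters only one of the two factors: the functional
  if m mod 3 = 1, the vector otherwise.\<close>

lemma tr_param:
  "tr m (y + smul s y') v = tr m y v + smul s (tr m y' v)"
  unfolding tr_def tf_def tz_def
  by (auto simp: fun_eq_iff plus_fun_apply smul_apply sum.distrib sum_distrib_left sum_distrib_right algebra_simps)

text \<open>A transvection minus the identity has square 0. Hence its inverse is again affine in the
  parameter, and inverse letters cost no more degree than letters do.\<close>

lemma tr_tr: assumes "m < 3 * n" "y \<in> V" shows "tr m y (tr m y v) = 0"
  unfolding tr_def fnl_smul[OF tf_fnl[OF assms(2)] tz_V[OF assms]] tf_tz by (simp add: smul_simps)

lemma el: assumes "m < 3 * n" "y \<in> V"
  shows el_closed: "el m y \<in> carrier G" and act_el: "\<And>v. v \<in> V \<Longrightarrow> act (el m y) v = v + tr m y v"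
    and act_inv_el: "\<And>v. v \<in> V \<Longrightarrow> act (inv (el m y)) v = v - tr m y v"
proof -
  have "\<exists>g. g \<in> carrier G \<and> (\<forall>v\<in>V. act g v = v + tr m y v)"
    using transv[OF tf_fnl[OF assms(2)] tz_V[OF assms] tf_tz] unfolding tr_def by blast
  then have *: "el m y \<in> carrier G \<and> (\<forall>v\<in>V. act (el m y) v = v + tr m y v)"
    unfolding el_def by (rule someI_ex)
  then show 1: "el m y \<in> carrier G" "\<And>v. v \<in> V \<Longrightarrow> act (el m y) v = v + tr m y v" by auto
  note l = lin_simps[OF tr_lin[OF assms]]
  fix v assume v: "v \<in> V"
  have "act (el m y) (v - tr m y v) = v"
    using 1(2)[OF V_closed(3)[OF v l(1)[OF v]]] l(5)[OF v l(1)[OF v]] tr_tr[OF assms, of v] by simp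
  then show "act (inv (el m y)) v = v - tr m y v"
    using act_inv(1)[OF 1(1) V_closed(3)[OF v l(1)[OF v]]] by simp
qed

primrec xseg :: "nat \<Rightarrow> nat \<Rightarrow> (nat \<Rightarrow> nat \<Rightarrow> 'u) \<Rightarrow> 'g" where
  "xseg a 0 y = \<one>"
| "xseg a (Suc l) y = el a (y a) \<otimes> xseg (Suc a) l y"

lemma xseg_closed: "a + l \<le> 3 * n \<Longrightarrow> (\<And>m. m < 3 * n \<Longrightarrow> y m \<in> V) \<Longrightarrow> xseg a l y \<in> carrier G"
  by (induction l arbitrary: a) (auto intro!: m_closed el_closed)

lemma xseg_cong: "(\<And>m. a \<le> m \<Longrightarrow> m < a + l \<Longrightarrow> y m = y' m) \<Longrightarrow> xseg a l y = xseg a l y'"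
  by (induction l arbitrary: a) auto

text \<open>Each of the \<open>l\<close> factors is affine in s, and so is its inverse; either way
  it raises the degree by one.\<close>

lemma polv_xseg:
  assumes y: "\<And>m. m < 3 * n \<Longrightarrow> y m \<in> V" "\<And>m. m < 3 * n \<Longrightarrow> y' m \<in> V"
  shows "a + l \<le> 3 * n \<Longrightarrow> polv d F \<Longrightarrow> polv (d + l) (\<lambda>s. act (xseg a l (\<lambda>m. y m + smul s (y' m))) (F s))"
    and "a + l \<le> 3 * n \<Longrightarrow> polv d F \<Longrightarrow> polv (d + l) (\<lambda>s. act (inv (xseg a l (\<lambda>m. y m + smul s (y' m)))) (F s))"
proof -
  let ?y = "\<lambda>s m. y m + smul s (y' m)"
  have yV: "?y s m \<in> V" if "m < 3 * n" for s m using V_closed(2)[OF y(1)[OF that] V_closed(5)[OF y(2)[OF that]]] .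
  have lid: "lin (\<lambda>v. v + tr a (y a) v)" "lin (\<lambda>v. v - tr a (y a) v)" "lin (\<lambda>v. - tr a (y' a) v)" if "a < 3 * n" for a
    using lin_simps[OF tr_lin[OF that y(1)[OF that]]] lin_simps[OF tr_lin[OF that y(2)[OF that]]]
    unfolding lin_def by (simp_all add: V_closed(2-4) smul_simps)
  show "a + l \<le> 3 * n \<Longrightarrow> polv d F \<Longrightarrow> polv (d + l) (\<lambda>s. act (xseg a l (?y s)) (F s))"
  proof (induction l arbitrary: a F)
    case 0
    then show ?case using act_one polv_V[OF 0(2)] by (auto intro: polv_cong)
  next
    case (Suc l)
    have a: "a < 3 * n" "Suc a + l \<le> 3 * n" using Suc.prems(1) by auto
    define F' where "F' s = act (xseg (Suc a) l (?y s)) (F s)" for s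
    have F': "polv (d + l) F'" unfolding F'_def by (rule Suc.IH[OF a(2) Suc.prems(2)])
    have "polv (Suc (d + l)) (\<lambda>s. (F' s + tr a (y a) (F' s)) + smul s (tr a (y' a) (F' s)))"
      by (rule polv_affine[OF lid(1)[OF a(1)] tr_lin[OF a(1) y(2)[OF a(1)]] F'])
    moreover have "act (xseg a (Suc l) (?y s)) (F s) = (F' s + tr a (y a) (F' s)) + smul s (tr a (y' a) (F' s))"
      if s: "s \<in> S" for s
    proof -
      have "act (xseg a (Suc l) (?y s)) (F s) = act (el a (?y s a)) (F' s)"
        unfolding F'_def using act_mult[OF el_closed[OF a(1) yV[OF a(1)]] xseg_closed[OF a(2) yV] polv_V[OF Suc.prems(2) s]]
        by simp
      then show ?thesis unfolding act_el[OF a(1) yV[OF a(1)] polv_V[OF F' s]] tr_param by (simp add: add.assoc)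
    qed
    ultimately show ?case by (auto intro: polv_cong)
  qed
  show "a + l \<le> 3 * n \<Longrightarrow> polv d F \<Longrightarrow> polv (d + l) (\<lambda>s. act (inv (xseg a l (?y s))) (F s))"
  \<comment> \<open>In the inverse of the product it is the first factor that acts first, so the
    degree of the argument grows and has to vary in the induction.\<close>
  proof (induction l arbitrary: a d F)
    case 0
    then show ?case using act_one polv_V[OF 0(2)] by (auto intro: polv_cong)
  next
    case (Suc l)
    have a: "a < 3 * n" "Suc a + l \<le> 3 * n" using Suc.prems(1) by auto
    define F' where "F' s = act (inv (el a (?y s a))) (F s)" for s
    have "polv (Suc d) (\<lambda>s. (F s - tr a (y a) (F s)) + smul s (- tr a (y' a) (F s)))"
      by (rule polv_affine[OF lid(2,3)[OF a(1)] Suc.prems(2)])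
    moreover have "F' s = (F s - tr a (y a) (F s)) + smul s (- tr a (y' a) (F s))" if s: "s \<in> S" for s
      unfolding F'_def act_inv_el[OF a(1) yV[OF a(1)] polv_V[OF Suc.prems(2) s]] tr_param
      by (simp add: smul_simps)
    ultimately have F': "polv (Suc d) F'" by (auto intro: polv_cong)
    have "polv (Suc d + l) (\<lambda>s. act (inv (xseg (Suc a) l (?y s))) (F' s))"
      by (rule Suc.IH[OF a(2) F'])
    moreover have "act (inv (xseg a (Suc l) (?y s))) (F s) = act (inv (xseg (Suc a) l (?y s))) (F' s)"
      if s: "s \<in> S" for s
    proof -
      have c: "el a (?y s a) \<in> carrier G" "xseg (Suc a) l (?y s) \<in> carrier G"
        using el_closed[OF a(1) yV[OF a(1)]] xseg_closed[OF a(2) yV] by auto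
      show ?thesis unfolding F'_def xseg.simps inv_mult_group[OF c]
        by (rule act_mult[OF inv_closed[OF c(2)] inv_closed[OF c(1)] polv_V[OF Suc.prems(2) s]])
    qed
    ultimately show ?case by (auto intro: polv_cong)
  qed
qed

text \<open>One column of Gaussian elimination over a local ring. The first operation provides a
  unit below the diagonal, the second uses it to make the diagonal entry \<open>e\<close>, the third
  clears the rest of the column. The row operation has no coefficients up to index c, so the earlier
  basis vectors stay fixed.\<close>

lemma clear_column:
  assumes g: "g \<in> carrier G" and c: "c < n" and fixes_eb: "\<And>i. i < c \<Longrightarrow> act g (eb i) = eb i"
  obtains y1 y2 y3 where "y1 \<in> V" "y2 \<in> V" "y3 \<in> V"
    "\<And>h i. h = el (3 * c) y1 \<otimes> (el (3 * c + 1) y2 \<otimes> el (3 * c + 2) y3) \<Longrightarrow> i \<le> c \<Longrightarrow> act h (eb i) = act g (eb i)"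
proof -
  note result = that
  define z where "z = act g (eb c)"
  have z: "z \<in> V" unfolding z_def by (rule act_V[OF g eb_V[OF c]])
  text \<open>It suffices to move the \<open>c\<close>-th column back to \<open>eb c\<close> by the inverse operations.\<close>
  have main: thesis if y: "y1 \<in> V" "y2 \<in> V" "\<And>i. i \<le> c \<Longrightarrow> y2 i = 0"
      and u: "u = z - smul (z c) (y1(c := 0))"
      and w: "w = u - smul (\<Sum>i\<in>{..<n} - {c}. y2 i * u i) (eb c)" and wc: "w c = e" for y1 y2 u w
  proof -
    have m: "3 * c < 3 * n" "3 * c + 1 < 3 * n" "3 * c + 2 < 3 * n" using c by auto
    have md: "(3 * c) mod 3 = 0" "(3 * c + 1) mod 3 = 1" "(3 * c + 2) mod 3 = 2"
      "(3 * c) div 3 = c" "(3 * c + 1) div 3 = c" "(3 * c + 2) div 3 = c" by presburger+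
    have uV: "u \<in> V" unfolding u by (rule V_closed(3)[OF z V_closed(5)[OF V_updI[OF y(1)]]])
    have wV: "w \<in> V" unfolding w by (rule V_closed(3)[OF uV V_closed(5)[OF eb_V[OF c]]])
    note tr1 = tr_def[of "3 * c"] tf_def[of "3 * c"] tz_def[of "3 * c"]
      and tr2 = tr_def[of "3 * c + 1"] tf_def[of "3 * c + 1"] tz_def[of "3 * c + 1"]
      and tr3 = tr_def[of "3 * c + 2"] tf_def[of "3 * c + 2"] tz_def[of "3 * c + 2"]
    define h where "h = el (3 * c) y1 \<otimes> (el (3 * c + 1) y2 \<otimes> el (3 * c + 2) w)"
    note C = el_closed[OF m(1) y(1)] el_closed[OF m(2) y(2)] el_closed[OF m(3) wV]
    have hact: "act h v = act (el (3 * c) y1) (act (el (3 * c + 1) y2) (act (el (3 * c + 2) w) v))" if "v \<in> V" for v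
      unfolding h_def using C that act_V by (simp add: act_mult)
    have i1: "act (inv (el (3 * c) y1)) z = u"
      unfolding act_inv_el[OF m(1) y(1) z] tr1 u by (simp add: md del: mult_Suc_right)
    have i2: "act (inv (el (3 * c + 1) y2)) u = w"
      unfolding act_inv_el[OF m(2) y(2) uV] tr2 w using md by simp
    \<comment> \<open>The column w serves as its own third parameter: its diagonal entry is
      \<open>e\<close>, and subtracting all other entries leaves the basis vector.\<close>
    have wz: "w - smul e (w(c := 0)) = eb c"
      using e_S V_S[OF wV] wc by (auto simp: fun_eq_iff minus_apply smul_apply eb_def)
    have i3: "act (inv (el (3 * c + 2) w)) w = eb c"
      unfolding act_inv_el[OF m(3) wV wV] tr3 using md wz wc by simp
    have hc: "act h (eb c) = z"
    proof -
      have "act (el (3 * c + 2) w) (eb c) = w" using act_inv(2)[OF C(3) wV] i3 by simp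
      moreover have "act (el (3 * c + 1) y2) w = u" using act_inv(2)[OF C(2) uV] i2 by simp
      moreover have "act (el (3 * c) y1) u = z" using act_inv(2)[OF C(1) z] i1 by simp
      ultimately show ?thesis using hact[OF eb_V[OF c]] by simp
    qed
    have hi: "act h (eb i) = eb i" if i: "i < c" for i
    proof -
      have ebi: "eb i \<in> V" using eb_V i c by simp
      have 0: "eb i c = 0" using i by (simp add: eb_def)
      have s0: "(\<Sum>j\<in>{..<n} - {c}. y2 j * eb i j) = 0"
        by (rule sum.neutral) (use y(3) i in \<open>auto simp: eb_def\<close>)
      have "act (el (3 * c + 2) w) (eb i) = eb i"
        unfolding act_el[OF m(3) wV ebi] tr3 using md 0 by (simp add: smul_simps)
      moreover have "act (el (3 * c + 1) y2) (eb i) = eb i"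
        unfolding act_el[OF m(2) y(2) ebi] tr2 using md s0 by (simp add: smul_simps)
      moreover have "act (el (3 * c) y1) (eb i) = eb i"
        unfolding act_el[OF m(1) y(1) ebi] tr1 using md 0 by (simp add: smul_simps)
      ultimately show ?thesis using hact[OF ebi] by simp
    qed
    show thesis
      by (rule result[OF y(1,2) wV]) (use hc hi fixes_eb z_def h_def in \<open>metis le_neq_implies_less\<close>)
  qed
  show thesis
  proof (cases "c = n - 1")
    case True
    \<comment> \<open>The last column has no entry below the diagonal; here determinant one, in the
      form of \<open>last_coord\<close>, gives the diagonal entry.\<close>
    have "z c = e" using last_coord[OF g] fixes_eb c unfolding z_def True eb_def by simp
    moreover have "(0::nat \<Rightarrow> 'u)(c := 0) = 0" by (auto simp: fun_eq_iff zero_fun_apply)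
    ultimately show thesis
      by (intro main[of 0 0 z z]) (simp_all add: V_closed(1) zero_fun_apply smul_simps)
  next
    case False
    then have c1: "Suc c < n" using c by simp
    \<comment> \<open>A unit \<open>u j\<close> below the diagonal suffices: \<open>y2\<close> is
      the multiple of the j-th basis vector for which the row operation subtracts u c - e from the
      diagonal entry.\<close>
    have fin: thesis if y1: "y1 \<in> V" and u: "u = z - smul (z c) (y1(c := 0))" and j: "c < j" "j < n" "u j * t = e" for y1 u j t
    proof -
      define y2 where "y2 = smul ((u c - e) * t) (eb j)"
      have uV: "u \<in> V" unfolding u by (rule V_closed(3)[OF z V_closed(5)[OF V_updI[OF y1]]])
      have y2: "y2 \<in> V" unfolding y2_def by (rule V_closed(5)[OF eb_V[OF j(2)]])
      have "(\<Sum>i\<in>{..<n} - {c}. y2 i * u i) = (\<Sum>i\<in>{j}. y2 i * u i)"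
        by (rule sum.mono_neutral_right) (use j in \<open>auto simp: y2_def smul_apply eb_def\<close>)
      also have "\<dots> = (u c - e) * e * (u j * t)" by (simp add: y2_def smul_apply)
      also have "\<dots> = e * (e * (u c - e))" unfolding j(3) by (simp add: mult.commute)
      also have "\<dots> = u c - e"
        using e_S[OF S_closed(4)[OF V_S[OF uV, of c] S_closed(2)]] by simp
      finally have sum: "(\<Sum>i\<in>{..<n} - {c}. y2 i * u i) = u c - e" .
      have "(u - smul (u c - e) (eb c)) c = u c - (u c - e) * e" by (simp add: minus_apply smul_apply)
      also have "\<dots> = e"
        using e_S[OF S_closed(4)[OF V_S[OF uV, of c] S_closed(2)]] by (simp add: mult.commute)
      finally have wc: "(u - smul (u c - e) (eb c)) c = e" .
      show thesis
      proof (rule main[OF y1 y2 _ u refl])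
        show "y2 i = 0" if "i \<le> c" for i using that j(1) by (simp add: y2_def smul_apply eb_def)
        show "(u - smul (\<Sum>i\<in>{..<n} - {c}. y2 i * u i) (eb c)) c = e" unfolding sum by (rule wc)
      qed
    qed
    show thesis
    proof (cases "z c \<in> I (Suc 0)")
      case False
      obtain t where t: "z c * t = e" using unit_or[OF V_S[OF z] False] by blast
      \<comment> \<open>If the diagonal entry is a unit, a multiple of it turns the entry just below
        into \<open>e\<close>.\<close>
      define y1 where "y1 = smul ((z (Suc c) - e) * t) (eb (Suc c))"
      have y1: "y1 \<in> V" unfolding y1_def by (rule V_closed(5)[OF eb_V[OF c1]])
      have "(z - smul (z c) (y1(c := 0))) (Suc c) = z (Suc c) - (z c * t) * (e * (z (Suc c) - e))"
        by (simp add: y1_def minus_apply smul_apply)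
      also have "\<dots> = z (Suc c) - e * (e * (z (Suc c) - e))" unfolding t ..
      also have "\<dots> = e"
        using e_S[OF S_closed(4)[OF V_S[OF z, of "Suc c"] S_closed(2)]] by simp
      finally show thesis using fin[OF y1 refl, of "Suc c" e] c1 ee by simp
    next
      case True
      \<comment> \<open>Otherwise the column would agree modulo \<open>\<pi>\<close> with a
        combination z' of basis vectors fixed by g; applying the inverse of g would put
        \<open>eb c - z'\<close> into \<open>P (Suc 0)\<close>, although its c-th coordinate is
        \<open>e\<close>.\<close>
      have "\<exists>j>c. j < n \<and> z j \<notin> I (Suc 0)"
      proof (rule ccontr)
        assume "\<not> ?thesis"
        then have nz: "z j \<in> I (Suc 0)" if "c < j" for j
          using that V_S[OF z] z I_closed(1) unfolding V_def by (cases "j < n") auto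
        define z' where "z' = (\<lambda>i. if i < c then z i else 0)"
        have z': "z' \<in> V" using z V_S[OF z] c by (auto simp: V_def z'_def)
        have fz': "act g z' = z'"
          by (rule lin_fixes_span[OF act_lin[OF g] fixes_eb]) (use c z' in \<open>auto simp: z'_def\<close>)
        have "(z - z') i \<in> I (Suc 0)" for i
          using True nz[of i] I_closed(1) by (cases "i = c") (auto simp: minus_apply z'_def)
        then have zz: "z - z' \<in> P (Suc 0)" using V_closed(3)[OF z z'] by (simp add: P_def)
        have "act (inv g) (z - z') = eb c - z'"
          using lin_diff[OF act_lin[OF inv_closed[OF g]] z z'] act_inv(1)[OF g z'] fz'
            act_inv(1)[OF g eb_V[OF c]] z_def by simp
        then have "eb c - z' \<in> P (Suc 0)" using lin_P[OF act_lin[OF inv_closed[OF g]] zz] by simp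
        then have "(eb c - z') c \<in> I (Suc 0)" by (simp add: P_def)
        then show False using e_notin by (simp add: minus_apply z'_def)
      qed
      then obtain j where j: "c < j" "j < n" "z j \<notin> I (Suc 0)" by blast
      obtain t where "z j * t = e" using unit_or[OF V_S[OF z] j(3)] by blast
      moreover have "z = z - smul (z c) ((0::nat \<Rightarrow> 'u)(c := 0))"
        by (auto simp: fun_eq_iff minus_apply smul_apply zero_fun_apply)
      ultimately show thesis using fin[of 0 z j t] j V_closed(1) by blast
    qed
  qed
qed

text \<open>For c = 0 every group element is a product of 3 n transvections in the prescribed order.
  A fixed pattern matters twice: it limits the degree to 3 n per letter, and it lets a suitable
  parameter reach any given tuple.\<close>

lemma xseg_surj:
  assumes "g \<in> carrier G" "c \<le> n" "\<And>i. i < c \<Longrightarrow> act g (eb i) = eb i"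
  shows "\<exists>y. (\<forall>m. y m \<in> V) \<and> xseg (3 * c) (3 * (n - c)) y = g"
  using assms
proof (induction "n - c" arbitrary: c g)
  case 0
  then have c: "c = n" by simp
  have "g = \<one>"
  proof (rule faithful[OF 0(2)])
    fix v assume "v \<in> V"
    then show "act g v = v"
      using lin_fixes_span[OF act_lin[OF 0(2)] 0(4), where v = v] c by (auto simp: V_def)
  qed
  then show ?case using c V_closed(1) by (intro exI[of _ "\<lambda>_. 0"]) simp
next
  case (Suc d)
  have c: "c < n" using Suc(2) by simp
  obtain y1 y2 y3 where y: "y1 \<in> V" "y2 \<in> V" "y3 \<in> V" and
    h0: "\<And>h i. h = el (3 * c) y1 \<otimes> (el (3 * c + 1) y2 \<otimes> el (3 * c + 2) y3) \<Longrightarrow> i \<le> c \<Longrightarrow> act h (eb i) = act g (eb i)"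
    by (rule clear_column[OF Suc(3) c], erule Suc(5), rule that)
  define h where "h = el (3 * c) y1 \<otimes> (el (3 * c + 1) y2 \<otimes> el (3 * c + 2) y3)"
  have cl: "el (3 * c) y1 \<in> carrier G" "el (3 * c + 1) y2 \<in> carrier G" "el (3 * c + 2) y3 \<in> carrier G"
    using c y by (auto intro!: el_closed)
  have hG: "h \<in> carrier G" unfolding h_def using cl by auto
  have "\<exists>y. (\<forall>m. y m \<in> V) \<and> xseg (3 * Suc c) (3 * (n - Suc c)) y = inv h \<otimes> g"
  proof (rule Suc.hyps(1))
    fix i assume i: "i < Suc c"
    have ebi: "eb i \<in> V" using i c eb_V by simp
    have "act (inv h \<otimes> g) (eb i) = act (inv h) (act h (eb i))"
      using act_mult[OF inv_closed[OF hG] Suc(3) ebi] h0[OF h_def] i by simp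
    then show "act (inv h \<otimes> g) (eb i) = eb i" using act_inv(1)[OF hG ebi] by simp
  qed (use Suc(2,3) hG c in auto)
  then obtain y where yy: "\<And>m. y m \<in> V" "xseg (3 * Suc c) (3 * (n - Suc c)) y = inv h \<otimes> g" by blast
  define y' where "y' = y(3 * c := y1, 3 * c + 1 := y2, 3 * c + 2 := y3)"
  have "xseg (3 * Suc c) (3 * (n - Suc c)) y' = inv h \<otimes> g"
    unfolding yy(2)[symmetric] by (rule xseg_cong) (auto simp: y'_def)
  moreover have "3 * Suc c = Suc (Suc (Suc (3 * c)))" by simp
  ultimately have t: "xseg (Suc (Suc (Suc (3 * c)))) (3 * (n - Suc c)) y' = inv h \<otimes> g" by (simp only:)
  have "3 * (n - c) = Suc (Suc (Suc (3 * (n - Suc c))))" using c by simp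
  then have "xseg (3 * c) (3 * (n - c)) y' = el (3 * c) y1 \<otimes> (el (3 * c + 1) y2 \<otimes> (el (3 * c + 2) y3 \<otimes> (inv h \<otimes> g)))"
    using t by (simp add: y'_def)
  also have "\<dots> = h \<otimes> (inv h \<otimes> g)" unfolding h_def using cl Suc(3) by (simp add: m_assoc)
  also have "\<dots> = g" using hG Suc(3) by (simp add: m_assoc[symmetric])
  finally show ?case using y yy(1) by (intro exI[of _ y']) (auto simp: y'_def)
qed

end

lemma sum_card_swap:
  assumes "finite A" "finite B"
  shows "(\<Sum>a\<in>A. card {b \<in> B. R a b}) = (\<Sum>b\<in>B. card {a \<in> A. R a b})"
proof -
  have "(\<Sum>a\<in>A. card {b \<in> B. R a b}) = (\<Sum>a\<in>A. \<Sum>b\<in>B. if R a b then 1 else 0)"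
    by (rule sum.cong[OF refl]) (simp add: sum.If_cases assms Int_def)
  also have "\<dots> = (\<Sum>b\<in>B. \<Sum>a\<in>A. if R a b then 1 else 0)" by (rule sum.swap)
  also have "\<dots> = (\<Sum>b\<in>B. card {a \<in> A. R a b})"
    by (rule sum.cong[OF refl]) (simp add: sum.If_cases assms Int_def)
  finally show ?thesis .
qed

text \<open>Serves to pass from a reduced word to its expansion into transvections, where neighbours
  must have different directions.\<close>

lemma successively_concat_map:
  assumes "\<And>a. g a \<noteq> []" "\<And>a. successively Q (g a)"
    and "\<And>a b. R a b \<Longrightarrow> Q (last (g a)) (hd (g b))"
  shows "successively R w \<Longrightarrow> successively Q (concat (map g w))"
proof (induction w)
  case (Cons a w)
  show ?case
  proof (cases w)
    case (Cons b w')
    then have "hd (concat (map g w)) = hd (g b)" using assms(1)[of b] by simp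
    moreover have "successively R w" "R a b" using Cons.prems Cons by auto
    ultimately show ?thesis using Cons.IH assms by (simp add: successively_append_iff)
  qed (use assms in simp)
qed simp

section \<open>Small rank: the word restricted to lines of parameters\<close>

context lin_group
begin

text \<open>For a fixed parameter t this permutes the tuples, so a uniform tuple stays uniform and
  the parameter may be averaged over separately.\<close>

definition shift :: "nat \<Rightarrow> (nat \<Rightarrow> 'g) \<Rightarrow> (nat \<times> nat \<Rightarrow> nat \<Rightarrow> 'u) \<Rightarrow> nat \<Rightarrow> 'g" where
  "shift r a t = (\<lambda>i\<in>{..<r}. a i \<otimes> xseg 0 (3 * n) (\<lambda>m. t (i, m)))"

abbreviation pars :: "nat \<Rightarrow> (nat \<times> nat) set" where "pars r \<equiv> {..<r} \<times> {..<3 * n}"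

lemma xseg_par_closed: "t \<in> pars r \<rightarrow>\<^sub>E V \<Longrightarrow> i < r \<Longrightarrow> xseg 0 (3 * n) (\<lambda>m. t (i, m)) \<in> carrier G"
  by (rule xseg_closed) (auto simp: PiE_iff)

lemma shift_tup: "a \<in> tup r \<Longrightarrow> t \<in> pars r \<rightarrow>\<^sub>E V \<Longrightarrow> shift r a t \<in> tup r"
  unfolding shift_def tup_def using xseg_par_closed by (auto simp: PiE_iff)

lemma line_par: assumes "t \<in> pars r \<rightarrow>\<^sub>E V" "v \<in> pars r \<rightarrow>\<^sub>E V" shows "line (pars r) t v s \<in> pars r \<rightarrow>\<^sub>E V"
proof -
  have "t j + smul s (v j) \<in> V" if "j \<in> pars r" for j
    by (rule V_closed(2)[OF PiE_mem[OF assms(1) that] V_closed(5)[OF PiE_mem[OF assms(2) that]]])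
  then show ?thesis unfolding line_def by auto
qed

lemma polv_word:
  assumes a: "a \<in> tup r" and t: "t \<in> pars r \<rightarrow>\<^sub>E V" and v: "v \<in> pars r \<rightarrow>\<^sub>E V" and x: "x \<in> V"
  shows "fst ` set w \<subseteq> {..<r} \<Longrightarrow>
    polv (length w * (3 * n)) (\<lambda>s. act (word_map G w (shift r a (line (pars r) t v s))) x)"
proof (induction w)
  case Nil
  show ?case using polv_constant[OF x, of 0] by (simp add: word_map_Nil act_one[OF x])
next
  case (Cons b w)
  then have b: "fst b < r" and w: "fst ` set w \<subseteq> {..<r}" by auto
  let ?g = "\<lambda>s. shift r a (line (pars r) t v s)"
  define F where "F s = act (word_map G w (?g s)) x" for s
  have F: "polv (length w * (3 * n)) F" unfolding F_def by (rule Cons.IH[OF w])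
  define i where "i = fst b"
  have i: "i < r" using b by (simp add: i_def)
  define Z where "Z s = xseg 0 (3 * n) (\<lambda>m. t (i, m) + smul s (v (i, m)))" for s
  have tV: "t (i, m) \<in> V" "v (i, m) \<in> V" if "m < 3 * n" for m
    using PiE_mem[OF t, of "(i, m)"] PiE_mem[OF v, of "(i, m)"] that i by auto
  have Xc: "Z s \<in> carrier G" for s
    unfolding Z_def by (rule xseg_closed) (use tV V_closed(2,5) in auto)
  have gi: "?g s i = a i \<otimes> Z s" for s
  proof -
    have "xseg 0 (3 * n) (\<lambda>m. line (pars r) t v s (i, m)) = Z s"
      unfolding Z_def by (rule xseg_cong) (use i in \<open>auto simp: line_def\<close>)
    then show ?thesis using i by (simp add: shift_def)
  qed
  have ai: "a i \<in> carrier G" using a i by (auto simp: tup_def)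
  have gt: "?g s \<in> tup r" for s by (rule shift_tup[OF a line_par[OF t v]])
  have step: "act (word_map G (b # w) (?g s)) x = act (ga b (?g s)) (F s)" for s
    unfolding F_def word_map_Cons by (rule act_mult[OF ga_closed[OF gt b] word_map_closed[OF w gt] x])
  have FV: "F s \<in> V" for s unfolding F_def by (rule act_V[OF word_map_closed[OF w gt] x])
  have "polv (length w * (3 * n) + 3 * n) (\<lambda>s. act (ga b (?g s)) (F s))"
  proof (cases "snd b")
    case True
    have "act (ga b (?g s)) (F s) = act (a i) (act (Z s) (F s))" for s
      using True gi act_mult[OF ai Xc FV] by (simp add: ga_def i_def)
    moreover have "polv (length w * (3 * n) + 3 * n) (\<lambda>s. act (Z s) (F s))"
      unfolding Z_def by (rule polv_xseg(1)[OF tV _ F]) auto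
    ultimately show ?thesis using polv_lin[OF act_lin[OF ai]] by simp
  next
    case False
    have "act (ga b (?g s)) (F s) = act (inv (Z s)) (act (inv (a i)) (F s))" for s
      using False gi act_mult[OF inv_closed[OF Xc] inv_closed[OF ai] FV]
      by (simp add: ga_def i_def inv_mult_group[OF ai[unfolded i_def] Xc])
    moreover have "polv (length w * (3 * n) + 3 * n) (\<lambda>s. act (inv (Z s)) (act (inv (a i)) (F s)))"
      unfolding Z_def by (rule polv_xseg(2)[OF tV _ polv_lin[OF act_lin[OF inv_closed[OF ai]] F]]) auto
    ultimately show ?thesis by simp
  qed
  then show ?case unfolding step by (simp add: algebra_simps)
qed

lemma unit_mult: "a * b = e \<Longrightarrow> c * d = e \<Longrightarrow> (a * c) * (b * d) = e"
  by (metis ee mult.assoc mult.left_commute)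

text \<open>Each generator is sent to a product of two transvections along the directions \<open>(1, 2i)\<close> and
  \<open>(1, 2i+1)\<close> with a common parameter, so that consecutive transvections in a reduced word have
  different directions and the coefficient of the top power of the parameter is a unit.\<close>

lemma word_not_law:
  assumes n: "2 \<le> n" and w: "reduced_word w" "w \<noteq> []" "fst ` set w \<subseteq> {..<r}"
    and pr: "2 * r \<le> p" and pl: "2 * length w + 1 < p"
  obtains b x where "b \<in> tup r" "x \<in> V" "act (word_map G w b) x - x \<notin> P (Suc 0)"
proof -
  \<comment> \<open>\<open>ya a\<close> is the direction (1, a) in the first two coordinates, and
    \<open>fa a\<close> a functional that vanishes on it. The value of \<open>fa a\<close> at
    \<open>ya b\<close> is b - a, a unit for distinct a, b < p.\<close>
  define ya where "ya a = eb 0 + smul (of_nat a) (eb 1)" for a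
  define fa where "fa a v = v 1 - of_nat a * v 0" for a and v :: "nat \<Rightarrow> 'u"
  have ebV: "eb 0 \<in> V" "eb 1 \<in> V" using n by (auto intro!: eb_V)
  have yaV: "ya a \<in> V" for a unfolding ya_def by (rule V_closed(2)[OF ebV(1) V_closed(5)[OF ebV(2)]])
  have fa: "fnl (fa a)" for a
    unfolding fnl_def fa_def
    using S_closed(4)[OF V_S S_closed(6)[OF V_S]] by (auto simp: plus_fun_apply smul_apply right_diff_distrib distrib_left)
  have faya: "fa a (ya b) = of_nat b * e - of_nat a * e" for a b
    by (simp add: fa_def ya_def plus_fun_apply smul_apply eb_def)
  have fax: "fa a (eb 1) = e" for a by (simp add: fa_def eb_def)
  have "\<forall>a c. \<exists>g. g \<in> carrier G \<and> (\<forall>v\<in>V. act g v = v + smul (fa a v) (smul c (ya a)))"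
  proof (intro allI)
    fix a c
    have "fa a (smul c (ya a)) = 0" unfolding fnl_smul[OF fa yaV] faya by simp
    then show "\<exists>g. g \<in> carrier G \<and> (\<forall>v\<in>V. act g v = v + smul (fa a v) (smul c (ya a)))"
      using transv[OF fa V_closed(5)[OF yaV]] by blast
  qed
  then obtain T where T: "\<And>a c. T a c \<in> carrier G"
    "\<And>a c v. v \<in> V \<Longrightarrow> act (T a c) v = v + smul (fa a v) (smul c (ya a))" by metis
  have Ti: "act (inv (T a c)) v = v - smul (fa a v) (smul c (ya a))" if v: "v \<in> V" for a c v
  proof -
    let ?u = "v - smul (fa a v) (smul c (ya a))"
    have m: "smul (fa a v) (smul c (ya a)) \<in> V" by (rule V_closed(5)[OF V_closed(5)[OF yaV]])
    have u: "?u \<in> V" by (rule V_closed(3)[OF v m])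
    have "fa a ?u = fa a v"
      unfolding fnl_diff[OF fa v m] fnl_smul[OF fa V_closed(5)[OF yaV]] fnl_smul[OF fa yaV] faya by simp
    then have "act (T a c) ?u = v" using T(2)[OF u] by simp
    then show ?thesis using act_inv(1)[OF T(1) u] by metis
  qed
  define sg :: "bool \<Rightarrow> 'u" where "sg \<epsilon> = (if \<epsilon> then 1 else - 1)" for \<epsilon>
  define tl where "tl c l = (if snd l then T (fst l) c else inv (T (fst l) c))" for c and l :: "nat \<times> bool"
  have tl: "tl c l \<in> carrier G" for c l using T(1) by (auto simp: tl_def)
  have act_tl: "act (tl c l) v = v + smul (sg (snd l) * fa (fst l) v) (smul c (ya (fst l)))" if "v \<in> V" for c l v
    using T(2)[OF that] Ti[OF that] by (simp add: tl_def sg_def smul_simps)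
  define bb where "bb c = (\<lambda>i\<in>{..<r}. T (2 * i) c \<otimes> T (2 * i + 1) c)" for c
  have bb: "bb c \<in> tup r" for c using T(1) by (auto simp: bb_def tup_def)
  \<comment> \<open>The expansion of a letter; for an inverse letter the order is reversed as well.
    A repeated letter meets itself as 2i+1, 2i; equal neighbouring directions arise only from a
    letter next to its own inverse.\<close>
  define xpd where "xpd l = (if snd l then [(2 * fst l, True), (2 * fst l + 1, True)]
      else [(2 * fst l + 1, False), (2 * fst l, False)])" for l :: "nat \<times> bool"
  define L where "L = concat (map xpd w)"
  have foldV: "foldr (\<lambda>l. act (tl c l)) L' v \<in> V" if "v \<in> V" for c L' v
    by (induction L') (simp_all add: that act_V[OF tl])
  have act_w: "act (word_map G w (bb c)) v = foldr (\<lambda>l. act (tl c l)) L v" if v: "v \<in> V" for c v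
    using w(3) unfolding L_def
  proof (induction w)
    case Nil
    then show ?case by (simp add: word_map_Nil act_one[OF v])
  next
    case (Cons b w)
    then have b: "fst b < r" and w': "fst ` set w \<subseteq> {..<r}" by auto
    have "act (ga b (bb c)) u = foldr (\<lambda>l. act (tl c l)) (xpd b) u" if u: "u \<in> V" for u
      using b u T(1) act_mult act_V by (simp add: ga_def bb_def xpd_def tl_def inv_mult_group)
    then show ?case
      using act_mult[OF ga_closed[OF bb b] word_map_closed[OF w' bb] v] Cons.IH[OF w'] foldV[OF v]
      by (simp add: word_map_Cons)
  qed
  have adj: "successively (\<lambda>l l'. fst l \<noteq> fst l') L"
    unfolding L_def
  proof (rule successively_concat_map)
    show "successively (\<lambda>a b. b \<noteq> inv_letter a) w" using w(1) by (simp add: reduced_word_def)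
    show "fst (last (xpd a)) \<noteq> fst (hd (xpd b))" if "b \<noteq> inv_letter a" for a b
      using that by (cases a; cases b) (auto simp: xpd_def inv_letter_def; presburger)
  qed (auto simp: xpd_def)
  have Lr: "fst l < p" if l: "l \<in> set L" for l
  proof -
    obtain b where "b \<in> set w" "l \<in> set (xpd b)" using l unfolding L_def set_concat set_map by blast
    moreover from this have "fst b < r" using w(3) by auto
    ultimately show ?thesis using pr by (auto simp: xpd_def split: if_splits)
  qed
  have lenL: "length L = 2 * length w"
    unfolding L_def by (induction w) (auto simp: xpd_def)
  \<comment> \<open>\<open>N s\<close> is s times the transvection with parameter 1/s. This clears
    denominators, and the coefficient of the highest power of the parameter becomes the value at s =
    0.\<close>
  define N where "N s l v = smul s v + smul (sg (snd l) * fa (fst l) v) (ya (fst l))" for s l v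
  define M where "M l v = smul (sg (snd l) * fa (fst l) v) (ya (fst l))" for l v
  have lM: "lin (M l)" for l
    unfolding lin_def M_def using fnl_simps[OF fa] V_closed(5)[OF yaV] by (simp add: smul_simps algebra_simps)
  have NM: "N s l v = M l v + smul s v" for s l v by (simp add: N_def M_def add.commute)
  have polN: "polv (length L') (\<lambda>s. foldr (N s) L' (eb 1))" for L'
  proof (induction L')
    case Nil
    then show ?case using polv_constant[OF ebV(2)] by simp
  next
    case (Cons l L')
    then show ?case using polv_affine[OF lM lin_id Cons.IH] by (simp add: NM)
  qed
  have NV: "foldr (N s) L' (eb 1) \<in> V" if "s \<in> S" for s L' using polv_V[OF polN that] .
  have hom: "foldr (N s) L' (eb 1) = smul (s ^ length L') (foldr (\<lambda>l. act (tl c l)) L' (eb 1))"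
    if s: "s \<in> S" "s * c = e" for s c L'
  proof (induction L')
    case Nil
    then show ?case by (simp add: smul_simps)
  next
    case (Cons l L')
    let ?v = "foldr (\<lambda>l. act (tl c l)) L' (eb 1)"
    have v: "?v \<in> V" by (rule foldV[OF ebV(2)])
    have eN: "smul e (M l ?v) = M l ?v" by (rule smul_e[OF lin_V[OF lM v]])
    have "smul s (act (tl c l) ?v) = smul s ?v + smul (s * c) (M l ?v)"
      unfolding act_tl[OF v] by (simp add: smul_simps M_def ac_simps)
    then have *: "smul s (act (tl c l) ?v) = M l ?v + smul s ?v" unfolding s(2) eN by (simp add: add.commute)
    have "foldr (N s) (l # L') (eb 1) = N s l (smul (s ^ length L') ?v)" by (simp only: foldr.simps o_apply Cons.IH)
    also have "\<dots> = smul (s ^ length L') (M l ?v + smul s ?v)"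
      unfolding NM lin_smul[OF lM v] by (simp add: smul_simps mult.commute)
    also have "\<dots> = smul (s ^ length (l # L')) (act (tl c l) ?v)"
      unfolding *[symmetric] by (simp add: smul_simps mult.commute)
    finally show ?case by simp
  qed
  \<comment> \<open>At s = 0 every factor has rank one and sends the direction of the factor acting
    before it to a multiple of its own direction; the multiplier is, up to sign, a difference of two
    distinct residues and thus a unit.\<close>
  have lead: "\<exists>u y. foldr (N 0) (l # L') (eb 1) = smul u (ya (fst l)) \<and> u * y = e"
    if "successively (\<lambda>l l'. fst l \<noteq> fst l') (l # L')" "\<forall>l'\<in>set (l # L'). fst l' < p" for l L'
    using that
  proof (induction L' arbitrary: l)
    case Nil
    have "foldr (N 0) [l] (eb 1) = N 0 l (eb 1)" by simp
    also have "\<dots> = smul (sg (snd l) * e) (ya (fst l))" unfolding NM M_def fax by (simp add: smul_simps)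
    finally have "foldr (N 0) [l] (eb 1) = smul (sg (snd l) * e) (ya (fst l))" .
    moreover have "(sg (snd l) * e) * (sg (snd l) * e) = e" by (simp add: sg_def ee)
    ultimately show ?case by blast
  next
    case (Cons l' L')
    have "successively (\<lambda>l l'. fst l \<noteq> fst l') (l' # L')" "\<forall>l\<in>set (l' # L'). fst l < p"
      using Cons.prems by auto
    then obtain u y where u: "foldr (N 0) (l' # L') (eb 1) = smul u (ya (fst l'))" "u * y = e"
      using Cons.IH by blast
    have "of_nat (fst l') * e - of_nat (fst l) * e \<notin> I (Suc 0)"
      by (rule nat_diff_notin) (use Cons.prems in auto)
    then obtain z where z: "(of_nat (fst l') * e - of_nat (fst l) * e) * z = e"
      using unit_or[of "of_nat (fst l') * e - of_nat (fst l) * e"] by blast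
    have "foldr (N 0) (l # l' # L') (eb 1) = N 0 l (foldr (N 0) (l' # L') (eb 1))" by simp
    also have "\<dots> = M l (smul u (ya (fst l')))" unfolding u(1) NM by (simp add: smul_simps)
    also have "\<dots> = smul (sg (snd l) * (u * (of_nat (fst l') * e - of_nat (fst l) * e))) (ya (fst l))"
      unfolding M_def fnl_smul[OF fa yaV] faya ..
    finally have 1: "foldr (N 0) (l # l' # L') (eb 1)
        = smul (sg (snd l) * (u * (of_nat (fst l') * e - of_nat (fst l) * e))) (ya (fst l))" .
    have "sg (snd l) * (u * (of_nat (fst l') * e - of_nat (fst l) * e)) * (sg (snd l) * (y * z)) = e"
      using unit_mult[OF u(2) z] by (simp add: sg_def)
    then show ?case using 1 by blast
  qed
  have L0: "L \<noteq> []" using lenL w(2) by auto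
  \<comment> \<open>For a unit s this is a power of s times the displacement of \<open>eb 1\<close>
    under the word at parameter 1/s, so F outside \<open>P (Suc 0)\<close> gives a displacement
    outside it.\<close>
  define F where "F s = foldr (N s) L (eb 1) - smul (s ^ length L) (eb 1)" for s
  have polF: "polv (length L) F" unfolding F_def by (rule polv_diff[OF polN polv_monomial[OF ebV(2)]])
  have F0: "F 0 \<notin> P (Suc 0)"
  proof
    obtain l L' where lL: "L = l # L'" using L0 by (cases L) auto
    obtain u y where u: "foldr (N 0) L (eb 1) = smul u (ya (fst l))" "u * y = e"
      using lead[of l L'] adj Lr unfolding lL by blast
    assume "F 0 \<in> P (Suc 0)"
    moreover have "(0::'u) ^ length L = 0" using lL by simp
    then have "F 0 = smul u (ya (fst l))" unfolding F_def u(1) by (simp add: smul_simps)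
    ultimately have "smul u (ya (fst l)) \<in> P (Suc 0)" by simp
    then have "smul u (ya (fst l)) 0 \<in> I (Suc 0)" by (simp add: P_def)
    then have "(u * e) * y \<in> I (Suc 0)"
      using I_closed(6) by (simp add: smul_apply ya_def plus_fun_apply eb_def)
    moreover have "(u * e) * y = e" using u(2) ee by (simp add: mult.commute mult.left_commute)
    ultimately show False using e_notin by simp
  qed
  \<comment> \<open>The degree is \<open>2 * length w\<close>, and the nodes 1, ..., 2 length w + 1
    are distinct modulo \<open>p\<close>, so \<open>polv_many_zeros\<close> with b = 0 forbids
    vanishing modulo \<open>\<pi>\<close> at all of them. The node 0 is avoided because s has to be
    invertible.\<close>
  have "\<exists>j\<le>length L. F (of_nat (j + 1) * e) \<notin> P (Suc 0)"
  proof (rule ccontr)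
    assume a: "\<not> ?thesis"
    have "F 0 \<in> P (Suc 0 - length L * 0)"
    proof (rule polv_many_zeros[OF polF, where \<sigma> = "\<lambda>j. of_nat (j + 1) * e"])
      show "of_nat (i + 1) * e - of_nat (j + 1) * e \<notin> I (Suc 0)" if "i \<le> length L" "j \<le> length L" "i \<noteq> j" for i j
        by (rule nat_diff_notin) (use that lenL pl in auto)
    qed (use a kpos in auto)
    then show False using F0 by simp
  qed
  then obtain j where j: "j \<le> length L" "F (of_nat (j + 1) * e) \<notin> P (Suc 0)" by blast
  define s where "s = of_nat (j + 1) * e"
  have sS: "s \<in> S" unfolding s_def by (rule S_closed(6)[OF S_closed(2)])
  obtain c where c: "c \<in> S" "of_nat (j + 1) * c = e" using nat_unit[of "j + 1"] j(1) lenL pl by auto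
  have sc: "s * c = e" using c e_S[OF c(1)] by (simp add: s_def mult.assoc)
  let ?W = "act (word_map G w (bb c)) (eb 1)"
  have "F s = smul (s ^ length L) (?W - eb 1)"
    unfolding F_def hom[OF sS sc] act_w[OF ebV(2)] by (simp add: smul_simps)
  then have "?W - eb 1 \<notin> P (Suc 0)" using j(2) P_closed(5) unfolding s_def[symmetric] by metis
  then show ?thesis using that[OF bb ebV(2)] by blast
qed

text \<open>For a fixed tuple \<open>a\<close>, \<open>xseg_surj\<close> gives a parameter at which
  the shifted tuple equals \<open>b0\<close>, where the word and h differ modulo
  \<open>\<pi>\<close>. Every line through this parameter carries a polynomial of degree d that is
  non-zero modulo \<open>\<pi>\<close> at s = 0, so \<open>card_polv_zeros\<close> and
  \<open>line_average\<close> apply; summing over \<open>a\<close> removes the shift.\<close>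

theorem word_fibre_small_rank:
  assumes n: "2 \<le> n" and w: "reduced_word w" "w \<noteq> []" "fst ` set w \<subseteq> {..<r}"
    and pr: "2 * r \<le> p" and pl: "2 * length w + 1 < p" and h: "h \<in> carrier G"
    and d: "d = length w * (3 * n)" and b: "d * b < k"
  shows "card {g \<in> tup r. word_map G w g = h} * Q ^ Suc b \<le> card (tup r) * (2 * d)"
proof -
  let ?J = "pars r" and ?T = "pars r \<rightarrow>\<^sub>E V"
  have finT: "finite ?T" by (simp add: finite_PiE)
  have Tne: "card ?T > 0" using finT V_closed(1) by (auto simp: card_gt_0_iff PiE_eq_empty_iff)
  have "length w > 0" using w(2) by simp
  then have "d > 0" using n unfolding d by simp
  then have "1 * b \<le> d * b" by (intro mult_le_mono1) simp
  then have bk: "Suc b \<le> k" using b by linarith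
  \<comment> \<open>If h is not the identity modulo \<open>\<pi>\<close>, the trivial tuple will do,
    as the word has value one there; otherwise the word itself must be non-trivial modulo
    \<open>\<pi>\<close> somewhere.\<close>
  obtain x b0 where x: "x \<in> V" and b0: "b0 \<in> tup r" and b0x: "act (word_map G w b0) x - act h x \<notin> P (Suc 0)"
  proof (cases "\<exists>x\<in>V. act h x - x \<notin> P (Suc 0)")
    case True
    then obtain x where x: "x \<in> V" "act h x - x \<notin> P (Suc 0)" by blast
    define g1 where "g1 = (\<lambda>i\<in>{..<r}. \<one>)"
    have g1: "g1 \<in> tup r" by (auto simp: tup_def g1_def)
    have "word_map G w g1 = \<one>"
      using w(3) by (induction w) (auto simp: word_map_Cons word_map_Nil ga_def g1_def)
    moreover have "x - act h x \<notin> P (Suc 0)" using x(2) P_closed(4)[of "x - act h x"] by auto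
    ultimately show ?thesis using that[OF x(1) g1] act_one[OF x(1)] by simp
  next
    case False
    obtain b x where bx: "b \<in> tup r" "x \<in> V" "act (word_map G w b) x - x \<notin> P (Suc 0)"
      by (rule word_not_law[OF n w pr pl])
    have "act h x - x \<in> P (Suc 0)" using False bx(2) by blast
    then have "act (word_map G w b) x - act h x \<notin> P (Suc 0)"
      using bx(3) P_closed(2)[of "act (word_map G w b) x - act h x" "Suc 0" "act h x - x"] by auto
    then show ?thesis using that bx by blast
  qed
  have shift_bij: "card {a \<in> tup r. word_map G w (shift r a t) = h} = card {g \<in> tup r. word_map G w g = h}"
    if t: "t \<in> ?T" for t
  proof (rule bij_betw_same_card)
    let ?Z = "\<lambda>i. xseg 0 (3 * n) (\<lambda>m. t (i, m))"
    have Z: "?Z i \<in> carrier G" if "i < r" for i by (rule xseg_par_closed[OF t that])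
    let ?f' = "\<lambda>g. \<lambda>i\<in>{..<r}. g i \<otimes> inv (?Z i)"
    have f': "?f' g \<in> tup r" if "g \<in> tup r" for g using that Z by (auto simp: tup_def)
    have 1: "shift r (?f' g) t = g" if "g \<in> tup r" for g
    proof
      fix i
      show "shift r (?f' g) t i = g i"
      proof (cases "i < r")
        case True
        then have "g i \<in> carrier G" using that by (auto simp: tup_def)
        then show ?thesis using True Z[OF True] by (simp add: shift_def m_assoc)
      next
        case False
        then show ?thesis using that PiE_arb[of g "{..<r}" "\<lambda>_. carrier G" i] by (simp add: shift_def tup_def)
      qed
    qed
    have 2: "?f' (shift r a t) = a" if "a \<in> tup r" for a
    proof
      fix i
      show "?f' (shift r a t) i = a i"
      proof (cases "i < r")
        case True
        then have "a i \<in> carrier G" using that by (auto simp: tup_def)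
        then show ?thesis using True Z[OF True] by (simp add: shift_def m_assoc)
      next
        case False
        then show ?thesis using that PiE_arb[of a "{..<r}" "\<lambda>_. carrier G" i] by (simp add: tup_def)
      qed
    qed
    show "bij_betw (\<lambda>a. shift r a t) {a \<in> tup r. word_map G w (shift r a t) = h} {g \<in> tup r. word_map G w g = h}"
      by (rule bij_betw_byWitness[where f' = ?f']) (use 1 2 f' shift_tup[OF _ t] in auto)
  qed
  have fib: "card {t \<in> ?T. word_map G w (shift r a t) = h} * Q ^ Suc b \<le> card ?T * (2 * d)"
    if a: "a \<in> tup r" for a
  proof -
    let ?E = "{t \<in> ?T. word_map G w (shift r a t) = h}"
    have "\<exists>y. (\<forall>m. y m \<in> V) \<and> xseg (3 * 0) (3 * (n - 0)) y = inv (a i) \<otimes> b0 i" if "i < r" for i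
      by (rule xseg_surj) (use a b0 that in \<open>auto simp: tup_def\<close>)
    then obtain y where y: "\<And>i m. i < r \<Longrightarrow> y i m \<in> V" "\<And>i. i < r \<Longrightarrow> xseg 0 (3 * n) (y i) = inv (a i) \<otimes> b0 i"
      by (simp, metis)
    define t0 where "t0 = (\<lambda>(i, m)\<in>?J. y i m)"
    have t0: "t0 \<in> ?T" unfolding t0_def using y(1) by auto
    have sh: "shift r a t0 = b0"
    proof
      fix i
      show "shift r a t0 i = b0 i"
      proof (cases "i < r")
        case True
        have "xseg 0 (3 * n) (\<lambda>m. t0 (i, m)) = xseg 0 (3 * n) (y i)"
          by (rule xseg_cong) (use True in \<open>auto simp: t0_def\<close>)
        moreover have "a i \<in> carrier G" "b0 i \<in> carrier G" using a b0 True by (auto simp: tup_def)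
        ultimately show ?thesis using True y(2)[OF True] by (simp add: shift_def m_assoc[symmetric])
      next
        case False
        then show ?thesis using b0 PiE_arb[of b0 "{..<r}" "\<lambda>_. carrier G" i] by (simp add: shift_def tup_def)
      qed
    qed
    have "card ?E * card S \<le> 2 * card ?T * (d * card (I (Suc b)))"
    proof (rule line_average[OF _ t0])
      fix v assume v: "v \<in> ?T"
      define F where "F s = act (word_map G w (shift r a (line ?J t0 v s))) x - act h x" for s
      have F: "polv d F" unfolding F_def d
        by (rule polv_diff[OF polv_word[OF a t0 v x w(3)] polv_constant[OF act_V[OF h x]]])
      have "line ?J t0 v 0 = t0"
      proof
        fix j
        show "line ?J t0 v 0 j = t0 j"
          using PiE_arb[OF t0, of j] by (cases "j \<in> ?J") (simp_all add: line_def smul_simps)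
      qed
      then have F0: "F 0 \<notin> P (Suc 0)" unfolding F_def sh[symmetric] using b0x sh by simp
      have "{s \<in> S. line ?J t0 v s \<in> ?E} \<subseteq> {s \<in> S. F s = 0}" unfolding F_def by auto
      then have "card {s \<in> S. line ?J t0 v s \<in> ?E} \<le> card {s \<in> S. F s = 0}"
        by (intro card_mono) auto
      then show "card {s \<in> S. line ?J t0 v s \<in> ?E} \<le> d * card (I (Suc b))"
        using card_polv_zeros[OF F F0 b] by linarith
    qed auto
    moreover have "card S = Q ^ Suc b * card (I (Suc b))"
      unfolding card_S card_I[OF bk] power_add[symmetric] using bk by simp
    ultimately have "(card ?E * Q ^ Suc b) * card (I (Suc b)) \<le> (card ?T * (2 * d)) * card (I (Suc b))"
      by (simp add: mult.commute mult.left_commute)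
    moreover have "0 < card (I (Suc b))" using I_closed(1) by (auto simp: card_gt_0_iff)
    ultimately show ?thesis by simp
  qed
  let ?W = "{g \<in> tup r. word_map G w g = h}"
  have "card ?T * card ?W = (\<Sum>t\<in>?T. card {a \<in> tup r. word_map G w (shift r a t) = h})"
    using shift_bij by simp
  also have "\<dots> = (\<Sum>a\<in>tup r. card {t \<in> ?T. word_map G w (shift r a t) = h})"
    by (rule sum_card_swap[OF finT finite_tup])
  finally have "card ?T * card ?W * Q ^ Suc b
      = (\<Sum>a\<in>tup r. card {t \<in> ?T. word_map G w (shift r a t) = h} * Q ^ Suc b)"
    by (simp only: sum_distrib_right)
  also have "\<dots> \<le> (\<Sum>a\<in>tup r. card ?T * (2 * d))" by (rule sum_mono) (rule fib)
  finally have "card ?T * (card ?W * Q ^ Suc b) \<le> card ?T * (card (tup r) * (2 * d))"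
    by (simp add: mult.commute mult.left_commute)
  then show ?thesis using Tne by simp
qed

end

section \<open>Choice of parameters and the numerical estimate\<close>

context lin_group
begin

lemma card_carrier_le: "card (carrier G) \<le> card S ^ (n * n)"
proof -
  have "card (carrier G) \<le> card ({..<n} \<rightarrow>\<^sub>E V)"
  proof (rule card_inj_on_le[where f = "\<lambda>g. \<lambda>i\<in>{..<n}. act g (eb i)"])
    show "inj_on (\<lambda>g. \<lambda>i\<in>{..<n}. act g (eb i)) (carrier G)"
    proof (rule inj_onI)
      fix g h assume g: "g \<in> carrier G" and h: "h \<in> carrier G"
        and eq: "(\<lambda>i\<in>{..<n}. act g (eb i)) = (\<lambda>i\<in>{..<n}. act h (eb i))"
      have gh: "inv h \<otimes> g \<in> carrier G" using g h by simp
      have "act (inv h \<otimes> g) (eb i) = eb i" if i: "i < n" for i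
      proof -
        have "act g (eb i) = act h (eb i)" using fun_cong[OF eq, of i] i by simp
        then show ?thesis
          using act_mult[OF inv_closed[OF h] g eb_V[OF i]] act_inv(1)[OF h eb_V[OF i]] by simp
      qed
      then have "act (inv h \<otimes> g) v = v" if "v \<in> V" for v
        using lin_fixes_span[OF act_lin[OF gh], of n v] that by (auto simp: V_def)
      then have "inv h \<otimes> g = \<one>" by (rule faithful[OF gh])
      then have "h \<otimes> (inv h \<otimes> g) = h" using h by simp
      then show "g = h" using g h by (simp add: m_assoc[symmetric])
    qed
    show "(\<lambda>g. \<lambda>i\<in>{..<n}. act g (eb i)) ` carrier G \<subseteq> {..<n} \<rightarrow>\<^sub>E V"
      using act_V eb_V by auto
  qed (simp add: finite_PiE)
  then show ?thesis by (simp add: card_PiE card_V power_mult)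
qed

text \<open>Because of the negative exponent an upper bound for the group order is what is wanted,
  and counting all matrices gives Q^(k n^2).\<close>

lemma card_carrier_powr:
  assumes "0 \<le> \<delta>"
  shows "real Q powr (- (real k * real n * real n * \<delta>)) \<le> real (card (carrier G)) powr (- \<delta>)"
proof -
  have pos: "0 < card (carrier G)" using finG by (auto simp: card_gt_0_iff)
  have "real (card (carrier G)) \<le> real Q ^ (k * (n * n))"
    using card_carrier_le unfolding card_S power_mult[symmetric]
    using of_nat_mono[where 'a = real] by (simp only: of_nat_power[symmetric])
  also have "\<dots> = real Q powr (real k * real n * real n)"
    using Q_gt_1 by (simp add: powr_realpow[symmetric] mult.assoc)
  finally have "(real Q powr (real k * real n * real n)) powr (- \<delta>) \<le> real (card (carrier G)) powr (- \<delta>)"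
    using pos assms by (intro powr_mono2') auto
  then show ?thesis by (simp add: powr_powr)
qed

text \<open>With l the length of the word, the rank counts as large if n \<ge> 8 and n \<ge> 2 l;
  otherwise n \<le> 8 l. The estimates tolerate any exponent up to 1/(16 l) in the first case and up
  to 1/(3072 l^4) in the second, so the stated one leaves a wide margin.\<close>

theorem word_fibre_bound:
  assumes n: "2 \<le> n" and w: "reduced_word w" "w \<noteq> []" "fst ` set w \<subseteq> {..<r}"
    and p: "2 ^ length w + 2304 * length w ^ 4 + 2 * r + 2 * length w + 2 \<le> p" and h: "h \<in> carrier G"
  shows "real (card {g \<in> tup r. word_map G w g = h})
    \<le> real (card (tup r)) * real (card (carrier G)) powr (- (1 / (2 * 10 ^ 17 * real (length w) ^ 9)))"
proof -
  define l where "l = length w"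
  have l: "1 \<le> l" using w(2) by (simp add: l_def Suc_le_eq)
  have rl: "1 \<le> real l" using l by simp
  define \<delta> where "\<delta> = 1 / (2 * 10 ^ 17 * real l ^ 9)"
  have \<delta>0: "0 \<le> \<delta>" by (simp add: \<delta>_def)
  have power_17: "(10::real) ^ 17 = 100000000000000000" by simp
  have Q: "2 ^ l + 2304 * l ^ 4 + 2 * r + 2 * l + 2 \<le> Q" using p Q_ge_p by (simp add: l_def)
  have Q1: "1 < real Q" using Q_gt_1 by simp
  let ?W = "{g \<in> tup r. word_map G w g = h}"
  have "real (card ?W) \<le> real (card (tup r)) * real Q powr (- (real k * real n * real n * \<delta>))"
  proof (cases "8 \<le> n \<and> 2 * l \<le> n")
    case True
    define M where "M = n div (2 * l)"
    have M1: "1 \<le> M" using True l by (simp add: M_def div_greater_zero_iff Suc_le_eq)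
    have Ml: "2 * (M * l) \<le> n" unfolding M_def using div_times_less_eq_dividend[of n "2 * l"] by (simp add: algebra_simps)
    have M2: "real n \<le> 4 * real l * real M"
    proof -
      have "n = M * (2 * l) + n mod (2 * l)" unfolding M_def by (rule div_mult_mod_eq[symmetric])
      moreover have "n mod (2 * l) < 2 * l" using l by (intro mod_less_divisor) simp
      ultimately have "n < M * (2 * l) + 2 * l" by linarith
      then have "n < 2 * l * Suc M" by (simp add: algebra_simps)
      also have "\<dots> \<le> 2 * l * (2 * M)" using M1 by (intro mult_le_mono2) simp
      finally have "real n \<le> real (2 * l * (2 * M))" by linarith
      then show ?thesis by simp
    qed
    \<comment> \<open>Here M l \<le> n/2, and n \<ge> 8 makes n/2 - 1 at least 1 + n/4. The summand
      1 will pay for the factor (k + 1)^l.\<close>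
    define \<beta> where "\<beta> = n - 1 - M * l"
    have \<beta>: "\<beta> + M * length w + 1 \<le> n" using Ml True by (simp add: \<beta>_def l_def)
    have \<beta>2: "1 + real n / 4 \<le> real \<beta>"
    proof -
      have "\<beta> + 1 + M * l = n" using Ml True by (simp add: \<beta>_def)
      then have "4 + n \<le> 4 * \<beta>" using Ml True by linarith
      then have "real (4 + n) \<le> real (4 * \<beta>)" by (simp only: of_nat_le_iff)
      then show ?thesis by simp
    qed
    have kl: "real (k + 1) ^ l \<le> real Q powr real k"
    proof -
      have "k < 2 ^ k" by (rule less_exp)
      then have "k + 1 \<le> 2 ^ k" by linarith
      then have "(k + 1) ^ l \<le> (2 ^ k) ^ l" by (rule power_mono) simp
      also have "\<dots> = (2 ^ l) ^ k" by (simp add: power_mult[symmetric] mult.commute)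
      also have "\<dots> \<le> Q ^ k" using Q by (intro power_mono) auto
      finally have "real ((k + 1) ^ l) \<le> real (Q ^ k)" by (simp only: of_nat_le_iff)
      then show ?thesis using Q1 by (simp add: powr_realpow)
    qed
    have "real (k + 1) ^ l / real Q ^ (k * \<beta>) \<le> real Q powr real k / real Q powr (real k * real \<beta>)"
      using kl Q1 by (simp add: powr_realpow[symmetric] divide_right_mono)
    also have "\<dots> = real Q powr (- (real k * (real \<beta> - 1)))"
      by (simp add: powr_diff[symmetric] algebra_simps)
    also have "\<dots> \<le> real Q powr (- (real k * (real n / 4)))"
    proof (rule powr_mono)
      have "real k * (real n / 4) \<le> real k * (real \<beta> - 1)" by (rule mult_left_mono) (use \<beta>2 in auto)
      then show "- (real k * (real \<beta> - 1)) \<le> - (real k * (real n / 4))" by linarith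
    qed (use Q1 in simp)
    finally have "(real (k + 1) ^ l / real Q ^ (k * \<beta>)) ^ M \<le> (real Q powr (- (real k * (real n / 4)))) ^ M"
      by (intro power_mono) auto
    also have "\<dots> = real Q powr (- (real k * (real n / 4) * real M))"
      using Q1 by (simp add: powr_realpow[symmetric] powr_powr)
    also have "\<dots> \<le> real Q powr (- (real k * real n * real n * \<delta>))"
    proof (rule powr_mono)
      have "real n * \<delta> \<le> real M / 4"
      proof -
        have "real n * \<delta> \<le> (4 * real l * real M) * \<delta>" using M2 \<delta>0 by (intro mult_right_mono) auto
        also have "\<dots> = real M * (4 * real l / (2 * 10 ^ 17 * real l ^ 9))" by (simp add: \<delta>_def)
        also have "\<dots> \<le> real M * (1 / 4)"
        proof (rule mult_left_mono)
          have "real l ^ 1 \<le> real l ^ 9" by (rule power_increasing) (use rl in auto)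
          then have le: "real l \<le> real l ^ 9" by (simp only: power_one_right)
          have "0 < 2 * 10 ^ 17 * real l ^ 9" using rl by simp
          moreover have "4 * real l \<le> 1 / 4 * (2 * 10 ^ 17 * real l ^ 9)"
            unfolding power_17 using le rl by linarith
          ultimately show "4 * real l / (2 * 10 ^ 17 * real l ^ 9) \<le> 1 / 4"
            by (simp only: pos_divide_le_eq)
        qed simp
        finally show ?thesis by simp
      qed
      then have "(real k * real n) * (real n * \<delta>) \<le> (real k * real n) * (real M / 4)"
        by (intro mult_left_mono) auto
      then show "- (real k * (real n / 4) * real M) \<le> - (real k * real n * real n * \<delta>)"
        by (simp add: algebra_simps)
    qed (use Q1 in simp)
    finally have "(real (k + 1) ^ length w / real Q ^ (k * \<beta>)) ^ M \<le> real Q powr (- (real k * real n * real n * \<delta>))"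
      by (simp add: l_def)
    then have "real (card (tup r)) * (real (k + 1) ^ length w / real Q ^ (k * \<beta>)) ^ M
       \<le> real (card (tup r)) * real Q powr (- (real k * real n * real n * \<delta>))"
      by (intro mult_left_mono) auto
    then show ?thesis using word_fibre_large_rank[OF w h \<beta>] by linarith
  next
    case False
    then have n8: "n \<le> 8 * l" using l by linarith
    define d where "d = l * (3 * n)"
    have d0: "0 < d" using n l by (simp add: d_def)
    have d24: "d \<le> 24 * l ^ 2"
    proof -
      have "d \<le> l * (3 * (8 * l))" unfolding d_def using n8 by (intro mult_le_mono2) auto
      then show ?thesis by (simp add: power2_eq_square algebra_simps)
    qed
    \<comment> \<open>The largest b with d b < k; consequently Suc b \<ge> k/d.\<close>
    define b where "b = (k - 1) div d"
    have "d * b \<le> k - 1" unfolding b_def by simp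
    then have b: "d * b < k" using kpos by linarith
    have b2: "k \<le> d * Suc b"
    proof -
      have "k - 1 = b * d + (k - 1) mod d" unfolding b_def by (rule div_mult_mod_eq[symmetric])
      moreover have "(k - 1) mod d < d" using d0 by (intro mod_less_divisor)
      ultimately have "k - 1 < b * d + d" by linarith
      then have "k - 1 < d * Suc b" by (simp add: algebra_simps)
      then show ?thesis by linarith
    qed
    have small: "card ?W * Q ^ Suc b \<le> card (tup r) * (2 * d)"
      by (rule word_fibre_small_rank[OF n w _ _ h _ b]) (use p in \<open>auto simp: d_def l_def\<close>)
    \<comment> \<open>Thus 2 d is at most the square root of Q and uses up at most half of the
      saving Q^(Suc b).\<close>
    have Qd: "(2 * d) ^ 2 \<le> Q"
    proof -
      have "(2 * d) ^ 2 \<le> (48 * l ^ 2) ^ 2" using d24 by (intro power_mono) auto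
      also have "\<dots> = 2304 * l ^ 4" by (simp add: power_mult_distrib power_mult[symmetric])
      finally show ?thesis using Q by linarith
    qed
    then have "real (2 * d) ^ 2 \<le> real Q" using of_nat_mono[OF Qd, where 'a = real] by (simp only: of_nat_power)
    also have "real Q = (real Q powr (1 / 2)) ^ 2" using Q1 by (simp add: powr_half_sqrt)
    finally have "real (2 * d) \<le> real Q powr (1 / 2)" by (rule power2_le_imp_le) simp
    also have "\<dots> \<le> real Q powr (real (Suc b) / 2)" using Q1 by (intro powr_mono) auto
    finally have dQ: "real (2 * d) \<le> real Q powr (real (Suc b) / 2)" .
    have QS: "real Q ^ Suc b = real Q powr (real (Suc b) / 2) * real Q powr (real (Suc b) / 2)"
    proof -
      have "real Q powr real (Suc b) = real Q ^ Suc b" by (rule powr_realpow) (use Q1 in simp)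
      then show ?thesis unfolding powr_add[symmetric] field_sum_of_halves by (rule sym)
    qed
    have "real (card ?W) * real Q ^ Suc b \<le> real (card (tup r)) * real (2 * d)"
      using of_nat_mono[OF small, where 'a = real] by (simp only: of_nat_mult of_nat_power)
    also have "\<dots> \<le> real (card (tup r)) * real Q powr (real (Suc b) / 2)"
      using dQ by (intro mult_left_mono) auto
    finally have "real (card ?W) * real Q powr (real (Suc b) / 2) \<le> real (card (tup r))"
      unfolding QS using Q1 by (simp add: mult.assoc[symmetric])
    then have "real (card ?W) \<le> real (card (tup r)) * real Q powr (- (real (Suc b) / 2))"
      using Q1 by (simp add: powr_minus field_simps)
    also have "\<dots> \<le> real (card (tup r)) * real Q powr (- (real k * real n * real n * \<delta>))"
    proof (rule mult_left_mono[OF powr_mono])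
      have dr: "real d \<le> 24 * real l ^ 2"
        using of_nat_mono[OF d24, where 'a = real] by (simp only: of_nat_mult of_nat_numeral of_nat_power)
      have nr: "real n \<le> 8 * real l" using n8 by linarith
      have "real n * real n * \<delta> * (2 * real d) \<le> (8 * real l) * (8 * real l) * \<delta> * (2 * (24 * real l ^ 2))"
        using dr nr \<delta>0 by (intro mult_mono) auto
      also have "\<dots> = 3072 * real l ^ 4 / (2 * 10 ^ 17 * real l ^ 9)" by (simp add: \<delta>_def power2_eq_square power4_eq_xxxx)
      also have "\<dots> \<le> 1"
      proof -
        have "real l ^ 4 \<le> real l ^ 9" by (rule power_increasing) (use rl in auto)
        moreover have "0 < 2 * 10 ^ 17 * real l ^ 9" using rl by simp
        moreover have "0 \<le> real l ^ 9" by simp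
        ultimately show ?thesis unfolding power_17 by (simp only: pos_divide_le_eq)
      qed
      finally have 1: "real n * real n * \<delta> * (2 * real d) \<le> 1" .
      have "real k \<le> real d * real (Suc b)" using of_nat_mono[OF b2, where 'a = real] by (simp only: of_nat_mult)
      then have "real k * (real n * real n * \<delta>) \<le> (real d * real (Suc b)) * (real n * real n * \<delta>)"
        using \<delta>0 by (intro mult_right_mono) auto
      also have "\<dots> = (real n * real n * \<delta> * (2 * real d)) * (real (Suc b) / 2)" by simp
      also have "\<dots> \<le> 1 * (real (Suc b) / 2)" by (rule mult_right_mono[OF 1]) simp
      finally show "- (real (Suc b) / 2) \<le> - (real k * real n * real n * \<delta>)" by (simp add: mult.assoc)
    qed (use Q1 in auto)
    finally show ?thesis .
  qed
  also have "\<dots> \<le> real (card (tup r)) * real (card (carrier G)) powr (- \<delta>)"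
    by (rule mult_left_mono[OF card_carrier_powr[OF \<delta>0]]) simp
  finally show ?thesis by (simp add: \<delta>_def l_def)
qed

end

section \<open>Special linear groups over finite chain rings\<close>

text \<open>The product of all commutative rings on the type \<open>'b\<close>, with a factor \<open>\<int>\<close> to make it non-trivial.
  Every ring \<open>R\<close> on \<open>'b\<close> is the ideal of this type-class ring generated by the idempotent of the factor
  \<open>R\<close>, so that type-class developments such as determinants apply to \<open>R\<close>.\<close>

typedef 'b uring = "{(f :: 'b ring \<Rightarrow> 'b, z :: int). \<forall>R. if cring R then f R \<in> carrier R else f R = undefined}"
proof -
  have "((\<lambda>R. if cring R then \<zero>\<^bsub>R\<^esub> else undefined), 0) \<in>
      {(f :: 'b ring \<Rightarrow> 'b, z :: int). \<forall>R. if cring R then f R \<in> carrier R else f R = undefined}"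
    by (auto simp: cring.cring_simprules)
  then show ?thesis by (rule exI)
qed

setup_lifting type_definition_uring

instantiation uring :: (type) comm_ring_1
begin

lift_definition zero_uring :: "'a uring" is "((\<lambda>R. if cring R then \<zero>\<^bsub>R\<^esub> else undefined), 0)"
  by (auto simp: cring.cring_simprules)
lift_definition one_uring :: "'a uring" is "((\<lambda>R. if cring R then \<one>\<^bsub>R\<^esub> else undefined), 1)"
  by (auto simp: cring.cring_simprules)
lift_definition plus_uring :: "'a uring \<Rightarrow> 'a uring \<Rightarrow> 'a uring" is
  "\<lambda>(f, y) (g, z). ((\<lambda>R. if cring R then f R \<oplus>\<^bsub>R\<^esub> g R else undefined), y + z)"
  by (auto simp: cring.cring_simprules)
lift_definition times_uring :: "'a uring \<Rightarrow> 'a uring \<Rightarrow> 'a uring" is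
  "\<lambda>(f, y) (g, z). ((\<lambda>R. if cring R then f R \<otimes>\<^bsub>R\<^esub> g R else undefined), y * z)"
  by (auto simp: cring.cring_simprules)
lift_definition uminus_uring :: "'a uring \<Rightarrow> 'a uring" is
  "\<lambda>(f, y). ((\<lambda>R. if cring R then \<ominus>\<^bsub>R\<^esub> f R else undefined), - y)"
  by (auto simp: cring.cring_simprules)
lift_definition minus_uring :: "'a uring \<Rightarrow> 'a uring \<Rightarrow> 'a uring" is
  "\<lambda>(f, y) (g, z). ((\<lambda>R. if cring R then f R \<ominus>\<^bsub>R\<^esub> g R else undefined), y - z)"
  by (auto simp: cring.cring_simprules)

instance
  by intro_classes
    (transfer; clarsimp simp: fun_eq_iff algebra_simps; metis cring.cring_simprules)+

end

lift_definition emb :: "'b ring \<Rightarrow> 'b \<Rightarrow> 'b uring" is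
  "\<lambda>R x. ((\<lambda>R'. if cring R' then (if R' = R \<and> x \<in> carrier R then x else \<zero>\<^bsub>R'\<^esub>) else undefined), 0)"
  by (auto simp: cring.cring_simprules)

lemma emb_add:
  assumes "cring R" "x \<in> carrier R" "y \<in> carrier R"
  shows "emb R (x \<oplus>\<^bsub>R\<^esub> y) = emb R x + emb R y"
  using assms by (transfer) (auto simp: fun_eq_iff cring.cring_simprules)

lemma emb_mult:
  assumes "cring R" "x \<in> carrier R" "y \<in> carrier R"
  shows "emb R (x \<otimes>\<^bsub>R\<^esub> y) = emb R x * emb R y"
  using assms by (transfer) (auto simp: fun_eq_iff cring.cring_simprules)

lemma emb_zero: "cring R \<Longrightarrow> emb R \<zero>\<^bsub>R\<^esub> = 0"
  by (transfer) (auto simp: fun_eq_iff cring.cring_simprules)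

lemma emb_uminus:
  assumes "cring R" "x \<in> carrier R" shows "emb R (\<ominus>\<^bsub>R\<^esub> x) = - emb R x"
proof -
  have "emb R (\<ominus>\<^bsub>R\<^esub> x) + emb R x = 0"
    using assms emb_add[of R "\<ominus>\<^bsub>R\<^esub> x" x] by (simp add: cring.cring_simprules emb_zero)
  then show ?thesis by (simp add: eq_neg_iff_add_eq_0)
qed

lemma emb_inj: "cring R \<Longrightarrow> inj_on (emb R) (carrier R)"
  by (rule inj_onI, transfer) (auto simp: fun_eq_iff split: if_splits)

text \<open>Multiplication by the idempotent kills all other components, so the ideal it generates
  is exactly the copy of \<open>R\<close>.\<close>

lemma emb_range: "cring R \<Longrightarrow> \<exists>x\<in>carrier R. emb R \<one>\<^bsub>R\<^esub> * u = emb R x"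
proof (transfer, clarsimp)
  fix R :: "'b ring" and f :: "'b ring \<Rightarrow> 'b"
  assume R: "cring R" and f: "\<forall>R. if cring R then f R \<in> carrier R else f R = undefined"
  show "\<exists>x\<in>carrier R.
     (\<lambda>R'. if cring R' then (if cring R' then if R' = R \<and> \<one>\<^bsub>R\<^esub> \<in> carrier R then \<one>\<^bsub>R\<^esub> else \<zero>\<^bsub>R'\<^esub> else undefined) \<otimes>\<^bsub>R'\<^esub> f R' else undefined) =
     (\<lambda>R'. if cring R' then if R' = R \<and> x \<in> carrier R then x else \<zero>\<^bsub>R'\<^esub> else undefined)"
    by (rule bexI[of _ "f R"]) (use R f in \<open>auto simp: fun_eq_iff cring.cring_simprules split: if_splits\<close>)
qed

lemma det_four_block_lower_left_zero_row:
  fixes A :: "'a::comm_ring_1 mat"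
  assumes A: "A \<in> carrier_mat n n" and B: "B \<in> carrier_mat n 1" and D: "D \<in> carrier_mat 1 1"
  shows "det (four_block_mat A B (0\<^sub>m 1 n) D) = det A * det D"
proof -
  have F: "four_block_mat A B (0\<^sub>m 1 n) D \<in> carrier_mat (n + 1) (n + 1)" by (rule four_block_carrier_mat[OF A D])
  have "det (four_block_mat A B (0\<^sub>m 1 n) D) = det (transpose_mat (four_block_mat A B (0\<^sub>m 1 n) D))"
    by (rule det_transpose[OF F, symmetric])
  also have "transpose_mat (four_block_mat A B (0\<^sub>m 1 n) D)
      = four_block_mat (transpose_mat A) (0\<^sub>m n 1) (transpose_mat B) (transpose_mat D)"
    by (subst transpose_four_block_mat[OF A B _ D]) auto
  also have "det \<dots> = det (transpose_mat A) * det (transpose_mat D)"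
    by (rule det_four_block_mat_upper_right_zero_col) (use A B D in auto)
  finally show ?thesis using det_transpose[OF A] det_transpose[OF D] by simp
qed

text \<open>A case of the matrix determinant lemma, valid without division. The bordered matrix with
  blocks 1, y, -l, 1 is factored in two ways into block triangular matrices, once with 1 + y l as a
  block and once with identity blocks alone; the hypothesis makes the lower right corner 1.\<close>

lemma det_one_plus_outer:
  fixes y l :: "nat \<Rightarrow> 'a::comm_ring_1"
  assumes "(\<Sum>i<n. l i * y i) = 0"
  shows "det (mat n n (\<lambda>(i, j). (if i = j then 1 else 0) + y i * l j)) = 1"
proof -
  let ?A = "mat n n (\<lambda>(i, j). (if i = j then 1 else 0) + y i * l j)"
  let ?Y = "mat n 1 (\<lambda>(i, j). y i)" and ?L = "mat 1 n (\<lambda>(i, j). - l j)"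
  let ?U = "four_block_mat (1\<^sub>m n) (0\<^sub>m n 1) ?L (1\<^sub>m 1)"
  let ?X = "four_block_mat ?A ?Y (0\<^sub>m 1 n) (1\<^sub>m 1)"
  let ?Z = "four_block_mat (1\<^sub>m n) ?Y (0\<^sub>m 1 n) (1\<^sub>m 1)"
  have U: "?U \<in> carrier_mat (n + 1) (n + 1)" and Z: "?Z \<in> carrier_mat (n + 1) (n + 1)"
    and Y: "?X \<in> carrier_mat (n + 1) (n + 1)"
    by (rule four_block_carrier_mat; simp)+
  have "?X * ?U = four_block_mat (?A * 1\<^sub>m n + ?Y * ?L) (?A * 0\<^sub>m n 1 + ?Y * 1\<^sub>m 1)
      (0\<^sub>m 1 n * 1\<^sub>m n + 1\<^sub>m 1 * ?L) (0\<^sub>m 1 n * 0\<^sub>m n 1 + 1\<^sub>m 1 * 1\<^sub>m 1)"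
    by (rule mult_four_block_mat) auto
  also have "?A * 1\<^sub>m n + ?Y * ?L = 1\<^sub>m n"
    by (rule eq_matI) (auto simp: scalar_prod_def)
  also have "?A * 0\<^sub>m n 1 + ?Y * 1\<^sub>m 1 = ?Y" by (rule eq_matI) (auto simp: scalar_prod_def)
  also have "0\<^sub>m 1 n * 1\<^sub>m n + 1\<^sub>m 1 * ?L = ?L" by (rule eq_matI) (auto simp: scalar_prod_def)
  also have "0\<^sub>m 1 n * 0\<^sub>m n 1 + 1\<^sub>m 1 * 1\<^sub>m 1 = (1\<^sub>m 1 :: 'a mat)" by (rule eq_matI) (auto simp: scalar_prod_def)
  finally have 1: "?X * ?U = four_block_mat (1\<^sub>m n) ?Y ?L (1\<^sub>m 1)" .
  have "?U * ?Z = four_block_mat (1\<^sub>m n * 1\<^sub>m n + 0\<^sub>m n 1 * 0\<^sub>m 1 n) (1\<^sub>m n * ?Y + 0\<^sub>m n 1 * 1\<^sub>m 1)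
      (?L * 1\<^sub>m n + 1\<^sub>m 1 * 0\<^sub>m 1 n) (?L * ?Y + 1\<^sub>m 1 * 1\<^sub>m 1)"
    by (rule mult_four_block_mat) auto
  also have "1\<^sub>m n * 1\<^sub>m n + 0\<^sub>m n 1 * 0\<^sub>m 1 n = (1\<^sub>m n :: 'a mat)" by (rule eq_matI) (auto simp: scalar_prod_def)
  also have "1\<^sub>m n * ?Y + 0\<^sub>m n 1 * 1\<^sub>m 1 = ?Y" by (rule eq_matI) (auto simp: scalar_prod_def)
  also have "?L * 1\<^sub>m n + 1\<^sub>m 1 * 0\<^sub>m 1 n = ?L" by (rule eq_matI) (auto simp: scalar_prod_def)
  also have "?L * ?Y + 1\<^sub>m 1 * 1\<^sub>m 1 = 1\<^sub>m 1"
  proof (rule eq_matI)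
    fix i j assume "i < dim_row (1\<^sub>m 1 :: 'a mat)" "j < dim_col (1\<^sub>m 1 :: 'a mat)"
    then have ij: "i = 0" "j = 0" by auto
    have "(?L * ?Y) $$ (0, 0) = - (\<Sum>i<n. l i * y i)"
      by (simp add: scalar_prod_def sum_negf atLeast0LessThan)
    then have "(?L * ?Y) $$ (0, 0) = 0" using assms by simp
    then show "(?L * ?Y + 1\<^sub>m 1 * 1\<^sub>m 1) $$ (i, j) = 1\<^sub>m 1 $$ (i, j)" unfolding ij by simp
  qed auto
  finally have 2: "?U * ?Z = four_block_mat (1\<^sub>m n) ?Y ?L (1\<^sub>m 1)" .
  have dU: "det ?U = 1"
    by (subst det_four_block_mat_upper_right_zero_col) auto
  have dZ: "det ?Z = 1" by (subst det_four_block_lower_left_zero_row) auto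
  have dX: "det ?X = det ?A" by (subst det_four_block_lower_left_zero_row) auto
  have "det ?X * det ?U = det ?U * det ?Z"
    using det_mult[OF Y U] det_mult[OF U Z] 1 2 by simp
  then show ?thesis using dU dZ dX by simp
qed

text \<open>The counterpart of \<open>chain_ring\<close> for a ring with explicit carrier;
  \<open>n\<close> is the size of the matrices over it.\<close>

locale finite_chain = cring R for R :: "'b ring" (structure) +
  fixes p k n :: nat
  assumes finR: "finite (carrier R)" and prime_p: "prime p" and k1: "k \<ge> 1" and n1: "n \<ge> 1"
    and unit_or_p: "x \<in> carrier R \<Longrightarrow> (\<exists>y\<in>carrier R. x \<otimes> y = \<one>) \<or> (\<exists>y\<in>carrier R. x = ([p] \<cdot> \<one>) \<otimes> y)"
    and pk0: "([p] \<cdot> \<one>) [^] k = \<zero>" and pk1: "([p] \<cdot> \<one>) [^] (k - 1) \<noteq> \<zero>"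
begin

abbreviation \<psi> :: "'b \<Rightarrow> 'b uring" where "\<psi> \<equiv> emb R"
abbreviation e :: "'b uring" where "e \<equiv> \<psi> \<one>"

lemmas emb_hom = emb_add[OF is_cring] emb_mult[OF is_cring] emb_zero[OF is_cring] emb_uminus[OF is_cring]

lemma emb_eq_iff: "x \<in> carrier R \<Longrightarrow> y \<in> carrier R \<Longrightarrow> \<psi> x = \<psi> y \<longleftrightarrow> x = y"
  using emb_inj[OF is_cring] by (auto simp: inj_on_def)

lemma e_emb: "x \<in> carrier R \<Longrightarrow> e * \<psi> x = \<psi> x"
  using emb_mult[OF is_cring, of \<one> x] by simp

lemma emb_surj: "e * u = u \<longleftrightarrow> u \<in> \<psi> ` carrier R"
  using emb_range[OF is_cring, of u] e_emb by auto

lemma emb_add_pow: "x \<in> carrier R \<Longrightarrow> \<psi> ([(m::nat)] \<cdot> x) = of_nat m * \<psi> x"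
  by (induction m) (simp_all add: emb_hom algebra_simps)

lemma emb_pow: "x \<in> carrier R \<Longrightarrow> \<psi> (x [^] (m::nat)) = \<psi> x ^ m * e"
  by (induction m) (simp_all add: emb_hom algebra_simps)

lemma emb_p: "\<psi> ([p] \<cdot> \<one>) = of_nat p * e" by (simp add: emb_add_pow)

lemma e_idem: "e * e = e" by (simp add: e_emb)

lemma e_pow: "e ^ m * e = e" by (induction m) (simp_all add: e_idem mult.assoc)

lemma emb_p_pow: "\<psi> (([p] \<cdot> \<one>) [^] (m::nat)) = of_nat p ^ m * e"
  using e_pow by (simp add: emb_pow emb_p power_mult_distrib mult.assoc)

sublocale chain_ring e p k n
proof
  show "e * e = e" by (rule e_idem)
  have "{x. e * x = x} = \<psi> ` carrier R" using emb_surj by blast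
  then show "finite {x. e * x = x}" using finR by simp
  show "k \<ge> 1" "prime p" by (rule k1 prime_p)+
  show "of_nat p ^ k * e = 0" using emb_p_pow[of k] pk0 by (simp add: emb_hom)
  show "of_nat p ^ (k - 1) * e \<noteq> 0"
  proof
    assume "of_nat p ^ (k - 1) * e = 0"
    then have "\<psi> (([p] \<cdot> \<one>) [^] (k - 1)) = \<psi> \<zero>" by (simp add: emb_p_pow emb_hom)
    then show False using pk1 by (subst (asm) emb_eq_iff) auto
  qed
  fix u
  obtain x where x: "x \<in> carrier R" "e * u = \<psi> x" using emb_range[OF is_cring] by blast
  from unit_or_p[OF x(1)] show "(\<exists>y. e * u * y = e) \<or> (\<exists>y. e * u = e * (of_nat p * y))"
  proof (elim disjE bexE)
    fix y assume y: "y \<in> carrier R" "x \<otimes> y = \<one>"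
    then have "e * u * \<psi> y = e" unfolding x(2) using emb_mult[OF is_cring x(1) y(1)] by simp
    then show ?thesis by blast
  next
    fix y assume y: "y \<in> carrier R" "x = ([p] \<cdot> \<one>) \<otimes> y"
    then have "e * u = e * (of_nat p * \<psi> y)"
      unfolding x(2) using emb_mult[OF is_cring, of "[p] \<cdot> \<one>" y] by (simp add: emb_p algebra_simps)
    then show ?thesis by blast
  qed
qed

lemma S_emb: "S = \<psi> ` carrier R" unfolding S_def using emb_surj by blast
lemma emb_S [simp]: "x \<in> carrier R \<Longrightarrow> \<psi> x \<in> S" unfolding S_emb by simp

lemma emb_finsum: "finite A \<Longrightarrow> f \<in> A \<rightarrow> carrier R \<Longrightarrow> \<psi> (\<Oplus>i\<in>A. f i) = (\<Sum>i\<in>A. \<psi> (f i))"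
  by (induction A rule: finite_induct) (auto simp: emb_hom finsum_insert Pi_iff intro!: emb_hom)

lemma emb_finprod: "finite A \<Longrightarrow> f \<in> A \<rightarrow> carrier R \<Longrightarrow> \<psi> (\<Otimes>i\<in>A. f i) = e * (\<Prod>i\<in>A. \<psi> (f i))"
proof (induction A rule: finite_induct)
  case (insert a A)
  then have "\<psi> (\<Otimes>i\<in>insert a A. f i) = \<psi> (f a) * \<psi> (\<Otimes>i\<in>A. f i)"
    by (subst finprod_insert) (auto simp: emb_hom Pi_iff intro!: emb_hom finprod_closed)
  then show ?case using insert by (simp add: algebra_simps)
qed simp

text \<open>The entries lie in the ideal generated by \<open>e\<close>, so the identity of the group
  becomes \<open>e\<close> times the identity matrix, and determinants are compared after
  multiplication by \<open>e\<close>.\<close>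

definition em :: "(nat \<times> nat \<Rightarrow> 'b) \<Rightarrow> 'b uring mat" where
  "em A = mat n n (\<lambda>ij. \<psi> (A ij))"

abbreviation mats :: "(nat \<times> nat \<Rightarrow> 'b) set" where "mats \<equiv> {..<n} \<times> {..<n} \<rightarrow>\<^sub>E carrier R"

lemma em_carrier [simp]: "em A \<in> carrier_mat n n" by (simp add: em_def)

lemma em_det: assumes A: "A \<in> mats" shows "mat_det n R A \<in> carrier R" "\<psi> (mat_det n R A) = e * det (em A)"
proof -
  let ?t = "\<lambda>\<sigma>. \<Otimes>i\<in>{..<n}. A (i, \<sigma> i)"
  let ?P = "{\<sigma>. \<sigma> permutes {..<n}}"
  have fP: "finite ?P" by (rule finite_permutations) simp
  have mem: "(\<lambda>i. A (i, \<sigma> i)) \<in> {..<n} \<rightarrow> carrier R" if "\<sigma> \<in> ?P" for \<sigma>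
    using A that permutes_in_image[of \<sigma> "{..<n}"] by (auto simp: PiE_iff)
  have tc: "?t \<sigma> \<in> carrier R" if "\<sigma> \<in> ?P" for \<sigma> using mem[OF that] by (rule finprod_closed)
  have tc': "(let t = ?t \<sigma> in if evenperm \<sigma> then t else \<ominus> t) \<in> carrier R" if "\<sigma> \<in> ?P" for \<sigma>
    using tc[OF that] by (simp add: Let_def)
  then show "mat_det n R A \<in> carrier R" unfolding mat_det_def by (intro finsum_closed) auto
  have "\<psi> (mat_det n R A) = (\<Sum>\<sigma>\<in>?P. \<psi> (let t = ?t \<sigma> in if evenperm \<sigma> then t else \<ominus> t))"
    unfolding mat_det_def by (rule emb_finsum[OF fP]) (use tc' in auto)
  also have "\<dots> = (\<Sum>\<sigma>\<in>?P. e * (of_int (sign \<sigma>) * (\<Prod>i = 0..<n. em A $$ (i, \<sigma> i))))"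
  proof (rule sum.cong[OF refl])
    fix \<sigma> assume s: "\<sigma> \<in> ?P"
    then have sn: "\<sigma> i < n" if "i < n" for i using that permutes_in_image[of \<sigma> "{..<n}"] by auto
    have "\<psi> (?t \<sigma>) = e * (\<Prod>i<n. \<psi> (A (i, \<sigma> i)))" by (rule emb_finprod[OF _ mem[OF s]]) simp
    also have "(\<Prod>i<n. \<psi> (A (i, \<sigma> i))) = (\<Prod>i = 0..<n. em A $$ (i, \<sigma> i))"
      unfolding lessThan_atLeast0 by (rule prod.cong) (auto simp: em_def sn)
    finally show "\<psi> (let t = ?t \<sigma> in if evenperm \<sigma> then t else \<ominus> t)
       = e * (of_int (sign \<sigma>) * (\<Prod>i = 0..<n. em A $$ (i, \<sigma> i)))"
      using tc[OF s] by (simp add: Let_def sign_def emb_hom)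
  qed
  also have "\<dots> = e * det (em A)"
    unfolding det_def'[OF em_carrier] lessThan_atLeast0 by (simp add: sum_distrib_left)
  finally show "\<psi> (mat_det n R A) = e * det (em A)" .
qed

lemma em_inj: assumes "A \<in> mats" "B \<in> mats" "em A = em B" shows "A = B"
proof (rule PiE_ext[OF assms(1,2)])
  fix ij assume ij: "ij \<in> {..<n} \<times> {..<n}"
  have "em A $$ ij = em B $$ ij" using assms(3) by simp
  then have "\<psi> (A ij) = \<psi> (B ij)" using ij by (auto simp: em_def)
  then show "A ij = B ij" using emb_eq_iff assms ij by (meson PiE_mem)
qed

lemma em_surj: assumes N: "N \<in> carrier_mat n n" "\<And>i j. i < n \<Longrightarrow> j < n \<Longrightarrow> N $$ (i, j) \<in> S"
  obtains A where "A \<in> mats" "em A = N"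
proof -
  have "\<forall>ij\<in>{..<n} \<times> {..<n}. \<exists>x. x \<in> carrier R \<and> \<psi> x = N $$ ij" using N(2) unfolding S_emb by fastforce
  then obtain f where f: "\<And>ij. ij \<in> {..<n} \<times> {..<n} \<Longrightarrow> f ij \<in> carrier R \<and> \<psi> (f ij) = N $$ ij" by metis
  show ?thesis
  proof (rule that[of "restrict f ({..<n} \<times> {..<n})"])
    show "em (restrict f ({..<n} \<times> {..<n})) = N"
      by (rule eq_matI) (use N f in \<open>auto simp: em_def\<close>)
  qed (use f in auto)
qed

abbreviation G where "G \<equiv> SL n R"

lemma SL_iff: "A \<in> carrier G \<longleftrightarrow> A \<in> mats \<and> e * det (em A) = e"
proof -
  have "mat_det n R A = \<one> \<longleftrightarrow> e * det (em A) = e" if "A \<in> mats"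
    using em_det[OF that] emb_eq_iff[OF em_det(1)[OF that] one_closed] by simp
  then show ?thesis by (auto simp: SL_def)
qed

lemma SL_mats: "A \<in> carrier G \<Longrightarrow> A \<in> mats" by (simp add: SL_iff)

lemma mats_entry: "A \<in> mats \<Longrightarrow> i < n \<Longrightarrow> j < n \<Longrightarrow> A (i, j) \<in> carrier R" by auto

lemma em_mult: assumes "A \<in> mats" "B \<in> mats"
  shows "A \<otimes>\<^bsub>G\<^esub> B \<in> mats" "em (A \<otimes>\<^bsub>G\<^esub> B) = em A * em B"
proof -
  have c: "(\<Oplus>k\<in>{..<n}. A (i, k) \<otimes> B (k, j)) \<in> carrier R" if "i < n" "j < n" for i j
    by (rule finsum_closed) (use that assms in \<open>auto intro!: m_closed mats_entry\<close>)
  then show "A \<otimes>\<^bsub>G\<^esub> B \<in> mats" by (auto simp: SL_def)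
  show "em (A \<otimes>\<^bsub>G\<^esub> B) = em A * em B"
  proof (rule eq_matI)
    fix i j assume "i < dim_row (em A * em B)" "j < dim_col (em A * em B)"
    then have ij: "i < n" "j < n" by (auto simp: em_def)
    have "em (A \<otimes>\<^bsub>G\<^esub> B) $$ (i, j) = \<psi> (\<Oplus>k\<in>{..<n}. A (i, k) \<otimes> B (k, j))"
      using ij by (simp add: em_def SL_def)
    also have "\<dots> = (\<Sum>k<n. \<psi> (A (i, k) \<otimes> B (k, j)))"
      by (rule emb_finsum) (use ij assms in \<open>auto intro!: m_closed mats_entry\<close>)
    also have "\<dots> = (\<Sum>k<n. \<psi> (A (i, k)) * \<psi> (B (k, j)))"
      by (rule sum.cong) (use ij assms mats_entry in \<open>auto intro!: emb_hom\<close>)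
    also have "\<dots> = (em A * em B) $$ (i, j)"
      using ij by (simp add: em_def scalar_prod_def atLeast0LessThan)
    finally show "em (A \<otimes>\<^bsub>G\<^esub> B) $$ (i, j) = (em A * em B) $$ (i, j)" .
  qed (simp_all add: em_def)
qed

lemma em_one: "\<one>\<^bsub>G\<^esub> \<in> mats" "em \<one>\<^bsub>G\<^esub> = e \<cdot>\<^sub>m 1\<^sub>m n"
proof -
  show "\<one>\<^bsub>G\<^esub> \<in> mats" by (auto simp: SL_def)
  show "em \<one>\<^bsub>G\<^esub> = e \<cdot>\<^sub>m 1\<^sub>m n" by (rule eq_matI) (auto simp: em_def SL_def emb_hom)
qed

lemma e_em: "A \<in> mats \<Longrightarrow> e \<cdot>\<^sub>m em A = em A"
  by (rule eq_matI) (auto simp: em_def e_emb mats_entry)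

lemma e_det_smult: "M \<in> carrier_mat n n \<Longrightarrow> e * det (e \<cdot>\<^sub>m M) = e * det M"
proof -
  assume "M \<in> carrier_mat n n"
  then have "e * det (e \<cdot>\<^sub>m M) = (e ^ n * e) * det M" by (simp add: algebra_simps)
  then show ?thesis by (simp add: e_pow)
qed

lemma em_S: "A \<in> mats \<Longrightarrow> i < n \<Longrightarrow> j < n \<Longrightarrow> em A $$ (i, j) \<in> S"
  by (simp add: em_def mats_entry)

lemma SL_group: "group G"
proof (rule groupI)
  fix A B assume A: "A \<in> carrier G" and B: "B \<in> carrier G"
  have "e * det (em A * em B) = (e * det (em A)) * (e * det (em B))"
    using det_mult[OF em_carrier em_carrier] e_idem by (simp add: mult.assoc mult.left_commute)
       (metis mult.assoc mult.left_commute)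
  then show "A \<otimes>\<^bsub>G\<^esub> B \<in> carrier G"
    using A B em_mult[OF SL_mats[OF A] SL_mats[OF B]] by (simp add: SL_iff e_idem)
next
  show "\<one>\<^bsub>G\<^esub> \<in> carrier G" using em_one e_det_smult[of "1\<^sub>m n"] by (simp add: SL_iff)
next
  fix A B C assume "A \<in> carrier G" "B \<in> carrier G" "C \<in> carrier G"
  then have m: "A \<in> mats" "B \<in> mats" "C \<in> mats" by (simp_all add: SL_iff)
  show "A \<otimes>\<^bsub>G\<^esub> B \<otimes>\<^bsub>G\<^esub> C = A \<otimes>\<^bsub>G\<^esub> (B \<otimes>\<^bsub>G\<^esub> C)"
    by (rule em_inj) (use m em_mult assoc_mult_mat[of "em A" n n "em B" n "em C" n] in simp_all)
next
  fix A assume A: "A \<in> carrier G"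
  have m: "A \<in> mats" using A by (simp add: SL_iff)
  have "(e \<cdot>\<^sub>m 1\<^sub>m n) * em A = e \<cdot>\<^sub>m (1\<^sub>m n * em A)"
    by (rule mult_smult_assoc_mat[OF one_carrier_mat em_carrier])
  also have "\<dots> = em A" using e_em[OF m] left_mult_one_mat[OF em_carrier] by simp
  finally show "\<one>\<^bsub>G\<^esub> \<otimes>\<^bsub>G\<^esub> A = A"
    by (intro em_inj) (use m em_mult em_one in simp_all)
next
  fix A assume A: "A \<in> carrier G"
  have m: "A \<in> mats" and dA: "e * det (em A) = e" using A by (simp_all add: SL_iff)
  \<comment> \<open>The inverse is the adjugate, projected to the ideal generated by
    \<open>e\<close>.\<close>
  let ?N = "e \<cdot>\<^sub>m adj_mat (em A)"
  note adj = adj_mat[OF em_carrier[of A]]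
  have N: "?N \<in> carrier_mat n n" using adj(1) by simp
  have "?N $$ (i, j) \<in> S" if "i < n" "j < n" for i j using that adj(1) by simp
  then obtain B where B: "B \<in> mats" "em B = ?N" using em_surj[OF N] by metis
  have "?N * em A = e \<cdot>\<^sub>m (adj_mat (em A) * em A)" by (rule mult_smult_assoc_mat[OF adj(1) em_carrier])
  also have "\<dots> = e \<cdot>\<^sub>m 1\<^sub>m n" unfolding adj(3) by (rule eq_matI) (simp_all add: dA mult.assoc[symmetric])
  finally have NA: "?N * em A = e \<cdot>\<^sub>m 1\<^sub>m n" .
  have "e * det (?N * em A) = e" unfolding NA using e_det_smult[of "1\<^sub>m n"] by simp
  moreover have "e * det (?N * em A) = (e * det (em A)) * det ?N"
    unfolding det_mult[OF N em_carrier] by (simp only: ac_simps)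
  ultimately have "e * det ?N = e" unfolding dA by simp
  then have "B \<in> carrier G" using B by (simp add: SL_iff)
  moreover have "B \<otimes>\<^bsub>G\<^esub> A = \<one>\<^bsub>G\<^esub>"
    by (rule em_inj) (use em_mult[OF B(1) m] em_one NA B in simp_all)
  ultimately show "\<exists>B\<in>carrier G. B \<otimes>\<^bsub>G\<^esub> A = \<one>\<^bsub>G\<^esub>" by blast
qed

definition sact :: "(nat \<times> nat \<Rightarrow> 'b) \<Rightarrow> (nat \<Rightarrow> 'b uring) \<Rightarrow> nat \<Rightarrow> 'b uring" where
  "sact A v = (\<lambda>i. if i < n then \<Sum>j<n. em A $$ (i, j) * v j else 0)"

lemma sact_eb: "A \<in> mats \<Longrightarrow> i < n \<Longrightarrow> j < n \<Longrightarrow> sact A (\<lambda>i. if i = j then e else 0) i = em A $$ (i, j)"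
  using e_S[OF em_S, of A i j] by (simp add: sact_def mult.commute if_distrib cong: if_cong)

lemma sum_fun_apply: "(\<Sum>j\<in>A. f j) i = (\<Sum>j\<in>A. f j i)"
  for f :: "'c \<Rightarrow> nat \<Rightarrow> 'd::comm_monoid_add"
  by (induction A rule: infinite_finite_induct) (simp_all add: zero_fun_apply plus_fun_apply)

lemma vec_expand: "v \<in> V \<Longrightarrow> v = (\<Sum>j<n. smul (v j) (\<lambda>i. if i = j then e else 0))"
  using V_S[of v] e_S
  by (auto simp: fun_eq_iff smul_apply V_def sum_fun_apply not_less mult.commute if_distrib cong: if_cong)

lemma fnl_expand: assumes f: "fnl f" and v: "v \<in> V"
  shows "f v = (\<Sum>j<n. v j * f (\<lambda>i. if i = j then e else 0))"
proof -
  have ebV: "(\<lambda>i. if i = j then e else 0) \<in> V" if "j < n" for j using that by (auto simp: V_def)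
  have sumV: "(\<Sum>j<m. smul (v j) (\<lambda>i. if i = j then e else 0)) \<in> V
     \<and> f (\<Sum>j<m. smul (v j) (\<lambda>i. if i = j then e else 0)) = (\<Sum>j<m. v j * f (\<lambda>i. if i = j then e else 0))"
    if "m \<le> n" for m
    using that
  proof (induction m)
    case (Suc m)
    then have IH: "(\<Sum>j<m. smul (v j) (\<lambda>i. if i = j then e else 0)) \<in> V"
      "f (\<Sum>j<m. smul (v j) (\<lambda>i. if i = j then e else 0)) = (\<Sum>j<m. v j * f (\<lambda>i. if i = j then e else 0))"
      by auto
    have m: "m < n" using Suc.prems by simp
    show ?case
      using V_closed(2)[OF IH(1) V_closed(5)[OF ebV[OF m]]]
        fnl_add[OF f IH(1) V_closed(5)[OF ebV[OF m]]] fnl_smul[OF f ebV[OF m]] IH(2)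
      by simp
  qed (simp add: fnl_0[OF f])
  show ?thesis using sumV[of n] unfolding vec_expand[OF v, symmetric] by simp
qed

text \<open>Two facts about determinants supply the group-specific axioms:
  \<open>det_one_plus_outer\<close> places the transvections in the group, and the determinant of a
  triangular matrix yields \<open>last_coord\<close>.\<close>

lemma SL_lin_group: "lin_group e p k n G sact"
proof -
  interpret SLG: group G by (rule SL_group)
  have ebV: "(\<lambda>i. if i = j then e else 0) \<in> V" if "j < n" for j using that by (auto simp: V_def)
  show ?thesis
  proof (unfold_locales)
    show "finite (carrier G)"
      by (rule finite_subset[of _ mats]) (auto simp: SL_def intro!: finite_PiE finR)
  next
    fix A assume "A \<in> carrier G"
    then have m: "A \<in> mats" by (rule SL_mats)
    show "lin (sact A)"
      unfolding lin_def
    proof (intro conjI ballI allI)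
      fix v w c assume v: "v \<in> V" and w: "w \<in> V"
      show "sact A v \<in> V" unfolding V_def sact_def using em_S[OF m] by (auto intro!: S_sum)
      show "sact A (v + w) = sact A v + sact A w"
        by (auto simp: sact_def fun_eq_iff plus_fun_apply sum.distrib distrib_left)
      show "sact A (smul c v) = smul c (sact A v)"
        by (auto simp: sact_def fun_eq_iff smul_apply sum_distrib_left mult.left_commute)
    qed
  next
    fix A B v assume A: "A \<in> carrier G" and B: "B \<in> carrier G"
    have AB: "em (A \<otimes>\<^bsub>G\<^esub> B) = em A * em B" using em_mult A B by (simp add: SL_mats)
    have "(\<Sum>j<n. (em A * em B) $$ (i, j) * v j) = (\<Sum>l<n. em A $$ (i, l) * (\<Sum>j<n. em B $$ (l, j) * v j))"
      if i: "i < n" for i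
    proof -
      have "(\<Sum>j<n. (em A * em B) $$ (i, j) * v j) = (\<Sum>j<n. \<Sum>l<n. em A $$ (i, l) * em B $$ (l, j) * v j)"
        by (rule sum.cong[OF refl])
           (use i in \<open>simp add: scalar_prod_def em_def atLeast0LessThan sum_distrib_right\<close>)
      also have "\<dots> = (\<Sum>l<n. \<Sum>j<n. em A $$ (i, l) * em B $$ (l, j) * v j)" by (rule sum.swap)
      finally show ?thesis by (simp add: sum_distrib_left mult.assoc)
    qed
    then show "sact (A \<otimes>\<^bsub>G\<^esub> B) v = sact A (sact B v)" unfolding sact_def AB by auto
  next
    fix v assume v: "v \<in> V"
    have "em \<one>\<^bsub>G\<^esub> $$ (i, j) * v j = (if j = i then v i else 0)" if "i < n" "j < n" for i j
      using that e_S[OF V_S[OF v]] by (simp add: em_one)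
    then show "sact \<one>\<^bsub>G\<^esub> v = v" using v by (auto simp: sact_def fun_eq_iff V_def)
  next
    fix f y assume f: "fnl f" and y: "y \<in> V" and fy: "f y = 0"
    let ?l = "\<lambda>j. f (\<lambda>i. if i = j then e else 0)"
    let ?M = "mat n n (\<lambda>(i, j). (if i = j then 1 else 0) + y i * ?l j)"
    let ?N = "e \<cdot>\<^sub>m ?M"
    have lS: "?l j \<in> S" if "j < n" for j using fnl_S[OF f ebV[OF that]] .
    have "(\<Sum>i<n. ?l i * y i) = 0" using fnl_expand[OF f y] fy by (simp add: mult.commute)
    then have dM: "det ?M = 1" by (rule det_one_plus_outer)
    have N: "?N \<in> carrier_mat n n" by simp
    obtain A where A: "A \<in> mats" "em A = ?N" by (rule em_surj[OF N]) auto
    have "A \<in> carrier G" using A e_det_smult[of ?M] dM by (simp add: SL_iff)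
    moreover have "sact A v = v + smul (f v) y" if v: "v \<in> V" for v
    proof
      fix i
      show "sact A v i = (v + smul (f v) y) i"
      proof (cases "i < n")
        case True
        have "em A $$ (i, j) * v j = (if i = j then v j else 0) + y i * (v j * ?l j)" if "j < n" for j
        proof -
          have "em A $$ (i, j) * v j = (if i = j then e * v j else 0) + (e * y i) * (v j * ?l j)"
            unfolding A(2) using True that by (simp add: algebra_simps)
          then show ?thesis unfolding e_S[OF V_S[OF v]] e_S[OF V_S[OF y]] .
        qed
        then have "sact A v i = (\<Sum>j<n. (if i = j then v j else 0) + y i * (v j * ?l j))"
          using True by (simp add: sact_def)
        also have "\<dots> = v i + y i * f v"
          using True fnl_expand[OF f v] by (simp add: sum.distrib sum_distrib_left)
        finally show ?thesis by (simp add: plus_fun_apply smul_apply mult.commute)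
      next
        case False
        then show ?thesis using v y by (simp add: sact_def plus_fun_apply smul_apply V_def)
      qed
    qed
    ultimately show "\<exists>g\<in>carrier G. \<forall>v\<in>V. sact g v = v + smul (f v) y" by blast
  next
    fix A assume A: "A \<in> carrier G" and fixed: "\<And>v. v \<in> V \<Longrightarrow> sact A v = v"
    have m: "A \<in> mats" using A by (rule SL_mats)
    show "A = \<one>\<^bsub>G\<^esub>"
    proof (rule em_inj[OF m em_one(1)], rule eq_matI)
      fix i j assume "i < dim_row (em \<one>\<^bsub>G\<^esub>)" "j < dim_col (em \<one>\<^bsub>G\<^esub>)"
      then have ij: "i < n" "j < n" by (auto simp: em_def)
      have "em A $$ (i, j) = (\<lambda>i. if i = j then e else 0) i"
        using sact_eb[OF m ij] fixed[OF ebV[OF ij(2)]] by simp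
      then show "em A $$ (i, j) = em \<one>\<^bsub>G\<^esub> $$ (i, j)" using ij by (simp add: em_one)
    qed (simp_all add: em_def)
  next
    fix A assume A: "A \<in> carrier G"
      and fixed: "\<And>i. i < n - 1 \<Longrightarrow> sact A (\<lambda>j. if j = i then e else 0) = (\<lambda>j. if j = i then e else 0)"
    have m: "A \<in> mats" and dA: "e * det (em A) = e" using A by (simp_all add: SL_iff)
    have col: "em A $$ (i, j) = (if i = j then e else 0)" if "i < n" "j < n - 1" for i j
      using sact_eb[OF m that(1), of j] fixed[OF that(2)] that by simp
    obtain n' where n': "n = Suc n'" using n1 by (cases n) auto
    \<comment> \<open>All columns but the last are those of the group identity, so the determinant
      reduces to the last diagonal entry.\<close>
    have "upper_triangular (em A)"
      unfolding upper_triangular_def using col by (auto simp: em_def)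
    then have det: "det (em A) = prod_list (diag_mat (em A))" by (rule det_upper_triangular[OF _ em_carrier])
    have dim: "dim_row (em A) = n" by (simp add: em_def)
    have up: "[0..<n] = [0..<n'] @ [n']" by (simp add: n')
    have "diag_mat (em A) = map (\<lambda>i. em A $$ (i, i)) [0..<n'] @ [em A $$ (n', n')]"
      unfolding diag_mat_def dim up by simp
    also have "map (\<lambda>i. em A $$ (i, i)) [0..<n'] = map (\<lambda>i. e) [0..<n']"
      by (rule map_cong) (use col n' in auto)
    finally have "det (em A) = e ^ n' * em A $$ (n', n')"
      unfolding det by (simp add: map_replicate_const prod_list_replicate)
    then have "e = (e ^ n' * e) * em A $$ (n', n')" using dA by (simp add: algebra_simps)
    also have "\<dots> = em A $$ (n', n')" using e_S[OF em_S[OF m]] n' by (simp add: e_pow)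
    finally have "em A $$ (n - 1, n - 1) = e" using n' by simp
    then show "sact A (\<lambda>j. if j = n - 1 then e else 0) (n - 1) = e" using sact_eb[OF m, of "n - 1" "n - 1"] n' by simp
  qed
qed

end

section \<open>Integral closure over a complete discrete valuation ring\<close>

text \<open>\<open>A\<close> stands for the p-adic integers, \<open>K\<close> for their fraction
  field and \<open>F\<close> for a finite extension; the whole ideal generated by \<open>e\<close>
  is a field, the algebraic closure in the application. \<open>A_sep\<close> and
  \<open>A_complete\<close> are p-adic separatedness and completeness, and \<open>F_dim\<close>
  expresses finite degree by linear dependence.\<close>

locale dvr_ext =
  fixes e :: "'u::comm_ring_1" and p :: nat and A K F :: "'u set"
  assumes ee: "e * e = e" and e0: "e \<noteq> 0"
    and inv_ex: "\<And>x. e * x = x \<Longrightarrow> x \<noteq> 0 \<Longrightarrow> \<exists>y. x * y = e"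
    and AK: "A \<subseteq> K" and KF: "K \<subseteq> F" and FS: "\<And>x. x \<in> F \<Longrightarrow> e * x = x"
    and eA: "e \<in> A" and A_diff: "\<And>x y. x \<in> A \<Longrightarrow> y \<in> A \<Longrightarrow> x - y \<in> A"
    and A_mult: "\<And>x y. x \<in> A \<Longrightarrow> y \<in> A \<Longrightarrow> x * y \<in> A"
    and F_diff: "\<And>x y. x \<in> F \<Longrightarrow> y \<in> F \<Longrightarrow> x - y \<in> F"
    and F_mult: "\<And>x y. x \<in> F \<Longrightarrow> y \<in> F \<Longrightarrow> x * y \<in> F"
    and p_nz: "of_nat p * e \<noteq> 0" and p_nonunit: "\<And>b. b \<in> A \<Longrightarrow> of_nat p * b \<noteq> e"
    and A_unit_or: "\<And>a. a \<in> A \<Longrightarrow> (\<exists>b\<in>A. a * b = e) \<or> (\<exists>b\<in>A. a = of_nat p * b)"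
    and A_sep: "\<And>a. a \<in> A \<Longrightarrow> a \<noteq> 0 \<Longrightarrow> \<exists>n. \<forall>b\<in>A. a \<noteq> of_nat p ^ n * b"
    and A_res: "\<exists>C. finite C \<and> C \<subseteq> A \<and> (\<forall>a\<in>A. \<exists>c\<in>C. \<exists>b\<in>A. a = c + of_nat p * b)"
    and A_complete: "\<And>d :: nat \<Rightarrow> 'u. (\<And>m. d m \<in> A) \<Longrightarrow>
      \<exists>b\<in>A. \<forall>M. \<exists>c\<in>A. b = (\<Sum>m<M. of_nat p ^ m * d m) + of_nat p ^ M * c"
    and K_frac: "\<And>x. x \<in> K \<Longrightarrow> \<exists>n. of_nat p ^ n * x \<in> A"
    and F_dim: "\<exists>s. \<forall>x :: nat \<Rightarrow> 'u. (\<forall>i\<le>s. x i \<in> F) \<longrightarrow>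
      (\<exists>c. (\<forall>i\<le>s. c i \<in> K) \<and> (\<exists>i\<le>s. c i \<noteq> 0) \<and> (\<Sum>i\<le>s. c i * x i) = 0)"
begin

abbreviation \<pi> :: 'u where "\<pi> \<equiv> of_nat p"

definition S :: "'u set" where "S = {x. e * x = x}"

lemma F_S: "x \<in> F \<Longrightarrow> x \<in> S" using FS by (simp add: S_def)
lemma A_F: "x \<in> A \<Longrightarrow> x \<in> F" using AK KF by auto
lemma A_S: "x \<in> A \<Longrightarrow> x \<in> S" using A_F F_S by blast
lemma S_diff: "x \<in> S \<Longrightarrow> y \<in> S \<Longrightarrow> x - y \<in> S" by (simp add: S_def algebra_simps)
lemma S_add: "x \<in> S \<Longrightarrow> y \<in> S \<Longrightarrow> x + y \<in> S" by (simp add: S_def algebra_simps)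
lemma S_mult: "x \<in> S \<Longrightarrow> c * x \<in> S" by (simp add: S_def mult.left_commute)
lemma eS: "e \<in> S" by (simp add: S_def ee)
lemma e_S: "x \<in> S \<Longrightarrow> e * x = x" "x \<in> S \<Longrightarrow> x * e = x" by (simp_all add: S_def mult.commute)

lemma A_0: "0 \<in> A" using A_diff[OF eA eA] by simp
lemma A_add: "x \<in> A \<Longrightarrow> y \<in> A \<Longrightarrow> x + y \<in> A" using A_diff[of x "0 - y"] A_diff[OF A_0, of y] by simp
lemma A_uminus: "x \<in> A \<Longrightarrow> - x \<in> A" using A_diff[OF A_0, of x] by simp
lemma F_0: "0 \<in> F" using A_F A_0 by blast
lemma F_add: "x \<in> F \<Longrightarrow> y \<in> F \<Longrightarrow> x + y \<in> F" using F_diff[of x "0 - y"] F_diff[OF F_0, of y] by simp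
lemma A_of_nat: "x \<in> A \<Longrightarrow> of_nat m * x \<in> A"
  by (induction m) (simp_all add: A_0 A_add distrib_right)
lemma A_pow: "x \<in> A \<Longrightarrow> \<pi> ^ m * x \<in> A"
  by (induction m) (simp_all add: A_of_nat mult.assoc)

lemma S_no_zero_div: assumes "x \<in> S" "y \<in> S" "x * y = 0" shows "x = 0 \<or> y = 0"
proof (rule ccontr)
  assume nz: "\<not> (x = 0 \<or> y = 0)"
  then obtain z where z: "x * z = e" using inv_ex[of x] assms(1) by (auto simp: S_def)
  have "e * y = z * (x * y)" unfolding z[symmetric] by (simp only: ac_simps)
  then show False using assms e_S nz by simp
qed

lemma p_cancel: assumes "x \<in> S" "y \<in> S" "\<pi> ^ m * x = \<pi> ^ m * y" shows "x = y"
  using assms(3)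
proof (induction m)
  case (Suc m)
  have "(\<pi> * e) * (\<pi> ^ m * x - \<pi> ^ m * y) = e * (\<pi> ^ Suc m * x - \<pi> ^ Suc m * y)" by (simp add: algebra_simps)
  also have "\<dots> = 0" using Suc.prems by simp
  finally have "\<pi> ^ m * x - \<pi> ^ m * y = 0"
    using S_no_zero_div[of "\<pi> * e" "\<pi> ^ m * x - \<pi> ^ m * y"] p_nz
      S_mult[OF eS] S_diff[OF S_mult[OF assms(1)] S_mult[OF assms(2)]] by blast
  then show ?case using Suc.IH by simp
qed simp

subsection \<open>Finitely generated modules\<close>

definition submod :: "'u set \<Rightarrow> bool" where
  "submod N \<longleftrightarrow> 0 \<in> N \<and> (\<forall>x\<in>N. \<forall>y\<in>N. x + y \<in> N) \<and> (\<forall>a\<in>A. \<forall>x\<in>N. a * x \<in> N)"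

definition spn :: "('i \<Rightarrow> 'u) \<Rightarrow> 'i set \<Rightarrow> 'u set" where
  "spn f J = {y. \<exists>c. (\<forall>j. c j \<in> A) \<and> y = (\<Sum>j\<in>J. c j * f j)}"

lemma submodD:
  assumes "submod N"
  shows "0 \<in> N" "x \<in> N \<Longrightarrow> y \<in> N \<Longrightarrow> x + y \<in> N" "a \<in> A \<Longrightarrow> x \<in> N \<Longrightarrow> a * x \<in> N"
  using assms by (auto simp: submod_def)

lemma submod_diff: assumes N: "submod N" "N \<subseteq> S" and x: "x \<in> N" "y \<in> N" shows "x - y \<in> N"
proof -
  have "(- e) * y \<in> N" by (rule submodD(3)[OF N(1) A_uminus[OF eA] x(2)])
  then have "- y \<in> N" using e_S(1)[of y] N x by auto
  then show ?thesis using submodD(2)[OF N(1) x(1)] by force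
qed

lemma submod_sum: "submod N \<Longrightarrow> (\<And>j. j \<in> J \<Longrightarrow> f j \<in> N) \<Longrightarrow> sum f J \<in> N"
  by (induction J rule: infinite_finite_induct) (auto simp: submodD)

lemma spnI: "(\<And>j. c j \<in> A) \<Longrightarrow> (\<Sum>j\<in>J. c j * f j) \<in> spn f J"
  unfolding spn_def by blast

lemma spn_submod: "submod (spn f J)"
  unfolding submod_def
proof (intro conjI ballI)
  show "0 \<in> spn f J" using spnI[of "\<lambda>_. 0" f J] A_0 by simp
  fix x y assume "x \<in> spn f J" "y \<in> spn f J"
  then obtain c d where "\<And>j. c j \<in> A" "x = (\<Sum>j\<in>J. c j * f j)" "\<And>j. d j \<in> A" "y = (\<Sum>j\<in>J. d j * f j)"
    unfolding spn_def by blast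
  then show "x + y \<in> spn f J"
    using spnI[of "\<lambda>j. c j + d j" f J] A_add by (simp add: sum.distrib distrib_right)
next
  fix a x assume "a \<in> A" "x \<in> spn f J"
  then obtain c where "\<And>j. c j \<in> A" "x = (\<Sum>j\<in>J. c j * f j)" unfolding spn_def by blast
  then show "a * x \<in> spn f J"
    using spnI[of "\<lambda>j. a * c j" f J] A_mult \<open>a \<in> A\<close> by (simp add: sum_distrib_left mult.assoc)
qed

lemma spn_gen: assumes "finite J" "j \<in> J" "f j \<in> S" shows "f j \<in> spn f J"
proof -
  have "(\<Sum>i\<in>J. (if i = j then e else 0) * f i) = (\<Sum>i\<in>J. if i = j then e * f i else 0)"
    by (rule sum.cong) auto
  also have "\<dots> = f j" using assms by (simp add: e_S)
  finally show ?thesis using spnI[of "\<lambda>i. if i = j then e else 0" f J] eA A_0 by simp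
qed

lemma spn_least: "submod N \<Longrightarrow> (\<And>j. j \<in> J \<Longrightarrow> f j \<in> N) \<Longrightarrow> spn f J \<subseteq> N"
  unfolding spn_def by (auto intro!: submod_sum submodD(3))

lemma S_submod: "submod S" unfolding submod_def by (auto simp: S_add S_mult) (simp add: S_def)

lemma spn_S: "(\<And>j. j \<in> J \<Longrightarrow> f j \<in> S) \<Longrightarrow> spn f J \<subseteq> S" by (rule spn_least[OF S_submod])

lemma spn_insert:
  assumes "finite J" "i \<notin> J"
  shows "y \<in> spn f (insert i J) \<longleftrightarrow> (\<exists>a\<in>A. \<exists>z\<in>spn f J. y = a * f i + z)"
proof
  assume "y \<in> spn f (insert i J)"
  then obtain c where "\<And>j. c j \<in> A" "y = (\<Sum>j\<in>insert i J. c j * f j)" unfolding spn_def by blast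
  then show "\<exists>a\<in>A. \<exists>z\<in>spn f J. y = a * f i + z" using assms spnI[of c f J] by auto
next
  assume "\<exists>a\<in>A. \<exists>z\<in>spn f J. y = a * f i + z"
  then obtain a c where a: "a \<in> A" "\<And>j. c j \<in> A" "y = a * f i + (\<Sum>j\<in>J. c j * f j)" unfolding spn_def by blast
  have "(\<Sum>j\<in>insert i J. (c(i := a)) j * f j) = a * f i + (\<Sum>j\<in>J. (c(i := a)) j * f j)"
    using assms by simp
  also have "(\<Sum>j\<in>J. (c(i := a)) j * f j) = (\<Sum>j\<in>J. c j * f j)"
    by (rule sum.cong) (use assms in auto)
  finally show "y \<in> spn f (insert i J)" using spnI[of "c(i := a)" f "insert i J"] a by simp
qed

text \<open>The Noetherian property. Over a discrete valuation ring the coefficients at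
  \<open>f i\<close> of elements of \<open>N\<close> are multiples of one coefficient of least
  valuation. An element with that coefficient, together with generators of the part of
  \<open>N\<close> inside \<open>spn f J\<close>, generates \<open>N\<close>.\<close>

lemma submod_fg:
  assumes "finite J"
  shows "(\<And>j. j \<in> J \<Longrightarrow> f j \<in> S) \<Longrightarrow> submod N \<Longrightarrow> N \<subseteq> spn f J \<Longrightarrow>
    \<exists>(w :: nat \<Rightarrow> 'u) m. (\<forall>i<m. w i \<in> N) \<and> N = spn w {..<m}"
  using assms
proof (induction J arbitrary: N rule: finite_induct)
  case empty
  then have "N = {0}" using submodD(1) by (auto simp: spn_def)
  then have "N = spn w {..<0}" for w :: "nat \<Rightarrow> 'u" by (auto simp: spn_def A_0 intro: exI[of _ "\<lambda>_. 0"])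
  then show ?case by blast
next
  case (insert i J)
  note N = insert.prems(2,3)
  have fS: "f i \<in> S" "\<And>j. j \<in> J \<Longrightarrow> f j \<in> S" using insert.prems(1) by auto
  have NS: "N \<subseteq> S" using N(2) spn_S[of "insert i J" f] insert.prems(1) by blast
  define C where "C = {c \<in> A. \<exists>y\<in>spn f J. c * f i + y \<in> N}"
  have dec: "\<exists>c\<in>C. \<exists>y\<in>spn f J. x = c * f i + y" if "x \<in> N" for x
    using that N(2) spn_insert[OF insert.hyps(1,2), of x f] unfolding C_def by blast
  define N' where "N' = N \<inter> spn f J"
  have "submod N'" using N(1) spn_submod[of f J] unfolding submod_def N'_def by blast
  then obtain w :: "nat \<Rightarrow> 'u" and m where w: "\<And>i. i < m \<Longrightarrow> w i \<in> N'" "N' = spn w {..<m}"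
    using insert.IH[of N'] fS(2) unfolding N'_def by blast
  show ?case
  proof (cases "C \<subseteq> {0}")
    case True
    have "N \<subseteq> N'"
    proof
      fix x assume x: "x \<in> N"
      then obtain c y where "c \<in> C" "y \<in> spn f J" "x = c * f i + y" using dec by blast
      then show "x \<in> N'" using True x by (auto simp: N'_def)
    qed
    then have "N = N'" by (auto simp: N'_def)
    then show ?thesis using w by blast
  next
    case False
    \<comment> \<open>The least l with this property is the smallest valuation of a coefficient; it
      exists because \<open>A\<close> is separated.\<close>
    define Q where "Q l \<longleftrightarrow> (\<exists>c\<in>C. \<forall>b\<in>A. c \<noteq> \<pi> ^ Suc l * b)" for l
    have exQ: "\<exists>l. Q l"
    proof -
      obtain c where c: "c \<in> C" "c \<noteq> 0" using False by auto
      then obtain l where l: "\<forall>b\<in>A. c \<noteq> \<pi> ^ l * b" using A_sep[of c] by (auto simp: C_def)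
      have "c \<noteq> \<pi> ^ Suc l * b" if b: "b \<in> A" for b
      proof
        assume "c = \<pi> ^ Suc l * b"
        then have "c = \<pi> ^ l * (\<pi> * b)" by (simp add: mult.assoc mult.left_commute)
        then show False using l A_of_nat[OF b] by blast
      qed
      then show ?thesis using c unfolding Q_def by blast
    qed
    define l where "l = (LEAST l. Q l)"
    have "Q l" unfolding l_def using exQ by (rule LeastI_ex)
    then obtain c0 where c0: "c0 \<in> C" "\<And>b. b \<in> A \<Longrightarrow> c0 \<noteq> \<pi> ^ Suc l * b" unfolding Q_def by blast
    have div: "\<exists>b\<in>A. c = \<pi> ^ l * b" if c: "c \<in> C" for c
    proof (cases l)
      case 0
      then show ?thesis using c by (auto simp: C_def)
    next
      case (Suc l')
      then have "\<not> Q l'" using not_less_Least[of l' Q] unfolding l_def by auto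
      then show ?thesis using c Suc unfolding Q_def by blast
    qed
    obtain b0 where b0: "b0 \<in> A" "c0 = \<pi> ^ l * b0" using div[OF c0(1)] by blast
    have "\<not> (\<exists>b\<in>A. b0 = \<pi> * b)"
    proof
      assume "\<exists>b\<in>A. b0 = \<pi> * b"
      then obtain b where b: "b \<in> A" "b0 = \<pi> * b" by blast
      then have "c0 = \<pi> ^ Suc l * b" using b0 by (simp add: mult.assoc mult.left_commute)
      then show False using c0(2) b by blast
    qed
    then obtain u where u: "u \<in> A" "b0 * u = e" using A_unit_or[OF b0(1)] by blast
    obtain y0 where y0: "y0 \<in> spn f J" "c0 * f i + y0 \<in> N" using c0(1) by (auto simp: C_def)
    let ?x0 = "c0 * f i + y0"
    let ?w = "w(m := ?x0)"
    have wN: "\<forall>i<Suc m. ?w i \<in> N" using w(1) y0 by (auto simp: N'_def less_Suc_eq)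
    have "N \<subseteq> spn ?w {..<Suc m}"
    proof
      fix x assume x: "x \<in> N"
      then obtain c y where c: "c \<in> C" "y \<in> spn f J" "x = c * f i + y" using dec by blast
      obtain b where b: "b \<in> A" "c = \<pi> ^ l * b" using div[OF c(1)] by blast
      let ?a = "u * b"
      have a: "?a \<in> A" by (rule A_mult[OF u(1) b(1)])
      have "?a * c0 = \<pi> ^ l * (b * (b0 * u))" using b0 by (simp add: algebra_simps)
      also have "\<dots> = c" using u b e_S(2)[OF A_S[OF b(1)]] by simp
      finally have ac: "?a * c0 = c" .
      have "x - ?a * ?x0 = y - ?a * y0" unfolding c(3) ac[symmetric] by (simp add: algebra_simps)
      moreover have "y - ?a * y0 \<in> spn f J"
        by (rule submod_diff[OF spn_submod spn_S c(2) submodD(3)[OF spn_submod a y0(1)]]) (use fS in auto)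
      moreover have "x - ?a * ?x0 \<in> N"
        by (rule submod_diff[OF N(1) NS x submodD(3)[OF N(1) a y0(2)]])
      ultimately have "x - ?a * ?x0 \<in> spn w {..<m}" using w(2) by (auto simp: N'_def)
      moreover have "spn w {..<m} = spn ?w {..<m}" unfolding spn_def by auto
      ultimately have z: "x - ?a * ?x0 \<in> spn ?w {..<m}" by (simp only:)
      have "x = ?a * ?w m + (x - ?a * ?x0)" by simp
      moreover have "m \<notin> {..<m}" by simp
      ultimately show "x \<in> spn ?w {..<Suc m}"
        unfolding lessThan_Suc using spn_insert[of "{..<m}" m x ?w] a z finite_lessThan by blast
    qed
    moreover have "spn ?w {..<Suc m} \<subseteq> N"
      by (rule spn_least[OF N(1)]) (use wN in auto)
    ultimately show ?thesis using wN by blast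
  qed
qed

subsection \<open>Integral elements\<close>

text \<open>Powers inside the ideal: for exponent 0 the factor \<open>e\<close> replaces the ambient
  1, which need not belong to the ideal.\<close>

definition pw :: "'u \<Rightarrow> nat \<Rightarrow> 'u" where "pw x i = x ^ i * e"

definition integ :: "'u \<Rightarrow> bool" where
  "integ x \<longleftrightarrow> (\<exists>d. pw x d \<in> spn (pw x) {..<d})"

lemma pw_S: "pw x i \<in> S" unfolding pw_def by (rule S_mult[OF eS])
lemma pw_mult: "pw x i * pw x j = pw x (i + j)"
proof -
  have "pw x i * pw x j = x ^ i * x ^ j * (e * e)" unfolding pw_def by (simp only: ac_simps)
  then show ?thesis unfolding ee pw_def power_add .
qed
lemma pw_Suc: "x * pw x i = pw x (Suc i)" by (simp add: pw_def mult.assoc)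

text \<open>A Noetherian argument in place of Cayley-Hamilton: the spans of the first d powers of x
  increase inside a finitely generated module, their union is finitely generated by
  \<open>submod_fg\<close>, so some power lies in the span of the lower ones.\<close>

lemma integ_of_stable:
  assumes J: "finite J" and f: "\<And>j. j \<in> J \<Longrightarrow> f j \<in> S" and e: "e \<in> spn f J"
    and st: "\<And>y. y \<in> spn f J \<Longrightarrow> x * y \<in> spn f J"
  shows "integ x"
proof -
  have pwM: "pw x i \<in> spn f J" for i
  proof (induction i)
    case 0
    then show ?case using e by (simp add: pw_def)
  next
    case (Suc i)
    then show ?case using st pw_Suc by metis
  qed
  let ?N = "\<Union>d. spn (pw x) {..<d}"
  have mono: "spn (pw x) {..<d} \<subseteq> spn (pw x) {..<d'}" if "d \<le> d'" for d d'
    by (rule spn_least[OF spn_submod]) (use that pw_S in \<open>auto intro!: spn_gen\<close>)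
  have "submod ?N"
    unfolding submod_def
  proof (intro conjI ballI)
    show "0 \<in> ?N" using submodD(1)[OF spn_submod] by blast
    fix y z assume "y \<in> ?N" "z \<in> ?N"
    then obtain a b where "y \<in> spn (pw x) {..<a}" "z \<in> spn (pw x) {..<b}" by blast
    then have "y \<in> spn (pw x) {..<max a b}" "z \<in> spn (pw x) {..<max a b}"
      using mono[of a "max a b"] mono[of b "max a b"] by auto
    then show "y + z \<in> ?N" using submodD(2)[OF spn_submod] by blast
  next
    fix a z assume "a \<in> A" "z \<in> ?N"
    then show "a * z \<in> ?N" using submodD(3)[OF spn_submod] by blast
  qed
  moreover have "?N \<subseteq> spn f J"
    by (rule UN_least) (rule spn_least[OF spn_submod pwM])
  ultimately have "\<exists>(w :: nat \<Rightarrow> 'u) m. (\<forall>i<m. w i \<in> ?N) \<and> ?N = spn w {..<m}"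
    by (intro submod_fg[OF J f])
  then obtain w :: "nat \<Rightarrow> 'u" and m where wm: "(\<forall>i<m. w i \<in> ?N) \<and> ?N = spn w {..<m}"
    by (elim exE) (rule that)
  note w = conjunct1[OF wm, rule_format] conjunct2[OF wm]
  have "\<exists>D. w i \<in> spn (pw x) {..<D}" if "i < m" for i
    using w(1)[OF that] by (elim UN_E) (rule exI)
  then obtain D where D: "\<And>i. i < m \<Longrightarrow> w i \<in> spn (pw x) {..<D i}" by metis
  define d where "d = (\<Sum>i<m. D i)"
  have "D i \<le> d" if "i < m" for i unfolding d_def by (rule member_le_sum) (use that in auto)
  then have "?N \<subseteq> spn (pw x) {..<d}" unfolding w(2)
    using D mono by (intro spn_least[OF spn_submod]) blast
  moreover have "pw x d \<in> spn (pw x) {..<Suc d}" by (rule spn_gen) (auto simp: pw_S)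
  ultimately show ?thesis unfolding integ_def by blast
qed

lemma spn_mult_stable:
  assumes "\<And>j. j \<in> J \<Longrightarrow> x * f j \<in> spn f J" "y \<in> spn f J" shows "x * y \<in> spn f J"
proof -
  obtain c where c: "\<And>j. c j \<in> A" "y = (\<Sum>j\<in>J. c j * f j)" using assms(2) unfolding spn_def by blast
  have "x * y = (\<Sum>j\<in>J. c j * (x * f j))" unfolding c(2) by (simp add: sum_distrib_left mult.left_commute)
  also have "\<dots> \<in> spn f J" by (rule submod_sum[OF spn_submod]) (auto intro!: submodD(3)[OF spn_submod] c assms)
  finally show ?thesis .
qed

lemma pw_stable: assumes "pw x d \<in> spn (pw x) {..<d}" "y \<in> spn (pw x) {..<d}"
  shows "x * y \<in> spn (pw x) {..<d}"
proof (rule spn_mult_stable[OF _ assms(2)])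
  fix j assume j: "j \<in> {..<d}"
  show "x * pw x j \<in> spn (pw x) {..<d}"
  proof (cases "Suc j < d")
    case True
    then show ?thesis unfolding pw_Suc by (intro spn_gen) (auto simp: pw_S)
  next
    case False
    then have "Suc j = d" using j by auto
    then show ?thesis unfolding pw_Suc using assms by simp
  qed
qed

text \<open>Both elements stabilise the module generated by the finitely many products of powers of
  x and y, and therefore so do their sum, difference and product.\<close>

lemma integ_add_mult:
  assumes x: "x \<in> S" "integ x" and y: "y \<in> S" "integ y"
  shows "integ (x + y)" "integ (x - y)" "integ (x * y)"
proof -
  obtain d where d: "pw x d \<in> spn (pw x) {..<d}" using x by (auto simp: integ_def)
  obtain d' where d': "pw y d' \<in> spn (pw y) {..<d'}" using y by (auto simp: integ_def)
  let ?J = "{..<d} \<times> {..<d'}" and ?f = "\<lambda>(i, j). pw x i * pw y j"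
  have fS: "?f ij \<in> S" for ij by (auto simp: split_beta intro!: S_mult pw_S)
  have dpos: "0 < d" "0 < d'"
    using d d' e0 by (auto simp: spn_def pw_def intro!: gr0I)
  have sx: "x * z \<in> spn ?f ?J" if z: "z \<in> spn ?f ?J" for z
  proof (rule spn_mult_stable[OF _ z])
    fix ij assume "ij \<in> ?J"
    then obtain i j where ij: "ij = (i, j)" "i < d" "j < d'" by auto
    have "pw x i \<in> spn (pw x) {..<d}" by (rule spn_gen) (use ij pw_S in auto)
    then have "x * pw x i \<in> spn (pw x) {..<d}" by (rule pw_stable[OF d])
    then obtain c where c: "\<And>l. c l \<in> A" "x * pw x i = (\<Sum>l<d. c l * pw x l)" unfolding spn_def by blast
    have "x * ?f ij = (\<Sum>l<d. c l * ?f (l, j))"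
      unfolding ij(1) using c(2) by (simp add: mult.assoc[symmetric] sum_distrib_right)
    also have "\<dots> \<in> spn ?f ?J"
      by (rule submod_sum[OF spn_submod], rule submodD(3)[OF spn_submod c(1)], rule spn_gen)
         (use ij fS in auto)
    finally show "x * ?f ij \<in> spn ?f ?J" .
  qed
  have sy: "y * z \<in> spn ?f ?J" if z: "z \<in> spn ?f ?J" for z
  proof (rule spn_mult_stable[OF _ z])
    fix ij assume "ij \<in> ?J"
    then obtain i j where ij: "ij = (i, j)" "i < d" "j < d'" by auto
    have "pw y j \<in> spn (pw y) {..<d'}" by (rule spn_gen) (use ij pw_S in auto)
    then have "y * pw y j \<in> spn (pw y) {..<d'}" by (rule pw_stable[OF d'])
    then obtain c where c: "\<And>l. c l \<in> A" "y * pw y j = (\<Sum>l<d'. c l * pw y l)" unfolding spn_def by blast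
    have "y * ?f ij = pw x i * (y * pw y j)" unfolding ij(1) by (simp add: mult.left_commute)
    also have "\<dots> = (\<Sum>l<d'. c l * ?f (i, l))"
      unfolding c(2) by (simp add: sum_distrib_left mult.left_commute)
    also have "\<dots> \<in> spn ?f ?J"
      by (rule submod_sum[OF spn_submod], rule submodD(3)[OF spn_submod c(1)], rule spn_gen)
         (use ij fS in auto)
    finally show "y * ?f ij \<in> spn ?f ?J" .
  qed
  have "?f (0, 0) \<in> spn ?f ?J" by (rule spn_gen) (use dpos fS in auto)
  then have e: "e \<in> spn ?f ?J" by (simp add: pw_def ee)
  have SS: "spn ?f ?J \<subseteq> S" by (rule spn_S) (rule fS)
  note int = integ_of_stable[of ?J ?f, OF _ fS e]
  show "integ (x + y)"
    by (rule int) (simp_all add: distrib_right submodD(2)[OF spn_submod] sx sy)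
  show "integ (x - y)"
    by (rule int) (simp_all add: left_diff_distrib submod_diff[OF spn_submod SS] sx sy)
  show "integ (x * y)" by (rule int) (simp_all add: mult.assoc sx sy)
qed

lemma integ_A: assumes "a \<in> A" shows "integ a"
proof -
  have "pw a 1 = (\<Sum>j<1. a * pw a j)" using e_S[OF A_S[OF assms]] by (simp add: pw_def)
  then have "pw a 1 \<in> spn (pw a) {..<1}" using spnI[of "\<lambda>_. a" "pw a" "{..<1}"] assms by simp
  then show ?thesis unfolding integ_def by blast
qed

definition \<O> :: "'u set" where "\<O> = {x \<in> F. integ x}"

lemma O_closed: "x \<in> \<O> \<Longrightarrow> y \<in> \<O> \<Longrightarrow> x + y \<in> \<O>" "x \<in> \<O> \<Longrightarrow> y \<in> \<O> \<Longrightarrow> x - y \<in> \<O>"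
    "x \<in> \<O> \<Longrightarrow> y \<in> \<O> \<Longrightarrow> x * y \<in> \<O>"
  and A_O: "a \<in> A \<Longrightarrow> a \<in> \<O>" and O_F: "x \<in> \<O> \<Longrightarrow> x \<in> F" and O_S: "x \<in> \<O> \<Longrightarrow> x \<in> S"
  unfolding \<O>_def
  by (simp_all add: integ_add_mult F_S F_add F_diff F_mult A_F integ_A)

lemma O_0: "0 \<in> \<O>" by (rule A_O[OF A_0])
lemma O_submod: "submod \<O>" 
  unfolding submod_def by (simp add: O_0 O_closed(1) O_closed(3)[OF A_O])

text \<open>If \<open>\<pi> * b = e\<close>, multiplying the integral equation of b by
  \<open>\<pi> ^ d\<close> exhibits \<open>e\<close> as a multiple of \<open>\<pi>\<close> already
  in \<open>A\<close>.\<close>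

lemma O_p_nonunit: assumes b: "b \<in> \<O>" shows "\<pi> * b \<noteq> e"
proof
  assume pb: "\<pi> * b = e"
  obtain d where "pw b d \<in> spn (pw b) {..<d}" using b by (auto simp: \<O>_def integ_def)
  then obtain c where c: "\<And>j. c j \<in> A" "pw b d = (\<Sum>j<d. c j * pw b j)" unfolding spn_def by blast
  have pj: "\<pi> ^ j * pw b j = e" for j
  proof (induction j)
    case (Suc j)
    have "\<pi> ^ Suc j * pw b (Suc j) = (\<pi> * b) * (\<pi> ^ j * pw b j)" by (simp add: pw_def algebra_simps)
    then show ?case using Suc pb ee by simp
  qed (simp add: pw_def)
  have "e = (\<Sum>j<d. c j * (\<pi> ^ d * pw b j))"
    using pj[of d] unfolding c(2) by (simp add: sum_distrib_left mult.left_commute)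
  also have "\<dots> = (\<Sum>j<d. \<pi> * (\<pi> ^ (d - Suc j) * c j))"
  proof (rule sum.cong[OF refl])
    fix j assume "j \<in> {..<d}"
    then have d: "d = Suc (d - Suc j) + j" by simp
    have "\<pi> ^ d * pw b j = \<pi> * \<pi> ^ (d - Suc j) * (\<pi> ^ j * pw b j)"
      by (subst d, subst power_add) (simp add: mult.assoc)
    moreover have "c j * (\<pi> * \<pi> ^ (d - Suc j) * e) = \<pi> * (\<pi> ^ (d - Suc j) * (c j * e))"
      by (simp only: ac_simps)
    ultimately show "c j * (\<pi> ^ d * pw b j) = \<pi> * (\<pi> ^ (d - Suc j) * c j)"
      unfolding pj e_S(2)[OF A_S[OF c(1)]] by (simp only:)
  qed
  also have "\<dots> = \<pi> * (\<Sum>j<d. \<pi> ^ (d - Suc j) * c j)" by (simp add: sum_distrib_left)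
  finally have "\<pi> * (\<Sum>j<d. \<pi> ^ (d - Suc j) * c j) = e" by simp
  moreover have "submod A" unfolding submod_def using A_0 A_add A_mult by blast
  then have "(\<Sum>j<d. \<pi> ^ (d - Suc j) * c j) \<in> A" by (rule submod_sum) (rule A_pow[OF c(1)])
  ultimately show False using p_nonunit by blast
qed

subsection \<open>The integral closure is local\<close>

text \<open>This lemma and the next two carry finiteness modulo \<open>\<pi>\<close>, completeness
  and separatedness from \<open>A\<close> to finitely generated modules.\<close>

lemma spn_res:
  assumes "finite J"
  shows "(\<And>j. j \<in> J \<Longrightarrow> f j \<in> S) \<Longrightarrow>
    \<exists>C. finite C \<and> C \<subseteq> spn f J \<and> (\<forall>y\<in>spn f J. \<exists>c\<in>C. \<exists>b\<in>spn f J. y = c + \<pi> * b)"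
  using assms
proof (induction J rule: finite_induct)
  case empty
  have "spn f {} = {0}" by (auto simp: spn_def A_0 intro: exI[of _ "\<lambda>_. 0"])
  then show ?case by (intro exI[of _ "{0}"]) auto
next
  case (insert i J)
  obtain C where C: "finite C" "C \<subseteq> spn f J" "\<And>y. y \<in> spn f J \<Longrightarrow> \<exists>c\<in>C. \<exists>b\<in>spn f J. y = c + \<pi> * b"
  proof -
    have "\<exists>C. finite C \<and> C \<subseteq> spn f J \<and> (\<forall>y\<in>spn f J. \<exists>c\<in>C. \<exists>b\<in>spn f J. y = c + \<pi> * b)"
      by (rule insert.IH) (use insert.prems in simp)
    then show ?thesis by (elim exE conjE) (rule that, assumption, assumption, erule (1) bspec)
  qed
  obtain D where D: "finite D" "D \<subseteq> A" "\<And>a. a \<in> A \<Longrightarrow> \<exists>c\<in>D. \<exists>b\<in>A. a = c + \<pi> * b" using A_res by blast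
  note ins = spn_insert[OF insert.hyps(1,2), of _ f]
  let ?E = "(\<lambda>(d, c). d * f i + c) ` (D \<times> C)"
  show ?case
  proof (intro exI[of _ ?E] conjI ballI)
    show "finite ?E" using C D by simp
    show "?E \<subseteq> spn f (insert i J)"
    proof clarify
      fix d c assume "d \<in> D" "c \<in> C"
      then have "d \<in> A" "c \<in> spn f J" using C(2) D(2) by auto
      then show "d * f i + c \<in> spn f (insert i J)" unfolding ins by blast
    qed
    fix y assume "y \<in> spn f (insert i J)"
    then obtain a z where a: "a \<in> A" "z \<in> spn f J" "y = a * f i + z" using ins by blast
    obtain d b where d: "d \<in> D" "b \<in> A" "a = d + \<pi> * b" using D(3)[OF a(1)] by blast
    obtain c b' where c: "c \<in> C" "b' \<in> spn f J" "z = c + \<pi> * b'" using C(3)[OF a(2)] by blast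
    have "y = (d * f i + c) + \<pi> * (b * f i + b')" unfolding a(3) d(3) c(3) by (simp add: algebra_simps)
    moreover have "b * f i + b' \<in> spn f (insert i J)" using ins d(2) c(2) by blast
    moreover have "d * f i + c \<in> ?E" using d(1) c(1) by force
    ultimately show "\<exists>c\<in>?E. \<exists>b\<in>spn f (insert i J). y = c + \<pi> * b" by blast
  qed
qed

lemma spn_complete:
  assumes "finite J"
  shows "(\<And>m. d m \<in> spn f J) \<Longrightarrow>
    \<exists>b\<in>spn f J. \<forall>M. \<exists>c\<in>spn f J. b = (\<Sum>m<M. \<pi> ^ m * d m) + \<pi> ^ M * c"
  using assms
proof (induction J arbitrary: d rule: finite_induct)
  case empty
  then have "d m = 0" for m by (auto simp: spn_def)
  then show ?case by (auto intro!: bexI[of _ 0] simp: submodD(1)[OF spn_submod])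
next
  case (insert i J)
  note ins = spn_insert[OF insert.hyps(1,2), of _ f]
  have "\<forall>m. \<exists>a z. a \<in> A \<and> z \<in> spn f J \<and> d m = a * f i + z" using insert.prems ins by blast
  then obtain a z where az: "\<And>m. a m \<in> A" "\<And>m. z m \<in> spn f J" "\<And>m. d m = a m * f i + z m" by metis
  obtain b where b: "b \<in> A" "\<And>M. \<exists>c\<in>A. b = (\<Sum>m<M. \<pi> ^ m * a m) + \<pi> ^ M * c"
    using A_complete[of a, OF az(1)] by blast
  obtain y where y: "y \<in> spn f J" "\<And>M. \<exists>c\<in>spn f J. y = (\<Sum>m<M. \<pi> ^ m * z m) + \<pi> ^ M * c"
    using insert.IH[of z, OF az(2)] by blast
  show ?case
  proof (rule bexI[of _ "b * f i + y"], rule allI)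
    show "b * f i + y \<in> spn f (insert i J)" using ins b(1) y(1) by blast
    fix M
    obtain c where c: "c \<in> A" "b = (\<Sum>m<M. \<pi> ^ m * a m) + \<pi> ^ M * c" using b(2) by blast
    obtain c' where c': "c' \<in> spn f J" "y = (\<Sum>m<M. \<pi> ^ m * z m) + \<pi> ^ M * c'" using y(2) by blast
    have "(\<Sum>m<M. \<pi> ^ m * d m) = (\<Sum>m<M. \<pi> ^ m * a m) * f i + (\<Sum>m<M. \<pi> ^ m * z m)"
      unfolding az(3) sum_distrib_right sum.distrib[symmetric]
      by (rule sum.cong) (simp_all add: algebra_simps)
    then have "b * f i + y = (\<Sum>m<M. \<pi> ^ m * d m) + \<pi> ^ M * (c * f i + c')"
      by (simp add: c(2) c'(2) algebra_simps)
    moreover have "c * f i + c' \<in> spn f (insert i J)" using ins c(1) c'(1) by blast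
    ultimately show "\<exists>c\<in>spn f (insert i J). b * f i + y = (\<Sum>m<M. \<pi> ^ m * d m) + \<pi> ^ M * c" by blast
  qed
qed

text \<open>A Krull intersection argument. Writing y = \<open>\<pi> ^ M * b M\<close>, the modules
  generated by the \<open>b M\<close> increase and lie in a finitely generated one, so for some M
  the element \<open>b (Suc M)\<close> is a multiple of \<open>b M\<close> =
  \<open>\<pi> * b (Suc M)\<close>. Then a non-zero element e - \<open>\<pi>\<close> a annihilates
  it.\<close>

lemma spn_separated:
  assumes J: "finite J" and f: "\<And>j. j \<in> J \<Longrightarrow> f j \<in> S"
    and y: "\<And>M. \<exists>c\<in>spn f J. y = \<pi> ^ M * c"
  shows "y = 0"
proof -
  have SS: "spn f J \<subseteq> S" by (rule spn_S) (rule f)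
  obtain b where b: "\<And>M. b M \<in> spn f J" "\<And>M. y = \<pi> ^ M * b M" using y by metis
  have bS: "b M \<in> S" for M using b(1) SS by blast
  have step: "b M = \<pi> * b (Suc M)" for M
  proof (rule p_cancel[OF bS S_mult[OF bS]])
    have "\<pi> ^ M * (\<pi> * b (Suc M)) = \<pi> ^ Suc M * b (Suc M)" by (simp only: power_Suc ac_simps)
    then show "\<pi> ^ M * b M = \<pi> ^ M * (\<pi> * b (Suc M))" using b(2)[of M] b(2)[of "Suc M"] by (simp only:)
  qed
  have steps: "\<exists>a\<in>A. b M = a * b (M + m)" for M m
  proof (induction m)
    case 0
    then show ?case using eA e_S bS by (intro bexI[of _ e]) auto
  next
    case (Suc m)
    then obtain a where a: "a \<in> A" "b M = a * b (M + m)" by blast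
    have "b M = (\<pi> * a) * b (M + Suc m)" using a(2) step[of "M + m"] by (simp add: mult.assoc mult.left_commute)
    then show ?case using A_of_nat[OF a(1)] by blast
  qed
  let ?N = "{x. \<exists>M. \<exists>a\<in>A. x = a * b M}"
  have "submod ?N"
    unfolding submod_def
  proof (intro conjI ballI)
    show "0 \<in> ?N" using A_0 by force
    fix x z assume "x \<in> ?N" "z \<in> ?N"
    then obtain M M' a a' where h: "a \<in> A" "x = a * b M" "a' \<in> A" "z = a' * b M'" by blast
    obtain u where u: "u \<in> A" "b M = u * b (M + M')" using steps[of M M'] by blast
    obtain u' where u': "u' \<in> A" "b M' = u' * b (M + M')" using steps[of M' M] by (auto simp: add.commute)
    have "x + z = (a * u + a' * u') * b (M + M')" by (simp add: h u(2) u'(2) distrib_right mult.assoc)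
    moreover have "a * u + a' * u' \<in> A" using h u u' A_add A_mult by blast
    ultimately show "x + z \<in> ?N" by blast
  next
    fix a x assume "a \<in> A" "x \<in> ?N"
    then show "a * x \<in> ?N" using A_mult by (auto simp: mult.assoc[symmetric]) blast
  qed
  moreover have "?N \<subseteq> spn f J" using b(1) submodD(3)[OF spn_submod] by blast
  ultimately have "\<exists>(w :: nat \<Rightarrow> 'u) m. (\<forall>i<m. w i \<in> ?N) \<and> ?N = spn w {..<m}"
    by (intro submod_fg[OF J f])
  then obtain w :: "nat \<Rightarrow> 'u" and m where wm: "(\<forall>i<m. w i \<in> ?N) \<and> ?N = spn w {..<m}"
    by (elim exE) (rule that)
  note w = conjunct1[OF wm, rule_format] conjunct2[OF wm]
  have "\<forall>i. \<exists>M. i < m \<longrightarrow> (\<exists>a\<in>A. w i = a * b M)" using w(1) by blast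
  then obtain D where D: "\<And>i. i < m \<Longrightarrow> \<exists>a\<in>A. w i = a * b (D i)" by metis
  define M where "M = (\<Sum>i<m. D i)"
  have "\<exists>a\<in>A. w i = a * b M" if i: "i < m" for i
  proof -
    have "D i \<le> M" unfolding M_def by (rule member_le_sum) (use i in auto)
    then obtain u where "u \<in> A" "b (D i) = u * b M" using steps[of "D i" "M - D i"] by auto
    moreover obtain a where "a \<in> A" "w i = a * b (D i)" using D i by blast
    ultimately show ?thesis using A_mult by (metis mult.assoc)
  qed
  moreover have "submod {x. \<exists>a\<in>A. x = a * b M}"
    unfolding submod_def using A_0 A_add A_mult
    by (auto simp: distrib_right[symmetric] mult.assoc[symmetric]) (metis mult_zero_left)
  ultimately have "spn w {..<m} \<subseteq> {x. \<exists>a\<in>A. x = a * b M}" by (intro spn_least) auto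
  moreover have "b (Suc M) = e * b (Suc M)" using e_S(1)[OF bS] by simp
  then have "b (Suc M) \<in> ?N" using eA by blast
  ultimately obtain a where a: "a \<in> A" "b (Suc M) = a * b M" using w(2) by auto
  have "(e - \<pi> * a) * b (Suc M) = 0"
    using a(2) step[of M] e_S(1)[OF bS[of "Suc M"]] by (simp add: algebra_simps)
  moreover have "e - \<pi> * a \<noteq> 0" using p_nonunit[OF a(1)] by simp
  ultimately have "b (Suc M) = 0"
    using S_no_zero_div[OF S_diff[OF eS A_S[OF A_of_nat[OF a(1)]]] bS] by blast
  then show ?thesis using b(2)[of "Suc M"] by simp
qed

lemma spn_pw_mult:
  assumes d: "pw a d \<in> spn (pw a) {..<d}" and yz: "y \<in> spn (pw a) {..<d}" "z \<in> spn (pw a) {..<d}"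
  shows "y * z \<in> spn (pw a) {..<d}"
proof -
  have pz: "pw a i * z \<in> spn (pw a) {..<d}" for i
  proof (induction i)
    case 0
    have "z \<in> S" using yz(2) spn_S[of "{..<d}" "pw a"] pw_S by blast
    then have "pw a 0 * z = z" using e_S(1) by (simp add: pw_def)
    then show ?case using yz(2) by (simp only:)
  next
    case (Suc i)
    have "pw a (Suc i) * z = a * (pw a i * z)" by (simp add: pw_Suc[symmetric] mult.assoc)
    then show ?case using pw_stable[OF d Suc] by simp
  qed
  obtain c where c: "\<And>j. c j \<in> A" "y = (\<Sum>j<d. c j * pw a j)" using yz(1) unfolding spn_def by blast
  have "y * z = (\<Sum>j<d. c j * (pw a j * z))" unfolding c(2) by (simp add: sum_distrib_right mult.assoc)
  also have "\<dots> \<in> spn (pw a) {..<d}"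
    by (rule submod_sum[OF spn_submod]) (rule submodD(3)[OF spn_submod c(1) pz])
  finally show ?thesis .
qed

text \<open>Everything happens in B = A[a], a finitely generated module and hence complete and
  separated. A power of a is congruent modulo \<open>\<pi>\<close> to an idempotent, which in a
  field is 0 or \<open>e\<close>; accordingly \<open>e - a\<close> or a divides a unit.\<close>

lemma \<O>_local:
  assumes a: "a \<in> \<O>"
  shows "(\<exists>b\<in>\<O>. a * b = e) \<or> (\<exists>b\<in>\<O>. (e - a) * b = e)"
proof -
  obtain d where d: "pw a d \<in> spn (pw a) {..<d}" using a by (auto simp: \<O>_def integ_def)
  define B where "B = spn (pw a) {..<d}"
  have Bsub: "submod B" unfolding B_def by (rule spn_submod)
  have BS: "B \<subseteq> S" unfolding B_def by (rule spn_S) (rule pw_S)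
  have Bm: "y * z \<in> B" if "y \<in> B" "z \<in> B" for y z using spn_pw_mult[OF d] that unfolding B_def by blast
  have Ba: "y + z \<in> B" if "y \<in> B" "z \<in> B" for y z using submodD(2)[OF Bsub that] .
  have Bd: "y - z \<in> B" if "y \<in> B" "z \<in> B" for y z using submod_diff[OF Bsub BS that] .
  have pwB: "pw a i \<in> B" for i
  proof (induction i)
    case 0
    have "0 < d" using d e0 by (auto simp: spn_def pw_def intro!: gr0I)
    then show ?case unfolding B_def by (intro spn_gen) (auto simp: pw_S)
  next
    case (Suc i)
    then show ?case using pw_stable[OF d] pw_Suc unfolding B_def by metis
  qed
  have eB: "e \<in> B" using pwB[of 0] by (simp add: pw_def)
  have Bn: "of_nat m * y \<in> B" if "y \<in> B" for m y
    using submodD(3)[OF Bsub A_of_nat[OF eA, of m] that] that BS e_S by (auto simp: mult.assoc)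
  have Bp: "\<pi> ^ m * y \<in> B" if "y \<in> B" for m y using Bn[OF that, of "p ^ m"] by simp
  have pwO: "pw a i \<in> \<O>" for i
  proof (induction i)
    case 0
    then show ?case using A_O[OF eA] by (simp add: pw_def)
  next
    case (Suc i)
    then show ?case using O_closed(3)[OF a] pw_Suc by metis
  qed
  have BO: "B \<subseteq> \<O>" unfolding B_def by (rule spn_least[OF O_submod]) (rule pwO)
  have limit: "\<exists>b\<in>B. \<forall>M. \<exists>c\<in>B. b = (\<Sum>m<M. \<pi> ^ m * dd m) + \<pi> ^ M * c"
    if "\<And>m. dd m \<in> B" for dd :: "nat \<Rightarrow> 'u"
    using spn_complete[of "{..<d}" dd "pw a"] that unfolding B_def by blast
  have separated: "y = 0" if "\<And>M. \<exists>c\<in>B. y = \<pi> ^ M * c" for y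
    by (rule spn_separated[of "{..<d}" "pw a"]) (use that pw_S in \<open>auto simp: B_def\<close>)
  \<comment> \<open>Elements congruent to \<open>e\<close> modulo \<open>\<pi>\<close> are units:
    completeness gives the limit of the geometric series, and separatedness turns the approximate
    identity into an equality.\<close>
  have geometric: "\<exists>c\<in>B. (e - \<pi> * b) * c = e" if b: "b \<in> B" for b
  proof -
    have bp: "pw b m \<in> B" for m
    proof (induction m)
      case (Suc m)
      then show ?case using Bm[OF b] pw_Suc by metis
    qed (simp add: pw_def eB)
    obtain c where c: "c \<in> B" "\<And>M. \<exists>x\<in>B. c = (\<Sum>m<M. \<pi> ^ m * pw b m) + \<pi> ^ M * x"
      using limit[of "pw b"] bp by blast
    have "(e - \<pi> * b) * c - e = 0"
    proof (rule separated)
      fix M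
      obtain x where x: "x \<in> B" "c = (\<Sum>m<M. \<pi> ^ m * pw b m) + \<pi> ^ M * x" using c(2) by blast
      have tel: "(e - \<pi> * b) * (\<Sum>m<M. \<pi> ^ m * pw b m) = e - \<pi> ^ M * pw b M"
      proof (induction M)
        case (Suc M)
        have "(e - \<pi> * b) * (\<pi> ^ M * pw b M) = \<pi> ^ M * (e * pw b M) - \<pi> ^ Suc M * (b * pw b M)"
          by (simp add: algebra_simps)
        then show ?case using Suc e_S(1)[OF pw_S] by (simp add: distrib_left pw_Suc)
      qed (simp add: pw_def)
      have "(e - \<pi> * b) * c - e = \<pi> ^ M * ((e - \<pi> * b) * x - pw b M)"
        unfolding x(2) distrib_left tel by (simp add: algebra_simps)
      moreover have "(e - \<pi> * b) * x - pw b M \<in> B" 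
        by (rule Bd[OF Bm[OF Bd[OF eB Bn[OF b]] x(1)] bp])
      ultimately show "\<exists>c'\<in>B. (e - \<pi> * b) * c - e = \<pi> ^ M * c'" by blast
    qed
    then show ?thesis using c(1) by auto
  qed
  text \<open>By finiteness of \<open>B / \<pi> B\<close> some power of \<open>a\<close> is idempotent modulo \<open>\<pi>\<close>.\<close>
  obtain C where C: "finite C" "\<And>y. y \<in> B \<Longrightarrow> \<exists>c\<in>C. \<exists>b\<in>B. y = c + \<pi> * b"
    using spn_res[of "{..<d}" "pw a"] pw_S unfolding B_def by auto
  obtain r where r: "\<And>i. r i \<in> C" "\<And>i. \<exists>b\<in>B. pw a i = r i + \<pi> * b" using C(2)[OF pwB] by metis
  have "\<not> inj_on r UNIV"
  proof
    assume "inj_on r UNIV"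
    then have "infinite (range r)" using finite_imageD by blast
    then show False using r(1) C(1) finite_subset[of "range r" C] by blast
  qed
  then obtain i t where it: "r i = r (i + t)" "0 < t"
    unfolding inj_on_def by (metis UNIV_I less_imp_add_positive linorder_neqE_nat)
  define cng where "cng x y \<longleftrightarrow> (\<exists>b\<in>B. x - y = \<pi> * b)" for x y
  have cng_it: "cng (pw a i) (pw a (i + t))"
  proof -
    obtain b b' where "b \<in> B" "pw a i = r i + \<pi> * b" "b' \<in> B" "pw a (i + t) = r (i + t) + \<pi> * b'" using r(2) by metis
    then have "pw a i - pw a (i + t) = \<pi> * (b - b')" using it(1) by (simp add: algebra_simps)
    then show ?thesis unfolding cng_def using Bd \<open>b \<in> B\<close> \<open>b' \<in> B\<close> by blast
  qed
  have cng_trans: "cng x z" if xyz: "cng x y" "cng y z" for x y z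
  proof -
    obtain b b' where "b \<in> B" "x - y = \<pi> * b" "b' \<in> B" "y - z = \<pi> * b'" using xyz unfolding cng_def by blast
    then have "x - z = \<pi> * (b + b')" by (simp add: algebra_simps)
    then show ?thesis unfolding cng_def using Ba \<open>b \<in> B\<close> \<open>b' \<in> B\<close> by blast
  qed
  have cng_m: "cng (pw a (i + m)) (pw a (i + m + t))" for m
  proof -
    obtain b where b: "b \<in> B" "pw a i - pw a (i + t) = \<pi> * b" using cng_it unfolding cng_def by blast
    have "pw a (i + m) - pw a (i + m + t) = pw a m * (pw a i - pw a (i + t))"
      by (simp add: right_diff_distrib pw_mult ac_simps)
    also have "\<dots> = \<pi> * (pw a m * b)" unfolding b(2) by (simp add: mult.left_commute)
    finally show ?thesis unfolding cng_def using Bm[OF pwB b(1)] by blast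
  qed
  have cng_rt: "cng (pw a (i + m)) (pw a (i + m + l * t))" for m l
  proof (induction l)
    case 0
    show ?case unfolding cng_def using submodD(1)[OF Bsub] by (intro bexI[of _ 0]) auto
  next
    case (Suc l)
    have "cng (pw a (i + m + l * t)) (pw a (i + m + l * t + t))" using cng_m[of "m + l * t"] by (simp add: add.assoc)
    then show ?case using cng_trans[OF Suc] by (simp add: ac_simps)
  qed
  \<comment> \<open>A positive multiple of the period t that is at least i; from index i on the
    powers are periodic modulo \<open>\<pi>\<close>, so the powers with exponents N and 2 N
    agree.\<close>
  define N where "N = t * Suc i"
  have Ni: "i \<le> N" and N0: "0 < N" using it(2) by (auto simp: N_def intro: trans_le_add2)
  have "cng (pw a N) (pw a (N + N))"
    using cng_rt[of "N - i" "Suc i"] Ni by (simp add: N_def mult.commute)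
  then obtain b0 where b0: "b0 \<in> B" "pw a N - pw a N * pw a N = \<pi> * b0" unfolding cng_def pw_mult by blast
  text \<open>Newton's iteration \<open>x \<mapsto> 3x\<^sup>2 - 2x\<^sup>3\<close> lifts it to an idempotent of the field.\<close>
  define E where "E = rec_nat (pw a N) (\<lambda>_ x. 3 * (x * x) - 2 * (x * (x * x)))"
  have E0: "E 0 = pw a N" and ES: "E (Suc m) = 3 * (E m * E m) - 2 * (E m * (E m * E m))" for m by (simp_all add: E_def)
  have Einv: "E m \<in> B \<and> (\<exists>b\<in>B. E m * E m - E m = \<pi> ^ Suc m * b)" for m
  proof (induction m)
    case 0
    have eb: "- e * b0 = - b0" using e_S(1)[of b0] BS b0(1) by auto
    have "pw a N * pw a N - pw a N = - (\<pi> * b0)" unfolding b0(2)[symmetric] by simp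
    then have "E 0 * E 0 - E 0 = \<pi> ^ Suc 0 * (- e * b0)" unfolding E0 eb by simp
    moreover have "- e * b0 \<in> B" using submodD(3)[OF Bsub A_uminus[OF eA] b0(1)] .
    moreover have "E 0 \<in> B" unfolding E0 by (rule pwB)
    ultimately show ?case by blast
  next
    case (Suc m)
    then obtain b where b: "E m \<in> B" "b \<in> B" "E m * E m - E m = \<pi> ^ Suc m * b" by blast
    have nB: "3 * y \<in> B" "2 * y \<in> B" "4 * y \<in> B" if "y \<in> B" for y
      using Bn[OF that, of 3] Bn[OF that, of 2] Bn[OF that, of 4] by simp_all
    have 1: "E (Suc m) \<in> B" unfolding ES
      by (rule Bd[OF nB(1)[OF Bm[OF b(1) b(1)]] nB(2)[OF Bm[OF b(1) Bm[OF b(1) b(1)]]]])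
    define x where "x = E m"
    \<comment> \<open>The new defect contains the square of the old one; only one additional level
      per step is recorded, which is enough for convergence.\<close>
    have "E (Suc m) * E (Suc m) - E (Suc m) = (x * x - x) * (x * x - x) * (4 * (x * x - x) - 3)"
      unfolding ES x_def[symmetric] by (simp add: algebra_simps)
    also have "\<dots> = \<pi> ^ Suc (Suc m) * (\<pi> ^ m * (4 * (b * (b * (\<pi> ^ Suc m * b))) - 3 * (b * b)))"
      using b(3) unfolding x_def[symmetric] by (simp add: algebra_simps)
    finally have "E (Suc m) * E (Suc m) - E (Suc m) = \<pi> ^ Suc (Suc m) * (\<pi> ^ m * (4 * (b * (b * (\<pi> ^ Suc m * b))) - 3 * (b * b)))" .
    moreover have "\<pi> ^ m * (4 * (b * (b * (\<pi> ^ Suc m * b))) - 3 * (b * b)) \<in> B"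
      by (rule Bp[OF Bd[OF nB(3)[OF Bm[OF b(2) Bm[OF b(2) Bp[OF b(2)]]]] nB(1)[OF Bm[OF b(2) b(2)]]]])
    ultimately show ?case using 1 by blast
  qed
  have "\<exists>b\<in>B. E (Suc m) - E m = \<pi> ^ m * (\<pi> * b)" for m
  proof -
    obtain b where b: "E m \<in> B" "b \<in> B" "E m * E m - E m = \<pi> ^ Suc m * b" using Einv[of m] by blast
    have "E (Suc m) - E m = (E m * E m - E m) * (e - 2 * E m)"
    proof -
      have "E m \<in> S" "E m * E m \<in> S" using BS b(1) Bm[OF b(1) b(1)] by auto
      then have "e * E m = E m" "e * (E m * E m) = E m * E m" by (simp_all only: e_S(1))
      then show ?thesis by (simp add: ES algebra_simps)
    qed
    also have "\<dots> = \<pi> ^ m * (\<pi> * (b * (e - 2 * E m)))" unfolding b(3) by (simp add: algebra_simps)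
    finally have "E (Suc m) - E m = \<pi> ^ m * (\<pi> * (b * (e - 2 * E m)))" .
    moreover have "2 * E m \<in> B" using Bn[OF b(1), of 2] by simp
    then have "b * (e - 2 * E m) \<in> B" by (rule Bm[OF b(2) Bd[OF eB]])
    ultimately show ?thesis by blast
  qed
  then obtain g where g: "\<And>m. g m \<in> B" "\<And>m. E (Suc m) - E m = \<pi> ^ m * (\<pi> * g m)" by metis
  obtain L where L: "L \<in> B" "\<And>M. \<exists>c\<in>B. L = (\<Sum>m<M. \<pi> ^ m * (\<pi> * g m)) + \<pi> ^ M * c"
    using limit[of "\<lambda>m. \<pi> * g m"] Bn g(1) by blast
  have EM: "E M = E 0 + (\<Sum>m<M. \<pi> ^ m * (\<pi> * g m))" for M
  proof (induction M)
    case (Suc M)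
    have "E (Suc M) = E M + (E (Suc M) - E M)" by simp
    then show ?case unfolding g(2) using Suc by (simp add: add.assoc)
  qed simp
  \<comment> \<open>The limit of the iteration. As L turns out to be a multiple of
    \<open>\<pi>\<close>, it is congruent to \<open>pw a N\<close>.\<close>
  define \<epsilon> where "\<epsilon> = E 0 + L"
  have \<epsilon>B: "\<epsilon> \<in> B" unfolding \<epsilon>_def using Ba Einv L(1) by blast
  have "\<epsilon> * \<epsilon> - \<epsilon> = 0"
  proof (rule separated)
    fix M
    obtain c where c: "c \<in> B" "L = (\<Sum>m<M. \<pi> ^ m * (\<pi> * g m)) + \<pi> ^ M * c" using L(2) by blast
    have eps: "\<epsilon> = E M + \<pi> ^ M * c" unfolding \<epsilon>_def c(2) EM[of M] by (simp add: add.assoc)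
    obtain b where b: "b \<in> B" "E M * E M - E M = \<pi> ^ Suc M * b" using Einv[of M] by blast
    have "\<epsilon> * \<epsilon> - \<epsilon> = (E M * E M - E M) + \<pi> ^ M * (2 * (E M * c) + \<pi> ^ M * (c * c) - c)"
      unfolding eps by (simp add: algebra_simps)
    also have "\<dots> = \<pi> ^ M * (\<pi> * b + (2 * (E M * c) + \<pi> ^ M * (c * c) - c))"
      unfolding b(2) by (simp add: algebra_simps)
    finally have 1: "\<epsilon> * \<epsilon> - \<epsilon> = \<pi> ^ M * (\<pi> * b + (2 * (E M * c) + \<pi> ^ M * (c * c) - c))" .
    have EMB: "E M \<in> B" using Einv by blast
    have "2 * (E M * c) \<in> B" using Bn[OF Bm[OF EMB c(1)], of 2] by simp
    then have "\<pi> * b + (2 * (E M * c) + \<pi> ^ M * (c * c) - c) \<in> B"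
      by (rule Ba[OF Bn[OF b(1)] Bd[OF Ba[OF _ Bp[OF Bm[OF c(1) c(1)]]] c(1)]])
    then show "\<exists>c\<in>B. \<epsilon> * \<epsilon> - \<epsilon> = \<pi> ^ M * c" using 1 by blast
  qed
  then have "\<epsilon> * (\<epsilon> - e) = 0" using e_S(2)[of \<epsilon>] \<epsilon>B BS by (auto simp: algebra_simps)
  then have "\<epsilon> = 0 \<or> \<epsilon> - e = 0"
    using S_no_zero_div[of \<epsilon> "\<epsilon> - e"] \<epsilon>B BS S_diff[OF _ eS] by blast
  moreover have "\<exists>c\<in>B. L = \<pi> * c"
  proof -
    obtain c where "c \<in> B" "L = (\<Sum>m<1. \<pi> ^ m * (\<pi> * g m)) + \<pi> ^ 1 * c" using L(2) by blast
    then have "L = \<pi> * (g 0 + c)" by (simp add: algebra_simps)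
    then show ?thesis using Ba[OF g(1) \<open>c \<in> B\<close>] by blast
  qed
  then obtain c where c: "c \<in> B" "L = \<pi> * c" by blast
  ultimately consider "pw a N = \<pi> * (- c)" | "pw a N = e - \<pi> * c"
    unfolding \<epsilon>_def E0 by (auto simp: algebra_simps add_eq_0_iff)
  then show ?thesis
  proof cases
    case 1
    have mc: "- c \<in> B" using Bd[OF submodD(1)[OF Bsub] c(1)] by simp
    obtain u where u: "u \<in> B" "(e - \<pi> * (- c)) * u = e" using geometric[OF mc] by blast
    define s where "s = (\<Sum>i<N. pw a i)"
    have sB: "s \<in> B" unfolding s_def by (rule submod_sum[OF Bsub pwB])
    have tel: "(e - a) * (\<Sum>i<M. pw a i) = e - pw a M" for M
    proof (induction M)
      case (Suc M)
      have "(e - a) * pw a M = pw a M - pw a (Suc M)"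
        using e_S(1)[OF pw_S] by (simp add: left_diff_distrib pw_Suc)
      then show ?case using Suc by (simp add: distrib_left)
    qed (simp add: pw_def)
    have "(e - a) * (s * u) = (e - pw a N) * u" unfolding s_def mult.assoc[symmetric] tel ..
    also have "\<dots> = e" using u(2) unfolding 1 .
    finally show ?thesis using Bm[OF sB u(1)] BO by blast
  next
    case 2
    obtain u where u: "u \<in> B" "(e - \<pi> * c) * u = e" using geometric[OF c(1)] by blast
    have "pw a N = a * pw a (N - 1)" using N0 by (simp add: pw_Suc)
    then have "a * (pw a (N - 1) * u) = e" using u(2) unfolding 2[symmetric] by (simp add: mult.assoc)
    then show ?thesis using Bm[OF pwB u(1)] BO by blast
  qed
qed

text \<open>\<open>good x m\<close> says that the first m terms of x are linearly independent modulo
  \<open>\<pi>\<close>. Finite degree bounds the size of such families, and a maximal one spans the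
  integral closure modulo \<open>\<pi>\<close>, so that \<open>spn_res\<close> provides the
  representatives.\<close>

lemma \<O>_res:
  "\<exists>C. finite C \<and> C \<subseteq> \<O> \<and> (\<forall>y\<in>\<O>. \<exists>c\<in>C. \<exists>b\<in>\<O>. y = c + \<pi> * b)"
proof -
  define good where "good x m \<longleftrightarrow> (\<forall>i<m. x i \<in> \<O>) \<and>
    (\<forall>c. (\<forall>i. c i \<in> A) \<longrightarrow> (\<exists>b\<in>\<O>. (\<Sum>i<m. c i * x i) = \<pi> * b) \<longrightarrow> (\<forall>i<m. \<exists>b\<in>A. c i = \<pi> * b))"
    for x :: "nat \<Rightarrow> 'u" and m
  obtain s where s: "\<And>x :: nat \<Rightarrow> 'u. (\<And>i. i \<le> s \<Longrightarrow> x i \<in> F) \<Longrightarrow>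
      \<exists>c. (\<forall>i\<le>s. c i \<in> K) \<and> (\<exists>i\<le>s. c i \<noteq> 0) \<and> (\<Sum>i\<le>s. c i * x i) = 0"
    using F_dim by blast
  \<comment> \<open>A relation over \<open>K\<close> is scaled to coefficients in \<open>A\<close>.
    Independence modulo \<open>\<pi>\<close> allows it to be divided by \<open>\<pi>\<close> again
    and again, so a non-zero coefficient would violate separatedness.\<close>
  have not_good: "\<not> good x (Suc s)" for x
  proof
    assume good: "good x (Suc s)"
    then have xO: "x i \<in> \<O>" if "i \<le> s" for i using that by (auto simp: good_def)
    then obtain c where c: "\<And>i. i \<le> s \<Longrightarrow> c i \<in> K" "\<exists>i\<le>s. c i \<noteq> 0" "(\<Sum>i\<le>s. c i * x i) = 0"
      using s[of x] O_F by blast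
    have "\<forall>i. \<exists>n. i \<le> s \<longrightarrow> \<pi> ^ n * c i \<in> A" using K_frac c(1) by blast
    then obtain n where n: "\<And>i. i \<le> s \<Longrightarrow> \<pi> ^ n i * c i \<in> A" by metis
    define m where "m = (\<Sum>i\<le>s. n i)"
    define c' where "c' i = (if i \<le> s then \<pi> ^ m * c i else 0)" for i
    have c'A: "c' i \<in> A" for i
    proof (cases "i \<le> s")
      case True
      have "n i \<le> m" unfolding m_def by (rule member_le_sum) (use True in auto)
      then have "\<pi> ^ m * c i = \<pi> ^ (m - n i) * (\<pi> ^ n i * c i)"
        by (simp add: mult.assoc[symmetric] power_add[symmetric])
      then show ?thesis using A_pow[OF n[OF True]] True by (simp add: c'_def)
    qed (simp add: c'_def A_0)
    have rel: "(\<Sum>i<Suc s. c' i * x i) = 0"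
    proof -
      have "(\<Sum>i<Suc s. c' i * x i) = (\<Sum>i\<le>s. \<pi> ^ m * (c i * x i))"
        unfolding lessThan_Suc_atMost by (rule sum.cong) (auto simp: c'_def mult.assoc)
      then show ?thesis using c(3) by (simp add: sum_distrib_left[symmetric])
    qed
    have all_div: "\<exists>f. (\<forall>i. f i \<in> A) \<and> (\<forall>i. c' i = \<pi> ^ t * f i)" for t
    proof (induction t)
      case 0
      show ?case using c'A by (intro exI[of _ c']) simp
    next
      case (Suc t)
      then obtain f where f: "\<And>i. f i \<in> A" "\<And>i. c' i = \<pi> ^ t * f i" by blast
      have "\<pi> ^ t * (\<Sum>i<Suc s. f i * x i) = \<pi> ^ t * 0"
        using rel unfolding f(2) by (simp add: sum_distrib_left mult.assoc distrib_left del: sum.lessThan_Suc)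
      then have "(\<Sum>i<Suc s. f i * x i) = 0"
      proof (rule p_cancel[rotated 2])
        show "(\<Sum>i<Suc s. f i * x i) \<in> S"
          by (rule submod_sum[OF S_submod]) (use xO O_S S_mult in auto)
        show "0 \<in> S" using submodD(1)[OF S_submod] .
      qed
      then have "\<exists>b\<in>\<O>. (\<Sum>i<Suc s. f i * x i) = \<pi> * b" using O_0 by (intro bexI[of _ 0]) auto
      then have "\<forall>i<Suc s. \<exists>b\<in>A. f i = \<pi> * b" using good f(1) unfolding good_def by blast
      then obtain h where h: "\<And>i. i < Suc s \<Longrightarrow> h i \<in> A \<and> f i = \<pi> * h i" by metis
      define h' where "h' i = (if i < Suc s then h i else 0)" for i
      have "c' i = \<pi> ^ Suc t * h' i" for i
      proof (cases "i < Suc s")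
        case True
        then show ?thesis unfolding f(2) h'_def using h[OF True] by (simp add: mult.assoc mult.left_commute)
      qed (simp add: c'_def h'_def)
      moreover have "h' i \<in> A" for i using h A_0 by (simp add: h'_def)
      ultimately show ?case by blast
    qed
    obtain i where i: "i \<le> s" "c i \<noteq> 0" using c(2) by blast
    have ciS: "c i \<in> S" using c(1)[OF i(1)] KF F_S by blast
    have "c' i \<noteq> 0"
    proof
      assume "c' i = 0"
      then have "\<pi> ^ m * c i = \<pi> ^ m * 0" using i(1) by (simp add: c'_def)
      then show False using p_cancel[OF ciS submodD(1)[OF S_submod]] i(2) by blast
    qed
    then obtain t where "\<forall>b\<in>A. c' i \<noteq> \<pi> ^ t * b" using A_sep[OF c'A] by blast
    then show False using all_div[of t] by blast
  qed
  have "good x 0" for x by (simp add: good_def)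
  have "\<exists>m. (\<exists>x. good x m) \<and> \<not> (\<exists>x. good x (Suc m))"
  proof (rule ccontr)
    assume ne: "\<not> ?thesis"
    have "\<exists>x. good x m" for m
    proof (induction m)
      case 0
      show ?case using \<open>\<And>x. good x 0\<close> by blast
    next
      case (Suc m)
      then show ?case using ne by blast
    qed
    then show False using not_good by blast
  qed
  then obtain m x where x: "good x m" and nx: "\<And>x. \<not> good x (Suc m)" by blast
  have xO: "x i \<in> \<O>" if "i < m" for i using x that by (auto simp: good_def)
  \<comment> \<open>Adding y destroys independence. In the resulting relation the coefficient of y
    must be a unit, since otherwise the old family would already be dependent.\<close>
  have gen: "\<exists>u\<in>spn x {..<m}. \<exists>b\<in>\<O>. y = u + \<pi> * b" if y: "y \<in> \<O>" for y
  proof -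
    let ?x = "x(m := y)"
    have O': "\<forall>i<Suc m. ?x i \<in> \<O>" using xO y by (auto simp: less_Suc_eq)
    obtain c b i where c: "\<And>i. c i \<in> A" "b \<in> \<O>" "(\<Sum>i<Suc m. c i * ?x i) = \<pi> * b"
      and i: "i < Suc m" "\<not> (\<exists>b\<in>A. c i = \<pi> * b)"
      using nx[of ?x] O' unfolding good_def by blast
    have sum: "(\<Sum>i<m. c i * x i) + c m * y = \<pi> * b"
    proof -
      have "(\<Sum>i<m. c i * ?x i) = (\<Sum>i<m. c i * x i)" by (rule sum.cong) auto
      then show ?thesis using c(3) by simp
    qed
    have "\<not> (\<exists>b\<in>A. c m = \<pi> * b)"
    proof
      assume "\<exists>b\<in>A. c m = \<pi> * b"
      then obtain b' where b': "b' \<in> A" "c m = \<pi> * b'" by blast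
      have "(\<Sum>i<m. c i * x i) = \<pi> * (b - b' * y)" using sum b'(2) by (simp add: algebra_simps)
      moreover have "b - b' * y \<in> \<O>" using O_closed c(2) A_O[OF b'(1)] y by blast
      ultimately have "\<forall>i<m. \<exists>b\<in>A. c i = \<pi> * b" using x c(1) unfolding good_def by blast
      then show False using i b' by (auto simp: less_Suc_eq)
    qed
    then obtain u where u: "u \<in> A" "c m * u = e" using A_unit_or[OF c(1)] by blast
    have "y = u * (c m * y)" using u(2) e_S(1)[OF O_S[OF y]] by (simp add: mult.assoc[symmetric] mult.commute)
    also have "c m * y = \<pi> * b - (\<Sum>i<m. c i * x i)" using sum by (simp add: algebra_simps)
    finally have "y = (\<Sum>i<m. (- u * c i) * x i) + \<pi> * (u * b)"
      by (simp add: algebra_simps sum_distrib_left sum_negf)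
    moreover have "(\<Sum>i<m. (- u * c i) * x i) \<in> spn x {..<m}"
      by (rule spnI) (rule A_mult[OF A_uminus[OF u(1)] c(1)])
    moreover have "u * b \<in> \<O>" using O_closed(3) A_O u(1) c(2) by blast
    ultimately show ?thesis by blast
  qed
  obtain C where C: "finite C" "C \<subseteq> spn x {..<m}" "\<And>y. y \<in> spn x {..<m} \<Longrightarrow> \<exists>c\<in>C. \<exists>b\<in>spn x {..<m}. y = c + \<pi> * b"
    using spn_res[of "{..<m}" x] xO O_S by auto
  have sO: "spn x {..<m} \<subseteq> \<O>" by (rule spn_least[OF O_submod]) (use xO in auto)
  have "\<exists>c\<in>C. \<exists>b\<in>\<O>. y = c + \<pi> * b" if y: "y \<in> \<O>" for y
  proof -
    obtain u b where u: "u \<in> spn x {..<m}" "b \<in> \<O>" "y = u + \<pi> * b" using gen[OF y] by blast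
    obtain c b' where c: "c \<in> C" "b' \<in> spn x {..<m}" "u = c + \<pi> * b'" using C(3)[OF u(1)] by blast
    have "y = c + \<pi> * (b' + b)" unfolding u(3) c(3) by (simp add: algebra_simps)
    moreover have "b' + b \<in> \<O>" using O_closed(1) sO c(2) u(2) by blast
    ultimately show ?thesis using c(1) by blast
  qed
  then show ?thesis using C(1,2) sO by blast
qed

end

section \<open>The field of p-adic numbers\<close>

context
  fixes p :: nat
  assumes p: "prime p"
begin

interpretation C: cring "padic_Cauchy_ring p" by (rule padic_Cauchy_ring_is_cring[OF p])
interpretation N: ideal "padic_null p" "padic_Cauchy_ring p" by (rule padic_null_ideal[OF p])
interpretation Q: field "Qp p" by (rule Qp_is_field[OF p])

definition Qp_class :: "(nat \<Rightarrow> rat) \<Rightarrow> (nat \<Rightarrow> rat) set" where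
  "Qp_class x = padic_null p +>\<^bsub>padic_Cauchy_ring p\<^esub> x"

lemma real_p_gt_1: "1 < real p" using prime_gt_1_nat[OF p] by simp

lemma padic_Cauchy_ring_simps [simp]:
  "x \<in> carrier (padic_Cauchy_ring p) \<longleftrightarrow> padic_Cauchy p x"
  "x \<otimes>\<^bsub>padic_Cauchy_ring p\<^esub> y = (\<lambda>n. x n * y n)" "x \<oplus>\<^bsub>padic_Cauchy_ring p\<^esub> y = (\<lambda>n. x n + y n)"
  "\<one>\<^bsub>padic_Cauchy_ring p\<^esub> = (\<lambda>n. 1)" "\<zero>\<^bsub>padic_Cauchy_ring p\<^esub> = (\<lambda>n. 0)"
  by (simp_all add: padic_Cauchy_ring_def)

lemma Qp_class_hom: "Qp_class \<in> ring_hom (padic_Cauchy_ring p) (Qp p)"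
  using N.rcos_ring_hom unfolding Qp_def Qp_class_def[abs_def] .

lemma Qp_class_simps:
  assumes "padic_Cauchy p x" "padic_Cauchy p y"
  shows "Qp_class x \<in> carrier (Qp p)" "Qp_class x \<otimes>\<^bsub>Qp p\<^esub> Qp_class y = Qp_class (\<lambda>n. x n * y n)"
    "Qp_class x \<oplus>\<^bsub>Qp p\<^esub> Qp_class y = Qp_class (\<lambda>n. x n + y n)"
  using ring_hom_closed[OF Qp_class_hom, of x] ring_hom_mult[OF Qp_class_hom, of x y] ring_hom_add[OF Qp_class_hom, of x y] assms
  by simp_all

lemma Qp_class_one: "\<one>\<^bsub>Qp p\<^esub> = Qp_class (\<lambda>n. 1)" using ring_hom_one[OF Qp_class_hom] by simp

lemma Qp_class_ex: assumes "a \<in> carrier (Qp p)" obtains x where "padic_Cauchy p x" "a = Qp_class x"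
  using assms unfolding Qp_def FactRing_def A_RCOSETS_def' Qp_class_def by auto

text \<open>The representative chosen in \<open>Qp_abs\<close> differs from x by a null sequence, so
  by the reverse triangle inequality both sequences of absolute values have the same limit.\<close>

lemma Qp_abs_lim: assumes x: "padic_Cauchy p x" shows "(\<lambda>n. padic_abs p (x n)) \<longlonglongrightarrow> Qp_abs p (Qp_class x)"
proof -
  have "x \<in> Qp_class x" unfolding Qp_class_def by (rule N.a_rcos_self) (simp add: x)
  then have "(SOME y. y \<in> Qp_class x) \<in> Qp_class x" using someI[of "\<lambda>y. y \<in> Qp_class x"] by blast
  then obtain h where h: "h \<in> padic_null p" "(SOME y. y \<in> Qp_class x) = (\<lambda>n. h n + x n)"
    unfolding Qp_class_def a_r_coset_def' by auto
  have "Cauchy (\<lambda>n. padic_abs p (x n))"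
  proof (rule CauchyI)
    fix \<epsilon> :: real assume "0 < \<epsilon>"
    then obtain M where M: "\<forall>m\<ge>M. \<forall>n\<ge>M. padic_abs p (x m - x n) < \<epsilon>" using x unfolding padic_Cauchy_def by blast
    have "norm (padic_abs p (x m) - padic_abs p (x n)) < \<epsilon>" if "m \<ge> M" "n \<ge> M" for m n
      using padic_abs_diff[OF p, of "x m" "x n"] padic_abs_diff[OF p, of "x n" "x m"] M that
        padic_abs_minus_commute[of p "x m" "x n"] by (simp add: abs_less_iff) (smt (verit))
    then show "\<exists>M. \<forall>m\<ge>M. \<forall>n\<ge>M. norm (padic_abs p (x m) - padic_abs p (x n)) < \<epsilon>" by blast
  qed
  then obtain l where l: "(\<lambda>n. padic_abs p (x n)) \<longlonglongrightarrow> l"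
    using Cauchy_convergent convergent_def by blast
  have h0: "(\<lambda>n. padic_abs p (h n)) \<longlonglongrightarrow> 0" using h by (simp add: padic_null_def)
  have "(\<lambda>n. padic_abs p (h n + x n) - padic_abs p (x n)) \<longlonglongrightarrow> 0"
  proof (rule Lim_null_comparison[OF _ h0], rule always_eventually, rule allI)
    fix n
    show "norm (padic_abs p (h n + x n) - padic_abs p (x n)) \<le> padic_abs p (h n)"
      using padic_abs_diff[OF p, of "h n + x n" "x n"] padic_abs_diff[OF p, of "x n" "h n + x n"]
        padic_abs_minus_commute[of p "x n" "h n + x n"] by (simp add: abs_le_iff)
  qed
  then have "(\<lambda>n. padic_abs p (h n + x n)) \<longlonglongrightarrow> 0 + l"
    using tendsto_add[OF _ l] by fastforce
  then have "Qp_abs p (Qp_class x) = l" unfolding Qp_abs_def h(2) by (simp add: limI)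
  then show ?thesis using l by simp
qed

lemma Qp_abs_eqI: "padic_Cauchy p x \<Longrightarrow> (\<lambda>n. padic_abs p (x n)) \<longlonglongrightarrow> l \<Longrightarrow> Qp_abs p (Qp_class x) = l"
  using Qp_abs_lim LIMSEQ_unique by blast

lemma Qp_abs_nonneg: "a \<in> carrier (Qp p) \<Longrightarrow> 0 \<le> Qp_abs p a"
  by (erule Qp_class_ex) (auto intro!: LIMSEQ_le_const[OF Qp_abs_lim])

lemma Qp_abs_mult: "a \<in> carrier (Qp p) \<Longrightarrow> b \<in> carrier (Qp p) \<Longrightarrow> Qp_abs p (a \<otimes>\<^bsub>Qp p\<^esub> b) = Qp_abs p a * Qp_abs p b"
proof (elim Qp_class_ex)
  fix x y assume "padic_Cauchy p x" "a = Qp_class x" "padic_Cauchy p y" "b = Qp_class y"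
  then show ?thesis
    using tendsto_mult[OF Qp_abs_lim[of x] Qp_abs_lim[of y]]
    by (simp add: Qp_class_simps) (rule Qp_abs_eqI, auto simp: padic_abs_mult[OF p] intro: padic_Cauchy_mult[OF p])
qed

lemma Qp_abs_add: "a \<in> carrier (Qp p) \<Longrightarrow> b \<in> carrier (Qp p) \<Longrightarrow>
    Qp_abs p (a \<oplus>\<^bsub>Qp p\<^esub> b) \<le> max (Qp_abs p a) (Qp_abs p b)"
proof (elim Qp_class_ex)
  fix x y assume h: "padic_Cauchy p x" "a = Qp_class x" "padic_Cauchy p y" "b = Qp_class y"
  have "Qp_abs p (Qp_class (\<lambda>n. x n + y n)) \<le> max (Qp_abs p (Qp_class x)) (Qp_abs p (Qp_class y))"
    by (rule LIMSEQ_le[OF Qp_abs_lim[OF padic_Cauchy_add[OF p h(1,3)]] tendsto_max[OF Qp_abs_lim[OF h(1)] Qp_abs_lim[OF h(3)]]])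
       (auto intro: padic_abs_add[OF p])
  then show ?thesis using h by (simp add: Qp_class_simps)
qed

lemma Qp_abs_const: "Qp_abs p (Qp_class (\<lambda>n. q)) = padic_abs p q"
  by (rule Qp_abs_eqI) (auto simp: padic_Cauchy_const)

lemma Qp_abs_one: "Qp_abs p \<one>\<^bsub>Qp p\<^esub> = 1" unfolding Qp_class_one Qp_abs_const using p by simp

lemma Qp_abs_uminus: assumes "a \<in> carrier (Qp p)" shows "Qp_abs p (\<ominus>\<^bsub>Qp p\<^esub> a) = Qp_abs p a"
proof -
  have "Qp_abs p (\<ominus>\<^bsub>Qp p\<^esub> a) ^ 2 = Qp_abs p a ^ 2"
    using Qp_abs_mult[OF Q.a_inv_closed[OF assms] Q.a_inv_closed[OF assms]] Qp_abs_mult[OF assms assms] assms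
    by (simp add: power2_eq_square Q.l_minus Q.r_minus)
  then show ?thesis using Qp_abs_nonneg assms by (simp add: power2_eq_iff_nonneg)
qed

lemma Qp_abs_0: assumes "a \<in> carrier (Qp p)" shows "Qp_abs p a = 0 \<longleftrightarrow> a = \<zero>\<^bsub>Qp p\<^esub>"
proof
  assume a0: "Qp_abs p a = 0"
  show "a = \<zero>\<^bsub>Qp p\<^esub>"
  proof (rule ccontr)
    assume "a \<noteq> \<zero>\<^bsub>Qp p\<^esub>"
    then have "a \<in> Units (Qp p)" using assms Q.field_Units by auto
    then have "Qp_abs p (a \<otimes>\<^bsub>Qp p\<^esub> inv\<^bsub>Qp p\<^esub> a) = 1" using Qp_abs_one by simp
    then show False using Qp_abs_mult[OF assms Q.Units_inv_closed[OF \<open>a \<in> Units (Qp p)\<close>]] a0 by simp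
  qed
next
  assume "a = \<zero>\<^bsub>Qp p\<^esub>"
  have "\<zero>\<^bsub>Qp p\<^esub> = Qp_class (\<lambda>n. 0)"
    using ring_hom_zero[OF Qp_class_hom C.ring_axioms Q.ring_axioms] by simp
  then show "Qp_abs p a = 0" using Qp_abs_const[of 0] \<open>a = \<zero>\<^bsub>Qp p\<^esub>\<close> by simp
qed

abbreviation pQ where "pQ \<equiv> [p] \<cdot>\<^bsub>Qp p\<^esub> \<one>\<^bsub>Qp p\<^esub>"

lemma Qp_of_nat: "[(m::nat)] \<cdot>\<^bsub>Qp p\<^esub> \<one>\<^bsub>Qp p\<^esub> = Qp_class (\<lambda>n. of_nat m)"
proof (induction m)
  case 0
  then show ?case using ring_hom_zero[OF Qp_class_hom C.ring_axioms Q.ring_axioms] by simp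
next
  case (Suc m)
  then show ?case using Qp_class_simps(3)[OF padic_Cauchy_const padic_Cauchy_const, of "of_nat m" 1]
    by (simp add: Qp_class_one add.commute)
qed

lemma padic_abs_p: "padic_abs p (of_nat p) = 1 / real p"
proof -
  have "padic_abs p (of_int (int p) / of_int 1) = real p powi (int (multiplicity (int p) 1) - int (multiplicity (int p) (int p)))"
    by (rule padic_abs_of_frac[OF p]) (use prime_gt_0_nat[OF p] in auto)
  moreover have "\<not> is_unit (int p)" using p not_prime_unit[of "int p"] by auto
  then have "multiplicity (int p) (int p) = 1" using prime_gt_0_nat[OF p] by (intro multiplicity_self) auto
  ultimately show ?thesis by (simp add: power_int_minus divide_inverse)
qed

lemma Qp_p_closed [simp]: "pQ \<in> carrier (Qp p)" by simp
lemma Qp_abs_p: "Qp_abs p pQ = 1 / real p" unfolding Qp_of_nat Qp_abs_const padic_abs_p ..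
lemma Qp_abs_p_pow: "Qp_abs p (pQ [^]\<^bsub>Qp p\<^esub> (m::nat)) = 1 / real p ^ m"
  by (induction m) (simp_all add: Qp_abs_one Qp_abs_mult Qp_abs_p)

lemma Qp_p_pow_nz: "pQ [^]\<^bsub>Qp p\<^esub> (m::nat) \<noteq> \<zero>\<^bsub>Qp p\<^esub>"
  using Qp_abs_0[of "pQ [^]\<^bsub>Qp p\<^esub> m"] Qp_abs_p_pow[of m] real_p_gt_1 by auto

lemma Qp_divide_p:
  assumes a: "a \<in> carrier (Qp p)" "Qp_abs p a \<le> 1 / real p ^ m"
  shows "\<exists>c\<in>Zp p. a = pQ [^]\<^bsub>Qp p\<^esub> m \<otimes>\<^bsub>Qp p\<^esub> c"
proof -
  let ?u = "pQ [^]\<^bsub>Qp p\<^esub> m"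
  have u: "?u \<in> Units (Qp p)" using Qp_p_pow_nz Q.field_Units by simp
  let ?c = "inv\<^bsub>Qp p\<^esub> ?u \<otimes>\<^bsub>Qp p\<^esub> a"
  have c: "?c \<in> carrier (Qp p)" using u a by simp
  have "?u \<otimes>\<^bsub>Qp p\<^esub> ?c = a" using u a by (simp add: Q.m_assoc[symmetric])
  moreover from this have "Qp_abs p ?c \<le> 1"
    using Qp_abs_mult[OF _ c, of ?u] a(2) real_p_gt_1 by (simp add: Qp_abs_p_pow field_simps)
  ultimately show ?thesis using c by (auto simp: Zp_def)
qed

lemma Zp_carrier: "a \<in> Zp p \<Longrightarrow> a \<in> carrier (Qp p)" by (simp add: Zp_def)
lemma Zp_one: "\<one>\<^bsub>Qp p\<^esub> \<in> Zp p" by (simp add: Zp_def Qp_abs_one)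
lemma Zp_mult: "a \<in> Zp p \<Longrightarrow> b \<in> Zp p \<Longrightarrow> a \<otimes>\<^bsub>Qp p\<^esub> b \<in> Zp p"
  using Qp_abs_nonneg by (simp add: Zp_def Qp_abs_mult mult_le_one)
lemma Zp_diff: "a \<in> Zp p \<Longrightarrow> b \<in> Zp p \<Longrightarrow> a \<ominus>\<^bsub>Qp p\<^esub> b \<in> Zp p"
  using Qp_abs_add[of a "\<ominus>\<^bsub>Qp p\<^esub> b"] Qp_abs_uminus by (auto simp: Zp_def a_minus_def max_def split: if_splits)

lemma Zp_p_nonunit: assumes "b \<in> Zp p" shows "pQ \<otimes>\<^bsub>Qp p\<^esub> b \<noteq> \<one>\<^bsub>Qp p\<^esub>"
proof
  assume "pQ \<otimes>\<^bsub>Qp p\<^esub> b = \<one>\<^bsub>Qp p\<^esub>"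
  then have "1 / real p * Qp_abs p b = 1" using Qp_abs_mult[of pQ b] assms Qp_abs_one Qp_abs_p by (simp add: Zp_def)
  then show False using assms real_p_gt_1 by (simp add: Zp_def field_simps)
qed

text \<open>Non-zero absolute values are integral powers of p, so the next one below p^m is
  p^(m-1).\<close>

lemma padic_abs_discrete:
  assumes "padic_abs p q < real p ^ m" shows "padic_abs p q \<le> real p ^ m / real p"
proof (cases "q = 0")
  case False
  define t where "t = int (multiplicity (int p) (snd (quotient_of q))) - int (multiplicity (int p) (fst (quotient_of q)))"
  have eq: "padic_abs p q = real p powi t" using False by (simp add: padic_abs_def t_def)
  have "real p powi t < real p powi (int m)" using assms eq by simp
  then have "t < int m" using real_p_gt_1 power_int_increasing[of "int m" t "real p"] by force
  then have "real p powi t \<le> real p powi (int m - 1)" using real_p_gt_1 by (intro power_int_increasing) auto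
  also have "\<dots> = real p ^ m / real p" using real_p_gt_1 by (simp add: power_int_diff)
  finally show ?thesis unfolding eq .
qed (use real_p_gt_1 in simp)

lemma Qp_abs_discrete: assumes "a \<in> carrier (Qp p)" "Qp_abs p a < 1" shows "Qp_abs p a \<le> 1 / real p"
proof -
  obtain x where x: "padic_Cauchy p x" "a = Qp_class x" using Qp_class_ex[OF assms(1)] by blast
  have "\<forall>\<^sub>F n in sequentially. padic_abs p (x n) < 1"
    using order_tendstoD(2)[OF Qp_abs_lim[OF x(1)]] assms(2) x(2) by simp
  then have "\<forall>\<^sub>F n in sequentially. padic_abs p (x n) \<le> 1 / real p"
    by (rule eventually_mono) (use padic_abs_discrete[of _ 0] in simp)
  then show ?thesis unfolding x(2) by (rule tendsto_upperbound[OF Qp_abs_lim[OF x(1)]]) simp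
qed

lemma Zp_unit_or: assumes a: "a \<in> Zp p"
  shows "(\<exists>b\<in>Zp p. a \<otimes>\<^bsub>Qp p\<^esub> b = \<one>\<^bsub>Qp p\<^esub>) \<or> (\<exists>b\<in>Zp p. a = pQ \<otimes>\<^bsub>Qp p\<^esub> b)"
proof (cases "Qp_abs p a < 1")
  case True
  then show ?thesis using Qp_abs_discrete[of a] Qp_divide_p[of a 1] a by (simp add: Zp_def)
next
  case False
  then have a1: "Qp_abs p a = 1" and ac: "a \<in> carrier (Qp p)" using a by (auto simp: Zp_def)
  have "a \<noteq> \<zero>\<^bsub>Qp p\<^esub>" using Qp_abs_0[OF ac] a1 by linarith
  then have u: "a \<in> Units (Qp p)" using Q.field_Units ac by simp
  then have "Qp_abs p a * Qp_abs p (inv\<^bsub>Qp p\<^esub> a) = 1" using Qp_abs_mult[OF ac, of "inv\<^bsub>Qp p\<^esub> a"] Qp_abs_one by simp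
  then have "inv\<^bsub>Qp p\<^esub> a \<in> Zp p" using a1 u by (simp add: Zp_def)
  then show ?thesis using Q.Units_r_inv[OF u] by blast
qed

lemma Qp_frac: assumes "x \<in> carrier (Qp p)" shows "\<exists>n. pQ [^]\<^bsub>Qp p\<^esub> (n::nat) \<otimes>\<^bsub>Qp p\<^esub> x \<in> Zp p"
proof -
  obtain n where "Qp_abs p x < real p ^ n" using real_arch_pow[OF real_p_gt_1] by blast
  then have "1 / real p ^ n * Qp_abs p x \<le> 1" using real_p_gt_1 by (simp add: field_simps)
  then show ?thesis using assms by (intro exI[of _ n]) (simp add: Zp_def Qp_abs_mult Qp_abs_p_pow)
qed

lemma Zp_sep: assumes "a \<in> Zp p" "a \<noteq> \<zero>\<^bsub>Qp p\<^esub>"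
  shows "\<exists>n. \<forall>b\<in>Zp p. a \<noteq> pQ [^]\<^bsub>Qp p\<^esub> (n::nat) \<otimes>\<^bsub>Qp p\<^esub> b"
proof -
  have ac: "a \<in> carrier (Qp p)" using assms by (simp add: Zp_def)
  then have pos: "0 < Qp_abs p a" using Qp_abs_nonneg[OF ac] Qp_abs_0[OF ac] assms(2) by linarith
  obtain n where n: "1 / Qp_abs p a < real p ^ n" using real_arch_pow[OF real_p_gt_1] by blast
  have "a \<noteq> pQ [^]\<^bsub>Qp p\<^esub> n \<otimes>\<^bsub>Qp p\<^esub> b" if b: "b \<in> Zp p" for b
  proof
    assume "a = pQ [^]\<^bsub>Qp p\<^esub> n \<otimes>\<^bsub>Qp p\<^esub> b"
    then have "Qp_abs p a = 1 / real p ^ n * Qp_abs p b" using b by (simp add: Qp_abs_mult Qp_abs_p_pow Zp_def)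
    also have "\<dots> \<le> 1 / real p ^ n * 1" using b by (intro mult_left_mono) (auto simp: Zp_def)
    finally show False using n pos real_p_gt_1 by (simp add: field_simps)
  qed
  then show ?thesis by blast
qed

text \<open>Density of the rationals: a sufficiently late term of a Cauchy sequence, taken as a
  constant, is close to its class.\<close>

lemma Qp_approx: assumes a: "a \<in> carrier (Qp p)" and "0 < \<epsilon>"
  obtains q where "Qp_abs p (a \<ominus>\<^bsub>Qp p\<^esub> Qp_class (\<lambda>n. q)) \<le> \<epsilon>"
proof -
  obtain x where x: "padic_Cauchy p x" "a = Qp_class x" using Qp_class_ex[OF a] by blast
  obtain M where M: "\<forall>m\<ge>M. \<forall>n\<ge>M. padic_abs p (x m - x n) < \<epsilon>" using x(1) \<open>0 < \<epsilon>\<close> unfolding padic_Cauchy_def by blast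
  have minus: "\<ominus>\<^bsub>Qp p\<^esub> Qp_class (\<lambda>n. x M) = Qp_class (\<lambda>n. - x M)"
    by (rule Q.minus_equality)
       (use Qp_class_simps[OF padic_Cauchy_const padic_Cauchy_const] ring_hom_zero[OF Qp_class_hom C.ring_axioms Q.ring_axioms] in simp_all)
  have "a \<ominus>\<^bsub>Qp p\<^esub> Qp_class (\<lambda>n. x M) = Qp_class (\<lambda>n. x n + - x M)"
    unfolding a_minus_def minus x(2) using Qp_class_simps(3)[OF x(1) padic_Cauchy_const[of p "- x M"]] .
  moreover have "Qp_abs p (Qp_class (\<lambda>n. x n + - x M)) \<le> \<epsilon>"
    by (rule tendsto_upperbound[OF Qp_abs_lim[OF padic_Cauchy_add[OF p x(1) padic_Cauchy_const]]])
       (auto simp: eventually_sequentially intro!: exI[of _ M] less_imp_le M[rule_format])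
  ultimately show ?thesis using that[of "x M"] by metis
qed

lemma Qp_class_diff: assumes "padic_Cauchy p x" "padic_Cauchy p y"
  shows "Qp_class x \<ominus>\<^bsub>Qp p\<^esub> Qp_class y = Qp_class (\<lambda>n. x n - y n)"
proof -
  have "\<ominus>\<^bsub>Qp p\<^esub> Qp_class y = Qp_class (\<lambda>n. - y n)"
    by (rule Q.minus_equality)
       (use assms Qp_class_simps[OF padic_Cauchy_uminus[OF assms(2)] assms(2)] Qp_class_simps(1)[OF assms(2) assms(2)]
         Qp_class_simps(1)[OF padic_Cauchy_uminus[OF assms(2)] assms(2)]
         ring_hom_zero[OF Qp_class_hom C.ring_axioms Q.ring_axioms] in simp_all)
  then show ?thesis unfolding a_minus_def using Qp_class_simps(3)[OF assms(1) padic_Cauchy_uminus[OF assms(2)]] by simp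
qed

lemma padic_residue: assumes "padic_abs p q \<le> 1" obtains c where "c < p" "padic_abs p (q - of_nat c) < 1"
proof (cases "q = 0")
  case True
  then show ?thesis using that[of 0] prime_gt_0_nat[OF p] by simp
next
  case False
  obtain u v where uv: "quotient_of q = (u, v)" by (cases "quotient_of q")
  have v: "v > 0" and q: "q = of_int u / of_int v" and cop: "coprime u v"
    using quotient_of_denom_pos[OF uv] quotient_of_div[OF uv] quotient_of_coprime[OF uv] by auto
  have u0: "u \<noteq> 0" using False q by auto
  have pu: "\<not> is_unit (int p)" using p not_prime_unit[of "int p"] by auto
  have pv: "\<not> int p dvd v"
  proof
    assume dv: "int p dvd v"
    then have "\<not> int p dvd u" using cop pu by (meson coprime_common_divisor)
    then have "multiplicity (int p) u = 0" by (rule not_dvd_imp_multiplicity_0)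
    moreover have "1 \<le> multiplicity (int p) v" using dv v pu by (intro multiplicity_geI) auto
    ultimately have "padic_abs p q = real p ^ multiplicity (int p) v"
      using padic_abs_of_frac[OF p, of u v] u0 v by (simp add: q)
    moreover have "real p ^ 1 \<le> real p ^ multiplicity (int p) v"
      by (rule power_increasing) (use \<open>1 \<le> multiplicity (int p) v\<close> real_p_gt_1 in auto)
    ultimately show False using assms real_p_gt_1 unfolding power_one_right by linarith
  qed
  have "coprime v (int p)" using pv p by (metis coprime_commute prime_imp_coprime prime_int_nat_transfer nat_int of_nat_0_le_iff)
  then obtain a b where ab: "a * v + b * int p = 1" using bezout_int[of v "int p"] coprime_iff_gcd_eq_1 by metis
  \<comment> \<open>Since a is an inverse of v modulo p, this is the residue of u / v.\<close>
  define c where "c = nat ((u * a) mod int p)"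
  have c: "int c = (u * a) mod int p" using prime_gt_0_nat[OF p] by (simp add: c_def)
  have "c < p" using prime_gt_0_nat[OF p] pos_mod_bound[of "int p" "u * a"] c by linarith
  have dvd: "int p dvd u - int c * v"
  proof -
    have "int p dvd u * a - int c" unfolding c by (rule dvd_minus_mod)
    moreover have "u - int c * v = u * (b * int p) + (u * a - int c) * v"
    proof -
      have "u = u * (a * v + b * int p)" using ab by simp
      then show ?thesis by (simp add: algebra_simps)
    qed
    ultimately show ?thesis by simp
  qed
  have "padic_abs p (q - of_nat c) < 1"
  proof (cases "u - int c * v = 0")
    case True
    then have "u = int c * v" by simp
    then have "q = of_nat c" unfolding q using v by simp
    then show ?thesis by simp
  next
    case False
    have "q - of_nat c = of_int (u - int c * v) / of_int v" unfolding q using v by (simp add: field_simps)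
    then have "padic_abs p (q - of_nat c)
        = real p powi (int (multiplicity (int p) v) - int (multiplicity (int p) (u - int c * v)))"
      using padic_abs_of_frac[OF p False, of v] v by simp
    also have "multiplicity (int p) v = 0" by (rule not_dvd_imp_multiplicity_0[OF pv])
    also have "real p powi (int 0 - int (multiplicity (int p) (u - int c * v))) \<le> real p powi (- 1)"
    proof (rule power_int_increasing)
      have "1 \<le> multiplicity (int p) (u - int c * v)" using dvd False pu by (intro multiplicity_geI) auto
      then show "int 0 - int (multiplicity (int p) (u - int c * v)) \<le> - 1" by simp
    qed (use real_p_gt_1 in simp)
    also have "\<dots> < 1" using real_p_gt_1 by (simp add: power_int_minus field_simps)
    finally show ?thesis .
  qed
  then show ?thesis using that \<open>c < p\<close> by blast
qed

lemma Qp_abs_add_le: "a \<in> carrier (Qp p) \<Longrightarrow> b \<in> carrier (Qp p) \<Longrightarrow> Qp_abs p a \<le> t \<Longrightarrow> Qp_abs p b \<le> t \<Longrightarrow>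
    Qp_abs p (a \<oplus>\<^bsub>Qp p\<^esub> b) \<le> t"
  using Qp_abs_add[of a b] by linarith

lemma Qp_add_diff:
  assumes "a \<in> carrier (Qp p)" "b \<in> carrier (Qp p)"
  shows "a \<oplus>\<^bsub>Qp p\<^esub> (b \<ominus>\<^bsub>Qp p\<^esub> a) = b" "(a \<oplus>\<^bsub>Qp p\<^esub> b) \<ominus>\<^bsub>Qp p\<^esub> a = b"
proof -
  have "b \<ominus>\<^bsub>Qp p\<^esub> a = \<ominus>\<^bsub>Qp p\<^esub> a \<oplus>\<^bsub>Qp p\<^esub> b" using assms by (simp add: a_minus_def Q.a_comm)
  then show "a \<oplus>\<^bsub>Qp p\<^esub> (b \<ominus>\<^bsub>Qp p\<^esub> a) = b" using assms by (simp add: Q.r_neg2)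
  have "(a \<oplus>\<^bsub>Qp p\<^esub> b) \<ominus>\<^bsub>Qp p\<^esub> a = \<ominus>\<^bsub>Qp p\<^esub> a \<oplus>\<^bsub>Qp p\<^esub> (a \<oplus>\<^bsub>Qp p\<^esub> b)"
    using assms by (simp add: a_minus_def Q.a_comm[of "a \<oplus>\<^bsub>Qp p\<^esub> b"])
  then show "(a \<oplus>\<^bsub>Qp p\<^esub> b) \<ominus>\<^bsub>Qp p\<^esub> a = b" using assms by (simp add: Q.r_neg1)
qed

lemma Qp_abs_trans:
  assumes "a \<in> carrier (Qp p)" "b \<in> carrier (Qp p)" "c \<in> carrier (Qp p)"
    "Qp_abs p (a \<ominus>\<^bsub>Qp p\<^esub> b) \<le> t" "Qp_abs p (b \<ominus>\<^bsub>Qp p\<^esub> c) \<le> t"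
  shows "Qp_abs p (a \<ominus>\<^bsub>Qp p\<^esub> c) \<le> t"
proof -
  have "(a \<ominus>\<^bsub>Qp p\<^esub> b) \<oplus>\<^bsub>Qp p\<^esub> (b \<ominus>\<^bsub>Qp p\<^esub> c) = a \<ominus>\<^bsub>Qp p\<^esub> c"
    using assms(1-3) by (simp add: a_minus_def Q.a_assoc Q.r_neg1)
  then show ?thesis using Qp_abs_add_le[of "a \<ominus>\<^bsub>Qp p\<^esub> b" "b \<ominus>\<^bsub>Qp p\<^esub> c" t] assms by simp
qed

lemma Qp_abs_minus_sym: "a \<in> carrier (Qp p) \<Longrightarrow> b \<in> carrier (Qp p) \<Longrightarrow>
    Qp_abs p (a \<ominus>\<^bsub>Qp p\<^esub> b) = Qp_abs p (b \<ominus>\<^bsub>Qp p\<^esub> a)"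
  using Qp_abs_uminus[of "a \<ominus>\<^bsub>Qp p\<^esub> b"] by (simp add: a_minus_def Q.minus_add Q.a_comm)

lemma Zp_res: "\<exists>C. finite C \<and> C \<subseteq> Zp p \<and> (\<forall>a\<in>Zp p. \<exists>c\<in>C. \<exists>b\<in>Zp p. a = c \<oplus>\<^bsub>Qp p\<^esub> pQ \<otimes>\<^bsub>Qp p\<^esub> b)"
proof (intro exI[of _ "(\<lambda>c. Qp_class (\<lambda>n. of_nat c)) ` {..<p}"] conjI ballI)
  show "(\<lambda>c. Qp_class (\<lambda>n. of_nat c)) ` {..<p} \<subseteq> Zp p"
    using padic_abs_int_le_1[OF p, of "int _"] Qp_class_simps(1)[OF padic_Cauchy_const padic_Cauchy_const]
    by (auto simp: Zp_def Qp_abs_const)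
  fix a assume a: "a \<in> Zp p"
  then have ac: "a \<in> carrier (Qp p)" by (simp add: Zp_def)
  obtain q where q: "Qp_abs p (a \<ominus>\<^bsub>Qp p\<^esub> Qp_class (\<lambda>n. q)) \<le> 1 / real p"
    using Qp_approx[OF ac, of "1 / real p"] real_p_gt_1 by auto
  have qc: "Qp_class (\<lambda>n. r) \<in> carrier (Qp p)" for r by (rule Qp_class_simps(1)[OF padic_Cauchy_const padic_Cauchy_const])
  have ip: "1 / real p \<le> 1" using real_p_gt_1 by simp
  have "Qp_abs p (Qp_class (\<lambda>n. q)) \<le> 1"
  proof -
    have "Qp_class (\<lambda>n. q) = a \<oplus>\<^bsub>Qp p\<^esub> (Qp_class (\<lambda>n. q) \<ominus>\<^bsub>Qp p\<^esub> a)"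
      using Qp_add_diff ac qc by simp
    moreover have "Qp_abs p (Qp_class (\<lambda>n. q) \<ominus>\<^bsub>Qp p\<^esub> a) \<le> 1" using q ip Qp_abs_minus_sym[OF ac qc] by simp
    moreover have "Qp_abs p a \<le> 1" using a by (simp add: Zp_def)
    ultimately show ?thesis using Qp_abs_add_le[OF ac, of "Qp_class (\<lambda>n. q) \<ominus>\<^bsub>Qp p\<^esub> a" 1] ac qc by simp
  qed
  then have "padic_abs p q \<le> 1" unfolding Qp_abs_const .
  then obtain c where c: "c < p" "padic_abs p (q - of_nat c) < 1" by (rule padic_residue)
  have "Qp_abs p (Qp_class (\<lambda>n. q) \<ominus>\<^bsub>Qp p\<^esub> Qp_class (\<lambda>n. of_nat c)) \<le> 1 / real p"
    unfolding Qp_class_diff[OF padic_Cauchy_const padic_Cauchy_const] Qp_abs_const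
    using padic_abs_discrete[of "q - of_nat c" 0] c(2) by simp
  then have "Qp_abs p (a \<ominus>\<^bsub>Qp p\<^esub> Qp_class (\<lambda>n. of_nat c)) \<le> 1 / real p ^ 1"
    using Qp_abs_trans[OF ac qc qc q] by simp
  then obtain b where b: "b \<in> Zp p" "a \<ominus>\<^bsub>Qp p\<^esub> Qp_class (\<lambda>n. of_nat c) = pQ [^]\<^bsub>Qp p\<^esub> (1::nat) \<otimes>\<^bsub>Qp p\<^esub> b"
    using Qp_divide_p[OF Q.minus_closed[OF ac qc]] by blast
  have "a = Qp_class (\<lambda>n. of_nat c) \<oplus>\<^bsub>Qp p\<^esub> (a \<ominus>\<^bsub>Qp p\<^esub> Qp_class (\<lambda>n. of_nat c))"
    using Qp_add_diff ac qc by simp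
  then have "a = Qp_class (\<lambda>n. of_nat c) \<oplus>\<^bsub>Qp p\<^esub> pQ \<otimes>\<^bsub>Qp p\<^esub> b" using b by simp
  then show "\<exists>c\<in>(\<lambda>c. Qp_class (\<lambda>n. of_nat c)) ` {..<p}. \<exists>b\<in>Zp p. a = c \<oplus>\<^bsub>Qp p\<^esub> pQ \<otimes>\<^bsub>Qp p\<^esub> b"
    using c(1) b(1) by blast
qed simp

text \<open>The partial sums form a Cauchy sequence of classes, whereas a p-adic number is the class
  of one Cauchy sequence of rationals. Choosing for each m a rational within p^(-m) of
  \<open>s m\<close> gives such a sequence; its class is within p^(-M) of \<open>s M\<close>, which
  makes the difference divisible by p^M.\<close>

lemma Zp_complete:
  assumes d: "\<And>m. d m \<in> Zp p" and s0: "s 0 = \<zero>\<^bsub>Qp p\<^esub>"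
    and sS: "\<And>m. s (Suc m) = s m \<oplus>\<^bsub>Qp p\<^esub> pQ [^]\<^bsub>Qp p\<^esub> m \<otimes>\<^bsub>Qp p\<^esub> d m"
  shows "\<exists>b\<in>Zp p. \<forall>M. \<exists>c\<in>Zp p. b = s M \<oplus>\<^bsub>Qp p\<^esub> pQ [^]\<^bsub>Qp p\<^esub> M \<otimes>\<^bsub>Qp p\<^esub> c"
proof -
  have sc: "s m \<in> carrier (Qp p)" for m by (induction m) (use d s0 sS Zp_carrier in auto)
  have qc: "Qp_class (\<lambda>n. r) \<in> carrier (Qp p)" for r by (rule Qp_class_simps(1)[OF padic_Cauchy_const padic_Cauchy_const])
  have mono: "1 / real p ^ n \<le> 1 / real p ^ m" if "m \<le> n" for m n
    using real_p_gt_1 that by (intro divide_left_mono power_increasing) auto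
  have zero: "Qp_abs p (a \<ominus>\<^bsub>Qp p\<^esub> a) \<le> 1 / real p ^ m" if "a \<in> carrier (Qp p)" for a m
    using that Qp_abs_0[of "a \<ominus>\<^bsub>Qp p\<^esub> a"] by (simp add: Q.r_right_minus_eq)
  have step: "Qp_abs p (s (Suc m) \<ominus>\<^bsub>Qp p\<^esub> s m) \<le> 1 / real p ^ m" for m
  proof -
    have "s (Suc m) \<ominus>\<^bsub>Qp p\<^esub> s m = pQ [^]\<^bsub>Qp p\<^esub> m \<otimes>\<^bsub>Qp p\<^esub> d m"
      unfolding sS using Qp_add_diff(2)[OF sc[of m]] Zp_carrier[OF d, of m] by simp
    then show ?thesis using d[of m] real_p_gt_1 by (simp add: Qp_abs_mult Qp_abs_p_pow Zp_def divide_right_mono)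
  qed
  have far: "Qp_abs p (s (m + n) \<ominus>\<^bsub>Qp p\<^esub> s m) \<le> 1 / real p ^ m" for m n
  proof (induction n)
    case 0
    then show ?case using zero[OF sc] by simp
  next
    case (Suc n)
    have "Qp_abs p (s (m + Suc n) \<ominus>\<^bsub>Qp p\<^esub> s (m + n)) \<le> 1 / real p ^ m"
      using step[of "m + n"] mono[of m "m + n"] by simp
    then show ?case by (rule Qp_abs_trans[OF sc sc sc _ Suc])
  qed
  have "\<forall>m. \<exists>q. Qp_abs p (s m \<ominus>\<^bsub>Qp p\<^esub> Qp_class (\<lambda>n. q)) \<le> 1 / real p ^ m"
  proof
    fix m
    have "0 < 1 / real p ^ m" using real_p_gt_1 by simp
    then show "\<exists>q. Qp_abs p (s m \<ominus>\<^bsub>Qp p\<^esub> Qp_class (\<lambda>n. q)) \<le> 1 / real p ^ m" by (rule Qp_approx[OF sc]) blast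
  qed
  then obtain q where q: "\<And>m. Qp_abs p (s m \<ominus>\<^bsub>Qp p\<^esub> Qp_class (\<lambda>n. q m)) \<le> 1 / real p ^ m" by metis
  have qq: "padic_abs p (q n - q m) \<le> 1 / real p ^ m" if mn: "m \<le> n" for m n
  proof -
    have "Qp_abs p (Qp_class (\<lambda>_. q n) \<ominus>\<^bsub>Qp p\<^esub> s n) \<le> 1 / real p ^ m"
      using q[of n] mono[OF mn] Qp_abs_minus_sym[OF sc qc] by simp
    moreover have "Qp_abs p (s n \<ominus>\<^bsub>Qp p\<^esub> s m) \<le> 1 / real p ^ m" using far[of m "n - m"] mn by simp
    ultimately have "Qp_abs p (Qp_class (\<lambda>_. q n) \<ominus>\<^bsub>Qp p\<^esub> s m) \<le> 1 / real p ^ m" by (rule Qp_abs_trans[OF qc sc sc])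
    then have "Qp_abs p (Qp_class (\<lambda>_. q n) \<ominus>\<^bsub>Qp p\<^esub> Qp_class (\<lambda>_. q m)) \<le> 1 / real p ^ m" using q by (rule Qp_abs_trans[OF qc sc qc])
    then show ?thesis unfolding Qp_class_diff[OF padic_Cauchy_const padic_Cauchy_const] Qp_abs_const .
  qed
  have qC: "padic_Cauchy p q"
    unfolding padic_Cauchy_def
  proof (intro allI impI)
    fix \<epsilon> :: real assume "0 < \<epsilon>"
    obtain M where M: "1 / \<epsilon> < real p ^ M" using real_arch_pow[OF real_p_gt_1] by blast
    have Me: "1 / real p ^ M < \<epsilon>" using M \<open>0 < \<epsilon>\<close> real_p_gt_1 by (simp add: field_simps)
    have "padic_abs p (q m - q n) < \<epsilon>" if "m \<ge> M" "n \<ge> M" for m n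
    proof -
      have "padic_abs p (q m - q M + (q M - q n)) \<le> 1 / real p ^ M"
        using padic_abs_add[OF p, of "q m - q M" "q M - q n"] qq[OF that(1)] qq[OF that(2)]
          padic_abs_minus_commute[of p "q M" "q n"] by simp
      then show ?thesis using Me by simp
    qed
    then show "\<exists>N. \<forall>m\<ge>N. \<forall>n\<ge>N. padic_abs p (q m - q n) < \<epsilon>" by blast
  qed
  have bc: "Qp_class q \<in> carrier (Qp p)" by (rule Qp_class_simps(1)[OF qC qC])
  have bs: "Qp_abs p (Qp_class q \<ominus>\<^bsub>Qp p\<^esub> s m) \<le> 1 / real p ^ m" for m
  proof (rule Qp_abs_trans[OF bc qc sc])
    show "Qp_abs p (Qp_class q \<ominus>\<^bsub>Qp p\<^esub> Qp_class (\<lambda>n. q m)) \<le> 1 / real p ^ m"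
      unfolding Qp_class_diff[OF qC padic_Cauchy_const]
    proof (rule tendsto_upperbound[OF Qp_abs_lim])
      show "padic_Cauchy p (\<lambda>n. q n - q m)"
        using padic_Cauchy_add[OF p qC padic_Cauchy_const[of p "- q m"]] by simp
    qed (use qq in \<open>auto simp: eventually_sequentially\<close>)
    show "Qp_abs p (Qp_class (\<lambda>n. q m) \<ominus>\<^bsub>Qp p\<^esub> s m) \<le> 1 / real p ^ m" using q Qp_abs_minus_sym[OF sc qc] by simp
  qed
  have rep: "\<exists>c\<in>Zp p. Qp_class q = s M \<oplus>\<^bsub>Qp p\<^esub> pQ [^]\<^bsub>Qp p\<^esub> M \<otimes>\<^bsub>Qp p\<^esub> c" for M
  proof -
    obtain c where c: "c \<in> Zp p" "Qp_class q \<ominus>\<^bsub>Qp p\<^esub> s M = pQ [^]\<^bsub>Qp p\<^esub> M \<otimes>\<^bsub>Qp p\<^esub> c"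
      using Qp_divide_p[OF Q.minus_closed[OF bc sc] bs] by blast
    have "Qp_class q = s M \<oplus>\<^bsub>Qp p\<^esub> (Qp_class q \<ominus>\<^bsub>Qp p\<^esub> s M)"
      using Qp_add_diff bc sc by simp
    then show ?thesis unfolding c(2) using c(1) by blast
  qed
  moreover have "Qp_class q \<in> Zp p"
    using rep[of 0] Zp_carrier s0 by auto
  ultimately show ?thesis by blast
qed

end

section \<open>Residue rings of unramified extensions\<close>

text \<open>By \<open>loc\<close> the non-units form the only maximal ideal, which gives the
  definite description \<open>max_ideal\<close> its meaning. As it is generated by p, its powers are
  generated by the powers of p.\<close>

lemma finite_chain_quotient:
  fixes R :: "'b ring" (structure)
  assumes R: "cring R" and p: "prime p" and k: "k \<ge> 1" and n: "n \<ge> 1"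
    and max: "PIdl ([p] \<cdot> \<one>) = max_ideal R"
    and loc: "\<And>x z. x \<in> carrier R \<Longrightarrow> z \<in> carrier R \<Longrightarrow> x \<oplus> z = \<one> \<Longrightarrow>
      (\<exists>y\<in>carrier R. x \<otimes> y = \<one>) \<or> (\<exists>y\<in>carrier R. z \<otimes> y = \<one>)"
    and nonunit: "\<And>y. y \<in> carrier R \<Longrightarrow> ([p] \<cdot> \<one>) \<otimes> y \<noteq> \<one>"
    and res: "\<exists>C. finite C \<and> C \<subseteq> carrier R \<and>
      (\<forall>x\<in>carrier R. \<exists>c\<in>C. \<exists>y\<in>carrier R. x = c \<oplus> ([p] \<cdot> \<one>) \<otimes> y)"
    and cancel: "\<And>x y m. x \<in> carrier R \<Longrightarrow> y \<in> carrier R \<Longrightarrow>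
      ([p] \<cdot> \<one>) [^] (m::nat) \<otimes> x = ([p] \<cdot> \<one>) [^] m \<otimes> y \<Longrightarrow> x = y"
  shows "finite_chain (R Quot (max_ideal R [^]\<^bsub>ideals_set R\<^esub> k)) p k n"
proof -
  interpret cring R by (rule R)
  let ?p = "[p] \<cdot> \<one>"
  have pc: "?p \<in> carrier R" "\<And>m::nat. ?p [^] m \<in> carrier R" by simp_all
  define M where "M = {x \<in> carrier R. \<forall>y\<in>carrier R. x \<otimes> y \<noteq> \<one>}"
  have z1: "\<zero> \<noteq> \<one>" using nonunit[of \<zero>] by simp
  have MR: "M \<subseteq> carrier R" by (auto simp: M_def)
  have Mm: "x \<otimes> y \<in> M" if "x \<in> M" "y \<in> carrier R" for x y
    using that by (auto simp: M_def m_assoc)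
  have Ma: "x \<oplus> y \<in> M" if x: "x \<in> M" and y: "y \<in> M" for x y
  proof (rule ccontr)
    assume "x \<oplus> y \<notin> M"
    then obtain z where z: "z \<in> carrier R" "(x \<oplus> y) \<otimes> z = \<one>" using x y by (auto simp: M_def)
    have c: "x \<in> carrier R" "y \<in> carrier R" using x y MR by auto
    have "x \<otimes> z \<oplus> y \<otimes> z = \<one>" using z c by (simp add: l_distr)
    then show False using loc[of "x \<otimes> z" "y \<otimes> z"] Mm[OF x z(1)] Mm[OF y z(1)] by (auto simp: M_def)
  qed
  have Mi: "ideal M R"
  proof (rule idealI[OF ring_axioms])
    show "subgroup M (add_monoid R)"
    proof (rule add.subgroupI)
      show "M \<noteq> {}" using z1 by (auto simp: M_def)
      fix x assume x: "x \<in> M"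
      then have "x \<otimes> (\<ominus> \<one>) \<in> M" by (rule Mm) simp
      then show "\<ominus> x \<in> M" using x MR by (auto simp: r_minus)
    qed (use MR Ma in auto)
    fix a x assume "a \<in> M" "x \<in> carrier R"
    then show "a \<otimes> x \<in> M" "x \<otimes> a \<in> M" using Mm[of a x] MR m_comm[of x a] by auto
  qed
  have Mn: "\<one> \<notin> M" by (auto simp: M_def)
  have proper: "J \<subseteq> M" if J: "ideal J R" "J \<noteq> carrier R" for J
  proof
    fix x assume x: "x \<in> J"
    interpret J: ideal J R by (rule J(1))
    have "x \<otimes> y \<noteq> \<one>" if "y \<in> carrier R" for y
      using J.I_r_closed[OF x that] J.one_imp_carrier J(2) by auto
    then show "x \<in> M" using x by (auto simp: M_def)
  qed
  have Mmax: "maximalideal M R"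
  proof (rule maximalidealI[OF Mi])
    show "carrier R \<noteq> M" using Mn by auto
    show "J = M \<or> J = carrier R" if "ideal J R" "M \<subseteq> J" "J \<subseteq> carrier R" for J
      using proper[OF that(1)] that by auto
  qed
  have "J = M" if "maximalideal J R" for J
  proof -
    interpret J: maximalideal J R by (rule that)
    show ?thesis using J.I_maximal[OF Mi proper[OF J.ideal_axioms]] J.I_notcarr MR Mn one_closed by blast
  qed
  then have maxM: "max_ideal R = M" unfolding max_ideal_def using Mmax by (intro the_equality)
  have unit_or: "(\<exists>y\<in>carrier R. x \<otimes> y = \<one>) \<or> (\<exists>y\<in>carrier R. x = ?p \<otimes> y)" if x: "x \<in> carrier R" for x
  proof (cases "x \<in> M")
    case True
    then obtain y where "y \<in> carrier R" "x = y \<otimes> ?p" unfolding maxM[symmetric] max[symmetric] cgenideal_def by blast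
    then show ?thesis using m_comm[OF _ pc(1)] by auto
  qed (use x in \<open>auto simp: M_def\<close>)

  interpret IS: comm_monoid "ideals_set R" by (rule ideals_set_is_comm_monoid)
  have pwI: "max_ideal R [^]\<^bsub>ideals_set R\<^esub> m = PIdl (?p [^] m)" for m :: nat
  proof (induction m)
    case 0
    have "PIdl \<one> = carrier R" by (auto simp: cgenideal_def) (metis r_one)
    then show ?case by (simp add: ideals_set_def)
  next
    case (Suc m)
    have "ideal_prod R (PIdl (?p [^] m)) (PIdl ?p) = PIdl (?p [^] m \<otimes> ?p)"
    proof (rule subset_antisym)
      show "ideal_prod R (PIdl (?p [^] m)) (PIdl ?p) \<subseteq> PIdl (?p [^] m \<otimes> ?p)"
      proof
        fix x assume "x \<in> ideal_prod R (PIdl (?p [^] m)) (PIdl ?p)"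
        then show "x \<in> PIdl (?p [^] m \<otimes> ?p)"
        proof (induction x rule: ideal_prod.induct)
          case (prod i j)
          then obtain a b where ab: "a \<in> carrier R" "b \<in> carrier R" "i = a \<otimes> ?p [^] m" "j = b \<otimes> ?p"
            by (auto simp: cgenideal_def)
          then have "i \<otimes> j = (a \<otimes> b) \<otimes> (?p [^] m \<otimes> ?p)" using pc by (simp add: m_ac)
          then show ?case using ab unfolding cgenideal_def by blast
        next
          case (sum x y)
          then show ?case
            using additive_subgroup.a_closed[OF ideal.axioms(1)[OF cgenideal_ideal]] pc by simp
        qed
      qed
      show "PIdl (?p [^] m \<otimes> ?p) \<subseteq> ideal_prod R (PIdl (?p [^] m)) (PIdl ?p)"
      proof
        fix x assume "x \<in> PIdl (?p [^] m \<otimes> ?p)"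
        then obtain a where a: "a \<in> carrier R" "x = a \<otimes> (?p [^] m \<otimes> ?p)" by (auto simp: cgenideal_def)
        then have "x = (a \<otimes> ?p [^] m) \<otimes> ?p" using pc by (simp add: m_assoc)
        moreover have "a \<otimes> ?p [^] m \<in> PIdl (?p [^] m)" using a unfolding cgenideal_def by blast
        ultimately show "x \<in> ideal_prod R (PIdl (?p [^] m)) (PIdl ?p)"
          using cgenideal_self[OF pc(1)] by (auto intro: ideal_prod.prod)
      qed
    qed
    then show ?case using Suc max by (simp add: ideals_set_def)
  qed
  define J where "J = PIdl (?p [^] k)"
  interpret J: ideal J R unfolding J_def by (rule cgenideal_ideal) simp
  let ?Q = "R Quot J" and ?h = "(+>) J"
  interpret Q: cring ?Q by (rule J.quotient_is_cring[OF R])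
  have h: "?h \<in> ring_hom R ?Q" by (rule J.rcos_ring_hom)
  note hs = ring_hom_closed[OF h] ring_hom_mult[OF h] ring_hom_add[OF h] ring_hom_one[OF h]
  have hz: "?h \<zero> = \<zero>\<^bsub>?Q\<^esub>" by (rule ring_hom_zero[OF h ring_axioms Q.ring_axioms])
  have hn: "?h ([m] \<cdot> \<one>) = [m] \<cdot>\<^bsub>?Q\<^esub> \<one>\<^bsub>?Q\<^esub>" for m :: nat
    by (induction m) (simp_all add: hs hz)
  have hp: "?h (?p [^] m) = ([p] \<cdot>\<^bsub>?Q\<^esub> \<one>\<^bsub>?Q\<^esub>) [^]\<^bsub>?Q\<^esub> m" for m :: nat
    by (induction m) (simp_all add: hs hn)
  have surj: "\<exists>x\<in>carrier R. a = ?h x" if "a \<in> carrier ?Q" for a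
    using that unfolding FactRing_def A_RCOSETS_def' by auto
  have zJ: "\<zero>\<^bsub>?Q\<^esub> = J" by (simp add: FactRing_def)
  \<comment> \<open>Expansion in digits: representatives modulo p^(m+1) are built from those modulo
    p^m and one further digit.\<close>
  have fin: "\<exists>C. finite C \<and> C \<subseteq> carrier R \<and> (\<forall>x\<in>carrier R. \<exists>c\<in>C. \<exists>y\<in>carrier R. x = c \<oplus> ?p [^] m \<otimes> y)" for m :: nat
  proof (induction m)
    case 0
    show ?case by (rule exI[of _ "{\<zero>}"]) auto
  next
    case (Suc m)
    then obtain C where C: "finite C" "C \<subseteq> carrier R" "\<forall>x\<in>carrier R. \<exists>c\<in>C. \<exists>y\<in>carrier R. x = c \<oplus> ?p [^] m \<otimes> y" by blast
    obtain D where D: "finite D" "D \<subseteq> carrier R" "\<forall>x\<in>carrier R. \<exists>c\<in>D. \<exists>y\<in>carrier R. x = c \<oplus> ?p \<otimes> y" using res by blast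
    let ?E = "(\<lambda>(c, d). c \<oplus> ?p [^] m \<otimes> d) ` (C \<times> D)"
    have E: "\<exists>c\<in>?E. \<exists>y\<in>carrier R. x = c \<oplus> ?p [^] Suc m \<otimes> y" if x: "x \<in> carrier R" for x
    proof -
      obtain c y where c: "c \<in> C" "y \<in> carrier R" "x = c \<oplus> ?p [^] m \<otimes> y" using C(3) x by blast
      obtain d z where d: "d \<in> D" "z \<in> carrier R" "y = d \<oplus> ?p \<otimes> z" using D(3) c(2) by blast
      have "c \<in> carrier R" "d \<in> carrier R" using subsetD[OF C(2) c(1)] subsetD[OF D(2) d(1)] by simp_all
      then have "x = (c \<oplus> ?p [^] m \<otimes> d) \<oplus> ?p [^] Suc m \<otimes> z"
        unfolding c(3) d(3) using d(2) pc by (simp add: r_distr a_assoc m_assoc)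
      moreover have "c \<oplus> ?p [^] m \<otimes> d \<in> ?E" using c(1) d(1) by (intro image_eqI[of _ _ "(c, d)"]) simp_all
      ultimately show ?thesis using d(2) by blast
    qed
    show ?case
    proof (intro exI[of _ ?E] conjI ballI E)
      show "finite ?E" using C(1) D(1) by simp
      show "?E \<subseteq> carrier R" using subsetD[OF C(2)] subsetD[OF D(2)] by clarsimp
    qed
  qed
  have "finite_chain ?Q p k n"
  proof (intro finite_chain.intro finite_chain_axioms.intro Q.cring_axioms p k n)
    obtain C where C: "finite C" "C \<subseteq> carrier R" "\<forall>x\<in>carrier R. \<exists>c\<in>C. \<exists>y\<in>carrier R. x = c \<oplus> ?p [^] k \<otimes> y"
      using fin[of k] by blast
    have "carrier ?Q \<subseteq> ?h ` C"
    proof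
      fix a assume "a \<in> carrier ?Q"
      then obtain x where x: "x \<in> carrier R" "a = ?h x" using surj by blast
      obtain c y where c: "c \<in> C" "y \<in> carrier R" "x = c \<oplus> ?p [^] k \<otimes> y" using C(3) x(1) by blast
      have "?p [^] k \<otimes> y = y \<otimes> ?p [^] k" using c(2) pc m_comm by simp
      then have "?p [^] k \<otimes> y \<in> J" unfolding J_def cgenideal_def using c(2) by blast
      then have "?h (?p [^] k \<otimes> y) = \<zero>\<^bsub>?Q\<^esub>" unfolding zJ by (rule a_rcos_zero[OF J.ideal_axioms])
      then have "a = ?h c" unfolding x(2) c(3) using hs(3)[of c "?p [^] k \<otimes> y"] hs(1)[of c] Q.r_zero c(1,2) C(2) pc by (metis m_closed subsetD)
      then show "a \<in> ?h ` C" using c(1) by blast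
    qed
    then show "finite (carrier ?Q)" using C(1) finite_surj by blast
    show "(\<exists>y\<in>carrier ?Q. a \<otimes>\<^bsub>?Q\<^esub> y = \<one>\<^bsub>?Q\<^esub>) \<or> (\<exists>y\<in>carrier ?Q. a = [p] \<cdot>\<^bsub>?Q\<^esub> \<one>\<^bsub>?Q\<^esub> \<otimes>\<^bsub>?Q\<^esub> y)"
      if a: "a \<in> carrier ?Q" for a
    proof -
      obtain x where x: "x \<in> carrier R" "a = ?h x" using surj[OF a] by blast
      from unit_or[OF x(1)] show ?thesis
      proof (elim disjE bexE)
        fix y assume y: "y \<in> carrier R" "x \<otimes> y = \<one>"
        then have "a \<otimes>\<^bsub>?Q\<^esub> ?h y = \<one>\<^bsub>?Q\<^esub>" unfolding x(2) using hs(2)[OF x(1) y(1)] hs(4) by simp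
        then show ?thesis using hs(1)[OF y(1)] by blast
      next
        fix y assume y: "y \<in> carrier R" "x = ?p \<otimes> y"
        then have "a = [p] \<cdot>\<^bsub>?Q\<^esub> \<one>\<^bsub>?Q\<^esub> \<otimes>\<^bsub>?Q\<^esub> ?h y" unfolding x(2) y(2) using hs(2)[OF pc(1) y(1)] hn by simp
        then show ?thesis using hs(1)[OF y(1)] by blast
      qed
    qed
    show "([p] \<cdot>\<^bsub>?Q\<^esub> \<one>\<^bsub>?Q\<^esub>) [^]\<^bsub>?Q\<^esub> k = \<zero>\<^bsub>?Q\<^esub>"
      unfolding hp[symmetric] zJ
      by (rule a_rcos_zero[OF J.ideal_axioms]) (unfold J_def, rule cgenideal_self, simp)
    show "([p] \<cdot>\<^bsub>?Q\<^esub> \<one>\<^bsub>?Q\<^esub>) [^]\<^bsub>?Q\<^esub> (k - 1) \<noteq> \<zero>\<^bsub>?Q\<^esub>"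
    proof
      assume "([p] \<cdot>\<^bsub>?Q\<^esub> \<one>\<^bsub>?Q\<^esub>) [^]\<^bsub>?Q\<^esub> (k - 1) = \<zero>\<^bsub>?Q\<^esub>"
      then have "?p [^] (k - 1) \<in> J" unfolding hp[symmetric] zJ by (intro J.rcos_const_imp_mem) simp
      \<comment> \<open>If p^(k-1) were a multiple of p^k, cancellation would make p a unit.\<close>
      then obtain x where x: "x \<in> carrier R" "?p [^] (k - 1) = x \<otimes> ?p [^] k" unfolding J_def cgenideal_def by blast
      have "?p [^] k = ?p [^] (k - 1) \<otimes> ?p" using k by (metis Suc_diff_1 Suc_le_eq One_nat_def nat_pow_Suc)
      then have "?p [^] (k - 1) \<otimes> \<one> = ?p [^] (k - 1) \<otimes> (?p \<otimes> x)"
        using x pc by (simp add: m_ac)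
      then have "\<one> = ?p \<otimes> x" by (rule cancel[rotated 2]) (use x in simp_all)
      then show False using nonunit[OF x(1)] by simp
    qed
  qed
  then show ?thesis unfolding pwI J_def .
qed

text \<open>In rank one \<open>last_coord\<close> has no vectors to assume fixed, and it forces
  every element to fix the only basis vector. This case is separate because the fibre bound needs
  two coordinates.\<close>

lemma (in lin_group) carrier_trivial:
  assumes n: "n = 1" shows "carrier G = {\<one>}"
proof -
  have "g = \<one>" if g: "g \<in> carrier G" for g
  proof (rule faithful[OF g])
    fix v assume v: "v \<in> V"
    have "act g (eb 0) 0 = e" using last_coord[OF g] n by (simp add: eb_def)
    have "act g (eb i) = eb i" if "i < n" for i
    proof (rule ext)
      fix j
      show "act g (eb i) j = eb i j"
      proof (cases "j = 0")
        case True
        then show ?thesis using \<open>act g (eb 0) 0 = e\<close> that n by (simp add: eb_def)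
      next
        case False
        have "act g (eb i) j = 0" using act_V[OF g eb_V[OF that]] unfolding V_def using False n by simp
        then show ?thesis using False that n by (simp add: eb_def)
      qed
    qed
    then show "act g v = v" using lin_fixes_span[OF act_lin[OF g], of n v] v by (auto simp: V_def)
  qed
  then show ?thesis using one_closed by blast
qed

lemma pmf_word_measure:
  assumes "finite (carrier G)" "carrier G \<noteq> {}"
  shows "pmf (word_measure G r w) g
    = real (card {x \<in> {..<r} \<rightarrow>\<^sub>E carrier G. word_map G w x = g}) / real (card ({..<r} \<rightarrow>\<^sub>E carrier G))"
proof -
  let ?T = "{..<r} \<rightarrow>\<^sub>E carrier G"
  have T: "finite ?T" "?T \<noteq> {}" using assms by (auto simp: finite_PiE PiE_eq_empty_iff)
  have "pmf (word_measure G r w) g = measure (pmf_of_set ?T) (word_map G w -` {g})"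
    unfolding word_measure_def by (rule pmf_map)
  also have "\<dots> = real (card (?T \<inter> (word_map G w -` {g}))) / real (card ?T)"
    by (rule measure_pmf_of_set[OF T(2,1)])
  also have "?T \<inter> (word_map G w -` {g}) = {x \<in> ?T. word_map G w x = g}" by auto
  finally show ?thesis .
qed

lemma SL_word_measure_bound:
  assumes R: "finite_chain R p k n" and w: "w \<in> carrier (free_group r)" "w \<noteq> \<one>\<^bsub>free_group r\<^esub>"
    and p: "2 ^ length w + 2304 * length w ^ 4 + 2 * r + 2 * length w + 2 \<le> p" and g: "g \<in> carrier (SL n R)"
  shows "pmf (word_measure (SL n R) r w) g
    \<le> real (card (carrier (SL n R))) powr (- (1 / (2 * 10 ^ 17 * real (length w) ^ 9)))"
proof -
  interpret R: finite_chain R p k n by (rule R)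
  interpret lin_group R.e p k n "SL n R" R.sact by (rule R.SL_lin_group)
  have w': "reduced_word w" "w \<noteq> []" "fst ` set w \<subseteq> {..<r}" using w by (auto simp: free_group_def)
  show ?thesis
  proof (cases "n = 1")
    case True
    then have "card (carrier (SL n R)) = 1" using carrier_trivial by simp
    then show ?thesis by (simp add: pmf_le_1)
  next
    case False
    then have n: "2 \<le> n" using R.n1 by simp
    have pos: "0 < card (tup r)" using finG g by (auto simp: tup_def card_gt_0_iff finite_PiE PiE_eq_empty_iff)
    have "pmf (word_measure (SL n R) r w) g = real (card {x \<in> tup r. word_map (SL n R) w x = g}) / real (card (tup r))"
      unfolding tup_def by (rule pmf_word_measure) (use finG g in auto)
    also have "\<dots> \<le> real (card (carrier (SL n R))) powr (- (1 / (2 * 10 ^ 17 * real (length w) ^ 9)))"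
      using word_fibre_bound[OF n w' p g] pos by (simp add: divide_le_eq mult.commute)
    finally show ?thesis .
  qed
qed

section \<open>The unramified extension as an instance of the abstract setting\<close>

locale unramified =
  fixes p s :: nat and F :: "Qp_alg set"
  assumes p: "prime p" and unr: "unramified_extension p s F"
begin

abbreviation L :: "Qp_alg ring" where "L \<equiv> Qp_closure p"
abbreviation "\<iota> \<equiv> Qp_embed p"

definition \<theta> :: "(nat \<Rightarrow> rat) set \<Rightarrow> Qp_alg uring" where "\<theta> x = emb L (\<iota> x)"

sublocale K: field "Qp p" by (rule Qp_is_field[OF p])
sublocale L: field L
  using Qp_closure_algebraic_closure[OF p] by (rule algebraic_closure.axioms(1))

lemma iota_hom: "\<iota> \<in> ring_hom (Qp p) L"
  unfolding Qp_closure_def by (rule K.alg_closureE(2))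

lemmas iota = ring_hom_closed[OF iota_hom] ring_hom_mult[OF iota_hom] ring_hom_add[OF iota_hom] ring_hom_one[OF iota_hom]

lemma iota_zero: "\<iota> \<zero>\<^bsub>Qp p\<^esub> = \<zero>\<^bsub>L\<^esub>"
  by (rule ring_hom_zero[OF iota_hom K.ring_axioms L.ring_axioms])

lemmas embL = emb_add[OF L.is_cring] emb_mult[OF L.is_cring] emb_zero[OF L.is_cring] emb_uminus[OF L.is_cring]

lemma embL_eq_iff: "x \<in> carrier L \<Longrightarrow> y \<in> carrier L \<Longrightarrow> emb L x = emb L y \<longleftrightarrow> x = y"
  using emb_inj[OF L.is_cring] by (auto simp: inj_on_def)

lemma embL_one: "x \<in> carrier L \<Longrightarrow> emb L \<one>\<^bsub>L\<^esub> * emb L x = emb L x"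
  using emb_mult[OF L.is_cring, of "\<one>\<^bsub>L\<^esub>" x] by simp

lemma embL_minus: "x \<in> carrier L \<Longrightarrow> y \<in> carrier L \<Longrightarrow> emb L (x \<ominus>\<^bsub>L\<^esub> y) = emb L x - emb L y"
  by (simp add: a_minus_def embL)

lemma embL_pow: "x \<in> carrier L \<Longrightarrow> emb L (x [^]\<^bsub>L\<^esub> (m::nat)) = emb L x ^ m * emb L \<one>\<^bsub>L\<^esub>"
  by (induction m) (simp_all add: embL algebra_simps)

lemma theta:
  assumes "x \<in> carrier (Qp p)" "y \<in> carrier (Qp p)"
  shows "\<theta> (x \<oplus>\<^bsub>Qp p\<^esub> y) = \<theta> x + \<theta> y" "\<theta> (x \<otimes>\<^bsub>Qp p\<^esub> y) = \<theta> x * \<theta> y"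
    "\<theta> (x \<ominus>\<^bsub>Qp p\<^esub> y) = \<theta> x - \<theta> y" "\<theta> x = \<theta> y \<longleftrightarrow> x = y"
proof -
  have add: "\<theta> (a \<oplus>\<^bsub>Qp p\<^esub> y) = \<theta> a + \<theta> y" if "a \<in> carrier (Qp p)" for a
    using that assms by (simp add: \<theta>_def iota embL)
  then show "\<theta> (x \<oplus>\<^bsub>Qp p\<^esub> y) = \<theta> x + \<theta> y" using assms(1) .
  show "\<theta> (x \<otimes>\<^bsub>Qp p\<^esub> y) = \<theta> x * \<theta> y" using assms by (simp add: \<theta>_def iota embL)
  have "(x \<ominus>\<^bsub>Qp p\<^esub> y) \<oplus>\<^bsub>Qp p\<^esub> y = x" using assms by (simp add: a_minus_def K.a_assoc K.l_neg)
  then show "\<theta> (x \<ominus>\<^bsub>Qp p\<^esub> y) = \<theta> x - \<theta> y" using add[of "x \<ominus>\<^bsub>Qp p\<^esub> y"] assms by simp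
  show "\<theta> x = \<theta> y \<longleftrightarrow> x = y"
    unfolding \<theta>_def using assms iota(1) inj_on_eq_iff[OF K.indexed_const_inj_on assms] by (simp add: embL_eq_iff)
qed

lemma theta_one: "\<theta> \<one>\<^bsub>Qp p\<^esub> = emb L \<one>\<^bsub>L\<^esub>" by (simp add: \<theta>_def iota)
lemma theta_zero: "\<theta> \<zero>\<^bsub>Qp p\<^esub> = 0" by (simp add: \<theta>_def iota_zero embL)
lemma theta_closed: "x \<in> carrier (Qp p) \<Longrightarrow> emb L \<one>\<^bsub>L\<^esub> * \<theta> x = \<theta> x"
  unfolding \<theta>_def by (rule embL_one) (rule iota)

lemma theta_nat: "\<theta> ([(m::nat)] \<cdot>\<^bsub>Qp p\<^esub> \<one>\<^bsub>Qp p\<^esub>) = of_nat m * emb L \<one>\<^bsub>L\<^esub>"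
  by (induction m) (simp_all add: theta theta_one theta_zero algebra_simps)

abbreviation pK where "pK \<equiv> [p] \<cdot>\<^bsub>Qp p\<^esub> \<one>\<^bsub>Qp p\<^esub>"

lemma theta_p_mult: "x \<in> carrier (Qp p) \<Longrightarrow> \<theta> (pK \<otimes>\<^bsub>Qp p\<^esub> x) = of_nat p * \<theta> x"
  by (simp add: theta theta_nat mult.assoc theta_closed)

lemma theta_p_pow: "x \<in> carrier (Qp p) \<Longrightarrow> \<theta> (pK [^]\<^bsub>Qp p\<^esub> (m::nat) \<otimes>\<^bsub>Qp p\<^esub> x) = of_nat p ^ m * \<theta> x"
proof (induction m)
  case (Suc m)
  then have "pK [^]\<^bsub>Qp p\<^esub> Suc m \<otimes>\<^bsub>Qp p\<^esub> x = pK \<otimes>\<^bsub>Qp p\<^esub> (pK [^]\<^bsub>Qp p\<^esub> m \<otimes>\<^bsub>Qp p\<^esub> x)"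
    by (simp add: K.m_ac)
  then show ?case using Suc theta_p_mult[of "pK [^]\<^bsub>Qp p\<^esub> m \<otimes>\<^bsub>Qp p\<^esub> x"] by (simp add: mult.assoc)
qed simp

lemma F_subfield: "subfield F L" and K_F: "\<iota> ` carrier (Qp p) \<subseteq> F"
  and F_dimension: "ring.dimension L s (\<iota> ` carrier (Qp p)) F"
  and p_max_ideal: "PIdl\<^bsub>ring_of_integers p F\<^esub> ([p] \<cdot>\<^bsub>ring_of_integers p F\<^esub> \<one>\<^bsub>ring_of_integers p F\<^esub>)
    = max_ideal (ring_of_integers p F)"
  using unr by (simp_all add: unramified_extension_def Let_def)

lemma F_carrier: "F \<subseteq> carrier L" by (rule subfieldE(3)[OF F_subfield])
lemma F_subring: "subring F L" by (rule subfieldE(1)[OF F_subfield])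

lemma combine_emb:
  "length Ks = length Us \<Longrightarrow> set Ks \<subseteq> carrier L \<Longrightarrow> set Us \<subseteq> carrier L \<Longrightarrow>
    emb L (L.combine Ks Us) = (\<Sum>i<length Us. emb L (Ks ! i) * emb L (Us ! i))"
proof (induction Ks Us rule: list_induct2)
  case (Cons k Ks u Us)
  then have "L.combine Ks Us \<in> carrier L" by (intro L.combine_in_carrier) auto
  then show ?case using Cons by (simp add: embL sum.lessThan_Suc_shift del: sum.lessThan_Suc)
qed (simp add: embL)

lemma K_subfield: "subfield (\<iota> ` carrier (Qp p)) L"
  using Qp_closure_algebraic_closure[OF p] by (rule algebraic_closure.axioms(2))

text \<open>A list of s + 1 elements exceeds the dimension s; the vanishing list combination is
  rewritten as a sum in the type-class ring.\<close>

lemma F_dependent: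
  fixes x :: "nat \<Rightarrow> Qp_alg uring"
  assumes "\<forall>i\<le>s. x i \<in> emb L ` F"
  shows "\<exists>c. (\<forall>i\<le>s. c i \<in> \<theta> ` carrier (Qp p)) \<and> (\<exists>i\<le>s. c i \<noteq> 0) \<and> (\<Sum>i\<le>s. c i * x i) = 0"
proof -
  have "\<forall>i. \<exists>y. i \<le> s \<longrightarrow> y \<in> F \<and> x i = emb L y" using assms by blast
  then obtain y where y: "\<And>i. i \<le> s \<Longrightarrow> y i \<in> F" "\<And>i. i \<le> s \<Longrightarrow> x i = emb L (y i)" by metis
  define Us where "Us = map y [0..<Suc s]"
  have len: "length Us = Suc s" by (simp add: Us_def)
  have UF: "set Us \<subseteq> F" using y(1) by (auto simp: Us_def less_Suc_eq_le simp del: upt_Suc)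
  have "\<not> L.independent (\<iota> ` carrier (Qp p)) Us"
    using L.independent_length_le_dimension[OF K_subfield F_dimension _ UF] len by auto
  then obtain Ks where Ks: "length Ks = length Us" "L.combine Ks Us = \<zero>\<^bsub>L\<^esub>"
      "set Ks \<subseteq> \<iota> ` carrier (Qp p)" "set Ks \<noteq> {\<zero>\<^bsub>L\<^esub>}"
    using L.dependent_imp_non_trivial_combine[OF K_subfield, of Us] UF F_carrier by blast
  have Kc: "set Ks \<subseteq> carrier L" using Ks(3) K_F F_carrier by blast
  have "set Ks \<noteq> {}" using Ks(1) len by auto
  then have "\<not> set Ks \<subseteq> {\<zero>\<^bsub>L\<^esub>}" using Ks(4) by (simp add: subset_singleton_iff)
  then obtain z where z: "z \<in> set Ks" "z \<noteq> \<zero>\<^bsub>L\<^esub>" by blast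
  then obtain i where i: "i < length Ks" "z = Ks ! i" by (auto simp: in_set_conv_nth)
  have nz: "emb L (Ks ! i) \<noteq> 0" using embL_eq_iff[OF subsetD[OF Kc z(1)] L.zero_closed] z(2) i(2) by (simp add: embL)
  have "0 = emb L (L.combine Ks Us)" using Ks(2) by (simp add: embL)
  also have "\<dots> = (\<Sum>i<Suc s. emb L (Ks ! i) * emb L (Us ! i))"
    using combine_emb[OF Ks(1) Kc] UF F_carrier len by auto
  also have "\<dots> = (\<Sum>i\<le>s. emb L (Ks ! i) * x i)"
    unfolding lessThan_Suc_atMost by (rule sum.cong) (auto simp: Us_def y(2) nth_map simp del: upt_Suc)
  finally have "(\<Sum>i\<le>s. emb L (Ks ! i) * x i) = 0" by simp
  moreover have "emb L (Ks ! j) \<in> \<theta> ` carrier (Qp p)" if j: "j \<le> s" for j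
  proof -
    have "Ks ! j \<in> set Ks" using j Ks(1) len by (intro nth_mem) simp
    then obtain a where "a \<in> carrier (Qp p)" "Ks ! j = \<iota> a" using Ks(3) by blast
    then show ?thesis by (simp add: \<theta>_def)
  qed
  moreover have "i \<le> s" using i(1) Ks(1) len by simp
  ultimately show ?thesis using nz by (intro exI[of _ "\<lambda>i. emb L (Ks ! i)"]) blast
qed

text \<open>The ambient field is the copy of the whole algebraic closure; the axioms for
  \<open>A\<close> and \<open>K\<close> are the facts on p-adic numbers transported along
  \<open>\<theta>\<close>.\<close>

sublocale D: dvr_ext "emb L \<one>\<^bsub>L\<^esub>" p "\<theta> ` Zp p" "\<theta> ` carrier (Qp p)" "emb L ` F"
proof
  let ?e = "emb L \<one>\<^bsub>L\<^esub>"
  note Zc = Zp_carrier[OF p]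
  show "?e * ?e = ?e" by (rule embL_one) simp
  show "?e \<noteq> 0" using embL_eq_iff[of "\<one>\<^bsub>L\<^esub>" "\<zero>\<^bsub>L\<^esub>"] by (simp add: embL)
  show "\<exists>y. x * y = ?e" if x: "?e * x = x" "x \<noteq> 0" for x
  proof -
    obtain z where z: "z \<in> carrier L" "x = emb L z" using emb_range[OF L.is_cring, of x] x(1) by auto
    have "z \<noteq> \<zero>\<^bsub>L\<^esub>" using x(2) z(2) by (auto simp: embL)
    then have u: "z \<in> Units L" using z(1) L.field_Units by simp
    then have "x * emb L (inv\<^bsub>L\<^esub> z) = ?e"
      unfolding z(2) using emb_mult[OF L.is_cring z(1) L.Units_inv_closed[OF u]] by simp
    then show ?thesis by blast
  qed
  show "\<theta> ` Zp p \<subseteq> \<theta> ` carrier (Qp p)" using Zc by blast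
  show "\<theta> ` carrier (Qp p) \<subseteq> emb L ` F" using K_F unfolding \<theta>_def by blast
  show "?e * x = x" if x: "x \<in> emb L ` F" for x
    using x embL_one F_carrier by auto
  show "?e \<in> \<theta> ` Zp p" using Zp_one[OF p] theta_one by (metis image_eqI)
  show "x - y \<in> \<theta> ` Zp p" if xy: "x \<in> \<theta> ` Zp p" "y \<in> \<theta> ` Zp p" for x y
  proof -
    obtain a b where ab: "a \<in> Zp p" "b \<in> Zp p" "x = \<theta> a" "y = \<theta> b" using xy by blast
    then have "x - y = \<theta> (a \<ominus>\<^bsub>Qp p\<^esub> b)" using theta(3)[OF Zc Zc] by simp
    then show ?thesis using Zp_diff[OF p ab(1,2)] by blast
  qed
  show "x * y \<in> \<theta> ` Zp p" if xy: "x \<in> \<theta> ` Zp p" "y \<in> \<theta> ` Zp p" for x y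
  proof -
    obtain a b where ab: "a \<in> Zp p" "b \<in> Zp p" "x = \<theta> a" "y = \<theta> b" using xy by blast
    then have "x * y = \<theta> (a \<otimes>\<^bsub>Qp p\<^esub> b)" using theta(2)[OF Zc Zc] by simp
    then show ?thesis using Zp_mult[OF p ab(1,2)] by blast
  qed
  show "x - y \<in> emb L ` F" if xy: "x \<in> emb L ` F" "y \<in> emb L ` F" for x y
  proof -
    obtain a b where ab: "a \<in> F" "b \<in> F" "x = emb L a" "y = emb L b" using xy by blast
    have "a \<ominus>\<^bsub>L\<^esub> b \<in> F" unfolding a_minus_def using subringE(5,7)[OF F_subring] ab by blast
    moreover have "x - y = emb L (a \<ominus>\<^bsub>L\<^esub> b)" using embL_minus[OF subsetD[OF F_carrier ab(1)] subsetD[OF F_carrier ab(2)]] ab by simp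
    ultimately show ?thesis by blast
  qed
  show "x * y \<in> emb L ` F" if xy: "x \<in> emb L ` F" "y \<in> emb L ` F" for x y
  proof -
    obtain a b where ab: "a \<in> F" "b \<in> F" "x = emb L a" "y = emb L b" using xy by blast
    have "a \<otimes>\<^bsub>L\<^esub> b \<in> F" using subringE(6)[OF F_subring] ab by blast
    moreover have "x * y = emb L (a \<otimes>\<^bsub>L\<^esub> b)" using embL(2)[OF subsetD[OF F_carrier ab(1)] subsetD[OF F_carrier ab(2)]] ab by simp
    ultimately show ?thesis by blast
  qed
  show "of_nat p * ?e \<noteq> 0"
  proof
    assume "of_nat p * ?e = 0"
    then have "\<theta> pK = \<theta> \<zero>\<^bsub>Qp p\<^esub>" by (simp add: theta_nat theta_zero)
    then have "pK = \<zero>\<^bsub>Qp p\<^esub>" by (subst (asm) theta(4)) simp_all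
    then show False using Qp_p_pow_nz[OF p, of 1] by simp
  qed
  show "of_nat p * b \<noteq> ?e" if b: "b \<in> \<theta> ` Zp p" for b
  proof
    assume eq: "of_nat p * b = ?e"
    obtain a where a: "a \<in> Zp p" "b = \<theta> a" using b by blast
    have "\<theta> (pK \<otimes>\<^bsub>Qp p\<^esub> a) = \<theta> \<one>\<^bsub>Qp p\<^esub>" using eq a theta_p_mult[OF Zc[OF a(1)]] by (simp add: theta_one)
    then have "pK \<otimes>\<^bsub>Qp p\<^esub> a = \<one>\<^bsub>Qp p\<^esub>" by (subst (asm) theta(4)) (use Zc[OF a(1)] in simp_all)
    then show False using Zp_p_nonunit[OF p a(1)] by simp
  qed
  show "(\<exists>b\<in>\<theta> ` Zp p. a * b = ?e) \<or> (\<exists>b\<in>\<theta> ` Zp p. a = of_nat p * b)" if a: "a \<in> \<theta> ` Zp p" for a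
  proof -
    obtain x where x: "x \<in> Zp p" "a = \<theta> x" using a by blast
    from Zp_unit_or[OF p x(1)] show ?thesis
    proof (elim disjE bexE)
      fix y assume y: "y \<in> Zp p" "x \<otimes>\<^bsub>Qp p\<^esub> y = \<one>\<^bsub>Qp p\<^esub>"
      then have "a * \<theta> y = ?e" using theta(2)[OF Zc[OF x(1)] Zc[OF y(1)]] x(2) by (simp add: theta_one)
      then show ?thesis using y(1) by blast
    next
      fix y assume y: "y \<in> Zp p" "x = pK \<otimes>\<^bsub>Qp p\<^esub> y"
      then have "a = of_nat p * \<theta> y" using theta_p_mult[OF Zc[OF y(1)]] x(2) by simp
      then show ?thesis using y(1) by blast
    qed
  qed
  show "\<exists>n. \<forall>b\<in>\<theta> ` Zp p. a \<noteq> of_nat p ^ n * b" if a: "a \<in> \<theta> ` Zp p" "a \<noteq> 0" for a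
  proof -
    obtain x where x: "x \<in> Zp p" "a = \<theta> x" using a(1) by blast
    have "x \<noteq> \<zero>\<^bsub>Qp p\<^esub>" using a(2) x(2) theta_zero by auto
    then obtain n where n: "\<forall>b\<in>Zp p. x \<noteq> pK [^]\<^bsub>Qp p\<^esub> (n::nat) \<otimes>\<^bsub>Qp p\<^esub> b" using Zp_sep[OF p x(1)] by blast
    have "a \<noteq> of_nat p ^ n * \<theta> b" if b: "b \<in> Zp p" for b
    proof
      assume "a = of_nat p ^ n * \<theta> b"
      then have "\<theta> x = \<theta> (pK [^]\<^bsub>Qp p\<^esub> n \<otimes>\<^bsub>Qp p\<^esub> b)" using theta_p_pow[OF Zc[OF b]] x(2) by simp
      then have "x = pK [^]\<^bsub>Qp p\<^esub> n \<otimes>\<^bsub>Qp p\<^esub> b" by (subst (asm) theta(4)) (use Zc x(1) b in simp_all)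
      then show False using n b by blast
    qed
    then show ?thesis by blast
  qed
  show "\<exists>C. finite C \<and> C \<subseteq> \<theta> ` Zp p \<and> (\<forall>a\<in>\<theta> ` Zp p. \<exists>c\<in>C. \<exists>b\<in>\<theta> ` Zp p. a = c + of_nat p * b)"
  proof -
    obtain C where C: "finite C" "C \<subseteq> Zp p" "\<forall>a\<in>Zp p. \<exists>c\<in>C. \<exists>b\<in>Zp p. a = c \<oplus>\<^bsub>Qp p\<^esub> pK \<otimes>\<^bsub>Qp p\<^esub> b"
      using Zp_res[OF p] by blast
    have "\<exists>c\<in>\<theta> ` C. \<exists>b\<in>\<theta> ` Zp p. \<theta> a = c + of_nat p * b" if a: "a \<in> Zp p" for a
    proof -
      obtain c b where cb: "c \<in> C" "b \<in> Zp p" "a = c \<oplus>\<^bsub>Qp p\<^esub> pK \<otimes>\<^bsub>Qp p\<^esub> b" using C(3) a by blast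
      have cc: "c \<in> carrier (Qp p)" "b \<in> carrier (Qp p)" using Zc C(2) cb(1,2) by auto
      have "\<theta> a = \<theta> c + of_nat p * \<theta> b"
        unfolding cb(3) using theta(1)[OF cc(1), of "pK \<otimes>\<^bsub>Qp p\<^esub> b"] theta_p_mult cc by simp
      then show ?thesis using cb by blast
    qed
    then show ?thesis using C(1,2) by (intro exI[of _ "\<theta> ` C"]) blast
  qed
  show "\<exists>b\<in>\<theta> ` Zp p. \<forall>M. \<exists>c\<in>\<theta> ` Zp p. b = (\<Sum>m<M. of_nat p ^ m * d m) + of_nat p ^ M * c"
    if d: "\<And>m. d m \<in> \<theta> ` Zp p" for d :: "nat \<Rightarrow> _"
  proof -
    have "\<forall>m. \<exists>x. x \<in> Zp p \<and> d m = \<theta> x" using d by blast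
    then obtain x where x: "\<And>m. x m \<in> Zp p" "\<And>m. d m = \<theta> (x m)" by metis
    define t where "t = rec_nat \<zero>\<^bsub>Qp p\<^esub> (\<lambda>m y. y \<oplus>\<^bsub>Qp p\<^esub> pK [^]\<^bsub>Qp p\<^esub> m \<otimes>\<^bsub>Qp p\<^esub> x m)"
    have t: "t 0 = \<zero>\<^bsub>Qp p\<^esub>" "\<And>m. t (Suc m) = t m \<oplus>\<^bsub>Qp p\<^esub> pK [^]\<^bsub>Qp p\<^esub> m \<otimes>\<^bsub>Qp p\<^esub> x m" by (simp_all add: t_def)
    have tc: "t m \<in> carrier (Qp p)" for m by (induction m) (use t Zc x(1) in simp_all)
    have ts: "\<theta> (t M) = (\<Sum>m<M. of_nat p ^ m * d m)" for M
    proof (induction M)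
      case (Suc M)
      then show ?case using theta(1)[OF tc, of "pK [^]\<^bsub>Qp p\<^esub> M \<otimes>\<^bsub>Qp p\<^esub> x M"] theta_p_pow[OF Zc[OF x(1)]] Zc[OF x(1)]
        by (simp add: t(2) x(2))
    qed (simp add: t(1) theta_zero)
    obtain b where b: "b \<in> Zp p" "\<forall>M. \<exists>c\<in>Zp p. b = t M \<oplus>\<^bsub>Qp p\<^esub> pK [^]\<^bsub>Qp p\<^esub> M \<otimes>\<^bsub>Qp p\<^esub> c"
      using Zp_complete[OF p x(1) t] by blast
    have "\<exists>c\<in>\<theta> ` Zp p. \<theta> b = (\<Sum>m<M. of_nat p ^ m * d m) + of_nat p ^ M * c" for M
    proof -
      obtain c where c: "c \<in> Zp p" "b = t M \<oplus>\<^bsub>Qp p\<^esub> pK [^]\<^bsub>Qp p\<^esub> M \<otimes>\<^bsub>Qp p\<^esub> c" using b(2) by blast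
      have "\<theta> b = \<theta> (t M) + of_nat p ^ M * \<theta> c"
        unfolding c(2) using theta(1)[OF tc, of "pK [^]\<^bsub>Qp p\<^esub> M \<otimes>\<^bsub>Qp p\<^esub> c"] theta_p_pow[OF Zc[OF c(1)]] Zc[OF c(1)] by simp
      then show ?thesis using c(1) ts by auto
    qed
    then show ?thesis using b(1) by blast
  qed
  show "\<exists>n. of_nat p ^ n * x \<in> \<theta> ` Zp p" if x: "x \<in> \<theta> ` carrier (Qp p)" for x
  proof -
    obtain a where a: "a \<in> carrier (Qp p)" "x = \<theta> a" using x by blast
    obtain n where n: "pK [^]\<^bsub>Qp p\<^esub> (n::nat) \<otimes>\<^bsub>Qp p\<^esub> a \<in> Zp p" using Qp_frac[OF p a(1)] by blast
    show ?thesis using theta_p_pow[OF a(1), of n] n a(2) by (metis image_eqI)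
  qed
  show "\<exists>s. \<forall>x :: nat \<Rightarrow> _. (\<forall>i\<le>s. x i \<in> emb L ` F) \<longrightarrow>
      (\<exists>c. (\<forall>i\<le>s. c i \<in> \<theta> ` carrier (Qp p)) \<and> (\<exists>i\<le>s. c i \<noteq> 0) \<and> (\<Sum>i\<le>s. c i * x i) = 0)"
    using F_dependent by blast
qed

lemma eval_emb:
  assumes x: "x \<in> carrier L"
  shows "set P \<subseteq> carrier L \<Longrightarrow>
    emb L (L.eval P x) = (\<Sum>i<length P. emb L (P ! (length P - 1 - i)) * D.pw (emb L x) i)"
proof (induction P)
  case (Cons c P)
  have "L.eval P x \<in> carrier L" using Cons.prems x by (intro L.eval_in_carrier) auto
  then have "emb L (L.eval (c # P) x) = emb L c * D.pw (emb L x) (length P) + emb L (L.eval P x)"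
    using Cons.prems x by (simp add: embL embL_pow D.pw_def)
  also have "\<dots> = emb L c * D.pw (emb L x) (length P)
      + (\<Sum>i<length P. emb L ((c # P) ! (length P - i)) * D.pw (emb L x) i)"
  proof -
    have "(\<Sum>i<length P. emb L (P ! (length P - 1 - i)) * D.pw (emb L x) i)
        = (\<Sum>i<length P. emb L ((c # P) ! (length P - i)) * D.pw (emb L x) i)"
    proof (rule sum.cong)
      fix i assume "i \<in> {..<length P}"
      then have "length P - i = Suc (length P - 1 - i)" by simp
      then show "emb L (P ! (length P - 1 - i)) * D.pw (emb L x) i
          = emb L ((c # P) ! (length P - i)) * D.pw (emb L x) i" by (simp only: nth_Cons_Suc)
    qed simp
    then show ?thesis using Cons by simp
  qed
  finally show ?case by simp
qed (simp add: embL)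

text \<open>A monic equation is solved for its highest power, which changes signs. Polynomials are
  lists with the leading coefficient at the head, so the coefficient of the i-th power is found by
  counting from the end.\<close>

lemma integral_over_iff:
  assumes x: "x \<in> carrier L"
  shows "integral_over L (\<iota> ` Zp p) x \<longleftrightarrow> D.integ (emb L x)"
proof
  assume "integral_over L (\<iota> ` Zp p) x"
  then obtain c P where P: "polynomial\<^bsub>L\<^esub> (\<iota> ` Zp p) (c # P)" "c = \<one>\<^bsub>L\<^esub>" "L.eval (c # P) x = \<zero>\<^bsub>L\<^esub>"
    unfolding integral_over_def by (metis list.exhaust_sel)
  have A: "set P \<subseteq> \<iota> ` Zp p" using P(1) by (simp add: polynomial_def)
  then have Pc: "set P \<subseteq> carrier L" using Zp_carrier[OF p] iota(1) by blast
  have "L.eval P x \<in> carrier L" using Pc x by (intro L.eval_in_carrier) auto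
  then have "0 = D.pw (emb L x) (length P) + emb L (L.eval P x)"
    using arg_cong[OF P(3), of "emb L"] x P(2) by (simp add: embL embL_pow D.pw_def D.e_S D.pw_S embL_one mult.left_commute D.ee)
  then have eq: "D.pw (emb L x) (length P)
      = (\<Sum>i<length P. - emb L (P ! (length P - 1 - i)) * D.pw (emb L x) i)"
    by (simp add: eval_emb[OF x Pc] sum_negf eq_neg_iff_add_eq_0)
  define c where "c i = (if i < length P then - emb L (P ! (length P - 1 - i)) else 0)" for i
  have "c i \<in> \<theta> ` Zp p" for i
  proof (cases "i < length P")
    case True
    then have "P ! (length P - 1 - i) \<in> set P" by (intro nth_mem) simp
    then obtain a where "a \<in> Zp p" "P ! (length P - 1 - i) = \<iota> a" using A by blast
    then have "emb L (P ! (length P - 1 - i)) \<in> \<theta> ` Zp p" by (simp add: \<theta>_def)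
    then show ?thesis using True D.A_uminus by (simp add: c_def)
  qed (simp add: c_def D.A_0)
  then have "D.pw (emb L x) (length P) \<in> D.spn (D.pw (emb L x)) {..<length P}"
    unfolding eq D.spn_def by (intro CollectI exI[of _ c]) (simp add: c_def)
  then show "D.integ (emb L x)" unfolding D.integ_def by blast
next
  assume "D.integ (emb L x)"
  then obtain d c where c: "\<And>j. c j \<in> \<theta> ` Zp p" "D.pw (emb L x) d = (\<Sum>j<d. c j * D.pw (emb L x) j)"
    unfolding D.integ_def D.spn_def by blast
  have "\<forall>j. \<exists>a. a \<in> Zp p \<and> c j = - \<theta> a"
  proof
    fix j
    have "- c j \<in> \<theta> ` Zp p" using D.A_uminus c(1) by blast
    then obtain a where "a \<in> Zp p" "- c j = \<theta> a" by blast
    then show "\<exists>a. a \<in> Zp p \<and> c j = - \<theta> a" by (metis minus_minus)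
  qed
  then obtain a where a: "\<And>j. a j \<in> Zp p" "\<And>j. c j = - \<theta> (a j)" by metis
  define P where "P = rev (map (\<lambda>j. \<iota> (a j)) [0..<d])"
  have len: "length P = d" by (simp add: P_def)
  have set: "set P \<subseteq> \<iota> ` Zp p" using a(1) by (auto simp: P_def)
  then have Pc: "set P \<subseteq> carrier L" using Zp_carrier[OF p] iota(1) by blast
  have nth: "P ! (d - Suc i) = \<iota> (a i)" if "i < d" for i
    using that by (simp add: P_def rev_nth)
  have "L.eval P x \<in> carrier L" using Pc x by (intro L.eval_in_carrier) auto
  then have "emb L (L.eval (\<one>\<^bsub>L\<^esub> # P) x) = D.pw (emb L x) d + emb L (L.eval P x)"
    using x len by (simp add: embL embL_pow D.pw_def embL_one mult.left_commute D.ee)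
  also have "emb L (L.eval P x) = (\<Sum>i<d. \<theta> (a i) * D.pw (emb L x) i)"
    unfolding eval_emb[OF x Pc] len by (rule sum.cong) (simp_all add: nth \<theta>_def)
  also have "D.pw (emb L x) d = - (\<Sum>i<d. \<theta> (a i) * D.pw (emb L x) i)"
    unfolding c(2) a(2) by (simp add: sum_negf)
  finally have "emb L (L.eval (\<one>\<^bsub>L\<^esub> # P) x) = emb L \<zero>\<^bsub>L\<^esub>" by (simp add: embL)
  then have "L.eval (\<one>\<^bsub>L\<^esub> # P) x = \<zero>\<^bsub>L\<^esub>"
    using L.eval_in_carrier[of "\<one>\<^bsub>L\<^esub> # P" x] Pc x by (subst (asm) embL_eq_iff) auto
  moreover have "\<one>\<^bsub>L\<^esub> \<in> \<iota> ` Zp p" using Zp_one[OF p] iota(4) by (metis image_eqI)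
  then have "polynomial\<^bsub>L\<^esub> (\<iota> ` Zp p) (\<one>\<^bsub>L\<^esub> # P)" using set by (simp add: polynomial_def)
  ultimately show "integral_over L (\<iota> ` Zp p) x"
    unfolding integral_over_def by (intro exI[of _ "\<one>\<^bsub>L\<^esub> # P"]) simp
qed

abbreviation R where "R \<equiv> ring_of_integers p F"

lemma R_simps [simp]: "x \<otimes>\<^bsub>R\<^esub> y = x \<otimes>\<^bsub>L\<^esub> y" "x \<oplus>\<^bsub>R\<^esub> y = x \<oplus>\<^bsub>L\<^esub> y" "\<one>\<^bsub>R\<^esub> = \<one>\<^bsub>L\<^esub>" "\<zero>\<^bsub>R\<^esub> = \<zero>\<^bsub>L\<^esub>"
  by (simp_all add: ring_of_integers_def)

lemma R_L: "x \<in> carrier R \<Longrightarrow> x \<in> carrier L"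
  using F_carrier by (auto simp: ring_of_integers_def)

lemma R_iff: assumes "x \<in> carrier L" shows "x \<in> carrier R \<longleftrightarrow> emb L x \<in> D.\<O>"
proof -
  have "emb L x \<in> emb L ` F \<longleftrightarrow> x \<in> F"
    using inj_on_image_mem_iff[OF emb_inj[OF L.is_cring] assms F_carrier] .
  then show ?thesis using integral_over_iff[OF assms] by (simp add: ring_of_integers_def D.\<O>_def)
qed

lemma O_ex: assumes "b \<in> D.\<O>" obtains y where "y \<in> carrier R" "b = emb L y"
proof -
  obtain y where y: "y \<in> F" "b = emb L y" using D.O_F[OF assms] by blast
  then show ?thesis using that R_iff[of y] F_carrier assms by blast
qed

lemma R_O: "x \<in> carrier R \<Longrightarrow> emb L x \<in> D.\<O>" using R_iff R_L by blast

lemma R_eqI: "x \<in> carrier R \<Longrightarrow> y \<in> carrier R \<Longrightarrow> emb L x = emb L y \<Longrightarrow> x = y"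
  using embL_eq_iff R_L by blast

lemma R_cring: "cring R"
proof -
  let ?H = "{x \<in> F. integral_over L (\<iota> ` Zp p) x}"
  have H: "x \<in> ?H \<longleftrightarrow> x \<in> carrier L \<and> emb L x \<in> D.\<O>" for x
    using R_iff[of x] R_L[of x] by (auto simp: ring_of_integers_def)
  have "subring ?H L"
  proof (rule L.subringI)
    show "?H \<subseteq> carrier L" using F_carrier by blast
    show "\<one>\<^bsub>L\<^esub> \<in> ?H" unfolding H using D.A_O[OF D.eA] by simp
    fix x assume "x \<in> ?H"
    then have x: "x \<in> carrier L" "emb L x \<in> D.\<O>" unfolding H by simp_all
    show "\<ominus>\<^bsub>L\<^esub> x \<in> ?H" unfolding H using x D.O_closed(2)[OF D.O_0 x(2)] by (simp add: embL)
    fix y assume "y \<in> ?H"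
    then have y: "y \<in> carrier L" "emb L y \<in> D.\<O>" unfolding H by simp_all
    show "x \<otimes>\<^bsub>L\<^esub> y \<in> ?H" "x \<oplus>\<^bsub>L\<^esub> y \<in> ?H" unfolding H using x y D.O_closed(1,3) by (simp_all add: embL)
  qed
  then have "subcring ?H L" by (rule L.subcringI')
  moreover have "?H \<subseteq> carrier L" using F_carrier by blast
  ultimately show ?thesis unfolding ring_of_integers_def using L.subcring_iff[of ?H] by simp
qed

text \<open>The ramification condition enters through \<open>p_max_ideal\<close>; locality,
  finiteness modulo p and cancellation come from the integral closure over the p-adic
  integers.\<close>

theorem residue_ring_finite_chain:
  assumes k: "k \<ge> 1" and n: "n \<ge> 1"
  shows "finite_chain (residue_ring_pow p F k) p k n"
proof -
  interpret R: cring R by (rule R_cring)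
  let ?p = "[p] \<cdot>\<^bsub>R\<^esub> \<one>\<^bsub>R\<^esub>"
  have emb_nat: "emb L ([(m::nat)] \<cdot>\<^bsub>R\<^esub> \<one>\<^bsub>R\<^esub>) = of_nat m * emb L \<one>\<^bsub>L\<^esub>" for m
  proof (induction m)
    case (Suc m)
    have "[m] \<cdot>\<^bsub>R\<^esub> \<one>\<^bsub>R\<^esub> \<in> carrier L" by (rule R_L, rule R.add.nat_pow_closed, rule R.one_closed)
    then have "emb L ([m] \<cdot>\<^bsub>R\<^esub> \<one>\<^bsub>R\<^esub> \<oplus>\<^bsub>L\<^esub> \<one>\<^bsub>L\<^esub>) = emb L ([m] \<cdot>\<^bsub>R\<^esub> \<one>\<^bsub>R\<^esub>) + emb L \<one>\<^bsub>L\<^esub>" by (simp only: embL L.one_closed)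
    then show ?case using Suc R.add.nat_pow_Suc[of m "\<one>\<^bsub>R\<^esub>"] by (simp add: algebra_simps)
  qed (use embL(3) R.add.nat_pow_0 in simp)
  have emb_mult_R: "emb L (x \<otimes>\<^bsub>R\<^esub> y) = emb L x * emb L y" if "x \<in> carrier R" "y \<in> carrier R" for x y
    using embL(2)[OF R_L[OF that(1)] R_L[OF that(2)]] by simp
  have emb_add_R: "emb L (x \<oplus>\<^bsub>R\<^esub> y) = emb L x + emb L y" if "x \<in> carrier R" "y \<in> carrier R" for x y
    using embL(1)[OF R_L[OF that(1)] R_L[OF that(2)]] by simp
  have emb_p: "emb L (?p \<otimes>\<^bsub>R\<^esub> x) = of_nat p * emb L x" if x: "x \<in> carrier R" for x
    using emb_mult_R[OF _ x, of ?p] embL_one[OF R_L[OF x]] by (simp only: emb_nat R.add.nat_pow_closed R.one_closed mult.assoc)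
  have emb_pm: "emb L (?p [^]\<^bsub>R\<^esub> (m::nat) \<otimes>\<^bsub>R\<^esub> x) = of_nat p ^ m * emb L x" if x: "x \<in> carrier R" for m x
  proof (induction m)
    case 0
    then show ?case using x R.l_one[OF x] by simp
  next
    case (Suc m)
    have "?p [^]\<^bsub>R\<^esub> Suc m \<otimes>\<^bsub>R\<^esub> x = ?p \<otimes>\<^bsub>R\<^esub> (?p [^]\<^bsub>R\<^esub> m \<otimes>\<^bsub>R\<^esub> x)"
      unfolding R.nat_pow_Suc
      using R.m_comm[of "?p [^]\<^bsub>R\<^esub> m" ?p] R.m_assoc[of ?p "?p [^]\<^bsub>R\<^esub> m" x] x
      by (simp del: R_simps R.nat_pow_Suc)
    then show ?case using Suc emb_p[of "?p [^]\<^bsub>R\<^esub> m \<otimes>\<^bsub>R\<^esub> x"] x by (simp del: R_simps add: mult.assoc)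
  qed
  have "finite_chain (R Quot (max_ideal R [^]\<^bsub>ideals_set R\<^esub> k)) p k n"
  proof (rule finite_chain_quotient[OF R_cring p k n p_max_ideal])
    fix x z assume x: "x \<in> carrier R" and z: "z \<in> carrier R" and xz: "x \<oplus>\<^bsub>R\<^esub> z = \<one>\<^bsub>R\<^esub>"
    have zx: "emb L \<one>\<^bsub>L\<^esub> - emb L x = emb L z" using emb_add_R[OF x z] xz by (simp add: algebra_simps)
    have inv: "\<exists>y\<in>carrier R. u \<otimes>\<^bsub>R\<^esub> y = \<one>\<^bsub>R\<^esub>" if u: "u \<in> carrier R" and b: "b \<in> D.\<O>" "emb L u * b = emb L \<one>\<^bsub>L\<^esub>" for u b
    proof -
      obtain y where y: "y \<in> carrier R" "b = emb L y" using O_ex[OF b(1)] .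
      have "u \<otimes>\<^bsub>R\<^esub> y = \<one>\<^bsub>R\<^esub>" 
        by (rule R_eqI[OF R.m_closed[OF u y(1)] R.one_closed]) (use y b(2) emb_mult_R[OF u y(1)] in simp)
      then show ?thesis using y(1) by blast
    qed
    from D.\<O>_local[OF R_O[OF x]] show "(\<exists>y\<in>carrier R. x \<otimes>\<^bsub>R\<^esub> y = \<one>\<^bsub>R\<^esub>) \<or> (\<exists>y\<in>carrier R. z \<otimes>\<^bsub>R\<^esub> y = \<one>\<^bsub>R\<^esub>)"
      unfolding zx using inv[OF x] inv[OF z] by blast
  next
    fix y assume y: "y \<in> carrier R"
    show "?p \<otimes>\<^bsub>R\<^esub> y \<noteq> \<one>\<^bsub>R\<^esub>" using D.O_p_nonunit[OF R_O[OF y]] emb_p[OF y] by (metis R_simps(3))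
  next
    obtain C where C: "finite C" "C \<subseteq> D.\<O>" "\<forall>y\<in>D.\<O>. \<exists>c\<in>C. \<exists>b\<in>D.\<O>. y = c + of_nat p * b" using D.\<O>_res by blast
    define C' where "C' = {c \<in> carrier R. emb L c \<in> C}"
    have "C' \<subseteq> carrier R" by (auto simp: C'_def)
    moreover have "finite C'"
    proof (rule inj_on_finite[of "emb L" _ C])
      show "inj_on (emb L) C'" using R_eqI by (auto simp: C'_def inj_on_def)
    qed (use C(1) in \<open>auto simp: C'_def\<close>)
    moreover have "\<exists>c\<in>C'. \<exists>y\<in>carrier R. x = c \<oplus>\<^bsub>R\<^esub> ?p \<otimes>\<^bsub>R\<^esub> y" if x: "x \<in> carrier R" for x
    proof -
      obtain c b where cb: "c \<in> C" "b \<in> D.\<O>" "emb L x = c + of_nat p * b" using C(3) R_O[OF x] by blast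
      obtain y where y: "y \<in> carrier R" "b = emb L y" using O_ex[OF cb(2)] .
      obtain c' where c': "c' \<in> carrier R" "c = emb L c'" using O_ex[of c] C(2) cb(1) by blast
      have "x = c' \<oplus>\<^bsub>R\<^esub> ?p \<otimes>\<^bsub>R\<^esub> y"
      proof (rule R_eqI[OF x])
        show "c' \<oplus>\<^bsub>R\<^esub> ?p \<otimes>\<^bsub>R\<^esub> y \<in> carrier R" using c' y by (simp del: R_simps)
        have "?p \<otimes>\<^bsub>R\<^esub> y \<in> carrier R" using y by (simp del: R_simps)
        then show "emb L x = emb L (c' \<oplus>\<^bsub>R\<^esub> ?p \<otimes>\<^bsub>R\<^esub> y)"
          unfolding emb_add_R[OF c'(1) \<open>?p \<otimes>\<^bsub>R\<^esub> y \<in> carrier R\<close>] emb_p[OF y(1)] using cb(3) c' y by simp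
      qed
      moreover have "c' \<in> C'" using c' cb(1) by (simp add: C'_def)
      ultimately show ?thesis using y(1) by blast
    qed
    ultimately show "\<exists>C. finite C \<and> C \<subseteq> carrier R \<and> (\<forall>x\<in>carrier R. \<exists>c\<in>C. \<exists>y\<in>carrier R. x = c \<oplus>\<^bsub>R\<^esub> ?p \<otimes>\<^bsub>R\<^esub> y)" by blast
  next
    fix x y and m :: nat
    assume x: "x \<in> carrier R" and y: "y \<in> carrier R" and eq: "?p [^]\<^bsub>R\<^esub> m \<otimes>\<^bsub>R\<^esub> x = ?p [^]\<^bsub>R\<^esub> m \<otimes>\<^bsub>R\<^esub> y"
    have "of_nat p ^ m * emb L x = of_nat p ^ m * emb L y" using arg_cong[OF eq, of "emb L"] unfolding emb_pm[OF x] emb_pm[OF y] .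
    then have "emb L x = emb L y" by (rule D.p_cancel[OF D.O_S[OF R_O[OF x]] D.O_S[OF R_O[OF y]]])
    then show "x = y" by (rule R_eqI[OF x y])
  qed
  then show ?thesis by (simp add: residue_ring_pow_def Let_def)
qed

end

text \<open>The excluded primes are those below a threshold that depends only on
  \<open>length w\<close> and \<open>r\<close>, so the same set serves every n. The bound is proved
  for each subfield of the algebraic closure that realises the unramified extension.\<close>

theorem theoremI:
  fixes r :: nat and w :: "letter list"
  assumes "w \<in> carrier (free_group r)" and "w \<noteq> \<one>\<^bsub>free_group r\<^esub>"
  shows "\<forall>n\<ge>1. \<exists>S. finite S \<and> (\<forall>p\<in>S. Factorial_Ring.prime p) \<and>
    (\<forall>q\<in>prime_powers_avoiding S. \<forall>p s F k.
       Factorial_Ring.prime p \<longrightarrow> q = p ^ s \<longrightarrow> unramified_extension p s F \<longrightarrow> k \<ge> 1 \<longrightarrow>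
       (let G = SL n (residue_ring_pow p F k) in
          \<forall>g\<in>carrier G. pmf (word_measure G r w) g
            \<le> real (card (carrier G)) powr (- (1 / (2 * 10 ^ 17 * real (length w) ^ 9)))))"
proof (intro allI impI)
  fix n :: nat assume n: "n \<ge> 1"
  let ?N = "2 ^ length w + 2304 * length w ^ 4 + 2 * r + 2 * length w + 2"
  let ?S = "{p. prime p \<and> p < ?N}"
  have "pmf (word_measure G r w) g \<le> real (card (carrier G)) powr (- (1 / (2 * 10 ^ 17 * real (length w) ^ 9)))"
    if q: "p ^ s \<in> prime_powers_avoiding ?S" and p: "prime p" and unr: "unramified_extension p s F" and k: "k \<ge> 1"
      and G: "G = SL n (residue_ring_pow p F k)" and g: "g \<in> carrier G" for p s F k g G
  proof -
    \<comment> \<open>Membership of q only provides some representation as a prime power; unique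
      factorisation identifies its prime with p.\<close>
    obtain p' s' where p': "p ^ s = p' ^ s'" "prime p'" "p' \<notin> ?S" "s' \<ge> 1"
      using q unfolding prime_powers_avoiding_def by blast
    have "p' dvd p ^ s" unfolding p'(1) using p'(4) by simp
    then have "p' = p" using p p'(2) by (meson prime_dvd_power primes_dvd_imp_eq)
    then have "?N \<le> p" using p' by auto
    interpret unramified p s F by (rule unramified.intro[OF p unr])
    show ?thesis
      unfolding G by (rule SL_word_measure_bound[OF residue_ring_finite_chain[OF k n] assms \<open>?N \<le> p\<close>]) (use g G in simp)
  qed
  then show "\<exists>S. finite S \<and> (\<forall>p\<in>S. Factorial_Ring.prime p) \<and>
    (\<forall>q\<in>prime_powers_avoiding S. \<forall>p s F k.
       Factorial_Ring.prime p \<longrightarrow> q = p ^ s \<longrightarrow> unramified_extension p s F \<longrightarrow> k \<ge> 1 \<longrightarrow>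
       (let G = SL n (residue_ring_pow p F k) in
          \<forall>g\<in>carrier G. pmf (word_measure G r w) g
            \<le> real (card (carrier G)) powr (- (1 / (2 * 10 ^ 17 * real (length w) ^ 9)))))"
    by (intro exI[of _ ?S]) (auto simp: Let_def)
qed

end
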